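(* Let $\mu$ be a measure on $M_k$ with $\#\,\mathrm{supp}\,\mu>1$ and let $L\in\mathcal{B}(M_k)$ be stochastic for $\mu$. Suppose that $L$ is generic for $\mu$ and that $\int_{M_k}|L(v)|^2\log|L(v)|\,d\mu(v)<\infty$. Then the Lyapunov exponents $$\infty>\gamma_1\ge\gamma_2\ge\dots\ge\gamma_k\ge-\infty$$ are well defined. Moreover: (a) $\gamma_2-\gamma_1<0$, where $\gamma_2-\gamma_1$ is the limit $$\lim_{n\to\infty}\frac1n\log\frac{|\bigwedge^2W_n|}{|W_n|^2}$$ whenever $\gamma_1=-\infty$. (b) For $\mathbb{P}_\nu$-almost sure $x$ (that is, for $\mathbb{P}_\nu$-almost every $(\hat x,\omega)$, with $x$ a unit vector representing $\hat x$), $$\lim_{n\to\infty}\frac1n\big(\log|W_n(x)|-\log|W_n|\big)=0,$$ where $\nu$ is any Borel probability on $P(\mathbb{C}^k)$.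
   Context: $M_k$ is the space of complex $k\times k$ matrices and $P(\mathbb{C}^k)$ the projective space of $\mathbb{C}^k$. $\mathcal{B}(M_k)$ is the set of continuous bounded functions $L:M_k\to M_k$ with the norm $\|L\|=\sup_{v}\|L(v)\|$. A property is generic in $\mathcal{B}(M_k)$ if the set of $L$ having it contains a countable intersection of open dense subsets. "$L$ is generic for $\mu$" means that $L$ belongs to the set of $L\in\mathcal{B}(M_k)$ that are irreducible for $\mu$, $\Phi$-Erg for $\mu$ and satisfy the purification condition with $\mu$ (all defined below); these properties are generic in $\mathcal{B}(M_k)$ for every fixed $\mu$ with $\#\,\mathrm{supp}\,\mu>1$. $L$ is stochastic for $\mu$ if $\int\|L(v)\|^2d\mu(v)<\infty$ and $\int_{M_k}L(v)^*L(v)\,d\mu(v)=\mathrm{Id}$. $L$ is irreducible for $\mu$ if the map $\phi_L(\rho)=\int_{M_k}L(v)\rho L(v)^*d\mu(v)$ is irreducible, i.e. there are no $\lambda>0$ and orthogonal projection $p$ onto a nonzero proper subspace of $\mathbb{C}^k$ with $\phi_L(p)\le\lambda p$. A subspace $E\subset\mathbb{C}^k$ is $(L,\mu)$-invariant if $L(v)E\subset E$ for all $v\in\mathrm{supp}\,\mu$; $L$ is $\Phi$-Erg for $\mu$ if there is a unique minimal nonzero $(L,\mu)$-invariant subspace. On $\Omega=M_k^{\mathbb{N}}$, $\omega=(\omega_1,\omega_2,\dots)$, put $W_n(\omega)=L(\omega_n)\cdots L(\omega_1)$. The pair $(L,\mu)$ satisfies the purification condition if every nonzero orthogonal projector $\pi$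 such that, for every $n\in\mathbb{N}$, $\pi W_n(\omega)^*W_n(\omega)\pi$ is a scalar multiple of $\pi$ for $\mu^{\otimes n}$-almost every $(\omega_1,\dots,\omega_n)$, has rank one. For a Borel probability $\nu$ on $P(\mathbb{C}^k)$, $\mathbb{P}_\nu$ is the probability on $P(\mathbb{C}^k)\times\Omega$ determined by $\mathbb{P}_\nu(S\times O_n)=\int_{S\times O_n}\|W_n(\omega)x\|^2\,d\nu(\hat x)\,d\mu^{\otimes n}(\omega)$, for Borel $S\subset P(\mathbb{C}^k)$ and measurable sets $O_n$ depending only on the first $n$ coordinates, with $x$ a unit representative of $\hat x$. $|\cdot|$ denotes the norm of vectors and the corresponding norm of operators. $\bigwedge^pW$ is the operator induced by $W$ on $\bigwedge^p\mathbb{C}^k$, which carries the inner product $\langle r_1\wedge\dots\wedge r_p,s_1\wedge\dots\wedge s_p\rangle=\det(\langle r_i,s_j\rangle)$. The Lyapunov exponents being well defined means that there exist numbers $\infty>\gamma_1\ge\dots\ge\gamma_k\ge-\infty$ such that, for every Borel probability $\nu$ on $P(\mathbb{C}^k)$ and every $p\in\{1,\dots,k\}$, $\lim_{n\to\infty}\frac1n\log|\bigwedge^pW_n|=\sum_{j=1}^p\gamma_j$ $\mathbb{P}_\nu$-almost surely. *)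

theory Defs
  imports "HOL-Probability.Probability"
begin

section \<open>Complex vectors and matrices\<close>

text \<open>The norm that the library puts on the type \<open>complex^'k^'k\<close> is the Frobenius norm; the norm of
  operators is \<open>opnorm\<close>.\<close>

definition cinner :: "complex^'k \<Rightarrow> complex^'k \<Rightarrow> complex" where
  "cinner x y = (\<Sum>i\<in>UNIV. x $ i * cnj (y $ i))"

definition cadj :: "complex^'k^'k \<Rightarrow> complex^'k^'k" where
  "cadj A = (\<chi> i j. cnj (A $ j $ i))"

definition opnorm :: "complex^'k^'k \<Rightarrow> real" where
  "opnorm A = onorm (\<lambda>x. A *v x)"

definition orth_projector :: "complex^'k^'k \<Rightarrow> bool" where
  "orth_projector p \<longleftrightarrow> p ** p = p \<and> cadj p = p"

definition loewner_le :: "complex^'k^'k \<Rightarrow> complex^'k^'k \<Rightarrow> bool" where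
  "loewner_le A B \<longleftrightarrow>
     (\<forall>x. Im (cinner ((B - A) *v x) x) = 0 \<and> 0 \<le> Re (cinner ((B - A) *v x) x))"

definition elog :: "real \<Rightarrow> ereal" where
  "elog x = (if x = 0 then -\<infinity> else ereal (ln x))"


section \<open>Exterior powers\<close>

text \<open>\<open>p\<close>-vectors are realised as antisymmetric tensors, i.e. as functions on the \<open>p\<close>-tuples of
  coordinate indices (and 0 elsewhere). With the factor \<open>1 / p!\<close>, the standard inner product of
  tensors becomes the determinant inner product on decomposable \<open>p\<close>-vectors, see
  \<open>ext_inner_wedge\<close>; by \<open>ext_map_wedge\<close>, \<open>ext_map\<close> acts on decomposable \<open>p\<close>-vectors as it should.\<close>

definition tuples :: "nat \<Rightarrow> (nat \<Rightarrow> 'k) set" where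
  "tuples p = PiE {..<p} (\<lambda>_. UNIV)"

definition wedge :: "nat \<Rightarrow> (nat \<Rightarrow> complex^'k) \<Rightarrow> (nat \<Rightarrow> 'k) \<Rightarrow> complex" where
  "wedge p r = (\<lambda>i. if i \<in> tuples p
     then \<Sum>\<sigma> | \<sigma> permutes {..<p}. of_int (sign \<sigma>) * (\<Prod>a<p. r (\<sigma> a) $ i a) else 0)"

definition ext_space :: "nat \<Rightarrow> ((nat \<Rightarrow> 'k::finite) \<Rightarrow> complex) set" where
  "ext_space p = {t. \<exists>(N::nat) c r. t = (\<lambda>i. \<Sum>m<N. c m * wedge p (r m) i)}"

definition ext_inner ::
    "nat \<Rightarrow> ((nat \<Rightarrow> 'k::finite) \<Rightarrow> complex) \<Rightarrow> ((nat \<Rightarrow> 'k) \<Rightarrow> complex) \<Rightarrow> complex" where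
  "ext_inner p s t = (\<Sum>i\<in>tuples p. s i * cnj (t i)) / fact p"

definition ext_norm :: "nat \<Rightarrow> ((nat \<Rightarrow> 'k::finite) \<Rightarrow> complex) \<Rightarrow> real" where
  "ext_norm p t = sqrt (Re (ext_inner p t t))"

definition ext_map ::
    "nat \<Rightarrow> complex^'k^'k \<Rightarrow> ((nat \<Rightarrow> 'k::finite) \<Rightarrow> complex) \<Rightarrow> (nat \<Rightarrow> 'k) \<Rightarrow> complex" where
  "ext_map p W t = (\<lambda>i. if i \<in> tuples p
     then \<Sum>j\<in>tuples p. (\<Prod>a<p. W $ i a $ j a) * t j else 0)"

text \<open>The supremum is taken over the unit ball, so that it is 0 when the exterior power is zero
  (\<open>p > CARD('k)\<close>).\<close>

definition ext_opnorm :: "nat \<Rightarrow> complex^'k^'k \<Rightarrow> real" where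
  "ext_opnorm p W = (SUP t\<in>{t \<in> ext_space p. ext_norm p t \<le> 1}. ext_norm p (ext_map p W t))"

lemma finite_tuples [simp]: "finite (tuples p :: (nat \<Rightarrow> 'k::finite) set)"
  unfolding tuples_def by (simp add: finite_PiE)

lemma ext_map_wedge:
  fixes W :: "complex^'k^'k"
  shows "ext_map p W (wedge p r) = wedge p (\<lambda>m. W *v r m)"
proof
  fix i :: "nat \<Rightarrow> 'k"
  show "ext_map p W (wedge p r) i = wedge p (\<lambda>m. W *v r m) i"
  proof (cases "i \<in> tuples p")
    case True
    have "(\<Sum>j\<in>tuples p. (\<Prod>a<p. W $ i a $ j a) * wedge p r j)
        = (\<Sum>j\<in>tuples p. \<Sum>\<sigma> | \<sigma> permutes {..<p}. of_int (sign \<sigma>) *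
            (\<Prod>a<p. W $ i a $ j a * r (\<sigma> a) $ j a))"
      by (simp add: wedge_def sum_distrib_left prod.distrib mult_ac)
    also have "\<dots> = (\<Sum>\<sigma> | \<sigma> permutes {..<p}. of_int (sign \<sigma>) *
            (\<Sum>j\<in>tuples p. \<Prod>a<p. W $ i a $ j a * r (\<sigma> a) $ j a))"
      by (subst sum.swap) (simp add: sum_distrib_left)
    also have "\<dots> = (\<Sum>\<sigma> | \<sigma> permutes {..<p}. of_int (sign \<sigma>) *
            (\<Prod>a<p. (W *v r (\<sigma> a)) $ i a))"
      by (simp add: tuples_def matrix_vector_mult_def
          prod_sum_PiE[where B="\<lambda>_. UNIV" and f="\<lambda>a l. W $ i a $ l * r (s a) $ l" for s])
    finally show ?thesis
      using True by (simp add: ext_map_def wedge_def)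
  qed (simp add: ext_map_def wedge_def)
qed

lemma ext_inner_wedge:
  fixes r s :: "nat \<Rightarrow> complex^'k"
  shows "ext_inner p (wedge p r) (wedge p s)
       = (\<Sum>\<sigma> | \<sigma> permutes {..<p}. of_int (sign \<sigma>) * (\<Prod>a<p. cinner (r a) (s (\<sigma> a))))"
proof -
  let ?P = "{\<sigma>. \<sigma> permutes {..<p}}"
  have swap: "(\<Sum>i\<in>(tuples p :: (nat \<Rightarrow> 'k) set). wedge p r i * cnj (wedge p s i))
     = (\<Sum>\<sigma>\<in>?P. \<Sum>\<tau>\<in>?P. of_int (sign \<sigma>) * of_int (sign \<tau>) *
         (\<Prod>a<p. cinner (r (\<sigma> a)) (s (\<tau> a))))"
  proof -
    have "(\<Sum>i\<in>(tuples p :: (nat \<Rightarrow> 'k) set). wedge p r i * cnj (wedge p s i))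
       = (\<Sum>i\<in>tuples p. \<Sum>\<sigma>\<in>?P. \<Sum>\<tau>\<in>?P. of_int (sign \<sigma>) * of_int (sign \<tau>) *
           (\<Prod>a<p. r (\<sigma> a) $ i a * cnj (s (\<tau> a) $ i a)))"
      by (simp add: wedge_def sum_product prod.distrib mult_ac)
    also have "\<dots> = (\<Sum>\<sigma>\<in>?P. \<Sum>\<tau>\<in>?P. \<Sum>i\<in>tuples p. of_int (sign \<sigma>) * of_int (sign \<tau>) *
           (\<Prod>a<p. r (\<sigma> a) $ i a * cnj (s (\<tau> a) $ i a)))"
      by (subst sum.swap) (intro sum.cong refl sum.swap)
    also have "\<dots> = (\<Sum>\<sigma>\<in>?P. \<Sum>\<tau>\<in>?P. of_int (sign \<sigma>) * of_int (sign \<tau>) *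
         (\<Prod>a<p. cinner (r (\<sigma> a)) (s (\<tau> a))))"
      by (simp add: tuples_def cinner_def sum_distrib_left[symmetric]
          prod_sum_PiE[where B="\<lambda>_. UNIV"
            and f="\<lambda>a l. r (u a) $ l * cnj (s (v a) $ l)" for u v])
    finally show ?thesis .
  qed
  have inner: "(\<Sum>\<tau>\<in>?P. of_int (sign \<sigma>) * of_int (sign \<tau>) *
         (\<Prod>a<p. cinner (r (\<sigma> a)) (s (\<tau> a))))
     = (\<Sum>\<rho>\<in>?P. of_int (sign \<rho>) * (\<Prod>a<p. cinner (r a) (s (\<rho> a))))"
    if \<sigma>: "\<sigma> permutes {..<p}" for \<sigma>
  proof -
    have "(\<Sum>\<tau>\<in>?P. of_int (sign \<sigma>) * of_int (sign \<tau>) * (\<Prod>a<p. cinner (r (\<sigma> a)) (s (\<tau> a))))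
       = (\<Sum>\<rho>\<in>?P. of_int (sign \<sigma>) * of_int (sign (\<rho> \<circ> \<sigma>)) *
           (\<Prod>a<p. cinner (r (\<sigma> a)) (s ((\<rho> \<circ> \<sigma>) a))))"
      by (rule sum_permutations_compose_right[OF \<sigma>])
    also have "\<dots> = (\<Sum>\<rho>\<in>?P. of_int (sign \<rho>) * (\<Prod>a<p. cinner (r a) (s (\<rho> a))))"
    proof (rule sum.cong[OF refl])
      fix \<rho> assume "\<rho> \<in> ?P"
      then have \<rho>: "\<rho> permutes {..<p}" by simp
      have "permutation \<rho>" "permutation \<sigma>"
        using \<rho> \<sigma> by (auto simp: permutation_permutes)
      then have "sign (\<rho> \<circ> \<sigma>) = sign \<rho> * sign \<sigma>"
        by (rule sign_compose)
      then have sg: "of_int (sign \<sigma>) * of_int (sign (\<rho> \<circ> \<sigma>)) = (of_int (sign \<rho>) :: complex)"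
        by (simp add: sign_def)
      have "(\<Prod>a<p. cinner (r (\<sigma> a)) (s ((\<rho> \<circ> \<sigma>) a))) = (\<Prod>a<p. cinner (r a) (s (\<rho> a)))"
        using prod.permute[OF \<sigma>, of "\<lambda>a. cinner (r a) (s (\<rho> a))"] by (simp add: o_def)
      with sg show "of_int (sign \<sigma>) * of_int (sign (\<rho> \<circ> \<sigma>)) *
           (\<Prod>a<p. cinner (r (\<sigma> a)) (s ((\<rho> \<circ> \<sigma>) a)))
        = of_int (sign \<rho>) * (\<Prod>a<p. cinner (r a) (s (\<rho> a)))" by simp
    qed
    finally show ?thesis .
  qed
  have "card ?P = fact p"
    by (simp add: card_permutations)
  then show ?thesis
    unfolding ext_inner_def swap by (simp add: inner)
qed


section \<open>Projective space\<close>

typedef ('k::finite) cproj = "{E :: (complex^'k) set. vec.subspace E \<and> vec.dim E = 1}"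
  morphisms line Abs_cproj
proof -
  have "(axis undefined 1 :: complex^'k) \<noteq> 0"
    by (simp add: axis_eq_0_iff)
  then have "vec.dim (vec.span {axis undefined 1 :: complex^'k}) = 1"
    by (simp add: vec.dim_span vec.dim_eq_card_independent)
  then show ?thesis by (auto intro!: exI[of _ "vec.span {axis undefined 1}"])
qed

definition proj_class :: "complex^'k \<Rightarrow> 'k cproj" where
  "proj_class x = Abs_cproj (vec.span {x})"

text \<open>The quotient topology with respect to \<open>proj_class\<close> on the nonzero vectors. The Borel sigma
  algebra of projective space is \<open>borel\<close> for this topology.\<close>

instantiation cproj :: (finite) topological_space
begin

definition open_cproj :: "'a cproj set \<Rightarrow> bool" where
  "open_cproj U \<longleftrightarrow> open {x :: complex^'a. x \<noteq> 0 \<and> proj_class x \<in> U}"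

instance
proof
  have "{x :: complex^'a. x \<noteq> 0} = - {0}" by auto
  then show "open (UNIV :: 'a cproj set)"
    by (simp add: open_cproj_def open_Compl)
next
  fix S T :: "'a cproj set"
  assume "open S" "open T"
  moreover have "{x. x \<noteq> 0 \<and> proj_class x \<in> S \<inter> T}
      = {x. x \<noteq> 0 \<and> proj_class x \<in> S} \<inter> {x. x \<noteq> 0 \<and> proj_class x \<in> T}" by auto
  ultimately show "open (S \<inter> T)"
    unfolding open_cproj_def by (simp add: open_Int)
next
  fix K :: "'a cproj set set"
  assume "\<forall>S\<in>K. open S"
  moreover have "{x. x \<noteq> 0 \<and> proj_class x \<in> \<Union>K}
      = (\<Union>S\<in>K. {x. x \<noteq> 0 \<and> proj_class x \<in> S})" by auto
  ultimately show "open (\<Union>K)"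
    unfolding open_cproj_def by (simp add: open_UN)
qed

end

definition unit_rep :: "'k::finite cproj \<Rightarrow> complex^'k" where
  "unit_rep xh = (SOME x. x \<in> line xh \<and> norm x = 1)"


section \<open>Stochastic and generic maps\<close>

definition msupp :: "'a::topological_space measure \<Rightarrow> 'a set" where
  "msupp \<mu> = {v. \<forall>U. open U \<and> v \<in> U \<longrightarrow> emeasure \<mu> U > 0}"

definition stochastic :: "(complex^'k^'k) measure \<Rightarrow> (complex^'k^'k \<Rightarrow> complex^'k^'k) \<Rightarrow> bool" where
  "stochastic \<mu> L \<longleftrightarrow>
     (\<integral>\<^sup>+ v. ennreal ((opnorm (L v))\<^sup>2) \<partial>\<mu>) < \<infinity> \<and>
     (LINT v|\<mu>. cadj (L v) ** L v) = mat 1"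

definition channel ::
    "(complex^'k^'k) measure \<Rightarrow> (complex^'k^'k \<Rightarrow> complex^'k^'k) \<Rightarrow> complex^'k^'k \<Rightarrow> complex^'k^'k" where
  "channel \<mu> L \<rho> = (LINT v|\<mu>. L v ** \<rho> ** cadj (L v))"

definition irreducible_for ::
    "(complex^'k^'k) measure \<Rightarrow> (complex^'k^'k \<Rightarrow> complex^'k^'k) \<Rightarrow> bool" where
  "irreducible_for \<mu> L \<longleftrightarrow>
     \<not> (\<exists>(c::real) p. c > 0 \<and> orth_projector p \<and>
          range (\<lambda>x. p *v x) \<noteq> {0} \<and> range (\<lambda>x. p *v x) \<noteq> UNIV \<and>
          loewner_le (channel \<mu> L p) (c *\<^sub>R p))"

definition invariant_subspace ::
    "(complex^'k^'k) measure \<Rightarrow> (complex^'k^'k \<Rightarrow> complex^'k^'k) \<Rightarrow> (complex^'k) set \<Rightarrow> bool" where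
  "invariant_subspace \<mu> L E \<longleftrightarrow>
     vec.subspace E \<and> (\<forall>v\<in>msupp \<mu>. (\<lambda>x. L v *v x) ` E \<subseteq> E)"

definition minimal_invariant_subspace ::
    "(complex^'k^'k) measure \<Rightarrow> (complex^'k^'k \<Rightarrow> complex^'k^'k) \<Rightarrow> (complex^'k) set \<Rightarrow> bool" where
  "minimal_invariant_subspace \<mu> L E \<longleftrightarrow>
     invariant_subspace \<mu> L E \<and> E \<noteq> {0} \<and>
     (\<forall>F. invariant_subspace \<mu> L F \<and> F \<noteq> {0} \<and> F \<subseteq> E \<longrightarrow> F = E)"

definition Phi_Erg :: "(complex^'k^'k) measure \<Rightarrow> (complex^'k^'k \<Rightarrow> complex^'k^'k) \<Rightarrow> bool" where
  "Phi_Erg \<mu> L \<longleftrightarrow> (\<exists>!E. minimal_invariant_subspace \<mu> L E)"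

text \<open>The coordinates of \<open>\<omega>\<close> are numbered from 0 here.\<close>

primrec Wprod ::
    "(complex^'k^'k \<Rightarrow> complex^'k^'k) \<Rightarrow> nat \<Rightarrow> (nat \<Rightarrow> complex^'k^'k) \<Rightarrow> complex^'k^'k" where
  "Wprod L 0 \<omega> = mat 1"
| "Wprod L (Suc n) \<omega> = L (\<omega> n) ** Wprod L n \<omega>"

definition purification :: "(complex^'k^'k) measure \<Rightarrow> (complex^'k^'k \<Rightarrow> complex^'k^'k) \<Rightarrow> bool" where
  "purification \<mu> L \<longleftrightarrow>
     (\<forall>q. orth_projector q \<and> q \<noteq> 0 \<and>
        (\<forall>n. AE \<omega> in PiM {..<n} (\<lambda>_. \<mu>).
           \<exists>c. q ** cadj (Wprod L n \<omega>) ** Wprod L n \<omega> ** q = mat c ** q)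
      \<longrightarrow> vec.dim (range (\<lambda>x. q *v x)) = 1)"

definition generic_maps ::
    "(complex^'k^'k) measure \<Rightarrow> (complex^'k^'k \<Rightarrow> complex^'k^'k) set" where
  "generic_maps \<mu> = {L \<in> bcontfun. irreducible_for \<mu> L \<and> Phi_Erg \<mu> L \<and> purification \<mu> L}"


section \<open>The trajectory measure and Lyapunov exponents\<close>

text \<open>The integral with respect to \<open>\<nu>\<close> and the \<open>n\<close>-fold product of \<open>\<mu>\<close> is written as an iterated
  integral.\<close>

definition traj_measure ::
    "(complex^'k^'k) measure \<Rightarrow> (complex^'k^'k \<Rightarrow> complex^'k^'k) \<Rightarrow> 'k cproj measure
      \<Rightarrow> ('k cproj \<times> (nat \<Rightarrow> complex^'k^'k)) measure" where
  "traj_measure \<mu> L \<nu> = (THE P.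
     prob_space P \<and> sets P = sets (borel \<Otimes>\<^sub>M PiM UNIV (\<lambda>_. borel)) \<and>
     (\<forall>n. \<forall>S\<in>sets borel. \<forall>A\<in>sets (PiM {..<n} (\<lambda>_. borel)).
        emeasure P (S \<times> {\<omega>. restrict \<omega> {..<n} \<in> A}) =
          (\<integral>\<^sup>+ xh\<in>S. (\<integral>\<^sup>+ \<omega>\<in>A. ennreal ((norm (Wprod L n \<omega> *v unit_rep xh))\<^sup>2)
             \<partial>PiM {..<n} (\<lambda>_. \<mu>)) \<partial>\<nu>)))"

definition lyapunov_exponents ::
    "(complex^'k^'k) measure \<Rightarrow> (complex^'k^'k \<Rightarrow> complex^'k^'k) \<Rightarrow> (nat \<Rightarrow> ereal) \<Rightarrow> bool" where
  "lyapunov_exponents \<mu> L \<gamma> \<longleftrightarrow>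
     \<gamma> 1 < \<infinity> \<and> (\<forall>i j. 1 \<le> i \<and> i \<le> j \<and> j \<le> CARD('k) \<longrightarrow> \<gamma> j \<le> \<gamma> i) \<and>
     (\<forall>\<nu>. prob_space \<nu> \<and> sets \<nu> = sets (borel :: 'k cproj measure) \<longrightarrow>
       (\<forall>p\<in>{1..CARD('k)}. AE (xh, \<omega>) in traj_measure \<mu> L \<nu>.
          (\<lambda>n. elog (ext_opnorm p (Wprod L n \<omega>)) / ereal (real n))
            \<longlonglongrightarrow> (\<Sum>j=1..p. \<gamma> j)))"

end

theory Submission
  imports Defs
begin

text \<open>Dividing \<open>L\<close> by its norm replaces \<open>\<mu>\<close> by a probability measure \<open>m\<close> and \<open>L\<close> by a bounded map \<open>V\<close> with
  \<open>\<integral> V\<^sup>* V dm = 1\<close>; the products \<open>W\<^sub>n\<close> change by scalar factors only. Then \<open>W\<^sub>n\<^sup>* W\<^sub>n\<close> is a martingale, so every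
  positive semidefinite \<open>\<rho>\<close> gives a measure \<open>law \<rho>\<close> on trajectories with density \<open>tr (W\<^sub>n \<rho> W\<^sub>n\<^sup>*)\<close> on the first
  \<open>n\<close> coordinates. All of these are absolutely continuous with respect to \<open>law 1\<close>, and the trajectory
  measure of \<open>\<nu>\<close> is a mixture of the \<open>law (x x\<^sup>*)\<close>.

  If an event \<open>A\<close> is shift invariant, then \<open>x \<mapsto> law (x x\<^sup>*) A\<close> is a nonnegative quadratic form that is harmonic
  along the trajectories, so the vectors at which it equals its minimum on the sphere times \<open>|x|\<^sup>2\<close> form an
  invariant subspace. By irreducibility this is everything, hence \<open>A\<close> is trivial for \<open>law 1\<close>. A fixed point
  of the channel, given by Brouwer's theorem, is positive definite and provides a stationary ergodic
  law equivalent to \<open>law 1\<close>. Kingman's theorem now gives the limits for all exterior powers.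

  For (a), the expected area of the parallelogram spanned by \<open>W\<^sub>n x\<close> and \<open>W\<^sub>n y\<close>, maximised over orthonormal
  pairs, is submultiplicative in \<open>n\<close>, and purification with compactness makes it smaller than 1 for some
  \<open>n\<close>; so it decays exponentially, and the Borel-Cantelli lemma transfers this to trajectories.
  For (b), \<open>|W\<^sub>n x|\<^sup>2\<close> is itself the density of \<open>law (x x\<^sup>*)\<close>, so that \<open>|W\<^sub>n x|\<^sup>2 < |W\<^sub>n|\<^sup>2 / n\<^sup>2\<close> (in the
  Frobenius norm) has probability at most \<open>k / n\<^sup>2\<close>, and Borel-Cantelli applies again.\<close>

section \<open>Finite products of arbitrary measures\<close>

text \<open>The measure \<open>\<mu>\<close> may fail to be sigma-finite, so neither Fubini nor
  infinite products are available for it; the box formula and \<open>PiM_density\<close> are there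
  to carry its finite powers over to those of \<open>m\<close>.

  The normalisation also settles (a) when \<open>\<gamma> 1 = -\<infinity>\<close>. The scalar
  factors can decay superexponentially, but the products of \<open>V\<close> cannot: the squared
  Frobenius norm of \<open>Wprod V n\<close> is the density of \<open>law (mat 1)\<close> on the
  first \<open>n\<close> coordinates, and a density is rarely small under its own law. Their top
  exponent is therefore finite, and since the ratio in (a) does not see scalars, it is computed with
  \<open>V\<close> in all cases.

  Linear identities between the weights of states, valid for all matrices \<open>W\<close>, pass to
  the laws. This is the source both of the quadratic dependence of the law on the initial vector and
  of its domination by \<open>law (mat 1)\<close>.\<close>

lemma boxes_subset_space:
  "PiE I ` {X. \<forall>i\<in>I. X i \<in> sets (M i)} \<subseteq> Pow (\<Pi>\<^sub>E i\<in>I. space (M i))"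
proof (rule image_subsetI, rule PowI, rule PiE_mono)
  fix X i assume "X \<in> {X. \<forall>i\<in>I. X i \<in> sets (M i)}" "i \<in> I"
  then show "X i \<subseteq> space (M i)" by (simp add: sets.sets_into_space)
qed

text \<open>In the difference of two boxes, the points are sorted by the first coordinate, in the
  order in which the finite induction adds them, that lies outside \<open>Y\<close>; each class is
  again a box. \<open>I\<close> is nonempty because over no coordinates the only box is a singleton,
  and the empty set would be missing.\<close>

lemma semiring_of_boxes:
  assumes I: "finite I" "I \<noteq> {}"
  shows "semiring_of_sets (\<Pi>\<^sub>E i\<in>I. space (M i)) (PiE I ` {X. \<forall>i\<in>I. X i \<in> sets (M i)})"
proof (intro semiring_of_sets.intro subset_class.intro semiring_of_sets_axioms.intro, goal_cases)
  case 1
  show ?case by (rule boxes_subset_space)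
next
  case 2
  from I obtain i where "i \<in> I" by auto
  then have "PiE I (\<lambda>_. {} :: 'b set) = {}" by (auto simp: PiE_eq_empty_iff)
  then show ?case by (intro image_eqI[where x="\<lambda>_. {}"]) auto
next
  case (3 a b)
  then obtain X Y where a: "a = PiE I X" "\<forall>i\<in>I. X i \<in> sets (M i)"
    and b: "b = PiE I Y" "\<forall>i\<in>I. Y i \<in> sets (M i)" by auto
  then show ?case
    by (intro image_eqI[where x="\<lambda>i. X i \<inter> Y i"]) (auto simp: PiE_Int)
next
  case (4 a b)
  then obtain X Y where a: "a = PiE I X" and X: "\<forall>i\<in>I. X i \<in> sets (M i)"
    and b: "b = PiE I Y" and Y: "\<forall>i\<in>I. Y i \<in> sets (M i)" by auto
  let ?B = "PiE I ` {X. \<forall>i\<in>I. X i \<in> sets (M i)}"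
  have "finite K \<Longrightarrow> K \<subseteq> I \<Longrightarrow>
    \<exists>C\<subseteq>?B. finite C \<and> disjoint C \<and> {\<omega>\<in>PiE I X. \<exists>i\<in>K. \<omega> i \<notin> Y i} = \<Union>C" for K
  proof (induction K rule: finite_induct)
    case empty
    then show ?case by (intro exI[of _ "{}"]) auto
  next
    case (insert i K)
    then obtain C where C: "C \<subseteq> ?B" "finite C" "disjoint C"
      "{\<omega>\<in>PiE I X. \<exists>i\<in>K. \<omega> i \<notin> Y i} = \<Union>C" by auto
    define Z where "Z j = (if j = i then X j - Y j else if j \<in> K then X j \<inter> Y j else X j)" for j
    have Z: "PiE I Z \<in> ?B" using X Y insert.prems by (intro imageI) (auto simp: Z_def)
    have Z_eq: "PiE I Z = {\<omega>\<in>PiE I X. (\<forall>j\<in>K. \<omega> j \<in> Y j) \<and> \<omega> i \<notin> Y i}"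
    proof (rule set_eqI)
      fix \<omega>
      have "\<omega> \<in> PiE I Z \<longleftrightarrow> \<omega> \<in> PiE I X \<and> (\<forall>j\<in>insert i K. \<omega> j \<in> Z j)"
        using insert.prems by (auto simp: PiE_iff Z_def split: if_splits)
      then show "\<omega> \<in> PiE I Z \<longleftrightarrow> \<omega> \<in> {\<omega>\<in>PiE I X. (\<forall>j\<in>K. \<omega> j \<in> Y j) \<and> \<omega> i \<notin> Y i}"
        using insert.prems insert.hyps by (auto simp: PiE_iff Z_def split: if_splits)
    qed
    have "PiE I Z \<inter> \<Union>C = {}" unfolding C(4)[symmetric] Z_eq by auto
    then have "disjoint (insert (PiE I Z) C)"
      using C(3) by (auto simp: pairwise_insert disjnt_def)
    moreover have "{\<omega>\<in>PiE I X. \<exists>i\<in>insert i K. \<omega> i \<notin> Y i} = \<Union>(insert (PiE I Z) C)"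
      using C(4) Z_eq by auto
    ultimately show ?case using C Z by (intro exI[of _ "insert (PiE I Z) C"]) auto
  qed
  moreover have "PiE I X - PiE I Y = {\<omega>\<in>PiE I X. \<exists>i\<in>I. \<omega> i \<notin> Y i}"
    by (auto simp: PiE_def Pi_def)
  ultimately show ?case
    unfolding a b using I(1) by simp
qed

text \<open>Each coordinate costs one application of monotone convergence, which holds for every
  measure. Integrals are never interchanged, so the argument covers measures that are not
  sigma-finite.\<close>

lemma box_premeasure_countably_additive:
  fixes M :: "'i \<Rightarrow> 'a measure"
  assumes I: "finite I" "I \<noteq> {}"
    and A: "\<And>n i. i \<in> I \<Longrightarrow> A n i \<in> sets (M i)" and B: "\<And>i. i \<in> I \<Longrightarrow> B i \<in> sets (M i)"
    and disj: "disjoint_family (\<lambda>n::nat. PiE I (A n))" and un: "(\<Union>n. PiE I (A n)) = PiE I B"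
  shows "(\<Sum>n. \<Prod>i\<in>I. emeasure (M i) (A n i)) = (\<Prod>i\<in>I. emeasure (M i) (B i))"
proof -
  \<comment> \<open>Integrate the pointwise identity between the indicators one coordinate at a time.\<close>
  have main: "finite K \<Longrightarrow> K \<subseteq> I \<Longrightarrow> \<omega> \<in> extensional I \<Longrightarrow>
     (\<Sum>n. (\<Prod>i\<in>K. emeasure (M i) (A n i)) * (\<Prod>i\<in>I - K. indicator (A n i) (\<omega> i)))
       = (\<Prod>i\<in>K. emeasure (M i) (B i)) * (\<Prod>i\<in>I - K. indicator (B i) (\<omega> i) :: ennreal)" for K \<omega>
  proof (induction K arbitrary: \<omega> rule: finite_induct)
    case empty
    have ind: "(\<Prod>i\<in>I. indicator (X i) (\<omega> i)) = (indicator (PiE I X) \<omega> :: ennreal)" for X :: "'i \<Rightarrow> 'a set"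
      using I empty.prems by (cases "\<omega> \<in> PiE I X") (auto simp: PiE_iff indicator_def intro!: prod.neutral)
    have "(\<Sum>n. indicator (PiE I (A n)) \<omega>) = (indicator (PiE I B) \<omega> :: ennreal)"
      using suminf_indicator[OF disj, of \<omega>] un by simp
    then show ?case by (simp add: ind)
  next
    case (insert k K)
    have split: "(\<Prod>i\<in>I - K. indicator (X i) (fun_upd \<omega> k y i))
        = (indicator (X k) y :: ennreal) * (\<Prod>i\<in>I - insert k K. indicator (X i) (\<omega> i))" for X :: "'i \<Rightarrow> 'a set" and y
    proof -
      have eq: "I - K = insert k (I - insert k K)" using insert by auto
      show ?thesis unfolding eq using I
        by (subst prod.insert) (auto intro!: arg_cong2[where f="(*)"] prod.cong)
    qed
    have k: "k \<in> I" using insert by auto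
    have meas: "emeasure (M k) X = (\<integral>\<^sup>+y. indicator X y \<partial>M k)" if "X \<in> sets (M k)" for X
      using that by simp
    have "(\<Sum>n. (\<Prod>i\<in>insert k K. emeasure (M i) (A n i)) * (\<Prod>i\<in>I - insert k K. indicator (A n i) (\<omega> i)))
      = (\<Sum>n. \<integral>\<^sup>+y. (\<Prod>i\<in>K. emeasure (M i) (A n i)) * (\<Prod>i\<in>I - K. indicator (A n i) (fun_upd \<omega> k y i)) \<partial>M k)"
    proof (intro suminf_cong)
      fix n
      let ?c = "(\<Prod>i\<in>K. emeasure (M i) (A n i)) * (\<Prod>i\<in>I - insert k K. indicator (A n i) (\<omega> i)) :: ennreal"
      have "(\<integral>\<^sup>+y. (\<Prod>i\<in>K. emeasure (M i) (A n i)) * (\<Prod>i\<in>I - K. indicator (A n i) (fun_upd \<omega> k y i)) \<partial>M k)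
        = (\<integral>\<^sup>+y. ?c * indicator (A n k) y \<partial>M k)"
        unfolding split by (simp add: mult_ac)
      also have "\<dots> = ?c * emeasure (M k) (A n k)"
        using A[OF k] by (simp add: nn_integral_cmult)
      finally show "(\<Prod>i\<in>insert k K. emeasure (M i) (A n i)) * (\<Prod>i\<in>I - insert k K. indicator (A n i) (\<omega> i))
        = (\<integral>\<^sup>+y. (\<Prod>i\<in>K. emeasure (M i) (A n i)) * (\<Prod>i\<in>I - K. indicator (A n i) (fun_upd \<omega> k y i)) \<partial>M k)"
        using insert.hyps by (simp add: mult_ac)
    qed
    also have "\<dots> = (\<integral>\<^sup>+y. (\<Sum>n. (\<Prod>i\<in>K. emeasure (M i) (A n i)) * (\<Prod>i\<in>I - K. indicator (A n i) (fun_upd \<omega> k y i))) \<partial>M k)"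
    proof (intro nn_integral_suminf[symmetric])
      fix n
      have [measurable]: "A n k \<in> sets (M k)" by (rule A[OF k])
      show "(\<lambda>y. (\<Prod>i\<in>K. emeasure (M i) (A n i)) * (\<Prod>i\<in>I - K. indicator (A n i) (fun_upd \<omega> k y i))) \<in> borel_measurable (M k)"
        unfolding split
        by (intro borel_measurable_times_ennreal borel_measurable_const borel_measurable_indicator A k)
    qed
    also have "\<dots> = (\<integral>\<^sup>+y. (\<Prod>i\<in>K. emeasure (M i) (B i)) * (\<Prod>i\<in>I - K. indicator (B i) (fun_upd \<omega> k y i)) \<partial>M k)"
      using insert.prems k by (intro nn_integral_cong insert.IH) (auto simp: extensional_def)
    also have "\<dots> = (\<integral>\<^sup>+y. (\<Prod>i\<in>K. emeasure (M i) (B i)) * (\<Prod>i\<in>I - insert k K. indicator (B i) (\<omega> i)) * indicator (B k) y \<partial>M k)"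
      unfolding split by (simp add: mult_ac)
    also have "\<dots> = (\<Prod>i\<in>insert k K. emeasure (M i) (B i)) * (\<Prod>i\<in>I - insert k K. indicator (B i) (\<omega> i))"
      using B[OF k] insert.hyps by (subst nn_integral_cmult) (simp_all add: mult_ac)
    finally show ?case .
  qed
  from main[OF I(1) subset_refl, of "\<lambda>_. undefined"] show ?thesis by (simp add: extensional_def)
qed

text \<open>\<open>PiM\<close> takes its prescribed values on boxes as soon as some measure takes
  all of them; the Caratheodory extension \<open>N\<close> of the box premeasure is such a
  measure.\<close>

lemma emeasure_PiM_box:
  fixes M :: "'i \<Rightarrow> 'a measure"
  assumes I: "finite I" and X: "\<And>i. i \<in> I \<Longrightarrow> X i \<in> sets (M i)"
  shows "emeasure (PiM I M) (PiE I X) = (\<Prod>i\<in>I. emeasure (M i) (X i))"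
proof (cases "I = {}")
  case True
  then show ?thesis by (simp add: PiM_empty)
next
  case ne: False
  define N where "N = extend_measure (\<Pi>\<^sub>E i\<in>I. space (M i)) {X. \<forall>i\<in>I. X i \<in> sets (M i)} (PiE I)
    (\<lambda>X. \<Prod>i\<in>I. emeasure (M i) (X i))"
  have N: "emeasure N (PiE I X) = (\<Prod>i\<in>I. emeasure (M i) (X i))"
    if "\<And>i. i \<in> I \<Longrightarrow> X i \<in> sets (M i)" for X
  proof (rule extend_measure_caratheodory[OF N_def _ semiring_of_boxes[OF I ne]])
    show "X \<in> {X. \<forall>i\<in>I. X i \<in> sets (M i)}" using that by auto
  next
    fix Y :: "'i \<Rightarrow> 'a set" assume "PiE I Y = {}"
    then obtain i where "i \<in> I" "Y i = {}" by (auto simp: PiE_eq_empty_iff)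
    then show "(\<Prod>i\<in>I. emeasure (M i) (Y i)) = 0"
      using I by (intro prod_zero bexI[of _ i]) auto
  next
    fix Y Z :: "'i \<Rightarrow> 'a set" assume eq: "PiE I Y = PiE I Z"
    show "(\<Prod>i\<in>I. emeasure (M i) (Y i)) = (\<Prod>i\<in>I. emeasure (M i) (Z i))"
    proof (cases "PiE I Y = {}")
      case True
      with eq obtain i j where "i \<in> I" "Y i = {}" "j \<in> I" "Z j = {}" by (metis PiE_eq_empty_iff)
      then have "(\<Prod>i\<in>I. emeasure (M i) (Y i)) = 0" "(\<Prod>i\<in>I. emeasure (M i) (Z i)) = 0"
        using prod_zero[OF I(1), of "\<lambda>i. emeasure (M i) (Y i)"] prod_zero[OF I(1), of "\<lambda>i. emeasure (M i) (Z i)"]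
        by (metis emeasure_empty)+
      then show ?thesis by (simp only:)
    next
      case False
      with eq have "\<forall>i\<in>I. Y i = Z i" by (metis PiE_eq_iff PiE_eq_empty_iff)
      then show ?thesis by simp
    qed
  next
    fix A :: "nat \<Rightarrow> 'i \<Rightarrow> 'a set" and B
    assume "A \<in> UNIV \<rightarrow> {X. \<forall>i\<in>I. X i \<in> sets (M i)}" "B \<in> {X. \<forall>i\<in>I. X i \<in> sets (M i)}"
      "disjoint_family (PiE I \<circ> A)" "(\<Union>i. PiE I (A i)) = PiE I B"
    then show "(\<Sum>n. \<Prod>i\<in>I. emeasure (M i) (A n i)) = (\<Prod>i\<in>I. emeasure (M i) (B i))"
      by (intro box_premeasure_countably_additive[OF I ne]) (auto simp: o_def)
  qed simp
  have space_N: "space N = (\<Pi>\<^sub>E i\<in>I. space (M i))"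
    unfolding N_def by (intro space_extend_measure boxes_subset_space)
  have "sets N = sigma_sets (\<Pi>\<^sub>E i\<in>I. space (M i)) (PiE I ` {X. \<forall>i\<in>I. X i \<in> sets (M i)})"
    unfolding N_def by (intro sets_extend_measure boxes_subset_space)
  also have "PiE I ` {X. \<forall>i\<in>I. X i \<in> sets (M i)} = prod_algebra I M"
    unfolding prod_algebra_eq_finite[OF I] by (auto simp: Pi_iff)
  finally have sets_N: "sets N = sets (PiM I M)" by (simp add: sets_PiM)
  have box: "prod_emb I M J (PiE J Y) = PiE I (\<lambda>i. if i \<in> J then Y i else space (M i))"
    if "J \<subseteq> I" "Y \<in> (\<Pi> j\<in>J. sets (M j))" for J Y
  proof -
    have "Y i \<subseteq> space (M i)" if "i \<in> J" for i
      using \<open>Y \<in> (\<Pi> j\<in>J. sets (M j))\<close> that by (auto intro!: sets.sets_into_space)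
    then have "x i \<in> space (M i)" if "i \<in> J" "x i \<in> Y i" for x i
      using that by blast
    with \<open>J \<subseteq> I\<close> show ?thesis
      by (intro set_eqI) (simp add: prod_emb_def PiE_iff, meson subsetD)
  qed
  have "emeasure (PiM I M) (prod_emb I M I (PiE I X))
     = (\<Prod>j\<in>I \<union> {i\<in>I. emeasure (M i) (space (M i)) \<noteq> 1}. if j \<in> I then emeasure (M j) (X j) else emeasure (M j) (space (M j)))"
  proof (rule emeasure_extend_measure_Pair[OF PiM_def, where \<mu>'="emeasure N"])
    fix J Y assume "(J \<noteq> {} \<or> I = {}) \<and> finite J \<and> J \<subseteq> I \<and> Y \<in> (\<Pi> j\<in>J. sets (M j))"
    then have J: "finite J" "J \<subseteq> I" and Y: "Y \<in> (\<Pi> j\<in>J. sets (M j))" by auto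
    have "emeasure N (prod_emb I M J (PiE J Y)) = (\<Prod>i\<in>I. emeasure (M i) (if i \<in> J then Y i else space (M i)))"
      unfolding box[OF J(2) Y] using Y by (intro N) auto
    \<comment> \<open>The definition of \<open>PiM\<close> lists a coordinate outside
      \<open>J\<close> only if its total mass differs from 1; the product over all of
      \<open>I\<close> has the same value.\<close>
    also have "\<dots> = (\<Prod>j\<in>J \<union> {i\<in>I. emeasure (M i) (space (M i)) \<noteq> 1}. if j \<in> J then emeasure (M j) (Y j) else emeasure (M j) (space (M j)))"
      using J I by (intro prod.mono_neutral_cong_right) auto
    finally show "emeasure N (prod_emb I M J (PiE J Y)) = \<dots>" .
  next
    show "positive (sets (PiM I M)) (emeasure N)" "countably_additive (sets (PiM I M)) (emeasure N)"
      unfolding sets_N[symmetric] by (rule emeasure_positive, rule emeasure_countably_additive)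
  qed (use I ne X in \<open>auto simp: prod_emb_def PiE_iff\<close>)
  moreover have "prod_emb I M I (PiE I X) = PiE I X"
    using X sets.sets_into_space by (intro prod_emb_PiE_same_index) auto
  moreover have "I \<union> {i\<in>I. emeasure (M i) (space (M i)) \<noteq> 1} = I" by auto
  ultimately show ?thesis by simp
qed

section \<open>The subadditive ergodic theorem\<close>

locale ergodic_map = prob_space M for M :: "'a measure" +
  fixes T :: "'a \<Rightarrow> 'a"
  assumes measurable_T [measurable]: "T \<in> M \<rightarrow>\<^sub>M M"
    and distr_T: "distr M M T = M"
    and ergodic: "\<And>A. A \<in> sets M \<Longrightarrow> (AE \<omega> in M. T \<omega> \<in> A \<longleftrightarrow> \<omega> \<in> A) \<Longrightarrow> prob A = 0 \<or> prob A = 1"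
begin

lemma measurable_funpow_T [measurable]: "T ^^ n \<in> M \<rightarrow>\<^sub>M M"
  by (induction n) auto

lemma distr_funpow_T: "distr M M (T ^^ n) = M"
proof (induction n)
  case 0
  show ?case by (simp add: distr_id)
next
  case (Suc n)
  have "distr M M (T ^^ Suc n) = distr (distr M M (T ^^ n)) M T"
    by (simp add: distr_distr)
  with Suc show ?case by (simp only: distr_T)
qed

lemma expectation_funpow_T:
  fixes f :: "'a \<Rightarrow> real"
  assumes [measurable]: "f \<in> borel_measurable M"
  shows "expectation (\<lambda>\<omega>. f ((T ^^ n) \<omega>)) = expectation f"
  using integral_distr[of "T ^^ n" M M f] by (simp add: distr_funpow_T)

text \<open>The preimage is contained in \<open>A\<close> and has the same probability, so the two
  agree almost surely. This is why \<open>ergodic\<close> is stated for invariance up to null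
  sets.\<close>

lemma prob_0_or_1_of_vimage_subset:
  assumes A [measurable]: "A \<in> sets M" and sub: "\<And>\<omega>. \<omega> \<in> space M \<Longrightarrow> T \<omega> \<in> A \<Longrightarrow> \<omega> \<in> A"
  shows "prob A = 0 \<or> prob A = 1"
proof (rule ergodic[OF A])
  let ?B = "T -` A \<inter> space M"
  have B [measurable]: "?B \<in> sets M" by measurable
  have "prob ?B = prob A" using measure_distr[of T M M A] by (simp add: distr_T)
  moreover have "?B \<subseteq> A" using sub by auto
  ultimately have "prob (A - ?B) = 0" by (simp add: finite_measure_Diff)
  then have "A - ?B \<in> null_sets M" by (simp add: emeasure_eq_measure null_sets_def)
  then have "AE \<omega> in M. \<omega> \<notin> A - ?B" by (rule AE_not_in)
  then show "AE \<omega> in M. T \<omega> \<in> A \<longleftrightarrow> \<omega> \<in> A"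
    using AE_space by eventually_elim (use sub in auto)
qed

text \<open>Greedy walk along the orbit: at a point outside \<open>D\<close>, jump over a block of
  length \<open>j \<le> K\<close> on which the average is at most \<open>s\<close>; at a point of
  \<open>D\<close>, advance by one step, which costs at most \<open>C\<close> and is charged to the
  visit to \<open>D\<close>. The last at most \<open>K\<close> steps are paid by
  \<open>C * K\<close>.\<close>

lemma subadditive_le_covering:
  fixes h :: "nat \<Rightarrow> 'a \<Rightarrow> real"
  assumes sub: "\<And>n m \<omega>. h (n + m) \<omega> \<le> h n \<omega> + h m ((T ^^ n) \<omega>)"
    and up: "\<And>n \<omega>. h n \<omega> \<le> C * real n" and C: "C \<ge> 0" and s: "s \<ge> (0::real)"
    and D: "\<And>\<omega>. \<omega> \<in> space M \<Longrightarrow> \<omega> \<notin> D \<Longrightarrow> \<exists>j\<in>{1..K}. h j \<omega> \<le> s * real j"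
    and \<omega>: "\<omega> \<in> space M"
  shows "h n \<omega> \<le> s * n + C * (\<Sum>i<n. indicator D ((T ^^ i) \<omega>)) + C * K"
  using \<omega>
proof (induction n arbitrary: \<omega> rule: less_induct)
  case (less n)
  have sp: "(T ^^ i) \<omega> \<in> space M" for i
    using measurable_space[OF measurable_funpow_T less.prems] .
  have step: ?case if j: "1 \<le> j" "j \<le> n"
    and hj: "h j \<omega> \<le> s * j + C * (\<Sum>i<j. indicator D ((T ^^ i) \<omega>))" for j
  proof -
    have sum: "(\<Sum>i<n. indicator D ((T ^^ i) \<omega>) :: real)
       = (\<Sum>i<j. indicator D ((T ^^ i) \<omega>)) + (\<Sum>i<n - j. indicator D ((T ^^ i) ((T ^^ j) \<omega>)))"
    proof -
      have "{..<n} = {..<j} \<union> {j..<n}" using j by auto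
      then have "(\<Sum>i<n. indicator D ((T ^^ i) \<omega>) :: real)
        = (\<Sum>i<j. indicator D ((T ^^ i) \<omega>)) + (\<Sum>i=j..<n. indicator D ((T ^^ i) \<omega>))"
        by (simp add: sum.union_disjoint ivl_disj_int)
      also have "(\<Sum>i=j..<n. indicator D ((T ^^ i) \<omega>) :: real)
         = (\<Sum>i<n - j. indicator D ((T ^^ i) ((T ^^ j) \<omega>)))"
        using sum.shift_bounds_nat_ivl[of "\<lambda>i. indicator D ((T ^^ i) \<omega>) :: real" 0 j "n - j"] j
        by (simp add: funpow_add lessThan_atLeast0)
      finally show ?thesis .
    qed
    have "h n \<omega> \<le> h j \<omega> + h (n - j) ((T ^^ j) \<omega>)" using sub[of j "n - j" \<omega>] j by simp
    also have "h (n - j) ((T ^^ j) \<omega>) \<le> s * real (n - j)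
       + C * (\<Sum>i<n - j. indicator D ((T ^^ i) ((T ^^ j) \<omega>))) + C * K"
      using j by (intro less.IH sp) auto
    also note hj
    finally have "h n \<omega> \<le> s * j + s * real (n - j) + C * ((\<Sum>i<j. indicator D ((T ^^ i) \<omega>))
         + (\<Sum>i<n - j. indicator D ((T ^^ i) ((T ^^ j) \<omega>)))) + C * K"
      by (simp add: algebra_simps)
    then show ?thesis using j by (simp add: sum of_nat_diff algebra_simps)
  qed
  show ?case
  proof (cases "n \<le> K")
    case True
    have "h n \<omega> \<le> C * n" by (rule up)
    also have "\<dots> \<le> C * K" using True C by (intro mult_left_mono) auto
    also have "\<dots> \<le> s * n + C * (\<Sum>i<n. indicator D ((T ^^ i) \<omega>)) + C * K"
      using C s by (auto intro!: add_nonneg_nonneg mult_nonneg_nonneg sum_nonneg)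
    finally show ?thesis .
  next
    case False
    show ?thesis
    proof (cases "\<omega> \<in> D")
      case True
      have "h 1 \<omega> \<le> C" using up[of 1 \<omega>] by simp
      then have "h 1 \<omega> \<le> s * real 1 + C * (\<Sum>i<1. indicator D ((T ^^ i) \<omega>))"
        using True s by simp
      then show ?thesis using False by (intro step[of 1]) auto
    next
      case nD: False
      then obtain j where j: "j \<in> {1..K}" "h j \<omega> \<le> s * j" using D less.prems by blast
      have "0 \<le> C * (\<Sum>i<j. indicator D ((T ^^ i) \<omega>))" using C by (auto intro!: mult_nonneg_nonneg sum_nonneg)
      with j have "h j \<omega> \<le> s * j + C * (\<Sum>i<j. indicator D ((T ^^ i) \<omega>))" by linarith
      then show ?thesis using False j by (intro step[of j]) auto
    qed
  qed
qed

text \<open>If the lower limit of \<open>h n / n\<close> were below \<open>u\<close> with positive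
  probability, hence almost surely by ergodicity, nearly every orbit point would start a good block
  of bounded length, and the covering bound would push the mean of \<open>h n\<close> below
  \<open>t * n\<close>. With \<open>u\<close> strictly between \<open>s\<close> and
  \<open>t\<close>, the bound on the lower limit becomes an eventual inequality.\<close>

lemma subadditive_eventually_ge:
  fixes h :: "nat \<Rightarrow> 'a \<Rightarrow> real" and s :: real
  assumes [measurable]: "\<And>n. h n \<in> borel_measurable M"
    and sub: "\<And>n m \<omega>. h (n + m) \<omega> \<le> h n \<omega> + h m ((T ^^ n) \<omega>)"
    and up: "\<And>n \<omega>. h n \<omega> \<le> C * real n" and low: "\<And>n \<omega>. 0 \<le> h n \<omega>"
    and t: "\<And>n. t * real n \<le> expectation (h n)" and st: "s < t"
  shows "AE \<omega> in M. \<forall>\<^sub>F n in sequentially. s * real n \<le> h n \<omega>"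
proof (cases "s < 0")
  case True
  have "s * real n \<le> h n \<omega>" for n :: nat and \<omega>
    using True low[of n \<omega>] by (meson mult_nonpos_nonneg of_nat_0_le_iff less_imp_le order_trans)
  then show ?thesis by simp
next
  case s0: False
  define u where "u = (s + t) / 2"
  have su: "s < u" and ut: "u < t" and u0: "0 \<le> u" using st s0 by (auto simp: u_def)
  have C: "C \<ge> 0" using up[of 1 undefined] low[of 1 undefined] by simp
  define A where "A = {\<omega>\<in>space M. liminf (\<lambda>n. ereal (h n \<omega> / real n)) < ereal u}"
  have [measurable]: "A \<in> sets M" unfolding A_def by measurable
  have inv: "\<omega> \<in> A" if \<omega>: "\<omega> \<in> space M" and TA: "T \<omega> \<in> A" for \<omega>
  proof -
    \<comment> \<open>The lower limit at \<open>\<omega>\<close> is at most the one at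
      \<open>T \<omega>\<close>: the first step costs at most \<open>C\<close>, which disappears
      after division.\<close>
    have 1: "h (Suc n) \<omega> / real (Suc n) \<le> C / real (Suc n) + h n (T \<omega>) / real n" for n
    proof -
      have "h (Suc n) \<omega> \<le> C + h n (T \<omega>)" using sub[of 1 n \<omega>] up[of 1 \<omega>] by simp
      then have "h (Suc n) \<omega> / real (Suc n) \<le> C / real (Suc n) + h n (T \<omega>) / real (Suc n)"
        by (simp add: divide_right_mono flip: add_divide_distrib)
      also have "h n (T \<omega>) / real (Suc n) \<le> h n (T \<omega>) / real n"
        using low[of n "T \<omega>"] up[of n "T \<omega>"] by (cases "n = 0") (auto intro!: divide_left_mono)
      finally show ?thesis by simp
    qed
    have lim: "(\<lambda>n. ereal (C / real (Suc n))) \<longlonglongrightarrow> ereal 0"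
      using LIMSEQ_Suc[OF lim_const_over_n[of C]] by simp
    have "liminf (\<lambda>n. ereal (h n \<omega> / real n)) = liminf (\<lambda>n. ereal (h (Suc n) \<omega> / real (Suc n)))"
      using liminf_shift[of "\<lambda>n. ereal (h n \<omega> / real n)"] by simp
    also have "\<dots> \<le> liminf (\<lambda>n. ereal (C / real (Suc n)) + ereal (h n (T \<omega>) / real n))"
      using 1 by (intro Liminf_mono) simp
    also have "\<dots> = ereal 0 + liminf (\<lambda>n. ereal (h n (T \<omega>) / real n))"
      by (rule ereal_liminf_lim_add[OF lim]) auto
    also have "\<dots> < ereal u" using TA by (simp add: A_def zero_ereal_def[symmetric])
    finally show ?thesis using \<omega> by (simp add: A_def)
  qed
  have "prob A = 0"
  proof (rule ccontr)
    assume "prob A \<noteq> 0"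
    then have A1: "prob A = 1" using prob_0_or_1_of_vimage_subset[of A] inv by auto
    define D where "D K = {\<omega>\<in>space M. \<forall>j\<in>{1..K}. u * real j < h j \<omega>}" for K
    have [measurable]: "D K \<in> sets M" for K unfolding D_def by measurable
    have "decseq D" by (auto simp: decseq_def D_def)
    then have "(\<lambda>K. prob (D K)) \<longlonglongrightarrow> prob (\<Inter>K. D K)"
      by (intro finite_Lim_measure_decseq) auto
    moreover have "prob (\<Inter>K. D K) = 0"
    proof -
      have "(\<Inter>K. D K) \<subseteq> space M - A"
      proof
        fix \<omega> assume *: "\<omega> \<in> (\<Inter>K. D K)"
        then have \<omega>: "\<omega> \<in> space M" by (auto simp: D_def)
        have "ereal u \<le> ereal (h j \<omega> / real j)" if "j \<ge> 1" for j
        proof -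
          have "\<omega> \<in> D j" using * by auto
          with that have "u * real j < h j \<omega>" by (auto simp: D_def)
          with that show ?thesis by (simp add: field_simps)
        qed
        then have "ereal u \<le> liminf (\<lambda>n. ereal (h n \<omega> / real n))"
          by (intro Liminf_bounded) (auto simp: eventually_sequentially)
        then show "\<omega> \<in> space M - A" using \<omega> by (auto simp: A_def)
      qed
      then have "prob (\<Inter>K. D K) \<le> prob (space M - A)" by (intro finite_measure_mono) auto
      also have "\<dots> = 0" using A1 by (subst prob_compl) auto
      finally show ?thesis by (simp add: measure_le_0_iff)
    qed
    ultimately have "(\<lambda>K. C * prob (D K)) \<longlonglongrightarrow> C * 0" by (intro tendsto_intros) simp
    \<comment> \<open>Half of the gap \<open>t - u\<close> pays for the visits to
      \<open>D K\<close>, the points without a good block of length at most \<open>K\<close>; the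
      other half pays for the boundary term \<open>C * K\<close> once \<open>n\<close> is
      large.\<close>
    then have "\<forall>\<^sub>F K in sequentially. C * prob (D K) < (t - u) / 2"
      using ut by (intro order_tendstoD) auto
    then obtain K where K: "C * prob (D K) < (t - u) / 2" by (auto simp: eventually_sequentially)
    have bd: "t * real n \<le> u * real n + C * (n * prob (D K)) + C * K" for n
    proof -
      have int: "integrable M (\<lambda>\<omega>. indicator (D K) ((T ^^ i) \<omega>) :: real)" for i
        by (intro integrable_const_bound[where B=1]) (auto simp: indicator_def)
      have "t * real n \<le> expectation (h n)" by (rule t)
      also have "\<dots> \<le> expectation (\<lambda>\<omega>. u * real n + C * (\<Sum>i<n. indicator (D K) ((T ^^ i) \<omega>)) + C * K)"
      proof (rule integral_mono)
        show "integrable M (h n)"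
          by (rule integrable_const_bound[where B="C * n"]) (use up low in auto)
        show "integrable M (\<lambda>\<omega>. u * real n + C * (\<Sum>i<n. indicator (D K) ((T ^^ i) \<omega>)) + C * K)"
          using int by auto
      qed (rule subadditive_le_covering[OF sub up C], use u0 in \<open>auto simp: D_def not_less\<close>)
      also have "\<dots> = u * real n + C * (\<Sum>i<n. expectation (\<lambda>\<omega>. indicator (D K) ((T ^^ i) \<omega>))) + C * K"
        using int by (simp add: prob_space)
      also have "(\<Sum>i<n. expectation (\<lambda>\<omega>. indicator (D K) ((T ^^ i) \<omega>))) = n * prob (D K)"
        by (subst expectation_funpow_T) auto
      finally show ?thesis .
    qed
    obtain n :: nat where n: "real n > C * K / ((t - u) / 2)" using reals_Archimedean2 by blast
    then have "C * K < real n * ((t - u) / 2)" using ut by (simp add: field_simps)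
    moreover have "C * (n * prob (D K)) \<le> real n * ((t - u) / 2)"
      using mult_left_mono[OF less_imp_le[OF K], of "real n"] by (simp add: mult_ac)
    ultimately show False using bd[of n] by (simp add: field_simps)
  qed
  then have "A \<in> null_sets M" by (simp add: emeasure_eq_measure null_sets_def)
  then have "AE \<omega> in M. \<omega> \<notin> A" by (rule AE_not_in)
  then show ?thesis using AE_space
  proof eventually_elim
    case (elim \<omega>)
    then have "ereal s < liminf (\<lambda>n. ereal (h n \<omega> / real n))"
      using su by (auto simp: A_def not_less elim!: less_le_trans[rotated])
    then have "\<forall>\<^sub>F n in sequentially. ereal s < ereal (h n \<omega> / real n)"
      by (rule less_LiminfD)
    with eventually_gt_at_top[of 0] show ?case
      by eventually_elim (simp add: field_simps)
  qed
qed

text \<open>Cut the orbit into blocks of length \<open>m\<close> in all \<open>m\<close> phases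
  \<open>r\<close> and add up: a time \<open>i < n\<close> starts at most one of these blocks. Each
  phase loses at most \<open>C * m\<close> before its first block and \<open>C * m\<close> after its
  last one, hence the term with \<open>2 * C\<close>.\<close>

lemma subadditive_le_block_average:
  fixes h :: "nat \<Rightarrow> 'a \<Rightarrow> real"
  assumes sub: "\<And>n m \<omega>. h (n + m) \<omega> \<le> h n \<omega> + h m ((T ^^ n) \<omega>)"
    and up: "\<And>n \<omega>. h n \<omega> \<le> C * real n" and low: "\<And>n \<omega>. 0 \<le> h n \<omega>" and m: "m > 0"
  shows "real m * h n \<omega> \<le> 2 * C * (real m)\<^sup>2 + (\<Sum>i<n. h m ((T ^^ i) \<omega>))"
proof -
  have C: "C \<ge> 0" using up[of 1 undefined] low[of 1 undefined] by simp
  have block: "h n \<omega> \<le> C * m + (\<Sum>j<n div m. h m ((T ^^ (j * m)) \<omega>))" for n \<omega>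
  proof (induction n arbitrary: \<omega> rule: less_induct)
    case (less n)
    show ?case
    proof (cases "n < m")
      case True
      then have "C * n \<le> C * m" using C by (intro mult_left_mono) auto
      with up[of n \<omega>] have "h n \<omega> \<le> C * m" by linarith
      then show ?thesis using True by simp
    next
      case False
      have "h n \<omega> \<le> h m \<omega> + h (n - m) ((T ^^ m) \<omega>)" using sub[of m "n - m" \<omega>] False by simp
      also have "h (n - m) ((T ^^ m) \<omega>) \<le> C * m + (\<Sum>j<(n - m) div m. h m ((T ^^ (j * m)) ((T ^^ m) \<omega>)))"
        using m False by (intro less.IH) auto
      also have "h m \<omega> + \<dots> = C * m + (\<Sum>j<Suc ((n - m) div m). h m ((T ^^ (j * m)) \<omega>))"
        by (subst sum.lessThan_Suc_shift) (simp add: funpow_add add.commute[of m])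
      also have "Suc ((n - m) div m) = n div m"
        using m False by (simp add: le_div_geq)
      finally show ?thesis by simp
    qed
  qed
  show ?thesis
  proof (cases "n < m")
    case True
    then have "C * n \<le> C * m" using C by (intro mult_left_mono) auto
    with up[of n \<omega>] have "h n \<omega> \<le> C * m" by linarith
    then have "real m * h n \<omega> \<le> real m * (C * m)" by (intro mult_left_mono) auto
    also have "\<dots> \<le> 2 * C * (real m)\<^sup>2" using C by (simp add: power2_eq_square)
    also have "\<dots> \<le> 2 * C * (real m)\<^sup>2 + (\<Sum>i<n. h m ((T ^^ i) \<omega>))" by (simp add: sum_nonneg low)
    finally show ?thesis .
  next
    case False
    let ?S = "Sigma {..<m} (\<lambda>r. {..<(n - r) div m})"
    have "h n \<omega> \<le> 2 * C * m + (\<Sum>j<(n - r) div m. h m ((T ^^ (r + j * m)) \<omega>))" if r: "r < m" for r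
    proof -
      have "h n \<omega> \<le> h r \<omega> + h (n - r) ((T ^^ r) \<omega>)" using sub[of r "n - r" \<omega>] r False by simp
      also have "h (n - r) ((T ^^ r) \<omega>) \<le> C * m + (\<Sum>j<(n - r) div m. h m ((T ^^ (j * m)) ((T ^^ r) \<omega>)))"
        by (rule block)
      finally have "h n \<omega> \<le> h r \<omega> + (C * m + (\<Sum>j<(n - r) div m. h m ((T ^^ (j * m)) ((T ^^ r) \<omega>))))"
        by simp
      moreover have "h r \<omega> \<le> C * m" using up[of r \<omega>] r C mult_left_mono[of "real r" "real m" C] by simp
      moreover have "(T ^^ (j * m)) ((T ^^ r) \<omega>) = (T ^^ (r + j * m)) \<omega>" for j
        by (simp add: add.commute[of r] funpow_add)
      ultimately show ?thesis by simp
    qed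
    then have "(\<Sum>r<m. h n \<omega>) \<le> (\<Sum>r<m. 2 * C * m + (\<Sum>j<(n - r) div m. h m ((T ^^ (r + j * m)) \<omega>)))"
      by (intro sum_mono) auto
    then have "real m * h n \<omega> \<le> 2 * C * (real m)\<^sup>2 + (\<Sum>r<m. \<Sum>j<(n - r) div m. h m ((T ^^ (r + j * m)) \<omega>))"
      by (simp add: sum.distrib power2_eq_square algebra_simps)
    also have "(\<Sum>r<m. \<Sum>j<(n - r) div m. h m ((T ^^ (r + j * m)) \<omega>))
       = (\<Sum>(r, j)\<in>?S. h m ((T ^^ (r + j * m)) \<omega>))"
      by (simp add: sum.Sigma)
    also have "\<dots> = (\<Sum>i\<in>(\<lambda>(r, j). r + j * m) ` ?S. h m ((T ^^ i) \<omega>))"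
    proof (subst sum.reindex)
      show "inj_on (\<lambda>(r, j). r + j * m) ?S"
      proof (rule inj_onI, clarsimp)
        fix r j r' j' :: nat assume *: "r < m" "r' < m" "r + j * m = r' + j' * m"
        have "(r + j * m) mod m = (r' + j' * m) mod m" using *(3) by (simp only:)
        then have "r = r'" using *(1,2) by simp
        with * m show "r = r' \<and> j = j'" by simp
      qed
    qed (simp add: case_prod_beta o_def)
    also have "\<dots> \<le> (\<Sum>i<n. h m ((T ^^ i) \<omega>))"
    proof (rule sum_mono2)
      show "(\<lambda>(r, j). r + j * m) ` ?S \<subseteq> {..<n}"
      proof (clarsimp)
        fix r j assume "r < m" "j < (n - r) div m"
        then have "Suc j * m \<le> (n - r) div m * m" by (intro mult_le_mono1) simp
        also have "\<dots> \<le> n - r" by (simp add: div_times_less_eq_dividend)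
        finally show "r + j * m < n" using m by simp
      qed
    qed (auto simp: low)
    finally show ?thesis by simp
  qed
qed

section \<open>The theorems of Birkhoff and Kingman for bounded increments\<close>

lemma tendsto_of_eventually_between:
  fixes x :: "nat \<Rightarrow> real"
  assumes "\<And>i::nat. \<forall>\<^sub>F n in sequentially. c - 1 / Suc i \<le> x n"
    and "\<And>i::nat. \<forall>\<^sub>F n in sequentially. x n \<le> c + 1 / Suc i"
  shows "x \<longlonglongrightarrow> c"
proof (rule tendstoI)
  fix e :: real assume "e > 0"
  then obtain i :: nat where i: "1 / Suc i < e" using nat_approx_posE by blast
  show "\<forall>\<^sub>F n in sequentially. dist (x n) c < e"
    using assms(1)[of i] assms(2)[of i] by eventually_elim (use i in \<open>auto simp: dist_real_def\<close>)
qed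

text \<open>Ergodic sums are additive, so the lower bound for subadditive sequences applies to them;
  applied to \<open>C - f\<close> as well, it yields the upper bound.\<close>

theorem birkhoff_bounded:
  fixes f :: "'a \<Rightarrow> real"
  assumes [measurable]: "f \<in> borel_measurable M" and f: "\<And>\<omega>. 0 \<le> f \<omega>" "\<And>\<omega>. f \<omega> \<le> C"
  shows "AE \<omega> in M. (\<lambda>n. (\<Sum>i<n. f ((T ^^ i) \<omega>)) / real n) \<longlonglongrightarrow> expectation f"
proof -
  have main: "AE \<omega> in M. \<forall>\<^sub>F n in sequentially. s * real n \<le> (\<Sum>i<n. g ((T ^^ i) \<omega>))"
    if [measurable]: "g \<in> borel_measurable M" and g: "\<And>\<omega>. 0 \<le> g \<omega>" "\<And>\<omega>. g \<omega> \<le> C"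
      and s: "s < expectation g" for g s
  proof (rule subadditive_eventually_ge[where C=C, OF _ _ _ _ _ s])
    fix n
    have "integrable M (\<lambda>\<omega>. g ((T ^^ i) \<omega>))" for i
      by (rule integrable_const_bound[where B=C]) (use g in auto)
    then show "expectation g * real n \<le> expectation (\<lambda>\<omega>. \<Sum>i<n. g ((T ^^ i) \<omega>))"
      by (simp add: expectation_funpow_T)
  next
    fix n m \<omega>
    show "(\<Sum>i<n + m. g ((T ^^ i) \<omega>)) \<le> (\<Sum>i<n. g ((T ^^ i) \<omega>)) + (\<Sum>i<m. g ((T ^^ i) ((T ^^ n) \<omega>)))"
      by (induction m) (auto simp: funpow_add add.commute[of n])
  next
    fix n \<omega>
    show "(\<Sum>i<n. g ((T ^^ i) \<omega>)) \<le> C * real n"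
      using sum_mono[of "{..<n}" "\<lambda>i. g ((T ^^ i) \<omega>)" "\<lambda>_. C"] g by (simp add: mult.commute)
  qed (auto intro: sum_nonneg g)
  have int: "integrable M f" by (rule integrable_const_bound[where B=C]) (use f in auto)
  have 1: "AE \<omega> in M. \<forall>i::nat. \<forall>\<^sub>F n in sequentially. (expectation f - 1 / Suc i) * real n \<le> (\<Sum>j<n. f ((T ^^ j) \<omega>))"
    unfolding AE_all_countable using f by (intro allI main) auto
  have 2: "AE \<omega> in M. \<forall>i::nat. \<forall>\<^sub>F n in sequentially. (expectation (\<lambda>\<omega>. C - f \<omega>) - 1 / Suc i) * real n \<le> (\<Sum>j<n. C - f ((T ^^ j) \<omega>))"
    unfolding AE_all_countable using f by (intro allI main) auto
  from 1 2 show ?thesis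
  proof eventually_elim
    case (elim \<omega>)
    show ?case
    proof (rule tendsto_of_eventually_between)
      fix i :: nat
      show "\<forall>\<^sub>F n in sequentially. expectation f - 1 / Suc i \<le> (\<Sum>j<n. f ((T ^^ j) \<omega>)) / real n"
        using elim(1)[rule_format, of i] eventually_gt_at_top[of 0]
        by eventually_elim (simp add: field_simps)
      show "\<forall>\<^sub>F n in sequentially. (\<Sum>j<n. f ((T ^^ j) \<omega>)) / real n \<le> expectation f + 1 / Suc i"
        using elim(2)[rule_format, of i] eventually_gt_at_top[of 0]
        by eventually_elim (use int in \<open>simp add: field_simps sum_subtractf prob_space\<close>)
    qed
  qed
qed

text \<open>The limit is the infimum \<open>c\<close> of the normalised means. It bounds every mean
  from below, which is what the eventual lower bound asks for; from above, phase averaging reduces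
  \<open>h n\<close> to Birkhoff sums of a single \<open>h m\<close> whose normalised mean is close
  to \<open>c\<close>.\<close>

theorem kingman_bounded:
  fixes h :: "nat \<Rightarrow> 'a \<Rightarrow> real"
  assumes meas [measurable]: "\<And>n. h n \<in> borel_measurable M"
    and sub: "\<And>n m \<omega>. h (n + m) \<omega> \<le> h n \<omega> + h m ((T ^^ n) \<omega>)"
    and up: "\<And>n \<omega>. h n \<omega> \<le> C * real n" and low: "\<And>n \<omega>. 0 \<le> h n \<omega>"
  shows "\<exists>c. AE \<omega> in M. (\<lambda>n. h n \<omega> / real n) \<longlonglongrightarrow> c"
proof -
  define c where "c = (INF m\<in>{1..}. expectation (h m) / real m)"
  have bdd: "bdd_below ((\<lambda>m. expectation (h m) / real m) ` {1..})"
    using low by (intro bdd_belowI[of _ 0]) (auto intro!: divide_nonneg_nonneg integral_nonneg)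
  have "c * real n \<le> expectation (h n)" for n
  proof (cases "n = 0")
    case True
    then show ?thesis using low by (auto intro: integral_nonneg)
  next
    case False
    then have "c \<le> expectation (h n) / real n" unfolding c_def by (intro cINF_lower bdd) auto
    then show ?thesis using False by (simp add: field_simps)
  qed
  then have 1: "AE \<omega> in M. \<forall>i::nat. \<forall>\<^sub>F n in sequentially. (c - 1 / Suc i) * real n \<le> h n \<omega>"
    unfolding AE_all_countable by (intro allI subadditive_eventually_ge[OF meas sub up low]) auto
  have 2: "AE \<omega> in M. \<forall>m. (\<lambda>n. (\<Sum>i<n. h m ((T ^^ i) \<omega>)) / real n) \<longlonglongrightarrow> expectation (h m)"
    unfolding AE_all_countable using up low by (intro allI birkhoff_bounded) auto
  from 1 2 have "AE \<omega> in M. (\<lambda>n. h n \<omega> / real n) \<longlonglongrightarrow> c"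
  proof eventually_elim
    case (elim \<omega>)
    show ?case
    proof (rule tendsto_of_eventually_between)
      fix i :: nat
      show "\<forall>\<^sub>F n in sequentially. c - 1 / Suc i \<le> h n \<omega> / real n"
        using elim(1)[rule_format, of i] eventually_gt_at_top[of 0]
        by eventually_elim (simp add: field_simps)
      have "c < c + 1 / Suc i" by simp
      then obtain m where m: "m \<ge> 1" "expectation (h m) / real m < c + 1 / Suc i"
        unfolding c_def using bdd by (subst (asm) cINF_less_iff) auto
      have "(\<lambda>n. 2 * C * real m / real n + (\<Sum>i<n. h m ((T ^^ i) \<omega>)) / real n / real m)
          \<longlonglongrightarrow> 0 + expectation (h m) / real m"
        using elim(2)[rule_format, of m] m by (intro tendsto_intros lim_const_over_n) auto
      then have "\<forall>\<^sub>F n in sequentially. 2 * C * real m / real n + (\<Sum>i<n. h m ((T ^^ i) \<omega>)) / real n / real m < c + 1 / Suc i"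
        using m by (intro order_tendstoD) auto
      then show "\<forall>\<^sub>F n in sequentially. h n \<omega> / real n \<le> c + 1 / Suc i"
        using eventually_gt_at_top[of 0]
      proof eventually_elim
        case (elim n)
        have "real m * h n \<omega> \<le> 2 * C * (real m)\<^sup>2 + (\<Sum>i<n. h m ((T ^^ i) \<omega>))"
          using m by (intro subadditive_le_block_average[OF sub up low]) auto
        then have "h n \<omega> / real n \<le> 2 * C * real m / real n + (\<Sum>i<n. h m ((T ^^ i) \<omega>)) / real n / real m"
          using m elim by (simp add: field_simps power2_eq_square)
        with elim show ?case by simp
      qed
    qed
  qed
  then show ?thesis by blast
qed

text \<open>Truncating \<open>ln (a n) / n\<close> from below at \<open>- K\<close> preserves subadditivity and reduces to the bounded case.\<close>

theorem kingman:
  fixes a :: "nat \<Rightarrow> 'a \<Rightarrow> real"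
  assumes meas [measurable]: "\<And>n. a n \<in> borel_measurable M"
    and sub: "\<And>n m \<omega>. a (n + m) \<omega> \<le> a m ((T ^^ n) \<omega>) * a n \<omega>"
    and up: "\<And>n \<omega>. a n \<omega> \<le> B ^ n" and low: "\<And>n \<omega>. 0 \<le> a n \<omega>" and B: "B \<ge> 1"
  shows "\<exists>s<\<infinity>. AE \<omega> in M. (\<lambda>n. elog (a n \<omega>) / ereal (real n)) \<longlonglongrightarrow> s"
proof -
  \<comment> \<open>Where \<open>a n\<close> vanishes its logarithm counts as
    \<open>-\<infinity>\<close>, which every truncation sends to 0; the default value of
    \<open>ln\<close> at 0 must not enter.\<close>
  define h where "h K n \<omega> = (if a n \<omega> = 0 then 0 else max 0 (ln (a n \<omega>) + real K * real n))"
    for K n :: nat and \<omega>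
  have "\<exists>c. AE \<omega> in M. (\<lambda>n. h K n \<omega> / real n) \<longlonglongrightarrow> c" for K
  proof (rule kingman_bounded[where C="ln B + real K"])
    fix n show "h K n \<in> borel_measurable M" unfolding h_def by measurable
  next
    fix n m \<omega>
    show "h K (n + m) \<omega> \<le> h K n \<omega> + h K m ((T ^^ n) \<omega>)"
    proof (cases "a (n + m) \<omega> = 0")
      case False
      then have pos: "0 < a (n + m) \<omega>" using low[of "n + m" \<omega>] by simp
      with sub[of n m \<omega>] have "0 < a m ((T ^^ n) \<omega>) * a n \<omega>" by linarith
      then have p: "0 < a m ((T ^^ n) \<omega>)" "0 < a n \<omega>"
        using low[of n \<omega>] low[of m "(T ^^ n) \<omega>"] by (auto simp: zero_less_mult_iff)
      have "ln (a (n + m) \<omega>) \<le> ln (a m ((T ^^ n) \<omega>) * a n \<omega>)"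
        using sub[of n m \<omega>] pos p by simp
      also have "\<dots> = ln (a m ((T ^^ n) \<omega>)) + ln (a n \<omega>)" using p by (simp add: ln_mult)
      finally show ?thesis using p pos unfolding h_def by (auto simp: algebra_simps)
    qed (auto simp: h_def)
  next
    fix n \<omega>
    show "0 \<le> h K n \<omega>" by (simp add: h_def)
    show "h K n \<omega> \<le> (ln B + real K) * real n"
    proof (cases "a n \<omega> = 0")
      case False
      then have "ln (a n \<omega>) \<le> ln (B ^ n)" using up[of n \<omega>] low[of n \<omega>] B by simp
      also have "\<dots> = n * ln B" using B by (simp add: ln_realpow)
      finally show ?thesis using B unfolding h_def by (auto simp: algebra_simps)
    qed (use B in \<open>auto simp: h_def\<close>)
  qed
  then obtain c where c: "\<And>K. AE \<omega> in M. (\<lambda>n. h K n \<omega> / real n) \<longlonglongrightarrow> c K" by metis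
  \<comment> \<open>If some \<open>c K\<close> is nonzero, hence positive, the truncation at
    \<open>- K\<close> is eventually inactive and the limit is \<open>c K - K\<close>, whichever
    such \<open>K\<close> is picked. If all of them vanish, the upper limit is at most
    \<open>- K\<close> for every \<open>K\<close>.\<close>
  define s where "s = (if \<exists>K. c K \<noteq> 0 then (let K = (SOME K. c K \<noteq> 0) in ereal (c K - real K)) else -\<infinity>)"
  have "AE \<omega> in M. \<forall>K. (\<lambda>n. h K n \<omega> / real n) \<longlonglongrightarrow> c K"
    unfolding AE_all_countable using c by simp
  then have "AE \<omega> in M. (\<lambda>n. elog (a n \<omega>) / ereal (real n)) \<longlonglongrightarrow> s"
  proof eventually_elim
    case (elim \<omega>)
    then have lim: "(\<lambda>n. h K n \<omega> / real n) \<longlonglongrightarrow> c K" for K by simp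
    have h_pos: "elog (a n \<omega>) / ereal (real n) = ereal (h K n \<omega> / real n - real K)"
      if "0 < h K n \<omega> / real n" for n K
    proof -
      have "0 < n" using that by (cases "n = 0") auto
      then show ?thesis
        using that low[of n \<omega>] by (auto simp: h_def elog_def field_simps max_def split: if_splits)
    qed
    have h_le: "elog (a n \<omega>) / ereal (real n) \<le> ereal (h K n \<omega> / real n - real K)"
      if "0 < n" for n K
      using that low[of n \<omega>] by (auto simp: h_def elog_def field_simps max_def split: if_splits)
    show ?case
    proof (cases "\<exists>K. c K \<noteq> 0")
      case True
      define K where "K = (SOME K. c K \<noteq> 0)"
      have K: "c K \<noteq> 0" unfolding K_def using True by (rule someI_ex)
      have "0 \<le> c K"
        by (rule LIMSEQ_le_const[OF lim]) (auto simp: h_def)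
      with K have "\<forall>\<^sub>F n in sequentially. 0 < h K n \<omega> / real n"
        by (intro order_tendstoD(1)[OF lim]) auto
      then have ev: "\<forall>\<^sub>F n in sequentially. ereal (h K n \<omega> / real n - real K) = elog (a n \<omega>) / ereal (real n)"
        by eventually_elim (rule h_pos[symmetric])
      have s: "s = ereal (c K - real K)" using True by (simp add: s_def K_def Let_def)
      have "(\<lambda>n. ereal (h K n \<omega> / real n - real K)) \<longlonglongrightarrow> s"
        unfolding s using lim by (auto intro!: tendsto_intros)
      then show ?thesis using ev by (rule Lim_transform_eventually)
    next
      case False
      have "\<forall>\<^sub>F n in sequentially. elog (a n \<omega>) / ereal (real n) < ereal r" for r
      proof -
        obtain K :: nat where K: "1 - r < real K" using reals_Archimedean2 by blast
        have "\<forall>\<^sub>F n in sequentially. h K n \<omega> / real n < 1"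
          using lim[of K] False by (intro order_tendstoD) auto
        then show ?thesis using eventually_gt_at_top[of 0]
        proof eventually_elim
          case (elim n)
          have "h K n \<omega> / real n - real K < r" using elim(1) K by linarith
          then have "ereal (h K n \<omega> / real n - real K) < ereal r" by simp
          with h_le[of n K] elim show ?case by (auto intro: le_less_trans)
        qed
      qed
      then show ?thesis using False by (simp add: s_def tendsto_MInfty)
    qed
  qed
  moreover have "s < \<infinity>" by (simp add: s_def Let_def)
  ultimately show ?thesis by blast
qed

end

section \<open>Measures on sequence spaces\<close>

definition shift :: "(nat \<Rightarrow> 'a) \<Rightarrow> nat \<Rightarrow> 'a" where
  "shift \<omega> = (\<lambda>i. \<omega> (Suc i))"

lemma funpow_shift: "(shift ^^ n) \<omega> = (\<lambda>i. \<omega> (i + n))"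
  by (induction n) (auto simp: shift_def)

lemma measurable_shift [measurable]: "shift \<in> PiM UNIV (\<lambda>_. M) \<rightarrow>\<^sub>M PiM UNIV (\<lambda>_. M)"
  unfolding shift_def by (rule measurable_PiM_single') (auto simp: space_PiM)

section \<open>Cylinder events and the measures they determine\<close>

definition cylinder :: "nat \<Rightarrow> (nat \<Rightarrow> 'a::topological_space) set \<Rightarrow> bool" where
  "cylinder n E \<longleftrightarrow> E \<in> sets (PiM UNIV (\<lambda>_. borel)) \<and> (\<forall>\<omega> \<omega>'. (\<forall>i<n. \<omega> i = \<omega>' i) \<longrightarrow> \<omega> \<in> E \<longrightarrow> \<omega>' \<in> E)"

lemma cylinder_sets [measurable_dest]: "cylinder n E \<Longrightarrow> E \<in> sets (PiM UNIV (\<lambda>_. borel))"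
  by (simp add: cylinder_def)

lemma cylinderD: "cylinder n E \<Longrightarrow> (\<And>i. i < n \<Longrightarrow> \<omega> i = \<omega>' i) \<Longrightarrow> \<omega> \<in> E \<longleftrightarrow> \<omega>' \<in> E"
  unfolding cylinder_def by metis

lemma cylinder_UNIV: "cylinder n UNIV"
  using sets.top[of "PiM UNIV (\<lambda>_. borel)"] by (simp add: cylinder_def space_PiM)

lemma cylinder_mono: "cylinder n E \<Longrightarrow> n \<le> m \<Longrightarrow> cylinder m E"
  unfolding cylinder_def by (meson less_le_trans)

lemma cylinder_Int: "cylinder n E \<Longrightarrow> cylinder n F \<Longrightarrow> cylinder n (E \<inter> F)"
  unfolding cylinder_def by blast

lemma cylinder_restrict:
  assumes "X \<in> sets (PiM {..<n} (\<lambda>_. borel))"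
  shows "cylinder n {\<omega>. restrict \<omega> {..<n} \<in> X}"
  unfolding cylinder_def
proof (intro conjI allI impI)
  have "(\<lambda>\<omega>. restrict \<omega> {..<n}) -` X \<inter> space (PiM UNIV (\<lambda>_. borel)) \<in> sets (PiM UNIV (\<lambda>_. borel))"
    using assms by (intro measurable_sets[OF measurable_restrict_subset]) auto
  then show "{\<omega>. restrict \<omega> {..<n} \<in> X} \<in> sets (PiM UNIV (\<lambda>_. borel))"
    by (simp add: space_PiM vimage_def)
next
  fix \<omega> \<omega>' :: "nat \<Rightarrow> 'a" assume "\<forall>i<n. \<omega> i = \<omega>' i" and "\<omega> \<in> {\<omega>. restrict \<omega> {..<n} \<in> X}"
  moreover from this(1) have "restrict \<omega> {..<n} = restrict \<omega>' {..<n}" by (auto simp: restrict_def)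
  ultimately show "\<omega>' \<in> {\<omega>. restrict \<omega> {..<n} \<in> X}" by simp
qed

text \<open>The measurable map \<open>ext\<close> fills the coordinates from \<open>n\<close> on
  with \<open>undefined\<close>; \<open>X\<close> is the preimage of \<open>E\<close> under it, and
  \<open>E\<close> cannot tell a sequence from its refilled version.\<close>

lemma cylinder_eq_restrict:
  fixes E :: "(nat \<Rightarrow> 'a::topological_space) set"
  assumes E: "cylinder n E"
  obtains X where "X \<in> sets (PiM {..<n} (\<lambda>_. borel))" "E = {\<omega>. restrict \<omega> {..<n} \<in> X}"
proof
  define ext :: "(nat \<Rightarrow> 'a) \<Rightarrow> nat \<Rightarrow> 'a" where "ext \<eta> = (\<lambda>i. if i < n then \<eta> i else undefined)" for \<eta>
  have ext: "ext \<in> PiM {..<n} (\<lambda>_. borel) \<rightarrow>\<^sub>M PiM UNIV (\<lambda>_. borel)"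
  proof (rule measurable_PiM_single')
    fix i show "(\<lambda>\<eta>. ext \<eta> i) \<in> PiM {..<n} (\<lambda>_. borel) \<rightarrow>\<^sub>M borel"
      unfolding ext_def by (cases "i < n") auto
  qed (auto simp: space_PiM)
  show "ext -` E \<inter> space (PiM {..<n} (\<lambda>_. borel)) \<in> sets (PiM {..<n} (\<lambda>_. borel))"
    using ext cylinder_sets[OF E] by (rule measurable_sets)
  have "\<omega> \<in> E \<longleftrightarrow> ext (restrict \<omega> {..<n}) \<in> E" for \<omega>
    by (rule cylinderD[OF E]) (simp add: ext_def)
  then show "E = {\<omega>. restrict \<omega> {..<n} \<in> ext -` E \<inter> space (PiM {..<n} (\<lambda>_. borel))}"
    by (auto simp: space_PiM)
qed

lemma cylinder_shift:
  assumes "cylinder p E" shows "cylinder (n + p) {\<omega>. (shift ^^ n) \<omega> \<in> E}"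
  unfolding cylinder_def
proof (intro conjI allI impI)
  have m: "(shift ^^ n) \<in> PiM UNIV (\<lambda>_. borel) \<rightarrow>\<^sub>M PiM UNIV (\<lambda>_. borel :: 'a measure)"
    by (induction n) auto
  show "{\<omega>. (shift ^^ n) \<omega> \<in> E} \<in> sets (PiM UNIV (\<lambda>_. borel))"
    using measurable_sets[OF m cylinder_sets[OF assms]] by (simp add: space_PiM vimage_def)
next
  fix \<omega> \<omega>' :: "nat \<Rightarrow> 'a" assume *: "\<forall>i<n + p. \<omega> i = \<omega>' i" and "\<omega> \<in> {\<omega>. (shift ^^ n) \<omega> \<in> E}"
  moreover have "(shift ^^ n) \<omega> \<in> E \<longleftrightarrow> (shift ^^ n) \<omega>' \<in> E"
    by (rule cylinderD[OF assms]) (use * in \<open>auto simp: funpow_shift\<close>)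
  ultimately show "\<omega>' \<in> {\<omega>. (shift ^^ n) \<omega> \<in> E}" by simp
qed

lemma cylinder_prod_emb:
  assumes J: "finite J" and A: "\<And>i. i \<in> J \<Longrightarrow> A i \<in> sets borel"
  shows "\<exists>n. cylinder n (prod_emb UNIV (\<lambda>_. borel) J (PiE J A))"
proof -
  obtain n where n: "J \<subseteq> {..<n}" using finite_nat_bounded[OF J] by blast
  have "prod_emb UNIV (\<lambda>_. borel) J (PiE J A) \<in> sets (PiM UNIV (\<lambda>_. borel))"
    using J A by (intro sets_PiM_I) auto
  then show ?thesis
    using n by (intro exI[of _ n]) (auto simp: cylinder_def prod_emb_def PiE_iff subset_eq)
qed

text \<open>Dynkin's theorem with the finite-dimensional boxes as generator, each of which is a
  cylinder.\<close>

lemma cylinder_induct [consumes 1, case_names cylinder compl union]: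
  fixes A :: "(nat \<Rightarrow> 'a::topological_space) set"
  assumes A: "A \<in> sets (PiM UNIV (\<lambda>_. borel))"
    and cyl: "\<And>n E. cylinder n E \<Longrightarrow> P E"
    and compl: "\<And>E. E \<in> sets (PiM UNIV (\<lambda>_. borel)) \<Longrightarrow> P E \<Longrightarrow> P (UNIV - E)"
    and union: "\<And>E :: nat \<Rightarrow> _. disjoint_family E \<Longrightarrow> range E \<subseteq> sets (PiM UNIV (\<lambda>_. borel)) \<Longrightarrow> (\<And>i. P (E i)) \<Longrightarrow> P (\<Union>i. E i)"
  shows "P A"
proof -
  have A': "A \<in> sigma_sets UNIV (prod_algebra UNIV (\<lambda>_. borel))"
    using A by (simp add: sets_PiM)
  have sets: "sigma_sets UNIV (prod_algebra UNIV (\<lambda>_. borel)) = sets (PiM UNIV (\<lambda>_. borel :: 'a measure))"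
    by (simp add: sets_PiM)
  show ?thesis
    using Int_stable_prod_algebra _ A'
  proof (rule sigma_sets_induct_disjoint)
    show "prod_algebra UNIV (\<lambda>_. borel :: 'a measure) \<subseteq> Pow UNIV" by simp
  next
    fix E :: "(nat \<Rightarrow> 'a) set" assume "E \<in> prod_algebra UNIV (\<lambda>_. borel :: 'a measure)"
    then obtain J X where "E = prod_emb UNIV (\<lambda>_. borel) J (PiE J X)" "finite J" "X \<in> (\<Pi> i\<in>J. sets borel)"
      by (rule prod_algebraE) auto
    then show "P E" using cylinder_prod_emb[of J X] cyl by (metis Pi_iff)
  next
    show "P {}" using compl[OF cylinder_sets[OF cylinder_UNIV[of 0]] cyl[OF cylinder_UNIV[of 0]]] by simp
  next
    fix E :: "(nat \<Rightarrow> 'a) set" assume "E \<in> sigma_sets UNIV (prod_algebra UNIV (\<lambda>_. borel :: 'a measure))" "P E"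
    then show "P (UNIV - E)" unfolding sets by (intro compl)
  next
    fix E :: "nat \<Rightarrow> (nat \<Rightarrow> 'a) set"
    assume "disjoint_family E" "range E \<subseteq> sigma_sets UNIV (prod_algebra UNIV (\<lambda>_. borel :: 'a measure))" "\<And>i. P (E i)"
    then show "P (\<Union>i. E i)" unfolding sets by (intro union)
  qed
qed

text \<open>Stated for signed combinations and not just for two measures, because polarisation and
  parallelogram identities between several laws are to be extended from cylinders to all
  events.\<close>

lemma linear_combination_eq_0:
  fixes M :: "'j \<Rightarrow> (nat \<Rightarrow> 'a::topological_space) measure"
  assumes fin: "\<And>j. j \<in> J \<Longrightarrow> finite_measure (M j)"
    and sets_M: "\<And>j. j \<in> J \<Longrightarrow> sets (M j) = sets (PiM UNIV (\<lambda>_. borel))"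
    and cyl: "\<And>n E. cylinder n E \<Longrightarrow> (\<Sum>j\<in>J. c j * measure (M j) E) = 0"
    and A: "A \<in> sets (PiM UNIV (\<lambda>_. borel))"
  shows "(\<Sum>j\<in>J. c j * measure (M j) A) = 0"
  using A
proof (induction A rule: cylinder_induct)
  case (compl E)
  have "measure (M j) (UNIV - E) = measure (M j) UNIV - measure (M j) E" if "j \<in> J" for j
    using finite_measure.finite_measure_compl[OF fin[OF that], of E] compl sets_M[OF that]
      sets_eq_imp_space_eq[OF sets_M[OF that]] by (simp add: space_PiM)
  then have "(\<Sum>j\<in>J. c j * measure (M j) (UNIV - E))
     = (\<Sum>j\<in>J. c j * measure (M j) UNIV) - (\<Sum>j\<in>J. c j * measure (M j) E)"
    by (simp add: right_diff_distrib sum_subtractf)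
  then show ?case using compl cyl[OF cylinder_UNIV[of 0]] by simp
next
  case (union E)
  have "(\<lambda>i. measure (M j) (E i)) sums measure (M j) (\<Union>i. E i)" if "j \<in> J" for j
    using finite_measure.finite_measure_UNION[OF fin[OF that], of E] union sets_M[OF that] by simp
  then have "(\<lambda>i. \<Sum>j\<in>J. c j * measure (M j) (E i)) sums (\<Sum>j\<in>J. c j * measure (M j) (\<Union>i. E i))"
    by (intro sums_sum sums_mult)
  then have "(\<lambda>i. 0) sums (\<Sum>j\<in>J. c j * measure (M j) (\<Union>i. E i))" using union by simp
  then show ?case using sums_unique2[OF sums_zero] by metis
qed (use cyl in auto)

lemma measure_eqI_cylinder:
  fixes M N :: "(nat \<Rightarrow> 'a::topological_space) measure"
  assumes "finite_measure M" "finite_measure N"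
    and M: "sets M = sets (PiM UNIV (\<lambda>_. borel))" and N: "sets N = sets (PiM UNIV (\<lambda>_. borel))"
    and cyl: "\<And>n E. cylinder n E \<Longrightarrow> measure M E = measure N E"
  shows "M = N"
proof (rule measure_eqI)
  fix A assume "A \<in> sets M"
  then have A: "A \<in> sets (PiM UNIV (\<lambda>_. borel))" using M by simp
  have "(\<Sum>b\<in>{True, False}. (if b then 1 else -1) * measure (if b then M else N) A) = 0"
    using A by (rule linear_combination_eq_0[rotated -1]) (use assms in auto)
  then show "emeasure M A = emeasure N A"
    using finite_measure.emeasure_eq_measure[of M] finite_measure.emeasure_eq_measure[of N] assms by simp
qed (use M N in simp)

lemma (in sequence_space) nn_integral_comb_seq:
  assumes [measurable]: "f \<in> borel_measurable S"
  shows "(\<integral>\<^sup>+\<omega>. f \<omega> \<partial>S) = (\<integral>\<^sup>+\<omega>. \<integral>\<^sup>+\<omega>'. f (comb_seq n \<omega> \<omega>') \<partial>S \<partial>S)"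
proof -
  have "(\<integral>\<^sup>+\<omega>. f \<omega> \<partial>S) = (\<integral>\<^sup>+\<omega>. f \<omega> \<partial>distr (S \<Otimes>\<^sub>M S) S (\<lambda>(\<omega>, \<omega>'). comb_seq n \<omega> \<omega>'))"
    by (subst PiM_comb_seq) simp
  also have "\<dots> = (\<integral>\<^sup>+x. f (case x of (\<omega>, \<omega>') \<Rightarrow> comb_seq n \<omega> \<omega>') \<partial>(S \<Otimes>\<^sub>M S))"
    by (rule nn_integral_distr) (auto intro: measurable_comb_seq)
  also have "\<dots> = (\<integral>\<^sup>+\<omega>. \<integral>\<^sup>+\<omega>'. f (comb_seq n \<omega> \<omega>') \<partial>S \<partial>S)"
    by (subst P.nn_integral_fst[symmetric]) auto
  finally show ?thesis .
qed

lemma (in sequence_space) nn_integral_component: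
  assumes [measurable]: "f \<in> borel_measurable M"
  shows "(\<integral>\<^sup>+\<omega>. f (\<omega> i) \<partial>S) = (\<integral>\<^sup>+v. f v \<partial>M)"
proof -
  have "(\<integral>\<^sup>+v. f v \<partial>M) = (\<integral>\<^sup>+v. f v \<partial>distr S M (\<lambda>\<omega>. \<omega> i))" by (subst PiM_component) auto
  also have "\<dots> = (\<integral>\<^sup>+\<omega>. f (\<omega> i) \<partial>S)" by (rule nn_integral_distr) auto
  finally show ?thesis ..
qed

subsection \<open>Change of measure along a martingale\<close>

text \<open>By the martingale identity the measures with density \<open>D n\<close>, seen on the
  first \<open>n\<close> coordinates, are consistent, and Kolmogorov's extension theorem on Polish
  spaces yields \<open>P\<close>. The densities need not converge to a density of \<open>P\<close>,
  which may be singular to \<open>R\<close>.\<close>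

lemma martingale_measure_exists_aux:
  fixes R :: "(nat \<Rightarrow> 'a::polish_space) measure" and D :: "nat \<Rightarrow> (nat \<Rightarrow> 'a) \<Rightarrow> ennreal"
  assumes R [measurable_cong]: "sets R = sets (PiM UNIV (\<lambda>_. borel))"
    and D [measurable]: "\<And>n. D n \<in> borel_measurable (PiM UNIV (\<lambda>_. borel))"
    and mart: "\<And>n E. cylinder n E \<Longrightarrow> (\<integral>\<^sup>+\<omega>. D (Suc n) \<omega> * indicator E \<omega> \<partial>R) = (\<integral>\<^sup>+\<omega>. D n \<omega> * indicator E \<omega> \<partial>R)"
    and total: "(\<integral>\<^sup>+\<omega>. D 0 \<omega> \<partial>R) = 1"
  shows "\<exists>P. prob_space P \<and> sets P = sets (PiM UNIV (\<lambda>_. borel)) \<and>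
    (\<forall>n E. cylinder n E \<longrightarrow> emeasure P E = (\<integral>\<^sup>+\<omega>. D n \<omega> * indicator E \<omega> \<partial>R))"
proof -
  let ?B = "\<lambda>_::nat. borel :: 'a measure"
  have space_R: "space R = UNIV" using sets_eq_imp_space_eq[OF R] by (simp add: space_PiM)
  have mart': "(\<integral>\<^sup>+\<omega>. D n \<omega> * indicator E \<omega> \<partial>R) = (\<integral>\<^sup>+\<omega>. D l \<omega> * indicator E \<omega> \<partial>R)"
    if "cylinder l E" "l \<le> n" for l n E
    using that(2) by (induction n rule: dec_induct) (auto simp: mart[OF cylinder_mono[OF that(1)]])
  define Q where "Q n = density R (D n)" for n
  have sets_Q [measurable_cong]: "sets (Q n) = sets (PiM UNIV ?B)" for n by (simp add: Q_def R)
  have space_Q: "space (Q n) = UNIV" for n by (simp add: Q_def space_R)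
  have Q: "emeasure (Q n) E = (\<integral>\<^sup>+\<omega>. D n \<omega> * indicator E \<omega> \<partial>R)" if "E \<in> sets (PiM UNIV ?B)" for n E
    unfolding Q_def using that by (intro emeasure_density) auto
  \<comment> \<open>A projective family is indexed by finite sets \<open>J\<close>; the marginal on
    \<open>J\<close> is read off at the first time that covers \<open>J\<close>, and
    \<open>P_eq\<close> shows that later times give the same.\<close>
  define N where "N J = (LEAST n. J \<subseteq> {..<n})" for J :: "nat set"
  have N: "J \<subseteq> {..<N J}" if "finite J" for J
  proof -
    obtain n where "J \<subseteq> {..<n}" using finite_nat_bounded[OF \<open>finite J\<close>] by blast
    then show ?thesis unfolding N_def by (rule LeastI)
  qed
  have N_le: "N J \<le> n" if "J \<subseteq> {..<n}" for J n unfolding N_def using that by (rule Least_le)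
  define P where "P J = distr (Q (N J)) (PiM J ?B) (\<lambda>\<omega>. restrict \<omega> J)" for J
  have restr [measurable]: "(\<lambda>\<omega>. restrict \<omega> J) \<in> PiM UNIV ?B \<rightarrow>\<^sub>M PiM J ?B" for J
    by (rule measurable_restrict_subset) auto
  have P_eq: "distr (Q n) (PiM J ?B) (\<lambda>\<omega>. restrict \<omega> J) = P J" if J: "J \<subseteq> {..<n}" for J n
  proof (rule measure_eqI)
    fix X assume "X \<in> sets (distr (Q n) (PiM J ?B) (\<lambda>\<omega>. restrict \<omega> J))"
    then have X: "X \<in> sets (PiM J ?B)" by simp
    let ?E = "{\<omega>. restrict \<omega> J \<in> X}"
    have finJ: "finite J" using J finite_subset by blast
    have E: "?E \<in> sets (PiM UNIV ?B)"
      using measurable_sets[OF restr X] by (simp add: space_PiM vimage_def)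
    have c: "cylinder (N J) ?E"
      unfolding cylinder_def
    proof (intro conjI allI impI E)
      fix \<omega> \<omega>' :: "nat \<Rightarrow> 'a" assume "\<forall>i<N J. \<omega> i = \<omega>' i" "\<omega> \<in> ?E"
      moreover from this(1) N[OF finJ] have "restrict \<omega> J = restrict \<omega>' J"
        by (intro restrict_ext) (auto simp: subset_eq)
      ultimately show "\<omega>' \<in> ?E" by simp
    qed
    have "emeasure (Q n) ?E = emeasure (Q (N J)) ?E"
      unfolding Q[OF E] by (rule mart'[OF c N_le[OF J]])
    then show "emeasure (distr (Q n) (PiM J ?B) (\<lambda>\<omega>. restrict \<omega> J)) X = emeasure (P J) X"
      using X unfolding P_def by (simp add: emeasure_distr space_Q vimage_def)
  qed (simp add: P_def)
  interpret proj: projective_family UNIV P ?B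
  proof (rule projective_family.intro)
    fix J H :: "nat set" assume JH: "J \<subseteq> H" "finite H"
    have "distr (P H) (PiM J ?B) (\<lambda>f. restrict f J)
       = distr (Q (N H)) (PiM J ?B) ((\<lambda>f. restrict f J) \<circ> (\<lambda>\<omega>. restrict \<omega> H))"
      unfolding P_def by (intro distr_distr measurable_restrict_subset JH) measurable
    also have "(\<lambda>f. restrict f J) \<circ> (\<lambda>\<omega>. restrict \<omega> H) = (\<lambda>\<omega> :: nat \<Rightarrow> 'a. restrict \<omega> J)"
      using JH by (auto simp: fun_eq_iff restrict_def)
    also have "distr (Q (N H)) (PiM J ?B) (\<lambda>\<omega>. restrict \<omega> J) = P J"
      using N[OF JH(2)] JH(1) by (intro P_eq) auto
    finally show "P J = distr (P H) (PiM J ?B) (\<lambda>f. restrict f J)" ..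
  next
    fix J :: "nat set" assume "finite J"
    have "emeasure (Q (N J)) (space (Q (N J))) = (\<integral>\<^sup>+\<omega>. D (N J) \<omega> * indicator UNIV \<omega> \<partial>R)"
      unfolding space_Q using sets.top[of "PiM UNIV ?B"] by (intro Q) (simp add: space_PiM)
    also have "\<dots> = 1" using mart'[OF cylinder_UNIV[of 0], of "N J"] total by simp
    finally have "prob_space (Q (N J))" by (rule prob_spaceI)
    then show "prob_space (P J)" unfolding P_def by (rule prob_space.prob_space_distr) measurable
  qed
  interpret pp: polish_projective UNIV P ..
  show ?thesis
  proof (intro exI[of _ proj.lim] conjI allI impI)
    show "prob_space proj.lim" by (rule pp.P.prob_space_axioms)
    show "sets proj.lim = sets (PiM UNIV ?B)" by (rule proj.sets_lim)
    fix n and E :: "(nat \<Rightarrow> 'a) set" assume c: "cylinder n E"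
    then obtain X where X: "X \<in> sets (PiM {..<n} ?B)" and E: "E = {\<omega>. restrict \<omega> {..<n} \<in> X}"
      by (rule cylinder_eq_restrict)
    have emb: "prod_emb UNIV ?B {..<n} X = E" by (auto simp: prod_emb_def E)
    have "emeasure proj.lim E = emeasure (P {..<n}) X"
      unfolding emb[symmetric] using X by (intro pp.emeasure_lim_emb) auto
    also have "P {..<n} = distr (Q n) (PiM {..<n} ?B) (\<lambda>\<omega>. restrict \<omega> {..<n})"
      by (rule P_eq[symmetric]) simp
    also have "emeasure \<dots> X = emeasure (Q n) E"
      using X by (simp add: emeasure_distr space_Q vimage_def E)
    also have "\<dots> = (\<integral>\<^sup>+\<omega>. D n \<omega> * indicator E \<omega> \<partial>R)"
      by (rule Q) (use c in \<open>simp add: cylinder_def\<close>)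
    finally show "emeasure proj.lim E = (\<integral>\<^sup>+\<omega>. D n \<omega> * indicator E \<omega> \<partial>R)" .
  qed
qed

theorem martingale_measure_exists:
  fixes R :: "(nat \<Rightarrow> 'a::polish_space) measure" and D :: "nat \<Rightarrow> (nat \<Rightarrow> 'a) \<Rightarrow> ennreal"
  assumes R [measurable_cong]: "sets R = sets (PiM UNIV (\<lambda>_. borel))"
    and D [measurable]: "\<And>n. D n \<in> borel_measurable (PiM UNIV (\<lambda>_. borel))"
    and mart: "\<And>n E. cylinder n E \<Longrightarrow> (\<integral>\<^sup>+\<omega>. D (Suc n) \<omega> * indicator E \<omega> \<partial>R) = (\<integral>\<^sup>+\<omega>. D n \<omega> * indicator E \<omega> \<partial>R)"
    and total: "(\<integral>\<^sup>+\<omega>. D 0 \<omega> \<partial>R) < \<infinity>"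
  shows "\<exists>P. finite_measure P \<and> sets P = sets (PiM UNIV (\<lambda>_. borel)) \<and>
    (\<forall>n E. cylinder n E \<longrightarrow> emeasure P E = (\<integral>\<^sup>+\<omega>. D n \<omega> * indicator E \<omega> \<partial>R))"
proof (cases "(\<integral>\<^sup>+\<omega>. D 0 \<omega> \<partial>R) = 0")
  case True
  have 0: "(\<integral>\<^sup>+\<omega>. D n \<omega> \<partial>R) = 0" for n
    using True mart[OF cylinder_UNIV] by (induction n) auto
  have "(\<integral>\<^sup>+\<omega>. D n \<omega> * indicator E \<omega> \<partial>R) = 0" for n E
  proof -
    have "(\<integral>\<^sup>+\<omega>. D n \<omega> * indicator E \<omega> \<partial>R) \<le> (\<integral>\<^sup>+\<omega>. D n \<omega> \<partial>R)"
      by (intro nn_integral_mono) (auto simp: indicator_def)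
    then show ?thesis using 0 by simp
  qed
  then show ?thesis
    by (intro exI[of _ "null_measure (PiM UNIV (\<lambda>_. borel))"]) (auto intro!: finite_measureI)
next
  case False
  let ?c = "\<integral>\<^sup>+\<omega>. D 0 \<omega> \<partial>R"
  have c: "?c \<noteq> 0" "?c \<noteq> \<infinity>" using False total by auto
  have div: "(\<integral>\<^sup>+\<omega>. D n \<omega> / ?c * indicator E \<omega> \<partial>R) = (\<integral>\<^sup>+\<omega>. D n \<omega> * indicator E \<omega> \<partial>R) / ?c"
    if [measurable]: "E \<in> sets (PiM UNIV (\<lambda>_. borel))" for n E
    by (subst nn_integral_divide[symmetric]) (auto simp: divide_ennreal_def mult_ac intro!: nn_integral_cong)
  have "\<exists>P. prob_space P \<and> sets P = sets (PiM UNIV (\<lambda>_. borel)) \<and>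
    (\<forall>n E. cylinder n E \<longrightarrow> emeasure P E = (\<integral>\<^sup>+\<omega>. D n \<omega> / ?c * indicator E \<omega> \<partial>R))"
  proof (rule martingale_measure_exists_aux[OF R])
    show "(\<integral>\<^sup>+\<omega>. D 0 \<omega> / ?c \<partial>R) = 1"
      using c by (subst nn_integral_divide) (auto simp: ennreal_divide_self less_top)
  qed (auto simp: div cylinder_sets mart)
  then obtain P where P: "prob_space P" "sets P = sets (PiM UNIV (\<lambda>_. borel))"
    "\<And>n E. cylinder n E \<Longrightarrow> emeasure P E = (\<integral>\<^sup>+\<omega>. D n \<omega> / ?c * indicator E \<omega> \<partial>R)" by blast
  show ?thesis
  proof (intro exI[of _ "scale_measure ?c P"] conjI allI impI)
    interpret prob_space P by fact
    show "finite_measure (scale_measure ?c P)"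
      using c by (intro finite_measureI) (simp add: emeasure_space_1 space_scale_measure)
    fix n and E :: "(nat \<Rightarrow> 'a) set" assume cy: "cylinder n E"
    have "emeasure (scale_measure ?c P) E = ?c * ((\<integral>\<^sup>+\<omega>. D n \<omega> * indicator E \<omega> \<partial>R) / ?c)"
      using cy by (simp add: P(3)[OF cy] div cylinder_sets)
    also have "\<dots> = (\<integral>\<^sup>+\<omega>. D n \<omega> * indicator E \<omega> \<partial>R)"
      using c by (simp add: ennreal_times_divide ennreal_mult_divide_eq mult.commute[of ?c])
    finally show "emeasure (scale_measure ?c P) E = (\<integral>\<^sup>+\<omega>. D n \<omega> * indicator E \<omega> \<partial>R)" .
  qed (simp add: P)
qed

section \<open>Complex linear algebra\<close>

lemma cinner_axis_right: "cinner y (axis i 1) = y $ i"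
  and cinner_axis_left: "cinner (axis i 1) y = cnj (y $ i)"
  by (simp_all add: cinner_def axis_def if_distrib if_distribR cong: if_cong)

lemma cinner_add_left: "cinner (x + y) z = cinner x z + cinner y z"
  and cinner_diff_left: "cinner (x - y) z = cinner x z - cinner y z"
  and cinner_add_right: "cinner z (x + y) = cinner z x + cinner z y"
  and cinner_diff_right: "cinner z (x - y) = cinner z x - cinner z y"
  and cinner_cmult_left: "cinner (a *s x) z = a * cinner x z"
  and cinner_cmult_right: "cinner z (a *s x) = cnj a * cinner z x"
  and cinner_scaleR_left: "cinner (r *\<^sub>R x) z = of_real r * cinner x z"
  and cinner_scaleR_right: "cinner z (r *\<^sub>R x) = of_real r * cinner z x"
  and cinner_0_left [simp]: "cinner 0 z = 0"
  and cinner_0_right [simp]: "cinner z 0 = 0"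
  by (simp_all add: cinner_def sum.distrib sum_subtractf algebra_simps sum_distrib_left scaleR_conv_of_real[where 'a=complex])

lemma cinner_sum_left: "cinner (\<Sum>i\<in>S. f i) z = (\<Sum>i\<in>S. cinner (f i) z)"
  by (induction S rule: infinite_finite_induct) (auto simp: cinner_add_left)

lemma cinner_commute: "cinner y x = cnj (cinner x y)"
  by (simp add: cinner_def mult.commute)

lemma Re_cinner: "Re (cinner x y) = inner x y"
  by (simp add: cinner_def inner_vec_def inner_complex_def)

lemma cinner_self: "cinner x x = of_real ((norm x)\<^sup>2)"
proof (rule complex_eqI)
  show "Im (cinner x x) = Im (of_real ((norm x)\<^sup>2))"
    by (simp add: cinner_def)
qed (simp add: Re_cinner power2_norm_eq_inner)

lemma norm_cmult_vec: "norm (a *s x) = cmod a * norm (x :: complex^'k)"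
proof -
  have "(norm (a *s x))\<^sup>2 = (cmod a * norm x)\<^sup>2"
  proof -
    have "complex_of_real ((norm (a *s x))\<^sup>2) = a * cnj a * of_real ((norm x)\<^sup>2)"
      by (simp only: cinner_self[symmetric] cinner_cmult_left cinner_cmult_right mult_ac)
    also have "\<dots> = of_real ((cmod a * norm x)\<^sup>2)"
      by (simp only: complex_norm_square[symmetric] power_mult_distrib of_real_mult)
    finally show ?thesis by (simp only: of_real_eq_iff)
  qed
  then show ?thesis by (simp add: power2_eq_iff_nonneg)
qed

lemma norm_add_orthogonal: "cinner x y = 0 \<Longrightarrow> (norm (x + y))\<^sup>2 = (norm x)\<^sup>2 + (norm y)\<^sup>2"
  by (simp add: norm_add_Pythagorean orthogonal_def flip: Re_cinner)

text \<open>The phase \<open>c\<close> makes the inner product real and nonnegative; the rest is the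
  real Cauchy-Schwarz inequality.\<close>

lemma cmod_cinner_le: "cmod (cinner x y) \<le> norm x * norm y"
proof -
  define c where "c = (if cinner x y = 0 then 1 else cnj (cinner x y) / cmod (cinner x y))"
  have c: "cmod c = 1" by (simp add: c_def norm_divide)
  have "c * cinner x y = of_real (cmod (cinner x y))"
    using complex_norm_square[of "cinner x y"] by (auto simp: c_def power2_eq_square field_simps)
  then have "cmod (cinner x y) = Re (cinner (c *s x) y)" by (simp add: cinner_cmult_left)
  also have "\<dots> \<le> norm (c *s x) * norm y" unfolding Re_cinner by (rule norm_cauchy_schwarz)
  finally show ?thesis by (simp add: norm_cmult_vec c)
qed

lemma cadj_cadj [simp]: "cadj (cadj A) = A" by (simp add: cadj_def vec_eq_iff)

lemma cadj_mult: "cadj (A ** B) = cadj B ** cadj A"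
  by (simp add: cadj_def matrix_matrix_mult_def vec_eq_iff mult.commute)

lemma cadj_add: "cadj (A + B) = cadj A + cadj B" by (simp add: cadj_def vec_eq_iff)

lemma cadj_scaleR: "cadj (r *\<^sub>R A) = r *\<^sub>R cadj A"
  by (simp add: cadj_def vec_eq_iff scaleR_conv_of_real[where 'a=complex])

lemma cadj_0 [simp]: "cadj 0 = 0" by (simp add: cadj_def vec_eq_iff)

lemma cadj_mat_1 [simp]: "cadj (mat 1) = mat 1" by (simp add: cadj_def mat_def vec_eq_iff)

lemma cinner_cadj: "cinner (A *v x) y = cinner x (cadj A *v y)"
proof -
  have "cinner (A *v x) y = (\<Sum>i\<in>UNIV. \<Sum>j\<in>UNIV. A $ i $ j * x $ j * cnj (y $ i))"
    by (simp add: cinner_def matrix_vector_mult_def sum_distrib_right)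
  also have "\<dots> = (\<Sum>j\<in>UNIV. \<Sum>i\<in>UNIV. A $ i $ j * x $ j * cnj (y $ i))" by (rule sum.swap)
  also have "\<dots> = cinner x (cadj A *v y)"
    by (simp add: cinner_def matrix_vector_mult_def cadj_def sum_distrib_left mult_ac)
  finally show ?thesis .
qed

lemma norm_matrix_square: "(norm A)\<^sup>2 = (\<Sum>i\<in>UNIV. \<Sum>j\<in>UNIV. (cmod (A $ i $ j))\<^sup>2)"
  by (simp add: norm_vec_def L2_set_def real_sqrt_pow2 sum_nonneg)

lemma norm_cadj [simp]: "norm (cadj A) = norm A"
proof -
  have "(norm (cadj A))\<^sup>2 = (norm A)\<^sup>2"
    unfolding norm_matrix_square by (subst sum.swap) (simp add: cadj_def)
  then show ?thesis by (simp add: power2_eq_iff_nonneg)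
qed

lemma matrix_vector_mult_axis: "A *v axis j 1 = column j (A :: complex^'k^'k)"
  by (simp add: matrix_vector_mult_def column_def axis_def vec_eq_iff if_distrib cong: if_cong)

lemma norm_matrix_columns: "(norm A)\<^sup>2 = (\<Sum>j\<in>UNIV. (norm (A *v axis j 1))\<^sup>2)" for A :: "complex^'k^'k"
  unfolding norm_matrix_square
  by (subst sum.swap) (simp add: matrix_vector_mult_axis column_def norm_vec_def L2_set_def sum_nonneg)

lemma norm_matrix_vector_mult_le: "norm (A *v x) \<le> norm A * norm (x :: complex^'k)"
proof -
  have comp: "cmod ((A *v x) $ i) \<le> norm (A $ i) * norm x" for i
  proof -
    have "(A *v x) $ i = cinner x (\<chi> j. cnj (A $ i $ j))"
      by (simp add: matrix_vector_mult_def cinner_def mult.commute)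
    then have "cmod ((A *v x) $ i) \<le> norm x * norm (\<chi> j. cnj (A $ i $ j))" by (simp add: cmod_cinner_le)
    also have "norm (\<chi> j. cnj (A $ i $ j)) = norm (A $ i)" by (simp add: norm_vec_def)
    finally show ?thesis by (simp add: mult.commute)
  qed
  have "norm (A *v x) \<le> L2_set (\<lambda>i. norm (A $ i) * norm x) UNIV"
    unfolding norm_vec_def[of "A *v x"] by (intro L2_set_mono comp) auto
  also have "\<dots> = norm A * norm x"
    using L2_set_left_distrib[of "norm x" "\<lambda>i. norm (A $ i)" UNIV] by (simp add: norm_vec_def[of A])
  finally show ?thesis .
qed

lemma norm_matrix_mult_le: "norm (A ** B) \<le> norm A * norm B" for A B :: "complex^'k^'k"
proof -
  have "(norm (A ** B))\<^sup>2 = (\<Sum>j\<in>UNIV. (norm (A *v (B *v axis j 1)))\<^sup>2)"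
    unfolding norm_matrix_columns by (simp add: matrix_vector_mul_assoc)
  also have "\<dots> \<le> (\<Sum>j\<in>UNIV. (norm A * norm (B *v axis j 1))\<^sup>2)"
    by (intro sum_mono power_mono norm_matrix_vector_mult_le) auto
  also have "\<dots> = (norm A * norm B)\<^sup>2"
    by (simp add: power_mult_distrib norm_matrix_columns[of B] sum_distrib_left)
  finally show ?thesis by (rule power2_le_imp_le) simp
qed

lemma matrix_mult_scaleR: "(r *\<^sub>R A) ** B = r *\<^sub>R (A ** B)" "A ** (r *\<^sub>R B) = r *\<^sub>R (A ** (B :: complex^'k^'k))"
  by (simp_all add: matrix_matrix_mult_def vec_eq_iff scaleR_sum_right)

lemma matrix_add_rdistrib: "(A + B) ** C = A ** C + B ** (C :: complex^'k^'k)"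
  by (simp add: matrix_matrix_mult_def vec_eq_iff distrib_right sum.distrib)

lemma bounded_bilinear_matrix_mult: "bounded_bilinear ((**) :: complex^'k^'k \<Rightarrow> complex^'k^'k \<Rightarrow> complex^'k^'k)"
proof
  show "\<exists>K. \<forall>(A :: complex^'k^'k) (B :: complex^'k^'k). norm (A ** B) \<le> norm A * norm B * K"
    by (intro exI[of _ 1]) (simp add: norm_matrix_mult_le)
qed (simp_all add: matrix_add_ldistrib matrix_add_rdistrib matrix_mult_scaleR)

lemma bounded_bilinear_matrix_vector_mult:
  "bounded_bilinear ((*v) :: complex^'k^'k \<Rightarrow> complex^'k \<Rightarrow> complex^'k)"
proof
  show "\<exists>K. \<forall>(A :: complex^'k^'k) (x :: complex^'k). norm (A *v x) \<le> norm A * norm x * K"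
    by (intro exI[of _ 1]) (simp add: norm_matrix_vector_mult_le)
  show "(r *\<^sub>R A) *v x = r *\<^sub>R (A *v x)" "A *v (r *\<^sub>R x) = r *\<^sub>R (A *v x)"
    for r and A :: "complex^'k^'k" and x
    by (simp_all add: vec_eq_iff matrix_vector_mult_def scaleR_sum_right)
qed (simp_all add: matrix_vector_mult_add_rdistrib matrix_vector_right_distrib)

lemma bounded_linear_cadj: "bounded_linear cadj"
  by (rule bounded_linear_intro[where K=1]) (auto simp: cadj_add cadj_scaleR)

lemma bounded_bilinear_cinner: "bounded_bilinear cinner"
proof
  show "\<exists>K. \<forall>x y. cmod (cinner x y) \<le> norm x * norm y * K"
    by (intro exI[of _ 1]) (simp add: cmod_cinner_le)
qed (simp_all add: cinner_add_left cinner_add_right cinner_scaleR_left cinner_scaleR_right scaleR_conv_of_real[where 'a=complex])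

lemmas continuous_on_matrix_mult [continuous_intros] = bounded_bilinear.continuous_on[OF bounded_bilinear_matrix_mult]
lemmas continuous_on_matrix_vector_mult [continuous_intros] = bounded_bilinear.continuous_on[OF bounded_bilinear_matrix_vector_mult]
lemmas continuous_on_cadj [continuous_intros] = bounded_linear.continuous_on[OF bounded_linear_cadj]
lemmas continuous_on_cinner [continuous_intros] = bounded_bilinear.continuous_on[OF bounded_bilinear_cinner]

lemma measurable_matrix_mult [measurable]:
  fixes f g :: "'a \<Rightarrow> complex^'k^'k"
  assumes "f \<in> borel_measurable M" "g \<in> borel_measurable M"
  shows "(\<lambda>x. f x ** g x) \<in> borel_measurable M"
  using assms by (rule borel_measurable_continuous_Pair) (intro continuous_intros)

lemma measurable_matrix_vector_mult [measurable]:
  fixes f :: "'a \<Rightarrow> complex^'k^'k" and g :: "'a \<Rightarrow> complex^'k"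
  assumes "f \<in> borel_measurable M" "g \<in> borel_measurable M"
  shows "(\<lambda>x. f x *v g x) \<in> borel_measurable M"
  using assms by (rule borel_measurable_continuous_Pair) (intro continuous_intros)

lemma measurable_cinner [measurable]:
  fixes f g :: "'a \<Rightarrow> complex^'k"
  assumes "f \<in> borel_measurable M" "g \<in> borel_measurable M"
  shows "(\<lambda>x. cinner (f x) (g x)) \<in> borel_measurable M"
  using assms by (rule borel_measurable_continuous_Pair) (intro continuous_intros)

lemma measurable_cadj [measurable]: "cadj \<in> borel_measurable borel"
  by (intro borel_measurable_continuous_onI continuous_intros)

lemma norm_matrix_vector_mult_le_opnorm: "norm (A *v x) \<le> opnorm A * norm (x :: complex^'k)"
  unfolding opnorm_def by (rule onorm) simp

lemma opnorm_nonneg: "0 \<le> opnorm (A :: complex^'k^'k)"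
  unfolding opnorm_def by (rule onorm_pos_le) simp

lemma opnorm_le_norm: "opnorm A \<le> norm (A :: complex^'k^'k)"
  unfolding opnorm_def by (rule onorm_bound) (auto intro: norm_matrix_vector_mult_le)

lemma norm_le_opnorm: "(norm A)\<^sup>2 \<le> CARD('k) * (opnorm (A :: complex^'k^'k))\<^sup>2"
proof -
  have "(norm A)\<^sup>2 \<le> (\<Sum>j\<in>(UNIV :: 'k set). (opnorm A)\<^sup>2)"
    unfolding norm_matrix_columns
  proof (intro sum_mono power_mono)
    fix j show "norm (A *v axis j 1) \<le> opnorm A"
      using norm_matrix_vector_mult_le_opnorm[of A "axis j 1"] by simp
  qed auto
  then show ?thesis by simp
qed

subsection \<open>Positive semidefinite matrices\<close>

definition outer :: "complex^'k \<Rightarrow> complex^'k^'k" where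
  "outer x = (\<chi> i j. x $ i * cnj (x $ j))"

definition psd :: "complex^'k^'k \<Rightarrow> bool" where
  "psd A \<longleftrightarrow> (\<forall>x. Im (cinner (A *v x) x) = 0 \<and> 0 \<le> Re (cinner (A *v x) x))"

text \<open>Born's rule without normalisation: for a state \<open>\<rho>\<close>, the weight of the
  outcome with Kraus operator \<open>W\<close>. The trace is real when \<open>psd \<rho>\<close>
  holds; \<open>Re\<close> then only adjusts the type.\<close>

definition weight :: "complex^'k^'k \<Rightarrow> complex^'k^'k \<Rightarrow> real" where
  "weight \<rho> W = Re (trace (W ** \<rho> ** cadj W))"

lemma outer_mult_vec: "outer x *v y = cinner y x *s x"
  by (simp add: outer_def matrix_vector_mult_def cinner_def vec_eq_iff sum_distrib_left mult_ac)

lemma cinner_outer: "cinner (outer x *v y) y = of_real ((cmod (cinner y x))\<^sup>2)"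
  by (simp only: outer_mult_vec cinner_cmult_left cinner_commute[of x y] complex_norm_square)

lemma psd_outer: "psd (outer x)"
  unfolding psd_def cinner_outer by simp

lemma cadj_outer: "cadj (outer x) = outer x"
  by (simp add: cadj_def outer_def vec_eq_iff mult.commute)

lemma trace_eq_cinner: "trace A = (\<Sum>i\<in>UNIV. cinner (A *v axis i 1) (axis i (1::complex)))"
  by (simp add: trace_def cinner_axis_right) (simp add: matrix_vector_mult_axis column_def)

lemma weight_eq_cinner: "weight \<rho> W = (\<Sum>i\<in>UNIV. Re (cinner (\<rho> *v (cadj W *v axis i 1)) (cadj W *v axis i 1)))"
  unfolding weight_def trace_eq_cinner Re_sum
  by (intro sum.cong refl arg_cong[where f=Re]) (simp add: cinner_cadj flip: matrix_vector_mul_assoc)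

lemma weight_nonneg: "psd \<rho> \<Longrightarrow> 0 \<le> weight \<rho> W"
  unfolding weight_eq_cinner psd_def by (intro sum_nonneg) auto

lemma weight_add: "weight (\<rho> + \<sigma>) W = weight \<rho> W + weight \<sigma> W"
  and weight_diff: "weight (\<rho> - \<sigma>) W = weight \<rho> W - weight \<sigma> W"
  and weight_scaleR: "weight (r *\<^sub>R \<rho>) W = r * weight \<rho> W"
  by (simp_all add: weight_eq_cinner matrix_vector_mult_add_rdistrib matrix_vector_mult_diff_rdistrib
      bounded_bilinear.scaleR_left[OF bounded_bilinear_matrix_vector_mult]
      cinner_add_left cinner_diff_left cinner_scaleR_left
      sum.distrib sum_subtractf sum_distrib_left)

lemma weight_mult: "weight \<rho> (A ** B) = weight (B ** \<rho> ** cadj B) A"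
  by (simp add: weight_def cadj_mult matrix_mul_assoc)

lemma weight_outer: "weight (outer x) W = (norm (W *v x))\<^sup>2"
proof -
  have "weight (outer x) W = (\<Sum>i\<in>UNIV. (cmod (cinner (cadj W *v axis i 1) x))\<^sup>2)"
    unfolding weight_eq_cinner cinner_outer by simp
  also have "\<dots> = (\<Sum>i\<in>UNIV. (cmod ((W *v x) $ i))\<^sup>2)"
  proof (intro sum.cong refl)
    fix i
    have "cinner (cadj W *v axis i 1) x = cnj ((W *v x) $ i)"
      by (simp add: cinner_cadj[of "cadj W"] cinner_axis_left)
    then show "(cmod (cinner (cadj W *v axis i 1) x))\<^sup>2 = (cmod ((W *v x) $ i))\<^sup>2" by simp
  qed
  finally show ?thesis by (simp add: norm_vec_def L2_set_def sum_nonneg)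
qed

lemma weight_mat_1: "weight (mat 1) W = (norm W)\<^sup>2"
proof -
  have "weight (mat 1) W = (\<Sum>i\<in>UNIV. (norm (cadj W *v axis i 1))\<^sup>2)"
    unfolding weight_eq_cinner by (simp add: cinner_self)
  then show ?thesis by (simp add: norm_matrix_columns[symmetric])
qed

lemma weight_id: "weight \<rho> (mat 1) = Re (trace \<rho>)"
  by (simp add: weight_def)

lemma bounded_linear_trace: "bounded_linear (trace :: complex^'k^'k \<Rightarrow> complex)"
  unfolding trace_def
  by (intro bounded_linear_sum bounded_linear_compose[OF bounded_linear_vec_nth bounded_linear_vec_nth])

lemma continuous_on_weight [continuous_intros]:
  "continuous_on S f \<Longrightarrow> continuous_on S g \<Longrightarrow> continuous_on S (\<lambda>x. weight (f x) (g x))"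
  unfolding weight_def
  by (intro continuous_intros bounded_linear.continuous_on[OF bounded_linear_trace])

lemma measurable_weight [measurable]:
  fixes f g :: "'a \<Rightarrow> complex^'k^'k"
  assumes "f \<in> borel_measurable M" "g \<in> borel_measurable M"
  shows "(\<lambda>x. weight (f x) (g x)) \<in> borel_measurable M"
  using assms by (rule borel_measurable_continuous_Pair) (intro continuous_intros)

lemma continuous_outer: "continuous_on S outer"
  unfolding outer_def by (intro continuous_intros)

subsection \<open>Orthonormal families\<close>

definition orthonormal :: "nat \<Rightarrow> (nat \<Rightarrow> complex^'k) \<Rightarrow> bool" where
  "orthonormal n x \<longleftrightarrow> (\<forall>i<n. \<forall>j<n. cinner (x i) (x j) = (if i = j then 1 else 0))"

definition orth_proj :: "nat \<Rightarrow> (nat \<Rightarrow> complex^'k) \<Rightarrow> complex^'k \<Rightarrow> complex^'k" where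
  "orth_proj n x y = (\<Sum>i<n. cinner y (x i) *s x i)"

lemma orthonormal_norm: "orthonormal n x \<Longrightarrow> i < n \<Longrightarrow> norm (x i) = 1"
proof -
  assume "orthonormal n x" "i < n"
  then have "of_real ((norm (x i))\<^sup>2) = (1 :: complex)"
    unfolding cinner_self[symmetric] by (auto simp: orthonormal_def)
  then have "(norm (x i))\<^sup>2 = 1\<^sup>2" by (simp only: of_real_eq_1_iff one_power2)
  then show ?thesis by (subst (asm) power2_eq_iff_nonneg) auto
qed

lemma orthonormal_independent:
  assumes o: "orthonormal n (x :: nat \<Rightarrow> complex^'k)"
  shows "inj_on x {..<n}" "vec.independent (x ` {..<n})"
proof -
  show inj: "inj_on x {..<n}"
  proof (rule inj_onI)
    fix i j assume ij: "i \<in> {..<n}" "j \<in> {..<n}" "x i = x j"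
    then have "cinner (x i) (x j) = 1" using o by (auto simp: orthonormal_def)
    then show "i = j" using o ij(1,2) by (auto simp: orthonormal_def split: if_splits)
  qed
  show "vec.independent (x ` {..<n})"
  proof (rule vec.independent_if_scalars_zero)
    fix f y assume eq: "(\<Sum>y\<in>x ` {..<n}. f y *s y) = 0" and "y \<in> x ` {..<n}"
    then obtain j where j: "j < n" "y = x j" by auto
    have "0 = cinner (\<Sum>i<n. f (x i) *s x i) (x j)" using eq by (simp add: sum.reindex[OF inj])
    also have "\<dots> = (\<Sum>i<n. f (x i) * (if i = j then 1 else 0))"
      using o j by (simp add: cinner_sum_left cinner_cmult_left orthonormal_def)
    also have "\<dots> = f y" using j by (simp add: if_distrib cong: if_cong)
    finally show "f y = 0" by simp
  qed simp
qed

lemma orthonormal_card_le: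
  assumes "orthonormal n (x :: nat \<Rightarrow> complex^'k)"
  shows "n \<le> CARD('k)"
proof -
  have "card (x ` {..<n}) \<le> vec.dim (UNIV :: (complex^'k) set)"
    using orthonormal_independent[OF assms] by (intro vec.independent_card_le_dim) auto
  then show ?thesis unfolding vec_dim_card by (simp add: card_image[OF orthonormal_independent(1)[OF assms]])
qed

lemma cinner_orth_proj_residual: "orthonormal n x \<Longrightarrow> i < n \<Longrightarrow> cinner (y - orth_proj n x y) (x i) = 0"
proof -
  assume o: "orthonormal n x" and i: "i < n"
  have "cinner (orth_proj n x y) (x i) = (\<Sum>j<n. cinner y (x j) * (if j = i then 1 else 0))"
    unfolding orth_proj_def cinner_sum_left cinner_cmult_left
    using o i by (intro sum.cong) (auto simp: orthonormal_def)
  also have "\<dots> = cinner y (x i)" using i by (simp add: if_distrib cong: if_cong)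
  finally show ?thesis by (simp add: cinner_diff_left)
qed

lemma orthonormal_extend:
  assumes o: "orthonormal n x" and y: "norm y = 1" "\<And>i. i < n \<Longrightarrow> cinner y (x i) = 0"
  shows "orthonormal (Suc n) (x(n := y))"
proof -
  have "cinner (x i) y = 0" if "i < n" for i using y(2)[OF that] cinner_commute[of "x i" y] by simp
  moreover have "cinner y y = 1" using y(1) by (simp add: cinner_self)
  ultimately show ?thesis using o y(2) by (auto simp: orthonormal_def less_Suc_eq)
qed

lemma orthonormal_extend_residual:
  assumes o: "orthonormal n x" and y: "orth_proj n x y \<noteq> y"
  obtains c where "orthonormal (Suc n) (x(n := c *s (y - orth_proj n x y)))"
proof (rule that, rule orthonormal_extend[OF o])
  let ?r = "y - orth_proj n x y"
  have "norm ?r \<noteq> 0" using y by simp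
  then show "norm (of_real (1 / norm ?r) *s ?r) = 1"
    unfolding norm_cmult_vec by (simp add: norm_divide)
  fix i assume "i < n"
  then show "cinner (of_real (1 / norm ?r) *s ?r) (x i) = 0"
    unfolding cinner_cmult_left using cinner_orth_proj_residual[OF o] by simp
qed

lemma orthonormal_complete:
  assumes "orthonormal (CARD('k)) (x :: nat \<Rightarrow> complex^'k)"
  shows "orth_proj (CARD('k)) x y = y"
proof (rule ccontr)
  assume "orth_proj (CARD('k)) x y \<noteq> y"
  then obtain c where "orthonormal (Suc CARD('k)) (x(CARD('k) := c *s (y - orth_proj (CARD('k)) x y)))"
    by (rule orthonormal_extend_residual[OF assms])
  from orthonormal_card_le[OF this] show False by simp
qed

lemma orthonormal_incomplete:
  assumes o: "orthonormal n (x :: nat \<Rightarrow> complex^'k)" and n: "n < CARD('k)"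
  obtains y where "norm y = 1" "\<And>i. i < n \<Longrightarrow> cinner y (x i) = 0"
proof -
  have "\<exists>y. orth_proj n x y \<noteq> y"
  proof (rule ccontr)
    assume "\<not> (\<exists>y. orth_proj n x y \<noteq> y)"
    then have eq: "y = orth_proj n x y" for y by auto
    have "orth_proj n x y \<in> vec.span (x ` {..<n})" for y
      unfolding orth_proj_def by (intro vec.span_sum vec.span_scale vec.span_base) auto
    with eq have "(UNIV :: (complex^'k) set) \<subseteq> vec.span (x ` {..<n})" by (metis subsetI)
    then have "vec.dim (UNIV :: (complex^'k) set) \<le> card (x ` {..<n})"
      by (intro vec.dim_le_card) auto
    also have "\<dots> \<le> n" using card_image_le[of "{..<n}" x] by simp
    finally show False using n unfolding vec_dim_card by simp
  qed
  then obtain y c where "orthonormal (Suc n) (x(n := c *s (y - orth_proj n x y)))"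
    using orthonormal_extend_residual[OF o] by metis
  note o' = this
  show thesis
  proof (rule that)
    show "norm (c *s (y - orth_proj n x y)) = 1" using orthonormal_norm[OF o', of n] by simp
    fix i assume "i < n"
    then show "cinner (c *s (y - orth_proj n x y)) (x i) = 0"
      unfolding cinner_cmult_left using cinner_orth_proj_residual[OF o] by simp
  qed
qed

text \<open>A longest orthonormal family inside \<open>S\<close> spans \<open>S\<close>, because a
  vector of \<open>S\<close> off its span would leave a residual in \<open>S\<close> that prolongs
  it. Lengths are bounded by the dimension, so a longest family exists.\<close>

lemma exists_orth_projector:
  assumes S: "vec.subspace (S :: (complex^'k) set)"
  obtains p where "orth_projector p" "range (\<lambda>x. p *v x) = S"
proof -
  define P where "P n \<longleftrightarrow> (\<exists>x. orthonormal n x \<and> (\<forall>i<n. x i \<in> S))" for n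
  have "P 0" by (auto simp: P_def orthonormal_def)
  moreover have "\<forall>n. P n \<longrightarrow> n \<le> CARD('k)" unfolding P_def using orthonormal_card_le by blast
  ultimately obtain n where n: "P n" and max: "\<And>m. P m \<Longrightarrow> m \<le> n"
  proof -
    have "\<exists>x. P x \<and> (\<forall>y. P y \<longrightarrow> id y \<le> id x)"
      using \<open>P 0\<close> \<open>\<forall>n. P n \<longrightarrow> n \<le> CARD('k)\<close>
      by (intro ex_has_greatest_nat[of P 0 id "Suc CARD('k)"]) (auto simp: less_Suc_eq_le)
    then show ?thesis using that by auto
  qed
  then obtain x where o: "orthonormal n x" and xS: "\<And>i. i < n \<Longrightarrow> x i \<in> S" by (auto simp: P_def)
  have projS: "orth_proj n x y \<in> S" for y
    unfolding orth_proj_def by (rule vec.subspace_sum[OF S]) (simp add: vec.subspace_scale[OF S] xS)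
  have fixS: "orth_proj n x y = y" if y: "y \<in> S" for y
  proof (rule ccontr)
    assume "orth_proj n x y \<noteq> y"
    then obtain c where "orthonormal (Suc n) (x(n := c *s (y - orth_proj n x y)))"
      by (rule orthonormal_extend_residual[OF o])
    moreover have "c *s (y - orth_proj n x y) \<in> S"
      by (rule vec.subspace_scale[OF S vec.subspace_diff[OF S y projS]])
    ultimately have "P (Suc n)" unfolding P_def using xS
      by (intro exI[of _ "x(n := c *s (y - orth_proj n x y))"]) (auto simp: less_Suc_eq)
    from max[OF this] show False by simp
  qed
  define p where "p = (\<Sum>i<n. outer (x i))"
  have p: "p *v y = orth_proj n x y" for y
    unfolding p_def orth_proj_def
    by (induction n) (auto simp: matrix_vector_mult_add_rdistrib outer_mult_vec)
  show thesis
  proof (rule that)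
    have "p ** p = p"
      by (subst matrix_eq) (simp add: p fixS projS flip: matrix_vector_mul_assoc)
    moreover have "cadj p = p"
      unfolding p_def by (induction n) (auto simp: cadj_add cadj_outer)
    ultimately show "orth_projector p" by (simp add: orth_projector_def)
    show "range (\<lambda>x. p *v x) = S"
    proof (rule set_eqI)
      fix y show "y \<in> range (\<lambda>x. p *v x) \<longleftrightarrow> y \<in> S"
        unfolding p using projS fixS[of y, symmetric] by auto
    qed
  qed
qed

subsection \<open>Singular values\<close>

text \<open>Near 0 a linear term cannot be dominated by a quadratic one; \<open>t = b / k\<close>
  with a positive \<open>k\<close> above \<open>K\<close> makes the conflict explicit.\<close>

lemma eq_0_of_quadratic_bound:
  fixes b K :: real
  assumes "\<And>t. 2 * t * b \<le> t\<^sup>2 * K"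
  shows "b = 0"
proof (rule ccontr)
  assume b: "b \<noteq> 0"
  define k where "k = \<bar>K\<bar> + 1"
  have k: "K \<le> k" "0 < k" by (auto simp: k_def)
  have "(b / k)\<^sup>2 * K \<le> (b / k)\<^sup>2 * k" using k by (intro mult_left_mono) auto
  also have "\<dots> = b\<^sup>2 / k" using k by (simp add: power2_eq_square)
  finally have "2 * (b / k) * b \<le> b\<^sup>2 / k" using assms[of "b / k"] by linarith
  moreover have "2 * (b / k) * b = 2 * (b\<^sup>2 / k)" by (simp add: power2_eq_square)
  moreover have "0 < b\<^sup>2 / k" using b k by simp
  ultimately show False by linarith
qed

text \<open>The maximiser \<open>y\<close> of \<open>norm (A *v y)\<close> on the unit sphere of a subspace \<open>S\<close>: moving from \<open>y\<close> in a
  direction \<open>z\<close> orthogonal to it cannot increase the ratio to first order.\<close>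

lemma maximizer_orthogonal:
  fixes A :: "complex^'k^'k"
  assumes max: "\<And>w. w \<in> S \<Longrightarrow> norm (A *v w) \<le> norm (A *v y) * norm w"
    and S: "\<And>a. y + a *s z \<in> S" and y: "norm y = 1" and z: "cinner z y = 0"
  shows "cinner (A *v z) (A *v y) = 0"
proof -
  have *: "Re (cinner (A *v (c *s z)) (A *v y)) = 0" for c
  proof (rule eq_0_of_quadratic_bound)
    fix t :: real
    let ?w = "y + t *\<^sub>R (c *s z)"
    have w: "?w = y + (of_real t * c) *s z" by (simp add: vec_eq_iff scaleR_conv_of_real[where 'a=complex])
    have nw: "(norm ?w)\<^sup>2 = 1 + t\<^sup>2 * (norm (c *s z))\<^sup>2"
    proof -
      have "cinner y (t *\<^sub>R (c *s z)) = 0"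
        using z cinner_commute[of y z] by (simp add: cinner_scaleR_right cinner_cmult_right)
      then show ?thesis using y by (simp add: norm_add_orthogonal power_mult_distrib)
    qed
    have "(norm (A *v y))\<^sup>2 + 2 * t * Re (cinner (A *v (c *s z)) (A *v y)) + t\<^sup>2 * (norm (A *v (c *s z)))\<^sup>2
        = (norm (A *v ?w))\<^sup>2"
    proof -
      have "A *v ?w = A *v y + t *\<^sub>R (A *v (c *s z))"
        by (simp only: matrix_vector_right_distrib bounded_bilinear.scaleR_right[OF bounded_bilinear_matrix_vector_mult])
      then show ?thesis
        by (simp only: Re_cinner power2_norm_eq_inner inner_add_left inner_add_right inner_scaleR_left inner_scaleR_right)
           (simp add: inner_commute power2_eq_square algebra_simps)
    qed
    also have "\<dots> \<le> (norm (A *v y) * norm ?w)\<^sup>2"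
      using max[of ?w] S unfolding w by (intro power_mono) auto
    also have "\<dots> = (norm (A *v y))\<^sup>2 * (1 + t\<^sup>2 * (norm (c *s z))\<^sup>2)"
      by (simp only: power_mult_distrib nw)
    finally show "2 * t * Re (cinner (A *v (c *s z)) (A *v y))
        \<le> t\<^sup>2 * ((norm (A *v y))\<^sup>2 * (norm (c *s z))\<^sup>2 - (norm (A *v (c *s z)))\<^sup>2)"
      by (simp add: algebra_simps)
  qed
  have lin: "cinner (A *v (c *s z)) (A *v y) = c * cinner (A *v z) (A *v y)" for c
    by (simp add: vector_scalar_commute cinner_cmult_left)
  show ?thesis
  proof (rule complex_eqI)
    show "Re (cinner (A *v z) (A *v y)) = Re 0" using *[of 1] unfolding lin by simp
    \<comment> \<open>The first variation controls real parts only; multiplying \<open>z\<close> by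
      \<open>- \<i>\<close> turns the imaginary part into a real one.\<close>
    show "Im (cinner (A *v z) (A *v y)) = Im 0" using *[of "- \<i>"] unfolding lin by simp
  qed
qed

text \<open>Right singular vectors, found one at a time: the next one maximises
  \<open>norm (A *v y)\<close> on the unit sphere of the orthogonal complement of the previous ones,
  and \<open>maximizer_orthogonal\<close> makes its image orthogonal to the images of all that
  follow. The numbers \<open>norm (A *v x i)\<close> are the singular values of
  \<open>A\<close>.\<close>

lemma exists_singular_basis:
  fixes A :: "complex^'k^'k"
  obtains x where "orthonormal (CARD('k)) x"
    "\<And>i j. i < j \<Longrightarrow> j < CARD('k) \<Longrightarrow> cinner (A *v x i) (A *v x j) = 0"
    "\<And>i j. i \<le> j \<Longrightarrow> j < CARD('k) \<Longrightarrow> norm (A *v x j) \<le> norm (A *v x i)"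
    "\<And>y. norm (A *v y) \<le> norm (A *v x 0) * norm y"
proof -
  define P where "P n x \<longleftrightarrow> orthonormal n x \<and>
      (\<forall>i<n. \<forall>y. (\<forall>j<i. cinner y (x j) = 0) \<longrightarrow> norm (A *v y) \<le> norm (A *v x i) * norm y) \<and>
      (\<forall>i<n. \<forall>y. (\<forall>j\<le>i. cinner y (x j) = 0) \<longrightarrow> cinner (A *v y) (A *v x i) = 0)" for n x
  have "n \<le> CARD('k) \<Longrightarrow> \<exists>x. P n x" for n
  proof (induction n)
    case 0
    show ?case by (auto simp: P_def orthonormal_def)
  next
    case (Suc n)
    then obtain x where Px: "P n x" by auto
    then have o: "orthonormal n x" by (simp add: P_def)
    define S where "S = {y. \<forall>i<n. cinner y (x i) = 0}"
    have "closed S"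
      unfolding S_def by (intro closed_Collect_all closed_Collect_imp closed_Collect_eq continuous_intros) auto
    then have "compact (S \<inter> sphere 0 1)" by (intro closed_Int_compact) auto
    moreover have "S \<inter> sphere 0 1 \<noteq> {}"
    proof -
      obtain y where "norm y = 1" "\<And>i. i < n \<Longrightarrow> cinner y (x i) = 0"
        using orthonormal_incomplete[OF o] Suc.prems by (metis Suc_le_lessD)
      then have "y \<in> S \<inter> sphere 0 1" by (simp add: S_def)
      then show ?thesis by blast
    qed
    moreover have "continuous_on (S \<inter> sphere 0 1) (\<lambda>y. norm (A *v y))"
      by (intro continuous_intros)
    ultimately have "\<exists>y\<in>S \<inter> sphere 0 1. \<forall>z\<in>S \<inter> sphere 0 1. norm (A *v z) \<le> norm (A *v y)"
      by (intro continuous_attains_sup)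
    then obtain y where y: "y \<in> S" "norm y = 1"
      and ymax: "\<And>z. z \<in> S \<Longrightarrow> norm z = 1 \<Longrightarrow> norm (A *v z) \<le> norm (A *v y)"
      by (auto simp: dist_norm)
    have max: "norm (A *v w) \<le> norm (A *v y) * norm w" if w: "w \<in> S" for w
    proof (cases "w = 0")
      case False
      have "(1 / norm w) *\<^sub>R w \<in> S" using w by (simp add: S_def cinner_scaleR_left)
      from ymax[OF this] False show ?thesis
        by (simp add: bounded_bilinear.scaleR_right[OF bounded_bilinear_matrix_vector_mult] field_simps)
    qed simp
    have "P (Suc n) (x(n := y))"
      unfolding P_def
    proof (intro conjI allI impI)
      show "orthonormal (Suc n) (x(n := y))"
        using y by (intro orthonormal_extend[OF o]) (auto simp: S_def)
    next
      fix i w assume i: "i < Suc n" and w: "\<forall>j<i. cinner w ((x(n := y)) j) = 0"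
      show "norm (A *v w) \<le> norm (A *v (x(n := y)) i) * norm w"
      proof (cases "i = n")
        case True
        with w have "w \<in> S" by (auto simp: S_def)
        with max True show ?thesis by simp
      next
        case False
        with Px i w show ?thesis by (auto simp: P_def)
      qed
    next
      fix i w assume i: "i < Suc n" and w: "\<forall>j\<le>i. cinner w ((x(n := y)) j) = 0"
      show "cinner (A *v w) (A *v (x(n := y)) i) = 0"
      proof (cases "i = n")
        case True
        have wS: "w \<in> S"
          unfolding S_def
        proof clarify
          fix j assume "j < n"
          with w True show "cinner w (x j) = 0" by (auto dest: spec[of _ j])
        qed
        have "cinner w y = 0" using w True by (auto dest: spec[of _ n])
        moreover have "y + a *s w \<in> S" for a
          using y wS by (auto simp: S_def cinner_add_left cinner_cmult_left)
        ultimately have "cinner (A *v w) (A *v y) = 0"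
          using max y(2) by (intro maximizer_orthogonal[of S]) auto
        with True show ?thesis by simp
      next
        case False
        with i have i': "i < n" by simp
        have "\<forall>j\<le>i. cinner w (x j) = 0"
        proof (intro allI impI)
          fix j assume "j \<le> i"
          with w i' show "cinner w (x j) = 0" by (auto dest: spec[of _ j])
        qed
        with Px i' show ?thesis by (auto simp: P_def)
      qed
    qed
    then show ?case by blast
  qed
  then obtain x where x: "P (CARD('k)) x" by blast
  then have o: "orthonormal (CARD('k)) x" by (simp add: P_def)
  show thesis
  proof (rule that[OF o])
    fix i j assume ij: "i < j" "j < CARD('k)"
    have "cinner (A *v x j) (A *v x i) = 0"
      using x ij o by (auto simp: P_def orthonormal_def)
    then show "cinner (A *v x i) (A *v x j) = 0"
      using cinner_commute[of "A *v x i" "A *v x j"] by simp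
  next
    fix i j assume ij: "i \<le> j" "j < CARD('k)"
    then have "norm (A *v x j) \<le> norm (A *v x i) * norm (x j)"
      using x o by (auto simp: P_def orthonormal_def)
    then show "norm (A *v x j) \<le> norm (A *v x i)"
      using orthonormal_norm[OF o ij(2)] by simp
  next
    fix y show "norm (A *v y) \<le> norm (A *v x 0) * norm y"
      using x by (auto simp: P_def)
  qed
qed

subsection \<open>Norms on exterior powers\<close>

lemma ext_inner_self: "ext_inner p t t = of_real ((\<Sum>i\<in>tuples p. (cmod (t i))\<^sup>2) / fact p)"
  unfolding ext_inner_def complex_norm_square[symmetric] by simp

lemma ext_norm_eq_L2: "ext_norm p t = L2_set (\<lambda>i. cmod (t i)) (tuples p) / sqrt (fact p)"
  unfolding ext_norm_def ext_inner_self Re_complex_of_real by (simp add: L2_set_def real_sqrt_divide)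

lemma ext_norm_nonneg [simp]: "0 \<le> ext_norm p t"
  by (simp add: ext_norm_eq_L2 L2_set_nonneg)

lemma ext_norm_cmult: "ext_norm p (\<lambda>i. c * t i) = cmod c * ext_norm p t"
  by (simp add: ext_norm_eq_L2 norm_mult L2_set_right_distrib)

lemma ext_norm_sum_le: "ext_norm p (\<lambda>i. \<Sum>m\<in>S. f m i) \<le> (\<Sum>m\<in>S. ext_norm p (f m))"
proof (induction S rule: infinite_finite_induct)
  case (insert m S)
  have "ext_norm p (\<lambda>i. f m i + (\<Sum>m\<in>S. f m i)) \<le> ext_norm p (f m) + ext_norm p (\<lambda>i. \<Sum>m\<in>S. f m i)"
  proof -
    have "L2_set (\<lambda>i. cmod (f m i + (\<Sum>m\<in>S. f m i))) (tuples p)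
        \<le> L2_set (\<lambda>i. cmod (f m i) + cmod (\<Sum>m\<in>S. f m i)) (tuples p)"
      by (intro L2_set_mono norm_triangle_ineq) auto
    also have "\<dots> \<le> L2_set (\<lambda>i. cmod (f m i)) (tuples p) + L2_set (\<lambda>i. cmod (\<Sum>m\<in>S. f m i)) (tuples p)"
      by (rule L2_set_triangle_ineq)
    finally show ?thesis by (simp add: ext_norm_eq_L2 divide_right_mono flip: add_divide_distrib)
  qed
  with insert show ?case by simp
qed (simp_all add: ext_norm_eq_L2 L2_set_def)

lemma cmod_le_ext_norm: "j \<in> tuples p \<Longrightarrow> cmod (t j) \<le> sqrt (fact p) * ext_norm p t"
  using member_le_L2_set[of "tuples p" j "\<lambda>i. cmod (t i)"] by (simp add: ext_norm_eq_L2)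

lemma wedge_permute:
  assumes \<tau>: "\<tau> permutes {..<p}"
  shows "wedge p (\<lambda>a. r (\<tau> a)) i = of_int (sign \<tau>) * wedge p r i"
proof (cases "i \<in> tuples p")
  case True
  let ?f = "\<lambda>\<sigma>. of_int (sign \<tau> * sign \<sigma>) * (\<Prod>a<p. r (\<sigma> a) $ i a) :: complex"
  have "of_int (sign \<tau>) * wedge p r i = (\<Sum>\<sigma> | \<sigma> permutes {..<p}. ?f \<sigma>)"
    using True by (simp add: wedge_def sum_distrib_left mult_ac)
  also have "\<dots> = (\<Sum>\<sigma> | \<sigma> permutes {..<p}. ?f (\<tau> \<circ> \<sigma>))"
    by (rule setum_permutations_compose_left[OF \<tau>])
  also have "\<dots> = wedge p (\<lambda>a. r (\<tau> a)) i"
  proof -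
    have "sign \<tau> * sign (\<tau> \<circ> \<sigma>) = sign \<sigma>" if "\<sigma> permutes {..<p}" for \<sigma>
      using that \<tau> by (simp add: sign_compose permutation_permutes exI[of _ "{..<p}"])
    then show ?thesis using True by (simp add: wedge_def)
  qed
  finally show ?thesis ..
qed (simp add: wedge_def)

lemma wedge_repeated:
  assumes ab: "a < p" "b < p" "a \<noteq> b" and eq: "r a = r b"
  shows "wedge p r i = 0"
proof -
  have "Transposition.transpose a b permutes {..<p}" using ab by (intro permutes_swap_id) auto
  moreover have "r (Transposition.transpose a b c) = r c" for c
    using eq by (auto simp: Transposition.transpose_def)
  ultimately have "wedge p r i = - wedge p r i"
    using wedge_permute[of "Transposition.transpose a b" p r i] ab by (simp add: sign_swap_id)
  then show ?thesis by simp
qed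

lemma tuples_compose_permutation:
  assumes \<tau>: "\<tau> permutes {..<p}"
  shows "bij_betw (\<lambda>j. j \<circ> \<tau>) (tuples p :: (nat \<Rightarrow> 'k) set) (tuples p)"
proof (rule bij_betw_byWitness[where f'="\<lambda>j. j \<circ> inv \<tau>"])
  have *: "j \<circ> \<sigma> \<in> tuples p" if "\<sigma> permutes {..<p}" "j \<in> tuples p" for \<sigma> and j :: "nat \<Rightarrow> 'k"
    using that by (auto simp: tuples_def PiE_iff extensional_def permutes_not_in)
  show "(\<lambda>j. j \<circ> \<tau>) ` tuples p \<subseteq> (tuples p :: (nat \<Rightarrow> 'k) set)"
       "(\<lambda>j. j \<circ> inv \<tau>) ` tuples p \<subseteq> (tuples p :: (nat \<Rightarrow> 'k) set)"
    using * \<tau> permutes_inv[OF \<tau>] by blast+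
  show "\<forall>j\<in>tuples p. (j \<circ> \<tau>) \<circ> inv \<tau> = (j :: nat \<Rightarrow> 'k)" "\<forall>j\<in>tuples p. (j \<circ> inv \<tau>) \<circ> \<tau> = (j :: nat \<Rightarrow> 'k)"
    using permutes_inv_o[OF \<tau>] by (simp_all add: o_assoc[symmetric])
qed

lemma wedge_antisym:
  assumes \<tau>: "\<tau> permutes {..<p}" and i: "i \<in> tuples p"
  shows "wedge p r (i \<circ> \<tau>) = of_int (sign \<tau>) * wedge p r i"
proof -
  have i': "i \<circ> \<tau> \<in> tuples p" using bij_betw_apply[OF tuples_compose_permutation[OF \<tau>] i] .
  let ?f = "\<lambda>\<sigma>. of_int (sign \<sigma>) * (\<Prod>a<p. r (\<sigma> a) $ i (\<tau> a)) :: complex"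
  have "wedge p r (i \<circ> \<tau>) = (\<Sum>\<sigma> | \<sigma> permutes {..<p}. ?f \<sigma>)"
    using i' by (simp add: wedge_def)
  also have "\<dots> = (\<Sum>\<sigma> | \<sigma> permutes {..<p}. ?f (\<sigma> \<circ> \<tau>))"
    by (rule sum_permutations_compose_right[OF \<tau>])
  also have "\<dots> = (\<Sum>\<sigma> | \<sigma> permutes {..<p}. of_int (sign \<tau>) * (of_int (sign \<sigma>) * (\<Prod>a<p. r (\<sigma> a) $ i a)))"
  proof (intro sum.cong refl)
    fix \<sigma> assume "\<sigma> \<in> {\<sigma>. \<sigma> permutes {..<p}}"
    then have "sign (\<sigma> \<circ> \<tau>) = sign \<sigma> * sign \<tau>"
      using \<tau> by (intro sign_compose) (auto simp: permutation_permutes)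
    moreover have "(\<Prod>a<p. r (\<sigma> (\<tau> a)) $ i (\<tau> a)) = (\<Prod>a<p. r (\<sigma> a) $ i a)"
      using prod.permute[OF \<tau>, of "\<lambda>a. r (\<sigma> a) $ i a"] by (simp add: o_def)
    ultimately show "?f (\<sigma> \<circ> \<tau>) = of_int (sign \<tau>) * (of_int (sign \<sigma>) * (\<Prod>a<p. r (\<sigma> a) $ i a))"
      by simp
  qed
  finally show ?thesis using i by (simp add: wedge_def sum_distrib_left)
qed

lemma ext_space_antisym:
  assumes "t \<in> ext_space p" "\<tau> permutes {..<p}" "i \<in> tuples p"
  shows "t (i \<circ> \<tau>) = of_int (sign \<tau>) * t i"
  using assms by (auto simp: ext_space_def wedge_antisym sum_distrib_left mult_ac)

lemma ext_map_ext_space: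
  assumes "t \<in> ext_space p" shows "ext_map p W t \<in> ext_space p"
proof -
  obtain N c r where t: "t = (\<lambda>i. \<Sum>m<(N::nat). c m * wedge p (r m) i)"
    using assms by (auto simp: ext_space_def)
  have "ext_map p W t = (\<lambda>i. \<Sum>m<N. c m * ext_map p W (wedge p (r m)) i)"
  proof
    fix i
    have "(\<Sum>j\<in>tuples p. (\<Prod>a<p. W $ i a $ j a) * (\<Sum>m<N. c m * wedge p (r m) j))
      = (\<Sum>m<N. c m * (\<Sum>j\<in>tuples p. (\<Prod>a<p. W $ i a $ j a) * wedge p (r m) j))"
      unfolding sum_distrib_left by (subst sum.swap) (simp add: mult_ac)
    then show "ext_map p W t i = (\<Sum>m<N. c m * ext_map p W (wedge p (r m)) i)"
      by (simp add: ext_map_def t)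
  qed
  then have eq: "ext_map p W t = (\<lambda>i. \<Sum>m<N. c m * wedge p (\<lambda>a. W *v r m a) i)"
    unfolding ext_map_wedge .
  show ?thesis
    unfolding ext_space_def eq by (intro CollectI exI[of _ N] exI[of _ c] exI[of _ "\<lambda>m a. W *v r m a"] refl)
qed

lemma wedge_ext_space: "wedge p r \<in> ext_space p"
  unfolding ext_space_def by (intro CollectI exI[of _ 1] exI[of _ "\<lambda>_. 1"] exI[of _ "\<lambda>_. r"]) simp

lemma cmult_ext_space: "t \<in> ext_space p \<Longrightarrow> (\<lambda>i. c * t i) \<in> ext_space p"
  unfolding ext_space_def
proof clarify
  fix N d r
  show "\<exists>(N'::nat) d' r'. (\<lambda>i. c * (\<Sum>m<(N::nat). d m * wedge p (r m) i)) = (\<lambda>i. \<Sum>m<N'. d' m * wedge p (r' m) i)"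
    by (intro exI[of _ N] exI[of _ "\<lambda>m. c * d m"] exI[of _ r]) (simp add: sum_distrib_left mult_ac)
qed

text \<open>The components of \<open>t\<close> are antisymmetric, so the sum over \<open>j\<close>
  may be averaged over the \<open>fact p\<close> rearrangements of \<open>j\<close>; the signed sum
  over these assembles wedges of columns of \<open>W\<close>.\<close>

lemma ext_map_expand:
  assumes t: "t \<in> ext_space p"
  shows "ext_map p (W :: complex^'k^'k) t i = (\<Sum>j\<in>tuples p. t j * wedge p (\<lambda>a. W *v axis (j a) 1) i) / fact p"
proof (cases "i \<in> tuples p")
  case True
  let ?P = "{\<tau>. \<tau> permutes {..<p}}"
  have "fact p * ext_map p W t i = (\<Sum>\<tau>\<in>?P. \<Sum>j\<in>tuples p. (\<Prod>a<p. W $ i a $ j a) * t j)"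
    using True by (simp add: ext_map_def card_permutations)
  also have "\<dots> = (\<Sum>\<tau>\<in>?P. \<Sum>j\<in>tuples p. (\<Prod>a<p. W $ i a $ j (\<tau> a)) * (of_int (sign \<tau>) * t j))"
  proof (rule sum.cong[OF refl])
    fix \<tau> assume "\<tau> \<in> ?P"
    then have \<tau>: "\<tau> permutes {..<p}" by simp
    show "(\<Sum>j\<in>tuples p. (\<Prod>a<p. W $ i a $ j a) * t j)
       = (\<Sum>j\<in>tuples p. (\<Prod>a<p. W $ i a $ j (\<tau> a)) * (of_int (sign \<tau>) * t j))"
      by (subst sum.reindex_bij_betw[OF tuples_compose_permutation[OF \<tau>], symmetric])
         (simp add: ext_space_antisym[OF t \<tau>])
  qed
  also have "\<dots> = (\<Sum>j\<in>tuples p. t j * wedge p (\<lambda>a. W *v axis (j a) 1) i)"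
    using True by (subst sum.swap) (simp add: wedge_def sum_distrib_left mult_ac matrix_vector_mult_axis column_def)
  finally show ?thesis by (simp add: field_simps)
qed (simp add: ext_map_def wedge_def)

text \<open>A computable substitute for \<open>ext_opnorm\<close>, comparable to it up to a
  constant: a finite sum of continuous functions of \<open>W\<close>, whose expectation can be
  estimated term by term, unlike that of a supremum.\<close>

definition ext_bound :: "nat \<Rightarrow> complex^'k^'k \<Rightarrow> real" where
  "ext_bound p W = (\<Sum>j\<in>tuples p. ext_norm p (wedge p (\<lambda>a. W *v axis (j a) 1)))"

lemma ext_norm_map_le_bound:
  assumes t: "t \<in> ext_space p" "ext_norm p t \<le> 1"
  shows "ext_norm p (ext_map p (W :: complex^'k^'k) t) \<le> ext_bound p W"
proof -
  have "ext_norm p (ext_map p W t) = ext_norm p (\<lambda>i. \<Sum>j\<in>tuples p. (t j / fact p) * wedge p (\<lambda>a. W *v axis (j a) 1) i)"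
    using t by (intro arg_cong[where f="ext_norm p"] ext) (simp add: ext_map_expand sum_divide_distrib)
  also have "\<dots> \<le> (\<Sum>j\<in>tuples p. ext_norm p (\<lambda>i. (t j / fact p) * wedge p (\<lambda>a. W *v axis (j a) 1) i))"
    by (rule ext_norm_sum_le)
  also have "\<dots> \<le> ext_bound p W"
    unfolding ext_bound_def
  proof (rule sum_mono)
    fix j :: "nat \<Rightarrow> 'k" assume j: "j \<in> tuples p"
    \<comment> \<open>The factor \<open>1 / fact p\<close> in the inner product allows components up
      to \<open>sqrt (fact p)\<close>; the division by \<open>fact p\<close> in the expansion brings
      every coefficient down to at most 1.\<close>
    have "cmod (t j) \<le> sqrt (fact p) * 1"
      using cmod_le_ext_norm[OF j, of t] t by (meson mult_left_mono order_trans real_sqrt_ge_zero fact_ge_zero)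
    also have "\<dots> \<le> fact p"
      using fact_ge_1[of p, where 'a=real] by (simp add: sqrt_le_D real_le_lsqrt power2_eq_square)
    finally have "cmod (t j / fact p) \<le> 1" by (simp add: norm_divide)
    then show "ext_norm p (\<lambda>i. (t j / fact p) * wedge p (\<lambda>a. W *v axis (j a) 1) i)
       \<le> ext_norm p (wedge p (\<lambda>a. W *v axis (j a) 1))"
      unfolding ext_norm_cmult by (intro mult_left_le_one_le) auto
  qed
  finally show ?thesis .
qed

lemma bdd_above_ext_norm: "bdd_above ((\<lambda>t. ext_norm p (ext_map p W t)) ` {t \<in> ext_space p. ext_norm p t \<le> 1})"
  using ext_norm_map_le_bound by (intro bdd_aboveI[of _ "ext_bound p W"]) auto

lemma zero_ext_space: "(\<lambda>_. 0) \<in> ext_space p"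
  using cmult_ext_space[OF wedge_ext_space, of 0] by simp

lemma ext_norm_zero [simp]: "ext_norm p (\<lambda>_. 0) = 0"
  using ext_norm_cmult[of p 0] by simp

lemma ext_unit_ball_ne: "{t \<in> ext_space p. ext_norm p t \<le> 1} \<noteq> {}"
  using zero_ext_space by force

lemma ext_norm_map_le:
  assumes t: "t \<in> ext_space p" "ext_norm p t \<le> 1"
  shows "ext_norm p (ext_map p W t) \<le> ext_opnorm p W"
  unfolding ext_opnorm_def using t by (intro cSUP_upper bdd_above_ext_norm) auto

lemma ext_opnorm_nonneg [simp]: "0 \<le> ext_opnorm p W"
  using ext_norm_map_le[OF zero_ext_space, of p W] order_trans[OF ext_norm_nonneg] by simp

lemma ext_opnorm_le_bound: "ext_opnorm p W \<le> ext_bound p W"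
  unfolding ext_opnorm_def using ext_norm_map_le_bound by (intro cSUP_least ext_unit_ball_ne) auto

lemma ext_map_cmult: "ext_map p W (\<lambda>i. c * t i) = (\<lambda>i. c * ext_map p W t i)"
  by (rule ext) (simp add: ext_map_def sum_distrib_left mult_ac)

lemma ext_norm_map_le_mult:
  assumes t: "t \<in> ext_space p"
  shows "ext_norm p (ext_map p (W :: complex^'k^'k) t) \<le> ext_opnorm p W * ext_norm p t"
proof (cases "ext_norm p t = 0")
  case True
  then have "t j = 0" if "j \<in> tuples p" for j using cmod_le_ext_norm[OF that, of t] by simp
  then have "ext_map p W t = (\<lambda>_. 0)" by (auto simp: ext_map_def)
  then show ?thesis using True by simp
next
  case False
  then have pos: "0 < ext_norm p t" by (simp add: less_le)
  let ?s = "\<lambda>i. of_real (1 / ext_norm p t) * t i"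
  have "ext_norm p (ext_map p W ?s) \<le> ext_opnorm p W"
    using pos by (intro ext_norm_map_le cmult_ext_space[OF t]) (simp only: ext_norm_cmult, simp add: norm_divide)
  then show ?thesis using pos unfolding ext_map_cmult ext_norm_cmult by (simp add: field_simps norm_divide)
qed

lemma ext_map_mult:
  fixes A B :: "complex^'k^'k"
  shows "ext_map p (A ** B) t = ext_map p A (ext_map p B t)"
proof
  fix i
  show "ext_map p (A ** B) t i = ext_map p A (ext_map p B t) i"
  proof (cases "i \<in> tuples p")
    case True
    have "(\<Sum>j\<in>tuples p. (\<Prod>a<p. (A ** B) $ i a $ j a) * t j)
      = (\<Sum>j\<in>tuples p. \<Sum>l\<in>tuples p. (\<Prod>a<p. A $ i a $ l a * B $ l a $ j a) * t j)"
      by (simp add: matrix_matrix_mult_def tuples_def sum_distrib_right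
          prod_sum_PiE[where B="\<lambda>_. UNIV" and f="\<lambda>a l. A $ i a $ l * B $ l $ j a" for j])
    also have "\<dots> = (\<Sum>l\<in>tuples p. (\<Prod>a<p. A $ i a $ l a) * (\<Sum>j\<in>tuples p. (\<Prod>a<p. B $ l a $ j a) * t j))"
      by (subst sum.swap) (simp add: sum_distrib_left prod.distrib mult_ac)
    finally show ?thesis using True by (simp add: ext_map_def)
  qed (simp add: ext_map_def)
qed

lemma ext_opnorm_mult:
  fixes A B :: "complex^'k^'k"
  shows "ext_opnorm p (A ** B) \<le> ext_opnorm p A * ext_opnorm p B"
  unfolding ext_opnorm_def[of p "A ** B"]
proof (rule cSUP_least[OF ext_unit_ball_ne])
  fix t :: "(nat \<Rightarrow> 'k) \<Rightarrow> complex" assume "t \<in> {t \<in> ext_space p. ext_norm p t \<le> 1}"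
  then have t: "t \<in> ext_space p" "ext_norm p t \<le> 1" by auto
  have "ext_norm p (ext_map p (A ** B) t) \<le> ext_opnorm p A * ext_norm p (ext_map p B t)"
    unfolding ext_map_mult by (intro ext_norm_map_le_mult ext_map_ext_space t)
  also have "\<dots> \<le> ext_opnorm p A * ext_opnorm p B"
    by (intro mult_left_mono ext_norm_map_le t ext_opnorm_nonneg)
  finally show "ext_norm p (ext_map p (A ** B) t) \<le> ext_opnorm p A * ext_opnorm p B" .
qed

text \<open>A supremum of continuous functions has open superlevel sets, however large the index
  set.\<close>

lemma measurable_ext_opnorm [measurable]: "(ext_opnorm p :: complex^'k^'k \<Rightarrow> real) \<in> borel_measurable borel"
proof (rule borel_measurableI_greater)
  fix y
  have eq: "{W :: complex^'k^'k. y < ext_opnorm p W}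
     = (\<Union>t\<in>{t \<in> ext_space p. ext_norm p t \<le> 1}. {W. y < ext_norm p (ext_map p W t)})"
    unfolding ext_opnorm_def by (auto simp: less_cSUP_iff[OF ext_unit_ball_ne bdd_above_ext_norm])
  have "open {W :: complex^'k^'k. y < ext_norm p (ext_map p W t)}" for t
    unfolding ext_norm_eq_L2 L2_set_def ext_map_def
    by (intro open_Collect_less continuous_intros) (auto intro!: continuous_intros)
  then have "open {W :: complex^'k^'k. y < ext_opnorm p W}"
    unfolding eq by (intro open_UN ballI)
  then have "{W :: complex^'k^'k. y < ext_opnorm p W} \<in> sets borel" by (rule borel_open)
  then show "{W \<in> space (borel :: (complex^'k^'k) measure). y < ext_opnorm p W} \<in> sets borel"
    by simp
qed

lemma ext_norm_wedge_square:
  "(ext_norm p (wedge p r))\<^sup>2 = Re (\<Sum>\<sigma> | \<sigma> permutes {..<p}. of_int (sign \<sigma>) * (\<Prod>a<p. cinner (r a) (r (\<sigma> a))))"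
proof -
  have "0 \<le> Re (ext_inner p (wedge p r) (wedge p r))"
    unfolding ext_inner_self Re_complex_of_real by (simp add: sum_nonneg)
  then show ?thesis unfolding ext_norm_def by (simp add: ext_inner_wedge)
qed

text \<open>In the Gram determinant only the identity permutation avoids a vanishing factor
  \<open>cinner (r a) (r (\<sigma> a))\<close> with \<open>\<sigma> a \<noteq> a\<close>.\<close>

lemma ext_norm_wedge_orthogonal:
  assumes "\<And>a b. a < p \<Longrightarrow> b < p \<Longrightarrow> a \<noteq> b \<Longrightarrow> cinner (r a) (r b) = 0"
  shows "ext_norm p (wedge p r) = (\<Prod>a<p. norm (r a))"
proof -
  have "(\<Sum>\<sigma> | \<sigma> permutes {..<p}. of_int (sign \<sigma>) * (\<Prod>a<p. cinner (r a) (r (\<sigma> a))))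
     = (\<Sum>\<sigma>\<in>{id}. of_int (sign \<sigma>) * (\<Prod>a<p. cinner (r a) (r (\<sigma> a))))"
  proof (rule sum.mono_neutral_right)
    show "\<forall>\<sigma>\<in>{\<sigma>. \<sigma> permutes {..<p}} - {id}. of_int (sign \<sigma>) * (\<Prod>a<p. cinner (r a) (r (\<sigma> a))) = 0"
    proof
      fix \<sigma> assume "\<sigma> \<in> {\<sigma>. \<sigma> permutes {..<p}} - {id}"
      then have \<sigma>: "\<sigma> permutes {..<p}" "\<sigma> \<noteq> id" by auto
      then obtain a where a: "\<sigma> a \<noteq> a" by (auto simp: fun_eq_iff)
      then have "a < p" using \<sigma>(1) by (meson lessThan_iff permutes_not_in)
      moreover have "\<sigma> a < p" using permutes_in_image[OF \<sigma>(1), of a] \<open>a < p\<close> by simp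
      ultimately have "cinner (r a) (r (\<sigma> a)) = 0" using assms a by metis
      then show "of_int (sign \<sigma>) * (\<Prod>a<p. cinner (r a) (r (\<sigma> a))) = 0"
        using \<open>a < p\<close> by auto
    qed
  qed (auto simp: finite_permutations permutes_id)
  then have "(ext_norm p (wedge p r))\<^sup>2 = Re (\<Prod>a<p. of_real ((norm (r a))\<^sup>2))"
    unfolding ext_norm_wedge_square by (simp add: cinner_self)
  also have "\<dots> = (\<Prod>a<p. norm (r a))\<^sup>2"
    by (simp only: of_real_prod[symmetric] Re_complex_of_real prod_power_distrib)
  finally show ?thesis by (simp add: power2_eq_iff_nonneg prod_nonneg)
qed

lemma ext_norm_wedge_2:
  "ext_norm 2 (wedge 2 r) = sqrt ((norm (r 0))\<^sup>2 * (norm (r 1))\<^sup>2 - (cmod (cinner (r 0) (r 1)))\<^sup>2)"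
proof -
  have P: "{\<sigma>. \<sigma> permutes {..<2::nat}} = {id, Transposition.transpose 0 1}"
  proof -
    have "{..<2::nat} = {0, 1}" by auto
    then show ?thesis using permutes_doubleton_iff[of _ "0::nat" 1] by auto
  qed
  have ne: "id \<noteq> Transposition.transpose (0::nat) 1"
    by (auto simp: fun_eq_iff Transposition.transpose_def intro!: exI[of _ 0])
  have "cinner (r 0) (r 1) * cinner (r 1) (r 0) = of_real ((cmod (cinner (r 0) (r 1)))\<^sup>2)"
    unfolding cinner_commute[of "r 1" "r 0"] by (rule complex_norm_square[symmetric])
  then have 1: "Re (cinner (r 0) (r 1) * cinner (r 1) (r 0)) = (cmod (cinner (r 0) (r 1)))\<^sup>2"
    by (simp only: Re_complex_of_real)
  have 2: "Re (cinner (r 0) (r 0) * cinner (r 1) (r 1)) = (norm (r 0))\<^sup>2 * (norm (r 1))\<^sup>2"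
    unfolding cinner_self by (simp only: of_real_mult[symmetric] Re_complex_of_real)
  have lt2: "{..<2::nat} = {0, 1}" by auto
  have "(ext_norm 2 (wedge 2 r))\<^sup>2
     = Re (cinner (r 0) (r 0) * cinner (r 1) (r 1) - cinner (r 0) (r 1) * cinner (r 1) (r 0))"
    unfolding ext_norm_wedge_square P using ne by (simp add: sign_swap_id lt2)
  also have "\<dots> = (norm (r 0))\<^sup>2 * (norm (r 1))\<^sup>2 - (cmod (cinner (r 0) (r 1)))\<^sup>2"
    by (simp only: minus_complex.sel 1 2)
  finally show ?thesis by (intro real_sqrt_unique[symmetric]) auto
qed

lemma wedge_multilinear:
  fixes n :: nat
  shows
  "wedge p (\<lambda>a. \<Sum>m<n. c a m *s x m) i
     = (\<Sum>f\<in>PiE {..<p} (\<lambda>_. {..<n}). (\<Prod>a<p. c a (f a)) * wedge p (\<lambda>a. x (f a)) i)"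
proof (cases "i \<in> tuples p")
  case True
  let ?P = "{\<sigma>. \<sigma> permutes {..<p}}" and ?F = "PiE {..<p} (\<lambda>_. {..<n})"
  have "(\<Prod>a<p. (\<Sum>m<n. c (\<sigma> a) m *s x m) $ i a)
      = (\<Sum>f\<in>?F. (\<Prod>a<p. c a (f a)) * (\<Prod>a<p. x (f (\<sigma> a)) $ i a))" if \<sigma>: "\<sigma> permutes {..<p}" for \<sigma>
  proof -
    \<comment> \<open>Reindexing the product by \<open>\<sigma>\<close> moves the permutation from
      the coefficients to the vectors, so that the coefficient belonging to \<open>f\<close> no
      longer depends on \<open>\<sigma>\<close>.\<close>
    have "(\<Prod>a<p. (\<Sum>m<n. c (\<sigma> a) m *s x m) $ i a)
        = (\<Prod>a<p. (\<lambda>b. \<Sum>m<n. c b m * x m $ i (inv \<sigma> b)) (\<sigma> a))"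
      using permutes_inverses[OF \<sigma>] by (simp add: sum_component)
    also have "\<dots> = (\<Prod>b<p. \<Sum>m<n. c b m * x m $ i (inv \<sigma> b))"
      using prod.permute[OF \<sigma>, of "\<lambda>b. \<Sum>m<n. c b m * x m $ i (inv \<sigma> b)"] by (simp add: o_def)
    also have "\<dots> = (\<Sum>f\<in>?F. \<Prod>b<p. c b (f b) * x (f b) $ i (inv \<sigma> b))"
      by (intro prod_sum_PiE finite_lessThan)
    also have "\<dots> = (\<Sum>f\<in>?F. (\<Prod>a<p. c a (f a)) * (\<Prod>a<p. x (f (\<sigma> a)) $ i a))"
    proof (intro sum.cong refl)
      fix f
      have "(\<Prod>b<p. x (f b) $ i (inv \<sigma> b)) = (\<Prod>a<p. x (f (\<sigma> a)) $ i a)"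
        using prod.permute[OF \<sigma>, of "\<lambda>b. x (f b) $ i (inv \<sigma> b)"] permutes_inverses[OF \<sigma>] by (simp add: o_def)
      then show "(\<Prod>b<p. c b (f b) * x (f b) $ i (inv \<sigma> b)) = (\<Prod>a<p. c a (f a)) * (\<Prod>a<p. x (f (\<sigma> a)) $ i a)"
        by (simp add: prod.distrib)
    qed
    finally show ?thesis .
  qed
  then have "wedge p (\<lambda>a. \<Sum>m<n. c a m *s x m) i
     = (\<Sum>\<sigma>\<in>?P. \<Sum>f\<in>?F. of_int (sign \<sigma>) * ((\<Prod>a<p. c a (f a)) * (\<Prod>a<p. x (f (\<sigma> a)) $ i a)))"
    using True by (simp add: wedge_def sum_distrib_left)
  also have "\<dots> = (\<Sum>f\<in>?F. (\<Prod>a<p. c a (f a)) * wedge p (\<lambda>a. x (f a)) i)"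
    using True by (subst sum.swap) (simp add: wedge_def sum_distrib_left mult_ac)
  finally show ?thesis .
qed (simp add: wedge_def)

text \<open>Among \<open>p + 1\<close> distinct indices the largest is at least \<open>p\<close>, so
  its factor is at most \<open>s p\<close>; induction handles the others.\<close>

lemma prod_antimono_le_initial:
  fixes s :: "nat \<Rightarrow> real"
  assumes S: "finite S" "S \<subseteq> {..<n}" and s: "\<And>i. 0 \<le> s i"
    and dec: "\<And>i j. i \<le> j \<Longrightarrow> j < n \<Longrightarrow> s j \<le> s i"
  shows "(\<Prod>i\<in>S. s i) \<le> (\<Prod>i<card S. s i)"
  using S
proof (induction "card S" arbitrary: S)
  case (Suc p)
  then have ne: "S \<noteq> {}" by auto
  let ?M = "Max S"
  have M: "?M \<in> S" using Suc ne by simp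
  have sub: "S - {?M} \<subseteq> {..<?M}" using Suc.prems(1) Max_ge[of S] by (auto simp: less_le)
  have c: "card (S - {?M}) = p" using Suc M by simp
  then have "p \<le> ?M" using card_mono[OF _ sub] by simp
  have "(\<Prod>i\<in>S. s i) = s ?M * (\<Prod>i\<in>S - {?M}. s i)" using Suc.prems(1) M by (simp add: prod.remove)
  also have "\<dots> \<le> s p * (\<Prod>i<card (S - {?M}). s i)"
  proof (intro mult_mono Suc(1))
    show "s ?M \<le> s p" using \<open>p \<le> ?M\<close> M Suc.prems by (intro dec) auto
  qed (use c Suc.prems s in \<open>auto intro!: prod_nonneg\<close>)
  also have "\<dots> = (\<Prod>i<card S. s i)" unfolding c Suc(2)[symmetric] by simp
  finally show ?case .
qed simp

text \<open>A factor independent of the matrix is harmless for exponents. This one counts the tuples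
  in \<open>ext_bound\<close> and, for each of them, the \<open>CARD('k) ^ p\<close> terms that
  arise when \<open>p\<close> basis vectors are expanded in singular vectors. The type argument
  carries the dimension.\<close>

definition ext_const :: "'k::finite itself \<Rightarrow> nat \<Rightarrow> real" where
  "ext_const TYPE('k) p = real (card (tuples p :: (nat \<Rightarrow> 'k) set)) * real (CARD('k)) ^ p"

text \<open>From below, test with the wedge of the first \<open>p\<close> singular vectors. From
  above, expand the basis vectors in the singular basis: wedges with a repeated vector vanish, and
  the others have as norm a product of \<open>p\<close> distinct singular values, at most that of
  the \<open>p\<close> largest. One sequence \<open>s\<close> serves all \<open>p\<close>, so that
  different exterior powers can be compared.\<close>

lemma ext_opnorm_singular_values:
  fixes A :: "complex^'k^'k"
  obtains s :: "nat \<Rightarrow> real" where "\<And>i. 0 \<le> s i" "\<And>i j. i \<le> j \<Longrightarrow> j < CARD('k) \<Longrightarrow> s j \<le> s i"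
    "s 0 = opnorm A"
    "\<And>p. p \<le> CARD('k) \<Longrightarrow> (\<Prod>i<p. s i) \<le> ext_opnorm p A"
    "\<And>p. p \<le> CARD('k) \<Longrightarrow> ext_bound p A \<le> ext_const TYPE('k) p * (\<Prod>i<p. s i)"
proof -
  obtain x where o: "orthonormal (CARD('k)) x"
    and orth: "\<And>i j. i < j \<Longrightarrow> j < CARD('k) \<Longrightarrow> cinner (A *v x i) (A *v x j) = 0"
    and dec: "\<And>i j. i \<le> j \<Longrightarrow> j < CARD('k) \<Longrightarrow> norm (A *v x j) \<le> norm (A *v x i)"
    and max: "\<And>y. norm (A *v y) \<le> norm (A *v x 0) * norm y"
    by (rule exists_singular_basis[of A]) blast
  have orth': "cinner (A *v x i) (A *v x j) = 0" if "i < CARD('k)" "j < CARD('k)" "i \<noteq> j" for i j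
    using orth[of i j] orth[of j i] that cinner_commute[of "A *v x i" "A *v x j"] by (cases "i < j") auto
  define s where "s i = norm (A *v x i)" for i
  show thesis
  proof (rule that[of s])
    show "s 0 = opnorm A"
    proof (rule antisym)
      show "s 0 \<le> opnorm A"
        using norm_matrix_vector_mult_le_opnorm[of A "x 0"] orthonormal_norm[OF o, of 0] by (simp add: s_def)
      show "opnorm A \<le> s 0"
        unfolding opnorm_def s_def by (rule onorm_bound) (use max in auto)
    qed
  next
    fix p assume p: "p \<le> CARD('k)"
    have "ext_norm p (wedge p x) = (\<Prod>a<p. norm (x a))"
      using o p by (intro ext_norm_wedge_orthogonal) (auto simp: orthonormal_def)
    also have "\<dots> = 1" using orthonormal_norm[OF o] p by (intro prod.neutral) auto
    finally have "ext_norm p (ext_map p A (wedge p x)) \<le> ext_opnorm p A"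
      by (intro ext_norm_map_le wedge_ext_space) simp
    also have "ext_norm p (ext_map p A (wedge p x)) = (\<Prod>i<p. s i)"
      unfolding ext_map_wedge s_def using p by (intro ext_norm_wedge_orthogonal orth') auto
    finally show "(\<Prod>i<p. s i) \<le> ext_opnorm p A" .
  next
    fix p assume p: "p \<le> CARD('k)"
    let ?F = "PiE {..<p} (\<lambda>_. {..<CARD('k)})"
    have "ext_norm p (wedge p (\<lambda>a. A *v axis (j a) 1)) \<le> real (CARD('k)) ^ p * (\<Prod>i<p. s i)"
      for j :: "nat \<Rightarrow> 'k"
    proof -
      define c where "c a m = cinner (axis (j a) 1) (x m)" for a m
      have exp: "A *v axis (j a) 1 = (\<Sum>m<CARD('k). c a m *s (A *v x m))" for a
        by (subst orthonormal_complete[OF o, of "axis (j a) 1", symmetric])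
           (simp add: orth_proj_def c_def linear_sum[OF matrix_vector_mul_linear] vector_scalar_commute)
      have c: "cmod (\<Prod>a<p. c a (f a)) \<le> 1" if f: "f \<in> ?F" for f
      proof -
        have "cmod (c a (f a)) \<le> 1" if "a < p" for a
        proof -
          have "f a < CARD('k)" using f that by (auto simp: PiE_iff)
          then show ?thesis
            using cmod_cinner_le[of "axis (j a) 1" "x (f a)"] orthonormal_norm[OF o] by (simp add: c_def)
        qed
        then show ?thesis unfolding prod_norm[symmetric] by (intro prod_le_1) auto
      qed
      have w: "ext_norm p (wedge p (\<lambda>a. A *v x (f a))) \<le> (\<Prod>i<p. s i)" if f: "f \<in> ?F" for f
      proof (cases "inj_on f {..<p}")
        case True
        have "ext_norm p (wedge p (\<lambda>a. A *v x (f a))) = (\<Prod>a<p. s (f a))"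
          unfolding s_def using f True
          by (intro ext_norm_wedge_orthogonal orth') (auto simp: PiE_iff inj_on_def)
        also have "\<dots> = (\<Prod>i\<in>f ` {..<p}. s i)" using True by (simp add: prod.reindex)
        also have "\<dots> \<le> (\<Prod>i<card (f ` {..<p}). s i)"
          using f by (intro prod_antimono_le_initial[where n="CARD('k)"])
             (auto simp: s_def dec PiE_iff)
        finally show ?thesis by (simp add: card_image[OF True])
      next
        case False
        then obtain a b where "a < p" "b < p" "a \<noteq> b" "f a = f b" by (auto simp: inj_on_def)
        then have "wedge p (\<lambda>a. A *v x (f a)) = (\<lambda>_. 0)"
          by (intro ext wedge_repeated[of a p b]) auto
        then show ?thesis by (simp add: prod_nonneg s_def)
      qed
      have "ext_norm p (wedge p (\<lambda>a. A *v axis (j a) 1))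
        = ext_norm p (\<lambda>i. \<Sum>f\<in>?F. (\<Prod>a<p. c a (f a)) * wedge p (\<lambda>a. A *v x (f a)) i)"
        unfolding exp by (intro arg_cong[where f="ext_norm p"] ext wedge_multilinear)
      also have "\<dots> \<le> (\<Sum>f\<in>?F. ext_norm p (\<lambda>i. (\<Prod>a<p. c a (f a)) * wedge p (\<lambda>a. A *v x (f a)) i))"
        by (rule ext_norm_sum_le)
      also have "\<dots> \<le> (\<Sum>f\<in>?F. (\<Prod>i<p. s i))"
      proof (rule sum_mono)
        fix f assume f: "f \<in> ?F"
        have "cmod (\<Prod>a<p. c a (f a)) * ext_norm p (wedge p (\<lambda>a. A *v x (f a))) \<le> 1 * (\<Prod>i<p. s i)"
          by (intro mult_mono c w f) auto
        then show "ext_norm p (\<lambda>i. (\<Prod>a<p. c a (f a)) * wedge p (\<lambda>a. A *v x (f a)) i) \<le> (\<Prod>i<p. s i)"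
          unfolding ext_norm_cmult by simp
      qed
      also have "\<dots> = real (CARD('k)) ^ p * (\<Prod>i<p. s i)" by (simp add: card_PiE)
      finally show ?thesis .
    qed
    then have "ext_bound p A \<le> (\<Sum>j\<in>(tuples p :: (nat \<Rightarrow> 'k) set). real (CARD('k)) ^ p * (\<Prod>i<p. s i))"
      unfolding ext_bound_def by (intro sum_mono) auto
    then show "ext_bound p A \<le> ext_const TYPE('k) p * (\<Prod>i<p. s i)"
      by (simp add: ext_const_def)
  qed (auto simp: s_def dec)
qed

section \<open>Quantum trajectories\<close>

lemma measurable_Wprod:
  assumes [measurable]: "V \<in> borel_measurable borel" and "{..<n} \<subseteq> I"
  shows "Wprod V n \<in> borel_measurable (PiM I (\<lambda>_. borel))"
  using assms(2)
proof (induction n)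
  case 0
  have "Wprod V 0 = (\<lambda>_. mat 1)" by auto
  then show ?case by simp
next
  case (Suc n)
  have sub: "{..<n} \<subseteq> I" "n \<in> I" using Suc.prems by (auto simp: lessThan_Suc)
  have [measurable]: "(\<lambda>\<omega>. \<omega> n) \<in> PiM I (\<lambda>_. borel) \<rightarrow>\<^sub>M borel"
    using sub by (intro measurable_component_singleton)
  note [measurable] = Suc.IH[OF sub(1)]
  have "Wprod V (Suc n) = (\<lambda>\<omega>. V (\<omega> n) ** Wprod V n \<omega>)" by auto
  then show ?case by simp
qed

lemma Wprod_cong: "(\<And>i. i < n \<Longrightarrow> \<omega> i = \<omega>' i) \<Longrightarrow> Wprod V n \<omega> = Wprod V n \<omega>'"
  by (induction n) auto

lemma Wprod_add: "Wprod V (n + p) \<omega> = Wprod V p ((shift ^^ n) \<omega>) ** Wprod V n \<omega>"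
  by (induction p) (auto simp: funpow_shift add.commute matrix_mul_assoc)

lemma Wprod_comb_seq: "Wprod V (n + p) (comb_seq n \<omega> \<omega>') = Wprod V p \<omega>' ** Wprod V n \<omega>"
proof -
  have "(shift ^^ n) (comb_seq n \<omega> \<omega>') = \<omega>'" by (auto simp: funpow_shift comb_seq_add)
  moreover have "Wprod V n (comb_seq n \<omega> \<omega>') = Wprod V n \<omega>" by (rule Wprod_cong) (simp add: comb_seq_less)
  ultimately show ?thesis by (simp add: Wprod_add)
qed

lemma cylinder_Wprod:
  assumes "V \<in> borel_measurable borel" and [measurable]: "B \<in> sets borel"
  shows "cylinder n {\<omega>. Wprod V n \<omega> \<in> B}"
  unfolding cylinder_def
proof (intro conjI allI impI)
  have "Wprod V n -` B \<inter> space (PiM UNIV (\<lambda>_. borel)) \<in> sets (PiM UNIV (\<lambda>_. borel))"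
    using assms by (intro measurable_sets[OF measurable_Wprod]) auto
  then show "{\<omega>. Wprod V n \<omega> \<in> B} \<in> sets (PiM UNIV (\<lambda>_. borel))" by (simp add: space_PiM vimage_def)
next
  fix \<omega> \<omega>' :: "nat \<Rightarrow> complex^'a^'a" assume "\<forall>i<n. \<omega> i = \<omega>' i" "\<omega> \<in> {\<omega>. Wprod V n \<omega> \<in> B}"
  then show "\<omega>' \<in> {\<omega>. Wprod V n \<omega> \<in> B}" using Wprod_cong[of n \<omega> \<omega>' V] by simp
qed

lemma trace_form: "weight \<sigma> A = Re (trace (cadj A ** A ** \<sigma>))"
proof -
  have "trace (A ** \<sigma> ** cadj A) = trace (cadj A ** (A ** \<sigma>))" by (rule trace_mul_sym)
  then show ?thesis by (simp add: weight_def matrix_mul_assoc)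
qed

text \<open>Polarisation over the real basis. The squared norms on the right are taken at finitely
  many vectors that do not depend on \<open>x\<close>, so \<open>law_linear\<close> can turn the
  identity into one between laws.\<close>

lemma norm_square_expand:
  fixes W :: "complex^'k^'k"
  shows "(norm (W *v x))\<^sup>2 = (\<Sum>b\<in>Basis. \<Sum>b'\<in>Basis. (x \<bullet> b) * (x \<bullet> b') *
    (((norm (W *v (b + b')))\<^sup>2 - (norm (W *v b))\<^sup>2 - (norm (W *v b'))\<^sup>2) / 2))"
proof -
  have "W *v x = W *v (\<Sum>b\<in>Basis. (x \<bullet> b) *\<^sub>R b)" by (simp only: euclidean_representation)
  also have "\<dots> = (\<Sum>b\<in>Basis. (x \<bullet> b) *\<^sub>R (W *v b))"
    by (simp only: linear_sum[OF matrix_vector_mul_linear] bounded_bilinear.scaleR_right[OF bounded_bilinear_matrix_vector_mult])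
  finally have 1: "(norm (W *v x))\<^sup>2 = (\<Sum>b\<in>Basis. \<Sum>b'\<in>Basis. (x \<bullet> b) * (x \<bullet> b') * ((W *v b') \<bullet> (W *v b)))"
    by (simp add: power2_norm_eq_inner inner_sum_left inner_sum_right sum_distrib_left mult_ac)
  have 2: "(W *v b') \<bullet> (W *v b) = ((norm (W *v (b + b')))\<^sup>2 - (norm (W *v b))\<^sup>2 - (norm (W *v b'))\<^sup>2) / 2" for b b'
    by (simp add: power2_norm_eq_inner matrix_vector_right_distrib inner_add_left inner_add_right inner_commute)
  show ?thesis unfolding 1 by (simp only: 2)
qed

lemma psd_add: "psd \<rho> \<Longrightarrow> psd \<sigma> \<Longrightarrow> psd (\<rho> + \<sigma>)"
  by (simp add: psd_def matrix_vector_mult_add_rdistrib cinner_add_left)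

lemma psd_scaleR: "psd \<rho> \<Longrightarrow> 0 \<le> a \<Longrightarrow> psd (a *\<^sub>R \<rho>)"
  by (simp add: psd_def bounded_bilinear.scaleR_left[OF bounded_bilinear_matrix_vector_mult] cinner_scaleR_left)

lemma psd_mat_1: "psd (mat 1)"
  by (simp add: psd_def cinner_self flip: of_real_power)

lemma psd_mat_1_minus:
  assumes "psd \<rho>" shows "psd (norm \<rho> *\<^sub>R mat 1 - \<rho>)"
  unfolding psd_def
proof (intro allI conjI)
  fix x
  have eq: "cinner ((norm \<rho> *\<^sub>R mat 1 - \<rho>) *v x) x = of_real (norm \<rho> * (norm x)\<^sup>2) - cinner (\<rho> *v x) x"
    by (simp add: matrix_vector_mult_diff_rdistrib bounded_bilinear.scaleR_left[OF bounded_bilinear_matrix_vector_mult]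
        cinner_diff_left cinner_scaleR_left cinner_self)
  show "Im (cinner ((norm \<rho> *\<^sub>R mat 1 - \<rho>) *v x) x) = 0"
    using assms unfolding eq by (simp add: psd_def del: of_real_mult of_real_power)
  have "Re (cinner (\<rho> *v x) x) \<le> norm (\<rho> *v x) * norm x"
    using cmod_cinner_le complex_Re_le_cmod order_trans by blast
  also have "\<dots> \<le> norm \<rho> * norm x * norm x"
    by (intro mult_right_mono norm_matrix_vector_mult_le) auto
  finally show "0 \<le> Re (cinner ((norm \<rho> *\<^sub>R mat 1 - \<rho>) *v x) x)"
    unfolding eq by (simp add: power2_eq_square mult_ac del: of_real_mult of_real_power)
qed

text \<open>A quantum instrument: the \<open>V v\<close> are Kraus operators, \<open>m\<close> is a
  reference law for the outcomes, and \<open>isometric\<close> expresses that the channel sending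
  \<open>\<rho>\<close> to the integral of \<open>V v ** \<rho> ** cadj (V v)\<close> preserves the
  trace.\<close>

locale instrument = prob_space m for m :: "(complex^'k^'k) measure" +
  fixes V :: "complex^'k^'k \<Rightarrow> complex^'k^'k" and C :: real
  assumes sets_m [measurable_cong]: "sets m = sets borel"
    and measurable_V [measurable]: "V \<in> borel_measurable borel"
    and norm_V: "norm (V v) \<le> C"
    and isometric: "(LINT v|m. cadj (V v) ** V v) = mat 1"
begin

sublocale seq: sequence_space m
  by unfold_locales

abbreviation \<Omega> :: "(nat \<Rightarrow> complex^'k^'k) measure" where "\<Omega> \<equiv> PiM UNIV (\<lambda>_. borel)"

lemma sets_S [measurable_cong]: "sets seq.S = sets \<Omega>"
  by (rule sets_PiM_cong) (auto simp: sets_m)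

lemma measurable_W [measurable]: "Wprod V n \<in> borel_measurable \<Omega>"
  by (rule measurable_Wprod) auto

lemma integrable_VV: "integrable m (\<lambda>v. cadj (V v) ** V v)"
proof (rule integrable_const_bound[where B="C * C"])
  have "norm (cadj (V v) ** V v) \<le> C * C" for v
    by (rule order_trans[OF norm_matrix_mult_le]) (auto intro!: mult_mono norm_V order_trans[OF norm_ge_zero norm_V])
  then show "AE v in m. norm (cadj (V v) ** V v) \<le> C * C" by simp
qed measurable

text \<open>Cyclicity of the trace puts \<open>cadj (V v) ** V v\<close> next to a fixed matrix; the
  integral then sees only its mean, the identity.\<close>

lemma nn_integral_weight:
  assumes "psd \<rho>"
  shows "(\<integral>\<^sup>+v. ennreal (weight \<rho> (V v ** B)) \<partial>m) = ennreal (weight \<rho> B)"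
proof -
  define \<sigma> where "\<sigma> = B ** \<rho> ** cadj B"
  define \<Lambda> where "\<Lambda> X = Re (trace (X ** \<sigma>))" for X
  have lin: "bounded_linear \<Lambda>"
    unfolding \<Lambda>_def
    by (intro bounded_linear_compose[OF bounded_linear_Re] bounded_linear_compose[OF bounded_linear_trace]
        bounded_bilinear.bounded_linear_left[OF bounded_bilinear_matrix_mult])
  have eq: "weight \<rho> (V v ** B) = \<Lambda> (cadj (V v) ** V v)" for v
    using trace_form[of "B ** \<rho> ** cadj B" "V v"] by (simp add: weight_mult \<Lambda>_def \<sigma>_def)
  have int: "integrable m (\<lambda>v. weight \<rho> (V v ** B))"
    unfolding eq by (rule integrable_bounded_linear[OF lin integrable_VV])
  have "(\<integral>\<^sup>+v. ennreal (weight \<rho> (V v ** B)) \<partial>m) = ennreal (LINT v|m. weight \<rho> (V v ** B))"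
    by (rule nn_integral_eq_integral[OF int]) (simp add: weight_nonneg assms)
  also have "(LINT v|m. weight \<rho> (V v ** B)) = \<Lambda> (mat 1)"
    unfolding eq by (simp add: integral_bounded_linear[OF lin integrable_VV] isometric)
  also have "\<dots> = weight \<rho> B" by (simp add: \<Lambda>_def \<sigma>_def weight_def)
  finally show ?thesis .
qed

text \<open>Under the product measure the factor \<open>V (\<omega> n)\<close> is independent of
  \<open>E\<close> and of the first \<open>n\<close> factors, and averaging over it leaves the
  weight unchanged.\<close>

lemma weight_martingale:
  assumes \<rho>: "psd \<rho>" and E: "cylinder n E"
  shows "(\<integral>\<^sup>+\<omega>. ennreal (weight \<rho> (Wprod V (Suc n) \<omega>)) * indicator E \<omega> \<partial>seq.S)
    = (\<integral>\<^sup>+\<omega>. ennreal (weight \<rho> (Wprod V n \<omega>)) * indicator E \<omega> \<partial>seq.S)"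
proof -
  note [measurable] = cylinder_sets[OF E]
  have ind: "indicator E (comb_seq n \<omega> \<omega>') = (indicator E \<omega> :: ennreal)" for \<omega> \<omega>'
    using cylinderD[OF E, of "comb_seq n \<omega> \<omega>'" \<omega>] by (simp add: indicator_def comb_seq_less)
  have W: "Wprod V (Suc n) (comb_seq n \<omega> \<omega>') = V (\<omega>' 0) ** Wprod V n \<omega>" for \<omega> \<omega>'
    using Wprod_comb_seq[of V n 1 \<omega> \<omega>'] by simp
  have "(\<integral>\<^sup>+\<omega>. ennreal (weight \<rho> (Wprod V (Suc n) \<omega>)) * indicator E \<omega> \<partial>seq.S)
    = (\<integral>\<^sup>+\<omega>. \<integral>\<^sup>+\<omega>'. ennreal (weight \<rho> (V (\<omega>' 0) ** Wprod V n \<omega>)) * indicator E \<omega> \<partial>seq.S \<partial>seq.S)"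
    by (subst seq.nn_integral_comb_seq[of _ n]) (auto simp only: W ind, measurable)
  also have "\<dots> = (\<integral>\<^sup>+\<omega>. ennreal (weight \<rho> (Wprod V n \<omega>)) * indicator E \<omega> \<partial>seq.S)"
  proof (rule nn_integral_cong)
    fix \<omega>
    have "(\<integral>\<^sup>+\<omega>'. ennreal (weight \<rho> (V (\<omega>' 0) ** Wprod V n \<omega>)) * indicator E \<omega> \<partial>seq.S)
      = (\<integral>\<^sup>+\<omega>'. ennreal (weight \<rho> (V (\<omega>' 0) ** Wprod V n \<omega>)) \<partial>seq.S) * indicator E \<omega>"
      by (rule nn_integral_multc) measurable
    also have "(\<integral>\<^sup>+\<omega>'. ennreal (weight \<rho> (V (\<omega>' 0) ** Wprod V n \<omega>)) \<partial>seq.S) = ennreal (weight \<rho> (Wprod V n \<omega>))"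
      by (subst seq.nn_integral_component[of "\<lambda>v. ennreal (weight \<rho> (V v ** Wprod V n \<omega>))"])
         (auto simp: nn_integral_weight[OF \<rho>])
    finally show "(\<integral>\<^sup>+\<omega>'. ennreal (weight \<rho> (V (\<omega>' 0) ** Wprod V n \<omega>)) * indicator E \<omega> \<partial>seq.S)
      = ennreal (weight \<rho> (Wprod V n \<omega>)) * indicator E \<omega>" .
  qed
  finally show ?thesis .
qed

text \<open>A measure of total mass \<open>Re (trace \<rho>)\<close>, provided by
  \<open>martingale_measure_exists\<close> and determined by its values on cylinders, so that the
  choice is harmless. It is not normalised, because that would destroy linearity in
  \<open>\<rho>\<close>.\<close>

definition law :: "complex^'k^'k \<Rightarrow> (nat \<Rightarrow> complex^'k^'k) measure" where
  "law \<rho> = (SOME P. finite_measure P \<and> sets P = sets \<Omega> \<and>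
    (\<forall>n E. cylinder n E \<longrightarrow> emeasure P E = (\<integral>\<^sup>+\<omega>. ennreal (weight \<rho> (Wprod V n \<omega>)) * indicator E \<omega> \<partial>seq.S)))"

lemma law:
  assumes \<rho>: "psd \<rho>"
  shows finite_law: "finite_measure (law \<rho>)" and sets_law: "sets (law \<rho>) = sets \<Omega>"
    and emeasure_law: "\<And>n E. cylinder n E \<Longrightarrow> emeasure (law \<rho>) E = (\<integral>\<^sup>+\<omega>. ennreal (weight \<rho> (Wprod V n \<omega>)) * indicator E \<omega> \<partial>seq.S)"
proof -
  have "\<exists>P. finite_measure P \<and> sets P = sets \<Omega> \<and>
    (\<forall>n E. cylinder n E \<longrightarrow> emeasure P E = (\<integral>\<^sup>+\<omega>. ennreal (weight \<rho> (Wprod V n \<omega>)) * indicator E \<omega> \<partial>seq.S))"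
    by (rule martingale_measure_exists[OF sets_S])
       (auto simp: weight_martingale[OF \<rho>, simplified] seq.P.emeasure_space_1)
  from someI_ex[OF this, folded law_def]
  show "finite_measure (law \<rho>)" "sets (law \<rho>) = sets \<Omega>"
    "\<And>n E. cylinder n E \<Longrightarrow> emeasure (law \<rho>) E = (\<integral>\<^sup>+\<omega>. ennreal (weight \<rho> (Wprod V n \<omega>)) * indicator E \<omega> \<partial>seq.S)"
    by blast+
qed

lemma space_law: "psd \<rho> \<Longrightarrow> space (law \<rho>) = UNIV"
  using sets_eq_imp_space_eq[OF sets_law] by (simp add: space_PiM)

lemma emeasure_law_eq_measure: "psd \<rho> \<Longrightarrow> emeasure (law \<rho>) A = ennreal (measure (law \<rho>) A)"
  using finite_measure.emeasure_eq_measure[OF finite_law] .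

lemma
  assumes \<rho>: "psd \<rho>" and E: "cylinder n E"
  shows integrable_weight: "integrable seq.S (\<lambda>\<omega>. weight \<rho> (Wprod V n \<omega>) * indicator E \<omega>)"
    and measure_law: "measure (law \<rho>) E = (LINT \<omega>|seq.S. weight \<rho> (Wprod V n \<omega>) * indicator E \<omega>)"
proof -
  note [measurable] = cylinder_sets[OF E]
  have nonneg: "AE \<omega> in seq.S. 0 \<le> weight \<rho> (Wprod V n \<omega>) * indicator E \<omega>"
    using \<rho> by (simp add: weight_nonneg)
  have eq: "emeasure (law \<rho>) E = (\<integral>\<^sup>+\<omega>. ennreal (weight \<rho> (Wprod V n \<omega>) * indicator E \<omega>) \<partial>seq.S)"
    unfolding emeasure_law[OF \<rho> E] by (intro nn_integral_cong) (auto simp: indicator_def)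
  show int: "integrable seq.S (\<lambda>\<omega>. weight \<rho> (Wprod V n \<omega>) * indicator E \<omega>)"
    by (rule integrableI_nonneg[OF _ nonneg]) (measurable, simp add: eq[symmetric] emeasure_law_eq_measure[OF \<rho>])
  show "measure (law \<rho>) E = (LINT \<omega>|seq.S. weight \<rho> (Wprod V n \<omega>) * indicator E \<omega>)"
    unfolding measure_def eq nn_integral_eq_integral[OF int nonneg]
    using \<rho> by (intro enn2real_ennreal integral_nonneg) (simp add: weight_nonneg)
qed

text \<open>The integrands on a cylinder are linear in the weights, so an identity valid for every
  matrix \<open>W\<close> holds for the laws of all cylinders and extends to all events. Additivity,
  scaling, polarisation and the parallelogram identity of the laws are instances.\<close>

lemma law_linear:
  assumes \<rho>: "\<And>j. j \<in> J \<Longrightarrow> psd (\<rho> j)" and A: "A \<in> sets \<Omega>"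
    and eq: "\<And>W. (\<Sum>j\<in>J. c j * weight (\<rho> j) W) = 0"
  shows "(\<Sum>j\<in>J. c j * measure (law (\<rho> j)) A) = 0"
proof (rule linear_combination_eq_0[OF _ _ _ A])
  fix n and E :: "(nat \<Rightarrow> complex^'k^'k) set" assume E: "cylinder n E"
  have "(\<Sum>j\<in>J. c j * measure (law (\<rho> j)) E)
    = (\<Sum>j\<in>J. (LINT \<omega>|seq.S. c j * (weight (\<rho> j) (Wprod V n \<omega>) * indicator E \<omega>)))"
    using \<rho> by (intro sum.cong) (simp_all add: measure_law[OF _ E])
  also have "\<dots> = (LINT \<omega>|seq.S. (\<Sum>j\<in>J. c j * (weight (\<rho> j) (Wprod V n \<omega>) * indicator E \<omega>)))"
    using \<rho> by (intro Bochner_Integration.integral_sum[symmetric] integrable_mult_right integrable_weight[OF _ E]) auto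
  also have "(\<lambda>\<omega>. \<Sum>j\<in>J. c j * (weight (\<rho> j) (Wprod V n \<omega>) * indicator E \<omega>)) = (\<lambda>\<omega>. 0)"
  proof
    fix \<omega>
    have "(\<Sum>j\<in>J. c j * (weight (\<rho> j) (Wprod V n \<omega>) * indicator E \<omega>))
        = (\<Sum>j\<in>J. c j * weight (\<rho> j) (Wprod V n \<omega>)) * indicator E \<omega>"
      unfolding sum_distrib_right by (intro sum.cong refl) (simp only: mult_ac)
    then show "(\<Sum>j\<in>J. c j * (weight (\<rho> j) (Wprod V n \<omega>) * indicator E \<omega>)) = 0" by (simp add: eq)
  qed
  finally show "(\<Sum>j\<in>J. c j * measure (law (\<rho> j)) E) = 0" by simp
qed (use \<rho> finite_law sets_law in auto)

lemma law_add:
  assumes "psd \<rho>" "psd \<sigma>" "A \<in> sets \<Omega>"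
  shows "measure (law (\<rho> + \<sigma>)) A = measure (law \<rho>) A + measure (law \<sigma>) A"
proof -
  let ?\<rho> = "\<lambda>j::nat. if j = 0 then \<rho> + \<sigma> else if j = 1 then \<rho> else \<sigma>"
  have "(\<Sum>j<3. (if j = 0 then 1 else -1) * measure (law (?\<rho> j)) A) = 0"
    by (rule law_linear) (use assms in \<open>auto simp: psd_add numeral_3_eq_3 weight_add\<close>)
  then show ?thesis by (simp add: numeral_3_eq_3)
qed

lemma law_scaleR:
  assumes "psd \<rho>" "0 \<le> a" "A \<in> sets \<Omega>"
  shows "measure (law (a *\<^sub>R \<rho>)) A = a * measure (law \<rho>) A"
proof -
  let ?\<rho> = "\<lambda>j::nat. if j = 0 then a *\<^sub>R \<rho> else \<rho>"
  have "(\<Sum>j<2. (if j = 0 then 1 else -a) * measure (law (?\<rho> j)) A) = 0"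
    by (rule law_linear) (use assms in \<open>auto simp: psd_scaleR numeral_2_eq_2 weight_scaleR\<close>)
  then show ?thesis by (simp add: numeral_2_eq_2)
qed

lemma law_mat_1:
  assumes A: "A \<in> sets \<Omega>"
  shows "measure (law (mat 1)) A = (\<Sum>i\<in>UNIV. measure (law (outer (axis i 1))) A)"
proof -
  have "(\<Sum>j\<in>UNIV. (case j of None \<Rightarrow> 1 | Some _ \<Rightarrow> -1) *
      measure (law (case j of None \<Rightarrow> mat 1 | Some i \<Rightarrow> outer (axis i 1))) A) = 0"
    by (rule law_linear) (auto simp: psd_mat_1 psd_outer UNIV_option_conv sum.reindex weight_mat_1 weight_outer
        norm_matrix_columns sum_negf split: option.splits intro: A)
  then show ?thesis by (simp add: UNIV_option_conv sum.reindex sum_negf)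
qed

text \<open>\<open>\<rho>\<close> and the positive remainder
  \<open>norm \<rho> *\<^sub>R mat 1 - \<rho>\<close> add up to a multiple of the identity, and laws
  add. Hence what holds almost surely for \<open>law (mat 1)\<close> holds for every law.\<close>

lemma law_le_mat_1:
  assumes \<rho>: "psd \<rho>" and A: "A \<in> sets \<Omega>"
  shows "measure (law \<rho>) A \<le> norm \<rho> * measure (law (mat 1)) A"
proof -
  have "measure (law (\<rho> + (norm \<rho> *\<^sub>R mat 1 - \<rho>))) A = measure (law \<rho>) A + measure (law (norm \<rho> *\<^sub>R mat 1 - \<rho>)) A"
    by (intro law_add \<rho> psd_mat_1_minus A)
  moreover have "\<rho> + (norm \<rho> *\<^sub>R mat 1 - \<rho>) = norm \<rho> *\<^sub>R mat 1" by simp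
  ultimately have "norm \<rho> * measure (law (mat 1)) A = measure (law \<rho>) A + measure (law (norm \<rho> *\<^sub>R mat 1 - \<rho>)) A"
    using law_scaleR[OF psd_mat_1 _ A, of "norm \<rho>"] by simp
  then show ?thesis by simp
qed

lemma AE_law_mono:
  assumes \<rho>: "psd \<rho>" and \<sigma>: "psd \<sigma>" and K: "\<And>A. A \<in> sets \<Omega> \<Longrightarrow> measure (law \<rho>) A \<le> K * measure (law \<sigma>) A"
    and AE: "AE \<omega> in law \<sigma>. Q \<omega>"
  shows "AE \<omega> in law \<rho>. Q \<omega>"
proof -
  from AE obtain N where N: "{\<omega> \<in> space (law \<sigma>). \<not> Q \<omega>} \<subseteq> N" "emeasure (law \<sigma>) N = 0" "N \<in> sets (law \<sigma>)"
    by (rule AE_E)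
  then have "measure (law \<rho>) N \<le> 0"
    using K[of N] by (simp add: sets_law[OF \<sigma>] measure_def)
  then have "emeasure (law \<rho>) N = 0"
    by (simp add: emeasure_law_eq_measure[OF \<rho>] ennreal_neg)
  with N show ?thesis
    by (intro AE_I[of _ _ N]) (auto simp: sets_law[OF \<rho>] sets_law[OF \<sigma>] space_law[OF \<rho>] space_law[OF \<sigma>])
qed

lemma AE_law_of_mat_1: "psd \<rho> \<Longrightarrow> AE \<omega> in law (mat 1). Q \<omega> \<Longrightarrow> AE \<omega> in law \<rho>. Q \<omega>"
  using AE_law_mono[OF _ psd_mat_1 law_le_mat_1] .

lemma measure_law_UNIV: "psd \<rho> \<Longrightarrow> measure (law \<rho>) UNIV = Re (trace \<rho>)"
  by (subst measure_law[OF _ cylinder_UNIV[of 0]]) (simp_all add: weight_id seq.P.prob_space)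

lemma law_outer_expand:
  assumes A: "A \<in> sets \<Omega>"
  shows "measure (law (outer x)) A = (\<Sum>b\<in>Basis. \<Sum>b'\<in>Basis. (x \<bullet> b) * (x \<bullet> b') *
    ((measure (law (outer (b + b'))) A - measure (law (outer b)) A - measure (law (outer b')) A) / 2))"
proof -
  \<comment> \<open>\<open>None\<close> stands for \<open>outer x\<close>; the triples carry the
    three terms of polarisation, \<open>i = 0, 1, 2\<close> for \<open>b + b'\<close>,
    \<open>b\<close> and \<open>b'\<close>, all moved to one side of the identity.\<close>
  let ?y = "\<lambda>b b' (i::nat). if i = 0 then b + b' else if i = 1 then b else b'"
  let ?J = "insert None (Some ` (Basis \<times> Basis \<times> {..<3::nat}))"
  let ?\<rho> = "\<lambda>j. case j of None \<Rightarrow> outer x | Some (b, b', i) \<Rightarrow> outer (?y b b' i)"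
  let ?c = "\<lambda>j. case j of None \<Rightarrow> 1 | Some (b, b', i) \<Rightarrow> - ((x \<bullet> b) * (x \<bullet> b') * (if i = 0 then 1 else -1) / 2)"
  have expand: "(\<Sum>j\<in>?J. ?c j * g (?\<rho> j)) = g (outer x) - (\<Sum>b\<in>Basis. \<Sum>b'\<in>Basis. (x \<bullet> b) * (x \<bullet> b') *
    ((g (outer (b + b')) - g (outer b) - g (outer b')) / 2))" for g :: "complex^'k^'k \<Rightarrow> real"
  proof -
    have "(\<Sum>j\<in>?J. ?c j * g (?\<rho> j)) = g (outer x) + (\<Sum>(b, b', i)\<in>Basis \<times> Basis \<times> {..<3}.
        - ((x \<bullet> b) * (x \<bullet> b') * (if i = 0 then 1 else -1) / 2) * g (outer (?y b b' i)))"
      by (subst sum.insert) (auto simp: sum.reindex case_prod_beta)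
    also have "(\<Sum>(b, b', i)\<in>Basis \<times> Basis \<times> {..<3}. - ((x \<bullet> b) * (x \<bullet> b') * (if i = 0 then 1 else -1) / 2) * g (outer (?y b b' i)))
      = (\<Sum>b\<in>Basis. \<Sum>b'\<in>Basis. \<Sum>i<3. - ((x \<bullet> b) * (x \<bullet> b') * (if i = 0 then 1 else -1) / 2) * g (outer (?y b b' i)))"
      by (simp add: sum.cartesian_product case_prod_beta)
    also have "\<dots> = (\<Sum>b\<in>Basis. \<Sum>b'\<in>Basis. - ((x \<bullet> b) * (x \<bullet> b') *
      ((g (outer (b + b')) - g (outer b) - g (outer b')) / 2)))"
      by (intro sum.cong refl) (simp add: numeral_3_eq_3 field_simps)
    finally show ?thesis by (simp add: sum_negf)
  qed
  have "(\<Sum>j\<in>?J. ?c j * measure (law (?\<rho> j)) A) = 0"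
  proof (rule law_linear[OF _ A])
    show "psd (?\<rho> j)" for j by (auto simp: psd_outer split: option.splits)
    show "(\<Sum>j\<in>?J. ?c j * weight (?\<rho> j) W) = 0" for W
      unfolding expand[of "\<lambda>\<rho>. weight \<rho> W"] weight_outer using norm_square_expand[of W x] by simp
  qed
  then show ?thesis unfolding expand[of "\<lambda>\<rho>. measure (law \<rho>) A"] by simp
qed

text \<open>By \<open>law_outer_expand\<close> this is a quadratic polynomial in the real
  coordinates of \<open>x\<close>.\<close>

lemma continuous_law_outer:
  assumes A: "A \<in> sets \<Omega>"
  shows "continuous_on UNIV (\<lambda>x. measure (law (outer x)) A)"
proof -
  have "continuous_on UNIV (\<lambda>x :: complex^'k. \<Sum>b\<in>Basis. \<Sum>b'\<in>Basis. (x \<bullet> b) * (x \<bullet> b') *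
    ((measure (law (outer (b + b'))) A - measure (law (outer b)) A - measure (law (outer b')) A) / 2))"
    by (intro continuous_intros)
  then show ?thesis by (subst continuous_on_cong[OF refl law_outer_expand[OF A]])
qed

lemma measurable_law_outer [measurable]:
  "A \<in> sets \<Omega> \<Longrightarrow> (\<lambda>x. measure (law (outer x)) A) \<in> borel_measurable borel"
  by (intro borel_measurable_continuous_onI continuous_law_outer)

text \<open>Markov property: after \<open>n\<close> outcomes the future obeys the law of the vector
  \<open>Wprod V n \<omega> *v x\<close>. This vector is not normalised, and the mass of its law,
  its squared norm, is exactly the density of the past; so the outer integral runs over the
  reference measure.\<close>

lemma law_markov:
  assumes O: "cylinder n O'" and A: "A \<in> sets \<Omega>"
  shows "emeasure (law (outer x)) (O' \<inter> {\<omega>. (shift ^^ n) \<omega> \<in> A})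
    = (\<integral>\<^sup>+\<omega>. emeasure (law (outer (Wprod V n \<omega> *v x))) A * indicator O' \<omega> \<partial>seq.S)"
  using A
proof (induction A rule: cylinder_induct)
  case (cylinder p E)
  note [measurable] = cylinder_sets[OF O] cylinder_sets[OF cylinder]
  have m: "(shift ^^ n) \<in> \<Omega> \<rightarrow>\<^sub>M \<Omega>" by (induction n) auto
  let ?F = "O' \<inter> {\<omega>. (shift ^^ n) \<omega> \<in> E}"
  have F: "cylinder (n + p) ?F"
    by (intro cylinder_Int cylinder_shift cylinder cylinder_mono[OF O]) simp
  note [measurable] = cylinder_sets[OF F]
  have ind: "indicator ?F (comb_seq n \<omega> \<omega>') = (indicator O' \<omega> * indicator E \<omega>' :: ennreal)" for \<omega> \<omega>'
  proof -
    have "comb_seq n \<omega> \<omega>' \<in> O' \<longleftrightarrow> \<omega> \<in> O'" by (rule cylinderD[OF O]) (simp add: comb_seq_less)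
    moreover have "(shift ^^ n) (comb_seq n \<omega> \<omega>') = \<omega>'" by (auto simp: funpow_shift comb_seq_add)
    ultimately show ?thesis by (simp add: indicator_def)
  qed
  have "emeasure (law (outer x)) ?F = (\<integral>\<^sup>+\<omega>. ennreal (weight (outer x) (Wprod V (n + p) \<omega>)) * indicator ?F \<omega> \<partial>seq.S)"
    by (rule emeasure_law[OF psd_outer F])
  also have "\<dots> = (\<integral>\<^sup>+\<omega>. \<integral>\<^sup>+\<omega>'. ennreal (weight (outer x) (Wprod V p \<omega>' ** Wprod V n \<omega>)) * (indicator O' \<omega> * indicator E \<omega>') \<partial>seq.S \<partial>seq.S)"
    by (subst seq.nn_integral_comb_seq[of _ n]) (auto simp only: Wprod_comb_seq ind, measurable)
  also have "\<dots> = (\<integral>\<^sup>+\<omega>. emeasure (law (outer (Wprod V n \<omega> *v x))) E * indicator O' \<omega> \<partial>seq.S)"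
  proof (rule nn_integral_cong)
    fix \<omega>
    have "(\<integral>\<^sup>+\<omega>'. ennreal (weight (outer x) (Wprod V p \<omega>' ** Wprod V n \<omega>)) * (indicator O' \<omega> * indicator E \<omega>') \<partial>seq.S)
      = (\<integral>\<^sup>+\<omega>'. ennreal (weight (outer (Wprod V n \<omega> *v x)) (Wprod V p \<omega>')) * indicator E \<omega>' * indicator O' \<omega> \<partial>seq.S)"
      by (intro nn_integral_cong) (simp add: weight_outer matrix_vector_mul_assoc mult_ac)
    also have "\<dots> = emeasure (law (outer (Wprod V n \<omega> *v x))) E * indicator O' \<omega>"
      unfolding emeasure_law[OF psd_outer cylinder] by (rule nn_integral_multc) measurable
    finally show "(\<integral>\<^sup>+\<omega>'. ennreal (weight (outer x) (Wprod V p \<omega>' ** Wprod V n \<omega>)) * (indicator O' \<omega> * indicator E \<omega>') \<partial>seq.S)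
      = emeasure (law (outer (Wprod V n \<omega> *v x))) E * indicator O' \<omega>" .
  qed
  finally show ?case .
next
  case (compl E)
  note [measurable] = cylinder_sets[OF O] compl(1)
  have m: "(shift ^^ n) \<in> \<Omega> \<rightarrow>\<^sub>M \<Omega>" by (induction n) auto
  have E': "{\<omega>. (shift ^^ n) \<omega> \<in> E} \<in> sets \<Omega>"
    using measurable_sets[OF m compl(1)] by (simp add: space_PiM vimage_def)
  let ?f = "\<lambda>A \<omega>. emeasure (law (outer (Wprod V n \<omega> *v x))) A * indicator O' \<omega>"
  have meas: "?f A \<in> borel_measurable seq.S" if [measurable]: "A \<in> sets \<Omega>" for A
    unfolding emeasure_law_eq_measure[OF psd_outer] by measurable
  have UNIV [measurable]: "UNIV \<in> sets \<Omega>" using cylinder_sets[OF cylinder_UNIV[of 0]] .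
  have "emeasure (law (outer x)) (O' \<inter> {\<omega>. (shift ^^ n) \<omega> \<in> UNIV - E})
      = emeasure (law (outer x)) (O' - O' \<inter> {\<omega>. (shift ^^ n) \<omega> \<in> E})"
    by (intro arg_cong2[where f=emeasure]) auto
  also have "\<dots> = emeasure (law (outer x)) O' - emeasure (law (outer x)) (O' \<inter> {\<omega>. (shift ^^ n) \<omega> \<in> E})"
    using E' cylinder_sets[OF O]
    by (intro emeasure_Diff) (auto simp: sets_law[OF psd_outer] emeasure_law_eq_measure[OF psd_outer])
  \<comment> \<open>The density of the first \<open>n\<close> outcomes is the total mass of the law
    of \<open>Wprod V n \<omega> *v x\<close>, so \<open>O'\<close> alone corresponds to the full
    event.\<close>
  also have "emeasure (law (outer x)) O' = (\<integral>\<^sup>+\<omega>. ?f UNIV \<omega> \<partial>seq.S)"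
    unfolding emeasure_law[OF psd_outer O]
    by (intro nn_integral_cong)
       (simp add: emeasure_law_eq_measure[OF psd_outer] measure_law_UNIV psd_outer weight_outer flip: weight_id)
  also have "\<dots> - emeasure (law (outer x)) (O' \<inter> {\<omega>. (shift ^^ n) \<omega> \<in> E}) = (\<integral>\<^sup>+\<omega>. ?f UNIV \<omega> - ?f E \<omega> \<partial>seq.S)"
    unfolding compl(2)
  proof (rule nn_integral_diff[symmetric])
    show "(\<integral>\<^sup>+\<omega>. ?f E \<omega> \<partial>seq.S) \<noteq> \<infinity>"
      unfolding compl(2)[symmetric] by (simp add: emeasure_law_eq_measure[OF psd_outer])
    show "AE \<omega> in seq.S. ?f E \<omega> \<le> ?f UNIV \<omega>"
      by (intro AE_I2 mult_right_mono emeasure_mono) (auto simp: sets_law[OF psd_outer])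
  qed (auto intro: meas compl(1))
  also have "\<dots> = (\<integral>\<^sup>+\<omega>. ?f (UNIV - E) \<omega> \<partial>seq.S)"
  proof (rule nn_integral_cong)
    fix \<omega>
    have "emeasure (law (outer (Wprod V n \<omega> *v x))) (UNIV - E)
      = emeasure (law (outer (Wprod V n \<omega> *v x))) UNIV - emeasure (law (outer (Wprod V n \<omega> *v x))) E"
      using compl(1) by (intro emeasure_Diff) (auto simp: sets_law[OF psd_outer] emeasure_law_eq_measure[OF psd_outer])
    then show "?f UNIV \<omega> - ?f E \<omega> = ?f (UNIV - E) \<omega>" by (simp add: indicator_def)
  qed
  finally show ?case .
next
  case (union E)
  note [measurable] = cylinder_sets[OF O]
  have E [measurable]: "E i \<in> sets \<Omega>" for i using union by auto
  have m: "(shift ^^ n) \<in> \<Omega> \<rightarrow>\<^sub>M \<Omega>" by (induction n) auto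
  have E': "{\<omega>. (shift ^^ n) \<omega> \<in> E i} \<in> sets \<Omega>" for i
    using measurable_sets[OF m E] by (simp add: space_PiM vimage_def)
  have "emeasure (law (outer x)) (O' \<inter> {\<omega>. (shift ^^ n) \<omega> \<in> (\<Union>i. E i)})
      = emeasure (law (outer x)) (\<Union>i. O' \<inter> {\<omega>. (shift ^^ n) \<omega> \<in> E i})"
    by (intro arg_cong2[where f=emeasure]) auto
  also have "\<dots> = (\<Sum>i. emeasure (law (outer x)) (O' \<inter> {\<omega>. (shift ^^ n) \<omega> \<in> E i}))"
    using E' cylinder_sets[OF O] union(1)
    by (intro suminf_emeasure[symmetric]) (auto simp: sets_law[OF psd_outer] disjoint_family_on_def)
  also have "\<dots> = (\<Sum>i. \<integral>\<^sup>+\<omega>. emeasure (law (outer (Wprod V n \<omega> *v x))) (E i) * indicator O' \<omega> \<partial>seq.S)"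
    by (simp add: union)
  also have "\<dots> = (\<integral>\<^sup>+\<omega>. (\<Sum>i. emeasure (law (outer (Wprod V n \<omega> *v x))) (E i) * indicator O' \<omega>) \<partial>seq.S)"
    unfolding emeasure_law_eq_measure[OF psd_outer] by (intro nn_integral_suminf[symmetric]) measurable
  also have "\<dots> = (\<integral>\<^sup>+\<omega>. emeasure (law (outer (Wprod V n \<omega> *v x))) (\<Union>i. E i) * indicator O' \<omega> \<partial>seq.S)"
  proof (rule nn_integral_cong)
    fix \<omega>
    have "(\<Sum>i. emeasure (law (outer (Wprod V n \<omega> *v x))) (E i)) = emeasure (law (outer (Wprod V n \<omega> *v x))) (\<Union>i. E i)"
      using union by (intro suminf_emeasure) (auto simp: sets_law[OF psd_outer])
    then show "(\<Sum>i. emeasure (law (outer (Wprod V n \<omega> *v x))) (E i) * indicator O' \<omega>)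
      = emeasure (law (outer (Wprod V n \<omega> *v x))) (\<Union>i. E i) * indicator O' \<omega>"
      by (simp add: ennreal_suminf_multc)
  qed
  finally show ?case .
qed

end

lemma matrix_eq_axis:
  fixes A B :: "complex^'k^'k"
  assumes "\<And>i. A *v axis i 1 = B *v axis i 1" shows "A = B"
  using assms by (simp add: matrix_vector_mult_axis column_def vec_eq_iff)

section \<open>The laws as quadratic forms in the initial vector\<close>

context instrument
begin

lemma law_outer_cmult:
  "A \<in> sets \<Omega> \<Longrightarrow> measure (law (outer (a *s x))) A = (cmod a)\<^sup>2 * measure (law (outer x)) A"
proof -
  assume A: "A \<in> sets \<Omega>"
  let ?x = "\<lambda>j::nat. if j = 0 then a *s x else x"
  have "(\<Sum>j<2. (if j = 0 then 1 else - (cmod a)\<^sup>2) * measure (law (outer (?x j))) A) = 0"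
    by (rule law_linear)
      (auto simp: psd_outer numeral_2_eq_2 weight_outer vector_scalar_commute norm_cmult_vec power_mult_distrib A)
  then show ?thesis by (simp add: numeral_2_eq_2)
qed

lemma law_outer_parallelogram:
  "A \<in> sets \<Omega> \<Longrightarrow> measure (law (outer (x + y))) A + measure (law (outer (x - y))) A
    = 2 * measure (law (outer x)) A + 2 * measure (law (outer y)) A"
proof -
  assume A: "A \<in> sets \<Omega>"
  let ?x = "\<lambda>j::nat. if j = 0 then x + y else if j = 1 then x - y else if j = 2 then x else y"
  have "(\<Sum>j<4. (if j < 2 then 1 else - 2) * measure (law (outer (?x j))) A) = 0"
  proof (rule law_linear[OF psd_outer A])
    fix W :: "complex^'k^'k"
    have "(norm (W *v (x + y)))\<^sup>2 + (norm (W *v (x - y)))\<^sup>2 = 2 * (norm (W *v x))\<^sup>2 + 2 * (norm (W *v y))\<^sup>2"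
      by (simp add: matrix_vector_right_distrib matrix_vector_mult_diff_distrib power2_norm_eq_inner
          inner_add_left inner_add_right inner_diff_left inner_diff_right inner_commute)
    then show "(\<Sum>j<4. (if j < 2 then 1 else - 2) * weight (outer (?x j)) W) = 0"
      by (simp add: weight_outer eval_nat_numeral)
  qed
  then show ?thesis by (simp add: eval_nat_numeral)
qed

lemma vimage_shift_sets: "A \<in> sets \<Omega> \<Longrightarrow> {\<omega>. (shift ^^ n) \<omega> \<in> A} \<in> sets \<Omega>"
proof -
  assume A: "A \<in> sets \<Omega>"
  have m: "(shift ^^ n) \<in> \<Omega> \<rightarrow>\<^sub>M \<Omega>" by (induction n) auto
  show ?thesis using measurable_sets[OF m A] by (simp add: space_PiM vimage_def)
qed

text \<open>By the Markov property the probability of lying in \<open>N\<close> after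
  \<open>n\<close> shifts is an integral of values of laws at \<open>N\<close>, all of which vanish
  because \<open>law (mat 1)\<close> dominates them.\<close>

lemma AE_law_shift:
  assumes "AE \<omega> in law (mat 1). Q \<omega>"
  shows "AE \<omega> in law (outer x). Q ((shift ^^ n) \<omega>)"
proof -
  from assms obtain N where N: "{\<omega> \<in> space (law (mat 1)). \<not> Q \<omega>} \<subseteq> N" "emeasure (law (mat 1)) N = 0" "N \<in> sets (law (mat 1))"
    by (rule AE_E)
  then have NS: "N \<in> sets \<Omega>" by (simp add: sets_law[OF psd_mat_1])
  have "emeasure (law (outer y)) N = 0" for y
  proof -
    have "measure (law (outer y)) N \<le> norm (outer y) * measure (law (mat 1)) N"
      by (rule law_le_mat_1[OF psd_outer NS])
    also have "\<dots> = 0" using N(2) by (simp add: measure_def)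
    finally show ?thesis by (simp add: emeasure_law_eq_measure[OF psd_outer] ennreal_neg)
  qed
  then have "emeasure (law (outer x)) (UNIV \<inter> {\<omega>. (shift ^^ n) \<omega> \<in> N}) = 0"
    unfolding law_markov[OF cylinder_UNIV NS] by simp
  then have "{\<omega>. (shift ^^ n) \<omega> \<in> N} \<in> null_sets (law (outer x))"
    using vimage_shift_sets[OF NS] by (simp add: null_sets_def sets_law[OF psd_outer])
  then have "AE \<omega> in law (outer x). \<omega> \<notin> {\<omega>. (shift ^^ n) \<omega> \<in> N}" by (rule AE_not_in)
  then show ?thesis
    by eventually_elim (use N(1) in \<open>auto simp: space_law[OF psd_mat_1]\<close>)
qed

lemma law_outer_shift:
  assumes A: "A \<in> sets \<Omega>"
  shows "emeasure (law (outer x)) {\<omega>. shift \<omega> \<in> A} = (\<integral>\<^sup>+v. ennreal (measure (law (outer (V v *v x))) A) \<partial>m)"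
proof -
  have "emeasure (law (outer x)) (UNIV \<inter> {\<omega>. (shift ^^ 1) \<omega> \<in> A})
      = (\<integral>\<^sup>+\<omega>. emeasure (law (outer (Wprod V 1 \<omega> *v x))) A * indicator UNIV \<omega> \<partial>seq.S)"
    by (rule law_markov[OF cylinder_UNIV A])
  also have "\<dots> = (\<integral>\<^sup>+\<omega>. ennreal (measure (law (outer (V (\<omega> 0) *v x))) A) \<partial>seq.S)"
    by (simp add: emeasure_law_eq_measure[OF psd_outer])
  also have "\<dots> = (\<integral>\<^sup>+v. ennreal (measure (law (outer (V v *v x))) A) \<partial>m)"
  proof (rule seq.nn_integral_component[of "\<lambda>v. ennreal (measure (law (outer (V v *v x))) A)"])
    have "(\<lambda>v. V v *v x) \<in> borel_measurable m" by measurable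
    then show "(\<lambda>v. ennreal (measure (law (outer (V v *v x))) A)) \<in> borel_measurable m"
      using measurable_compose[OF _ measurable_law_outer[OF A]] by (intro measurable_compose[OF _ measurable_ennreal])
  qed
  finally show ?thesis by simp
qed

lemma nn_integral_norm_V: "(\<integral>\<^sup>+v. ennreal ((norm (V v *v x))\<^sup>2) \<partial>m) = ennreal ((norm x)\<^sup>2)"
  using nn_integral_weight[OF psd_outer, of x "mat 1"] by (simp add: weight_outer)

end

section \<open>Ergodicity\<close>

text \<open>The condition on \<open>p\<close> means that the range of \<open>p\<close> is invariant
  under almost every \<open>V v\<close>.\<close>

locale irreducible_instrument = instrument m V C for m :: "(complex^'k^'k) measure" and V C +
  assumes irreducible: "orth_projector p \<Longrightarrow> (AE v in m. (mat 1 - p) ** V v ** p = 0) \<Longrightarrow> p = 0 \<or> p = mat 1"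
begin

text \<open>The null set in \<open>inv\<close> may depend on \<open>x\<close>; it suffices to
  exclude those of the finitely many vectors \<open>p *v axis i 1\<close>, which span
  \<open>E\<close>.\<close>

lemma irreducible_subspace:
  assumes E: "vec.subspace E" "x0 \<in> E" "x0 \<noteq> 0" and inv: "\<And>x. x \<in> E \<Longrightarrow> AE v in m. V v *v x \<in> E"
  shows "E = UNIV"
proof -
  obtain p where p: "orth_projector p" "range (\<lambda>x. p *v x) = E" by (rule exists_orth_projector[OF E(1)])
  have fix_p: "p *v y = y" if "y \<in> E" for y
  proof -
    from that p(2) obtain z where "y = p *v z" by auto
    then show ?thesis using p(1) by (simp add: orth_projector_def matrix_vector_mul_assoc)
  qed
  have "AE v in m. \<forall>i. V v *v (p *v axis i 1) \<in> E"
    unfolding AE_all_countable using p(2) by (intro allI inv) auto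
  then have "AE v in m. (mat 1 - p) ** V v ** p = 0"
  proof eventually_elim
    case (elim v)
    show ?case
    proof (rule matrix_eq_axis)
      fix i
      have "((mat 1 - p) ** V v ** p) *v axis i 1 = V v *v (p *v axis i 1) - p *v (V v *v (p *v axis i 1))"
        by (simp add: matrix_vector_mult_diff_rdistrib flip: matrix_vector_mul_assoc)
      also have "\<dots> = 0" using elim fix_p by simp
      finally show "((mat 1 - p) ** V v ** p) *v axis i 1 = 0 *v axis i 1" by simp
    qed
  qed
  from irreducible[OF p(1) this] show ?thesis
  proof
    assume "p = 0"
    then show ?thesis using fix_p[OF E(2)] E(3) by simp
  next
    assume "p = mat 1"
    then show ?thesis using p(2) by auto
  qed
qed

lemma invariant_event_law:
  assumes A: "A \<in> sets \<Omega>" and inv: "AE \<omega> in law (mat 1). shift \<omega> \<in> A \<longleftrightarrow> \<omega> \<in> A"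
  shows "\<exists>c\<ge>0. \<forall>x. measure (law (outer x)) A = c * (norm x)\<^sup>2"
proof -
  define u where "u x = measure (law (outer x)) A" for x
  have u_inv: "ennreal (u x) = (\<integral>\<^sup>+v. ennreal (u (V v *v x)) \<partial>m)" for x
  proof -
    have "AE \<omega> in law (outer x). \<omega> \<in> A \<longleftrightarrow> \<omega> \<in> {\<omega>. shift \<omega> \<in> A}"
      using AE_law_of_mat_1[OF psd_outer inv] by eventually_elim auto
    then have "emeasure (law (outer x)) A = emeasure (law (outer x)) {\<omega>. shift \<omega> \<in> A}"
      using A vimage_shift_sets[OF A, of 1] by (intro emeasure_eq_AE) (auto simp: sets_law[OF psd_outer])
    then show ?thesis unfolding law_outer_shift[OF A] by (simp add: emeasure_law_eq_measure[OF psd_outer] u_def)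
  qed
  have ne: "sphere (0 :: complex^'k) 1 \<noteq> {}" by (auto intro!: exI[of _ "axis undefined 1"])
  have cont: "continuous_on (sphere 0 1) u"
    unfolding u_def using continuous_law_outer[OF A] by (rule continuous_on_subset) auto
  obtain x0 where x0: "norm x0 = 1" and min: "\<And>x. norm x = 1 \<Longrightarrow> u x0 \<le> u x"
    using continuous_attains_inf[OF compact_sphere ne cont] by (auto simp: dist_norm)
  define c where "c = u x0"
  have c0: "0 \<le> c" by (simp add: c_def u_def)
  have scale: "u (a *s x) = (cmod a)\<^sup>2 * u x" for a x
    unfolding u_def by (rule law_outer_cmult[OF A])
  define w where "w x = u x - c * (norm x)\<^sup>2" for x
  have w_nonneg: "0 \<le> w x" for x
  proof (cases "x = 0")
    case True
    then show ?thesis using scale[of 0 x] by (simp add: w_def)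
  next
    case False
    have "c \<le> u (of_real (1 / norm x) *s x)"
      unfolding c_def using False by (intro min) (simp add: norm_cmult_vec norm_divide)
    then show ?thesis using False unfolding scale w_def by (simp add: norm_divide field_simps)
  qed
  have w_par: "w (x + y) + w (x - y) = 2 * w x + 2 * w y" for x y
  proof -
    have "(norm (x + y))\<^sup>2 + (norm (x - y))\<^sup>2 = 2 * (norm x)\<^sup>2 + 2 * (norm y)\<^sup>2"
      by (simp add: power2_norm_eq_inner inner_add_left inner_add_right inner_diff_left inner_diff_right inner_commute)
    then have "c * (norm (x + y))\<^sup>2 + c * (norm (x - y))\<^sup>2 = 2 * (c * (norm x)\<^sup>2) + 2 * (c * (norm y)\<^sup>2)"
      by (metis (no_types, opaque_lifting) distrib_left mult.left_commute)
    moreover have "a - a' + (b - b') = 2 * (d - d') + 2 * (e - e')"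
      if "a' + b' = 2 * d' + 2 * e'" "a + b = 2 * d + 2 * e" for a a' b b' d d' e e' :: real
    proof -
      have "a - a' + (b - b') = (a + b) - (a' + b')" by simp
      then show ?thesis unfolding that by simp
    qed
    ultimately show ?thesis using law_outer_parallelogram[OF A, of x y] unfolding w_def u_def by blast
  qed
  have w_scale: "w (a *s x) = (cmod a)\<^sup>2 * w x" for a x
    by (simp add: w_def scale norm_cmult_vec power_mult_distrib algebra_simps)
  \<comment> \<open>A nonnegative form that vanishes at \<open>x\<close> and \<open>y\<close>
    vanishes at \<open>x + y\<close>, since the parallelogram identity gives
    \<open>w (x + y) + w (x - y) = 0\<close>.\<close>
  have sub: "vec.subspace {x. w x = 0}"
  proof (rule vec.subspaceI)
    show "0 \<in> {x. w x = 0}" using w_scale[of 0 0] by simp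
    show "x + y \<in> {x. w x = 0}" if "x \<in> {x. w x = 0}" "y \<in> {x. w x = 0}" for x y
      using w_par[of x y] w_nonneg[of "x + y"] w_nonneg[of "x - y"] that by simp
    show "a *s x \<in> {x. w x = 0}" if "x \<in> {x. w x = 0}" for a x using that by (simp add: w_scale)
  qed
  have "{x. w x = 0} = UNIV"
  proof (rule irreducible_subspace[OF sub])
    show "x0 \<in> {x. w x = 0}" "x0 \<noteq> 0" using x0 by (auto simp: w_def c_def)
    fix x assume "x \<in> {x. w x = 0}"
    then have ux: "u x = c * (norm x)\<^sup>2" by (simp add: w_def)
    have [measurable]: "u \<in> borel_measurable borel" unfolding u_def using A by measurable
    have cV: "(\<integral>\<^sup>+v. ennreal (c * (norm (V v *v x))\<^sup>2) \<partial>m) = ennreal (c * (norm x)\<^sup>2)"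
      using c0 by (simp add: ennreal_mult nn_integral_cmult nn_integral_norm_V)
    \<comment> \<open>Averaging over \<open>V v\<close> preserves \<open>u\<close> because the event
      is invariant, and the squared norm because of \<open>isometric\<close>; so the nonnegative
      \<open>w (V v *v x)\<close> has mean \<open>w x = 0\<close>.\<close>
    have "(\<integral>\<^sup>+v. ennreal (u (V v *v x)) - ennreal (c * (norm (V v *v x))\<^sup>2) \<partial>m)
       = (\<integral>\<^sup>+v. ennreal (u (V v *v x)) \<partial>m) - (\<integral>\<^sup>+v. ennreal (c * (norm (V v *v x))\<^sup>2) \<partial>m)"
    proof (rule nn_integral_diff)
      show "AE v in m. ennreal (c * (norm (V v *v x))\<^sup>2) \<le> ennreal (u (V v *v x))"
        using w_nonneg by (intro AE_I2 ennreal_leI) (simp add: w_def)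
    qed (auto simp: cV)
    also have "\<dots> = 0" unfolding cV u_inv[symmetric] ux by simp
    finally have "AE v in m. ennreal (u (V v *v x)) - ennreal (c * (norm (V v *v x))\<^sup>2) = 0"
      by (subst (asm) nn_integral_0_iff_AE) auto
    then show "AE v in m. V v *v x \<in> {x. w x = 0}"
    proof eventually_elim
      case (elim v)
      have "ennreal (w (V v *v x)) = 0"
        using elim c0 unfolding w_def by (subst ennreal_minus[symmetric]) auto
      then show ?case using w_nonneg[of "V v *v x"] by simp
    qed
  qed
  then show ?thesis using c0 unfolding w_def u_def by (intro exI[of _ c]) (auto simp: set_eq_iff)
qed

text \<open>Invariance replaces \<open>A\<close> by its \<open>n\<close>-th preimage. By the Markov
  property and the constancy of the form on the sphere, \<open>A\<close> then cuts down every
  cylinder by the same factor \<open>c\<close>, hence every event, including \<open>A\<close>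
  itself: either \<open>A\<close> is null or \<open>c = 1\<close>.\<close>

lemma invariant_event_0_1:
  assumes A: "A \<in> sets \<Omega>" and inv: "AE \<omega> in law (mat 1). shift \<omega> \<in> A \<longleftrightarrow> \<omega> \<in> A"
  shows "measure (law (mat 1)) A = 0 \<or> measure (law (mat 1)) (UNIV - A) = 0"
proof -
  obtain c where c0: "c \<ge> 0" and c: "\<And>x. measure (law (outer x)) A = c * (norm x)\<^sup>2"
    using invariant_event_law[OF A inv] by blast
  have cyl_outer: "measure (law (outer x)) (E \<inter> A) = c * measure (law (outer x)) E" if E: "cylinder n E" for n E x
  proof -
    note [measurable] = cylinder_sets[OF E]
    have "AE \<omega> in law (outer x). \<forall>i. shift ((shift ^^ i) \<omega>) \<in> A \<longleftrightarrow> (shift ^^ i) \<omega> \<in> A"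
      unfolding AE_all_countable using AE_law_shift[OF inv] by simp
    then have "AE \<omega> in law (outer x). \<omega> \<in> E \<inter> A \<longleftrightarrow> \<omega> \<in> E \<inter> {\<omega>. (shift ^^ n) \<omega> \<in> A}"
    proof eventually_elim
      case (elim \<omega>)
      have "(shift ^^ i) \<omega> \<in> A \<longleftrightarrow> \<omega> \<in> A" for i using elim by (induction i) auto
      then show ?case by simp
    qed
    then have "emeasure (law (outer x)) (E \<inter> A) = emeasure (law (outer x)) (E \<inter> {\<omega>. (shift ^^ n) \<omega> \<in> A})"
      using A vimage_shift_sets[OF A] cylinder_sets[OF E] by (intro emeasure_eq_AE) (auto simp: sets_law[OF psd_outer])
    also have "\<dots> = (\<integral>\<^sup>+\<omega>. ennreal c * (ennreal (weight (outer x) (Wprod V n \<omega>)) * indicator E \<omega>) \<partial>seq.S)"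
      unfolding law_markov[OF E A]
      using c0 by (intro nn_integral_cong)
        (simp add: emeasure_law_eq_measure[OF psd_outer] c weight_outer ennreal_mult mult_ac)
    also have "\<dots> = ennreal c * emeasure (law (outer x)) E"
      unfolding emeasure_law[OF psd_outer E] by (rule nn_integral_cmult) measurable
    finally show ?thesis
      using c0 by (simp add: emeasure_law_eq_measure[OF psd_outer] flip: ennreal_mult)
  qed
  let ?D = "density (law (mat 1)) (indicator A)"
  have D: "measure ?D B = measure (law (mat 1)) (B \<inter> A)" if B: "B \<in> sets \<Omega>" for B
  proof -
    have [measurable]: "A \<in> sets (law (mat 1))" "B \<in> sets (law (mat 1))"
      using A B by (simp_all add: sets_law[OF psd_mat_1])
    have "emeasure ?D B = (\<integral>\<^sup>+\<omega>. indicator A \<omega> * indicator B \<omega> \<partial>law (mat 1))"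
      by (rule emeasure_density) measurable
    also have "\<dots> = (\<integral>\<^sup>+\<omega>. indicator (B \<inter> A) \<omega> \<partial>law (mat 1))"
      by (intro nn_integral_cong) (simp split: split_indicator)
    also have "\<dots> = emeasure (law (mat 1)) (B \<inter> A)"
      using A B by (intro nn_integral_indicator) (auto simp: sets_law[OF psd_mat_1])
    finally show ?thesis by (simp add: measure_def)
  qed
  have fin_D: "finite_measure ?D"
  proof (rule finite_measureI)
    have [measurable]: "A \<in> sets (law (mat 1))" using A by (simp add: sets_law[OF psd_mat_1])
    have "emeasure ?D (space ?D) = (\<integral>\<^sup>+\<omega>. indicator A \<omega> * indicator (space (law (mat 1))) \<omega> \<partial>law (mat 1))"
      unfolding space_density by (rule emeasure_density) measurable
    also have "\<dots> \<le> (\<integral>\<^sup>+\<omega>. 1 \<partial>law (mat 1))"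
      by (intro nn_integral_mono) (simp split: split_indicator)
    also have "\<dots> < \<infinity>" by (simp add: emeasure_law_eq_measure[OF psd_mat_1])
    finally show "emeasure ?D (space ?D) \<noteq> \<infinity>" by simp
  qed
  have main: "measure (law (mat 1)) (B \<inter> A) = c * measure (law (mat 1)) B" if B: "B \<in> sets \<Omega>" for B
  proof -
    have "(\<Sum>b\<in>{True, False}. (if b then 1 else - c) * measure (if b then ?D else law (mat 1)) B) = 0"
    proof (rule linear_combination_eq_0[OF _ _ _ B])
      fix n and E :: "(nat \<Rightarrow> complex^'k^'k) set" assume E: "cylinder n E"
      have EA: "E \<inter> A \<in> sets \<Omega>" using cylinder_sets[OF E] A by auto
      have "measure (law (mat 1)) (E \<inter> A) = c * measure (law (mat 1)) E"
        unfolding law_mat_1[OF EA] law_mat_1[OF cylinder_sets[OF E]]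
        by (simp add: cyl_outer[OF E] sum_distrib_left)
      then show "(\<Sum>b\<in>{True, False}. (if b then 1 else - c) * measure (if b then ?D else law (mat 1)) E) = 0"
        using cylinder_sets[OF E] by (simp add: D)
    qed (auto simp: fin_D finite_law psd_mat_1 sets_law)
    then show ?thesis using B by (simp add: D)
  qed
  have UNIV: "UNIV \<in> sets \<Omega>" using cylinder_sets[OF cylinder_UNIV[of 0]] .
  show ?thesis
  proof (cases "measure (law (mat 1)) A = 0")
    case False
    then have "c = 1" using main[OF A] by simp
    then have "measure (law (mat 1)) A = measure (law (mat 1)) UNIV" using main[OF UNIV] by simp
    then show ?thesis
      using finite_measure.finite_measure_compl[OF finite_law[OF psd_mat_1], of A] A
      by (simp add: sets_law[OF psd_mat_1] space_law[OF psd_mat_1])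
  qed simp
qed

section \<open>The channel and its faithful stationary state\<close>

definition chan :: "complex^'k^'k \<Rightarrow> complex^'k^'k" where
  "chan \<rho> = (LINT v|m. V v ** \<rho> ** cadj (V v))"

lemma integrable_chan: "integrable m (\<lambda>v. V v ** \<rho> ** cadj (V v))"
proof (rule integrable_const_bound[where B="C * norm \<rho> * C"])
  have C: "0 \<le> C" using norm_ge_zero norm_V order_trans by blast
  have "norm (V v ** \<rho> ** cadj (V v)) \<le> C * norm \<rho> * C" for v
  proof -
    have "norm (V v ** \<rho> ** cadj (V v)) \<le> norm (V v ** \<rho>) * norm (V v)"
      using norm_matrix_mult_le[of "V v ** \<rho>" "cadj (V v)"] by simp
    also have "\<dots> \<le> (norm (V v) * norm \<rho>) * norm (V v)" by (intro mult_right_mono norm_matrix_mult_le) auto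
    also have "\<dots> \<le> C * norm \<rho> * C" using C by (intro mult_mono norm_V) auto
    finally show ?thesis .
  qed
  then show "AE v in m. norm (V v ** \<rho> ** cadj (V v)) \<le> C * norm \<rho> * C" by simp
qed measurable

lemma chan_functional:
  assumes "bounded_linear \<Lambda>"
  shows "\<Lambda> (chan \<rho>) = (LINT v|m. \<Lambda> (V v ** \<rho> ** cadj (V v)))"
  unfolding chan_def by (rule integral_bounded_linear[OF assms integrable_chan, symmetric])

lemma cinner_chan: "cinner (chan \<rho> *v x) x = (LINT v|m. cinner (\<rho> *v (cadj (V v) *v x)) (cadj (V v) *v x))"
proof -
  have "bounded_linear (\<lambda>X :: complex^'k^'k. cinner (X *v x) x)"
    by (intro bounded_linear_compose[OF bounded_bilinear.bounded_linear_left[OF bounded_bilinear_cinner]]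
        bounded_bilinear.bounded_linear_left[OF bounded_bilinear_matrix_vector_mult])
  from chan_functional[OF this] show ?thesis
    by (simp add: cinner_cadj[of "V _"] flip: matrix_vector_mul_assoc)
qed

lemma integrable_cinner_chan: "integrable m (\<lambda>v. cinner (\<rho> *v (cadj (V v) *v x)) (cadj (V v) *v x))"
proof -
  have "bounded_linear (\<lambda>X :: complex^'k^'k. cinner (X *v x) x)"
    by (intro bounded_linear_compose[OF bounded_bilinear.bounded_linear_left[OF bounded_bilinear_cinner]]
        bounded_bilinear.bounded_linear_left[OF bounded_bilinear_matrix_vector_mult])
  from integrable_bounded_linear[OF this integrable_chan] show ?thesis
    by (simp add: cinner_cadj[of "V _"] flip: matrix_vector_mul_assoc)
qed

lemma psd_chan: "psd \<rho> \<Longrightarrow> psd (chan \<rho>)"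
  unfolding psd_def cinner_chan
  by (auto simp flip: integral_Re[OF integrable_cinner_chan] integral_Im[OF integrable_cinner_chan])

lemma weight_chan: "weight (chan \<rho>) B = (LINT v|m. weight \<rho> (B ** V v))"
proof -
  have "bounded_linear (\<lambda>\<rho> :: complex^'k^'k. weight \<rho> B)"
    unfolding weight_def
    by (intro bounded_linear_compose[OF bounded_linear_Re] bounded_linear_compose[OF bounded_linear_trace]
        bounded_linear_compose[OF bounded_bilinear.bounded_linear_left[OF bounded_bilinear_matrix_mult]]
        bounded_bilinear.bounded_linear_right[OF bounded_bilinear_matrix_mult])
  from chan_functional[OF this] show ?thesis by (simp add: weight_mult)
qed

lemma trace_chan:
  assumes "psd \<rho>" shows "Re (trace (chan \<rho>)) = Re (trace \<rho>)"
proof -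
  have "ennreal (weight \<rho> (mat 1)) = (\<integral>\<^sup>+v. ennreal (weight \<rho> (V v ** mat 1)) \<partial>m)"
    by (rule nn_integral_weight[OF assms, symmetric])
  then have "weight \<rho> (mat 1) = enn2real (\<integral>\<^sup>+v. ennreal (weight \<rho> (V v)) \<partial>m)"
    using weight_nonneg[OF assms, of "mat 1"] enn2real_ennreal[of "weight \<rho> (mat 1)"] by simp
  also have "\<dots> = (LINT v|m. weight \<rho> (V v))"
    by (rule integral_eq_nn_integral[symmetric]) (auto simp: weight_nonneg assms)
  also have "\<dots> = weight (chan \<rho>) (mat 1)" by (simp add: weight_chan)
  finally show ?thesis by (simp add: weight_id)
qed

lemma linear_chan: "linear chan"
proof (rule linearI)
  show "chan (\<rho> + \<sigma>) = chan \<rho> + chan \<sigma>" for \<rho> \<sigma>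
    unfolding chan_def
    by (simp add: matrix_add_ldistrib matrix_add_rdistrib Bochner_Integration.integral_add[OF integrable_chan integrable_chan])
  show "chan (r *\<^sub>R \<rho>) = r *\<^sub>R chan \<rho>" for r \<rho>
    unfolding chan_def by (simp add: matrix_mult_scaleR)
qed

end

text \<open>Polarisation writes the entry as a combination of the values of the form
  \<open>q\<close> at four vectors, and the parallelogram identity adds these up to diagonal
  entries. The constant is not sharp; the estimate serves to bound the set of states.\<close>

lemma psd_entry_bound:
  fixes \<rho> :: "complex^'k^'k"
  assumes "psd \<rho>"
  shows "cmod (\<rho> $ i $ j) \<le> 2 * Re (trace \<rho>)"
proof -
  define q where "q x = cinner (\<rho> *v x) x" for x
  have q: "0 \<le> Re (q x)" "Im (q x) = 0" for x using assms by (auto simp: psd_def q_def)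
  then have cq: "cmod (q x) = Re (q x)" for x by (simp add: cmod_eq_Re)
  let ?x = "axis j 1 :: complex^'k" and ?y = "axis i 1 :: complex^'k"
  have pol: "4 * cinner (\<rho> *v ?x) ?y = q (?x + ?y) - q (?x - ?y) + \<i> * q (?x + \<i> *s ?y) - \<i> * q (?x - \<i> *s ?y)"
    by (simp add: q_def matrix_vector_right_distrib matrix_vector_mult_diff_distrib vector_scalar_commute
        cinner_add_left cinner_add_right cinner_diff_left cinner_diff_right cinner_cmult_left cinner_cmult_right
        algebra_simps)
  have par: "q (x + y) + q (x - y) = 2 * q x + 2 * q y" for x y
    by (simp add: q_def matrix_vector_right_distrib matrix_vector_mult_diff_distrib
        cinner_add_left cinner_add_right cinner_diff_left cinner_diff_right)
  have qi: "q (\<i> *s y) = q y" for y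
    by (simp add: q_def vector_scalar_commute cinner_cmult_left cinner_cmult_right)
  have tr: "Re (q (axis l 1)) \<le> Re (trace \<rho>)" for l
  proof -
    have "Re (trace \<rho>) = (\<Sum>l\<in>UNIV. Re (q (axis l 1)))" by (simp add: trace_eq_cinner q_def)
    then show ?thesis using q member_le_sum[of l UNIV "\<lambda>l. Re (q (axis l 1))"] by simp
  qed
  have entry: "cinner (\<rho> *v ?x) ?y = \<rho> $ i $ j"
    by (simp add: cinner_axis_right matrix_vector_mult_axis column_def)
  have "4 * cmod (\<rho> $ i $ j) = cmod (q (?x + ?y) - q (?x - ?y) + \<i> * q (?x + \<i> *s ?y) - \<i> * q (?x - \<i> *s ?y))"
    unfolding pol[symmetric] entry by (simp add: norm_mult)
  also have "\<dots> \<le> cmod (q (?x + ?y)) + cmod (q (?x - ?y)) + cmod (q (?x + \<i> *s ?y)) + cmod (q (?x - \<i> *s ?y))"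
    by (intro order_trans[OF norm_triangle_ineq4] add_mono order_trans[OF norm_triangle_ineq])
       (auto simp: norm_mult norm_triangle_ineq4)
  also have "\<dots> = Re (q (?x + ?y) + q (?x - ?y)) + Re (q (?x + \<i> *s ?y) + q (?x - \<i> *s ?y))"
    by (simp add: cq)
  also have "\<dots> = 4 * Re (q ?x) + 4 * Re (q ?y)" unfolding par qi by simp
  also have "\<dots> \<le> 8 * Re (trace \<rho>)" using tr[of i] tr[of j] by simp
  finally show ?thesis by simp
qed

context irreducible_instrument
begin

text \<open>States form a compact convex set, nonempty because of the normalised identity, and
  \<open>chan\<close> maps it to itself because it preserves positivity and trace.\<close>

lemma exists_invariant_state: "\<exists>\<rho>. psd \<rho> \<and> Re (trace \<rho>) = 1 \<and> chan \<rho> = \<rho>"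
proof -
  define S where "S = {\<rho> :: complex^'k^'k. psd \<rho> \<and> Re (trace \<rho>) = 1}"
  have "bounded S"
  proof (rule boundedI)
    fix \<rho> assume "\<rho> \<in> S"
    then have *: "cmod (\<rho> $ i $ j) \<le> 2" for i j using psd_entry_bound[of \<rho> i j] by (simp add: S_def)
    have "(norm \<rho>)\<^sup>2 \<le> (\<Sum>i\<in>(UNIV :: 'k set). \<Sum>j\<in>(UNIV :: 'k set). 2\<^sup>2)"
      unfolding norm_matrix_square by (intro sum_mono power_mono *) auto
    then show "norm \<rho> \<le> sqrt (\<Sum>i\<in>(UNIV :: 'k set). \<Sum>j\<in>(UNIV :: 'k set). 2\<^sup>2)"
      by (rule real_le_rsqrt)
  qed
  moreover have "closed S"
    unfolding S_def psd_def
    by (intro closed_Collect_conj closed_Collect_all closed_Collect_eq closed_Collect_le continuous_intros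
        bounded_linear.continuous_on[OF bounded_linear_trace])
  ultimately have "compact S" by (simp add: compact_eq_bounded_closed)
  moreover have "convex S"
    unfolding S_def
    by (rule convexI) (auto simp: psd_add psd_scaleR trace_add linear_scale[OF bounded_linear.linear[OF bounded_linear_trace]])
  moreover have "(1 / CARD('k)) *\<^sub>R mat 1 \<in> S"
    unfolding S_def by (auto simp: psd_scaleR psd_mat_1 linear_scale[OF bounded_linear.linear[OF bounded_linear_trace]] trace_I)
  moreover have "continuous_on S chan" using linear_chan by (simp add: linear_continuous_on linear_conv_bounded_linear)
  moreover have "chan \<in> S \<rightarrow> S" by (auto simp: S_def psd_chan trace_chan)
  ultimately obtain \<rho> where "\<rho> \<in> S" "chan \<rho> = \<rho>"
    using brouwer[of S chan] by auto
  then show ?thesis by (auto simp: S_def)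
qed

text \<open>If the form of \<open>\<rho>\<close> vanishes at \<open>x\<close>, invariance writes 0
  as the mean of its values at \<open>cadj (V v) *v x\<close>. Its null space is therefore invariant
  under almost every adjoint, the orthogonal complement under almost every \<open>V v\<close>, and
  irreducibility together with the trace leaves only the trivial null space. \<open>a\<close> is the
  minimum of the form on the sphere, the smallest eigenvalue.\<close>

lemma invariant_state_faithful:
  assumes \<rho>: "psd \<rho>" "Re (trace \<rho>) = 1" "chan \<rho> = \<rho>"
  shows "\<exists>a>0. psd (\<rho> - a *\<^sub>R mat 1)"
proof -
  define w where "w x = Re (cinner (\<rho> *v x) x)" for x
  have w_nonneg: "0 \<le> w x" for x using \<rho>(1) by (simp add: w_def psd_def)
  have w_eq: "cinner (\<rho> *v x) x = of_real (w x)" for x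
    using \<rho>(1) by (intro complex_eqI) (auto simp: w_def psd_def)
  have w_par: "w (x + y) + w (x - y) = 2 * w x + 2 * w y" for x y
    by (simp add: w_def matrix_vector_right_distrib matrix_vector_mult_diff_distrib
        cinner_add_left cinner_add_right cinner_diff_left cinner_diff_right)
  have w_scale: "w (a *s x) = (cmod a)\<^sup>2 * w x" for a x
  proof -
    have "cinner (\<rho> *v (a *s x)) (a *s x) = a * cnj a * cinner (\<rho> *v x) x"
      by (simp only: vector_scalar_commute cinner_cmult_left cinner_cmult_right mult_ac)
    then have "of_real (w (a *s x)) = (of_real ((cmod a)\<^sup>2 * w x) :: complex)"
      by (simp only: w_eq complex_norm_square[symmetric] of_real_mult)
    then show ?thesis by (simp only: of_real_eq_iff)
  qed
  have sub: "vec.subspace {x. w x = 0}"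
  proof (rule vec.subspaceI)
    show "0 \<in> {x. w x = 0}" using w_scale[of 0 0] by simp
    show "x + y \<in> {x. w x = 0}" if "x \<in> {x. w x = 0}" "y \<in> {x. w x = 0}" for x y
      using w_par[of x y] w_nonneg[of "x + y"] w_nonneg[of "x - y"] that by simp
    show "a *s x \<in> {x. w x = 0}" if "x \<in> {x. w x = 0}" for a x using that by (simp add: w_scale)
  qed
  obtain p where p: "orth_projector p" "range (\<lambda>x. p *v x) = {x. w x = 0}" by (rule exists_orth_projector[OF sub])
  have pp: "p ** p = p" "cadj p = p" using p(1) by (auto simp: orth_projector_def)
  have fix_p: "p *v y = y" if "w y = 0" for y
  proof -
    from that p(2) obtain z where "y = p *v z" by (metis (mono_tags, lifting) imageE mem_Collect_eq)
    then show ?thesis using pp by (simp add: matrix_vector_mul_assoc)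
  qed
  have "AE v in m. w (cadj (V v) *v x) = 0" if x: "w x = 0" for x
  proof -
    have int: "integrable m (\<lambda>v. w (cadj (V v) *v x))"
      unfolding w_def by (rule integrable_Re[OF integrable_cinner_chan])
    have "(LINT v|m. w (cadj (V v) *v x)) = Re (cinner (chan \<rho> *v x) x)"
      unfolding w_def cinner_chan by (rule integral_Re[OF integrable_cinner_chan])
    also have "\<dots> = 0" using x \<rho>(3) by (simp add: w_def)
    finally show ?thesis
      using integral_nonneg_eq_0_iff_AE[OF int] w_nonneg by simp
  qed
  then have "AE v in m. \<forall>i. w (cadj (V v) *v (p *v axis i 1)) = 0"
    unfolding AE_all_countable using p(2) by auto
  then have "AE v in m. (mat 1 - (mat 1 - p)) ** V v ** (mat 1 - p) = 0"
  proof eventually_elim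
    case (elim v)
    have "cadj (V v) ** p = p ** (cadj (V v) ** p)"
      by (rule matrix_eq_axis) (simp add: fix_p elim flip: matrix_vector_mul_assoc)
    then have "cadj (cadj (V v) ** p) = cadj (p ** (cadj (V v) ** p))" by simp
    then have "p ** V v = p ** V v ** p" by (simp add: cadj_mult pp matrix_mul_assoc)
    then have "p ** V v ** mat 1 - p ** V v ** p = 0" by simp
    then show ?case
      using bounded_bilinear.diff_right[OF bounded_bilinear_matrix_mult, of "p ** V v" "mat 1" p] by simp
  qed
  moreover have "orth_projector (mat 1 - p)"
  proof -
    have "cadj (mat 1 - p) = mat 1 - p"
      using linear_diff[OF bounded_linear.linear[OF bounded_linear_cadj], of "mat 1" p] pp by simp
    then show ?thesis using pp unfolding orth_projector_def
      by (simp add: bounded_bilinear.diff_right[OF bounded_bilinear_matrix_mult] bounded_bilinear.diff_left[OF bounded_bilinear_matrix_mult])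
  qed
  ultimately have "mat 1 - p = 0 \<or> mat 1 - p = mat 1" by (intro irreducible)
  moreover have "p \<noteq> mat 1"
  proof
    assume "p = mat 1"
    then have "w x = 0" for x using p(2) by auto
    then have "Re (trace \<rho>) = 0" unfolding trace_eq_cinner Re_sum by (simp add: w_def)
    then show False using \<rho>(2) by simp
  qed
  ultimately have "p = 0" by auto
  then have pos: "x = 0" if "w x = 0" for x using fix_p[OF that] by simp
  have ne: "sphere (0 :: complex^'k) 1 \<noteq> {}" by (auto intro!: exI[of _ "axis undefined 1"])
  have cont: "continuous_on (sphere 0 1) w" unfolding w_def by (intro continuous_intros)
  obtain x0 where x0: "norm x0 = 1" and min: "\<And>x. norm x = 1 \<Longrightarrow> w x0 \<le> w x"
    using continuous_attains_inf[OF compact_sphere ne cont] by (auto simp: dist_norm)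
  define a where "a = w x0"
  have a: "0 < a" using w_nonneg[of x0] pos[of x0] x0 by (auto simp: a_def less_le)
  have w_ge: "a * (norm x)\<^sup>2 \<le> w x" for x
  proof (cases "x = 0")
    case False
    have "a \<le> w (of_real (1 / norm x) *s x)"
      unfolding a_def using False by (intro min) (simp add: norm_cmult_vec norm_divide)
    then show ?thesis using False unfolding w_scale by (simp add: norm_divide field_simps)
  qed (use w_nonneg in simp)
  have "psd (\<rho> - a *\<^sub>R mat 1)"
    unfolding psd_def
  proof (intro allI conjI)
    fix x
    have "cinner ((\<rho> - a *\<^sub>R mat 1) *v x) x = of_real (w x - a * (norm x)\<^sup>2)"
      by (simp add: matrix_vector_mult_diff_rdistrib bounded_bilinear.scaleR_left[OF bounded_bilinear_matrix_vector_mult]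
        cinner_diff_left cinner_scaleR_left cinner_self w_eq)
    then show "Im (cinner ((\<rho> - a *\<^sub>R mat 1) *v x) x) = 0" "0 \<le> Re (cinner ((\<rho> - a *\<^sub>R mat 1) *v x) x)"
      using w_ge[of x] by simp_all
  qed
  with a show ?thesis by blast
qed

text \<open>Shifting discards the first outcome; integrating it out replaces \<open>\<rho>\<close>
  by \<open>chan \<rho>\<close>.\<close>

lemma law_stationary:
  assumes \<rho>: "psd \<rho>" "chan \<rho> = \<rho>"
  shows "distr (law \<rho>) (law \<rho>) shift = law \<rho>"
proof (rule measure_eqI_cylinder)
  have ms: "shift \<in> law \<rho> \<rightarrow>\<^sub>M law \<rho>"
    using measurable_shift by (simp add: measurable_cong_sets[OF sets_law[OF \<rho>(1)] sets_law[OF \<rho>(1)]])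
  show fin: "finite_measure (law \<rho>)" by (rule finite_law[OF \<rho>(1)])
  show "finite_measure (distr (law \<rho>) (law \<rho>) shift)" by (rule finite_measure.finite_measure_distr[OF fin ms])
  show "sets (law \<rho>) = sets \<Omega>" "sets (distr (law \<rho>) (law \<rho>) shift) = sets \<Omega>" by (simp_all add: sets_law[OF \<rho>(1)])
  fix n and E :: "(nat \<Rightarrow> complex^'k^'k) set" assume E: "cylinder n E"
  note [measurable] = cylinder_sets[OF E]
  have E1: "cylinder (1 + n) {\<omega>. (shift ^^ 1) \<omega> \<in> E}" by (rule cylinder_shift[OF E])
  then have E1': "cylinder (Suc n) {\<omega>. shift \<omega> \<in> E}" by simp
  note [measurable] = cylinder_sets[OF E1']
  interpret pair_sigma_finite seq.S seq.S ..
  have ind: "indicator {\<omega>. shift \<omega> \<in> E} (comb_seq 1 \<omega> \<omega>') = (indicator E \<omega>' :: ennreal)" for \<omega> \<omega>'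
  proof -
    have "shift (comb_seq 1 \<omega> \<omega>') = \<omega>'" using comb_seq_add[of 1 \<omega> \<omega>'] by (auto simp: shift_def)
    then show ?thesis by (simp add: indicator_def)
  qed
  have "emeasure (law \<rho>) {\<omega>. shift \<omega> \<in> E}
     = (\<integral>\<^sup>+\<omega>. ennreal (weight \<rho> (Wprod V (1 + n) \<omega>)) * indicator {\<omega>. shift \<omega> \<in> E} \<omega> \<partial>seq.S)"
    using emeasure_law[OF \<rho>(1) E1'] by simp
  also have "\<dots> = (\<integral>\<^sup>+\<omega>. \<integral>\<^sup>+\<omega>'. ennreal (weight \<rho> (Wprod V n \<omega>' ** Wprod V 1 \<omega>)) * indicator E \<omega>' \<partial>seq.S \<partial>seq.S)"
    by (subst seq.nn_integral_comb_seq[of _ 1]) (auto simp only: Wprod_comb_seq ind, measurable)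
  also have "\<dots> = (\<integral>\<^sup>+\<omega>'. \<integral>\<^sup>+\<omega>. ennreal (weight \<rho> (Wprod V n \<omega>' ** Wprod V 1 \<omega>)) * indicator E \<omega>' \<partial>seq.S \<partial>seq.S)"
    by (rule Fubini'[symmetric]) measurable
  also have "\<dots> = (\<integral>\<^sup>+\<omega>'. ennreal (weight \<rho> (Wprod V n \<omega>')) * indicator E \<omega>' \<partial>seq.S)"
  proof (rule nn_integral_cong)
    fix \<omega>'
    have "(\<integral>\<^sup>+\<omega>. ennreal (weight \<rho> (Wprod V n \<omega>' ** Wprod V 1 \<omega>)) * indicator E \<omega>' \<partial>seq.S)
        = (\<integral>\<^sup>+\<omega>. ennreal (weight \<rho> (Wprod V n \<omega>' ** V (\<omega> 0))) \<partial>seq.S) * indicator E \<omega>'"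
      by (subst nn_integral_multc[symmetric]) auto
    also have "(\<integral>\<^sup>+\<omega>. ennreal (weight \<rho> (Wprod V n \<omega>' ** V (\<omega> 0))) \<partial>seq.S)
        = (\<integral>\<^sup>+v. ennreal (weight \<rho> (Wprod V n \<omega>' ** V v)) \<partial>m)"
      by (rule seq.nn_integral_component[of "\<lambda>v. ennreal (weight \<rho> (Wprod V n \<omega>' ** V v))"]) measurable
    also have "\<dots> = ennreal (LINT v|m. weight \<rho> (Wprod V n \<omega>' ** V v))"
    proof (rule nn_integral_eq_integral)
      have "bounded_linear (\<lambda>\<rho> :: complex^'k^'k. weight \<rho> (Wprod V n \<omega>'))"
        unfolding weight_def
        by (intro bounded_linear_compose[OF bounded_linear_Re] bounded_linear_compose[OF bounded_linear_trace]
            bounded_linear_compose[OF bounded_bilinear.bounded_linear_left[OF bounded_bilinear_matrix_mult]]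
            bounded_bilinear.bounded_linear_right[OF bounded_bilinear_matrix_mult])
      from integrable_bounded_linear[OF this integrable_chan[of \<rho>]]
      show "integrable m (\<lambda>v. weight \<rho> (Wprod V n \<omega>' ** V v))" by (simp add: weight_mult)
    qed (simp add: weight_nonneg \<rho>)
    also have "(LINT v|m. weight \<rho> (Wprod V n \<omega>' ** V v)) = weight \<rho> (Wprod V n \<omega>')"
      unfolding weight_chan[symmetric] \<rho>(2) ..
    finally show "(\<integral>\<^sup>+\<omega>. ennreal (weight \<rho> (Wprod V n \<omega>' ** Wprod V 1 \<omega>)) * indicator E \<omega>' \<partial>seq.S)
      = ennreal (weight \<rho> (Wprod V n \<omega>')) * indicator E \<omega>'" .
  qed
  also have "\<dots> = emeasure (law \<rho>) E" by (rule emeasure_law[OF \<rho>(1) E, symmetric])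
  finally have "emeasure (law \<rho>) {\<omega>. shift \<omega> \<in> E} = emeasure (law \<rho>) E" .
  then show "measure (distr (law \<rho>) (law \<rho>) shift) E = measure (law \<rho>) E"
    using cylinder_sets[OF E] ms
    by (simp add: measure_def emeasure_distr sets_law[OF \<rho>(1)] space_law[OF \<rho>(1)] vimage_def)
qed

text \<open>\<open>\<rho>\<close> lies above \<open>a\<close> times the identity, so its law
  dominates \<open>law (mat 1)\<close> in turn: the two have the same null sets, and the zero-one
  law carries over.\<close>

lemma exists_ergodic_law:
  "\<exists>\<rho>. psd \<rho> \<and> ergodic_map (law \<rho>) shift \<and> (\<forall>Q. (AE \<omega> in law \<rho>. Q \<omega>) \<longrightarrow> (AE \<omega> in law (mat 1). Q \<omega>))"
proof -
  obtain \<rho> where \<rho>: "psd \<rho>" "Re (trace \<rho>) = 1" "chan \<rho> = \<rho>" using exists_invariant_state by blast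
  obtain a where a: "a > 0" "psd (\<rho> - a *\<^sub>R mat 1)" using invariant_state_faithful[OF \<rho>] by blast
  have le: "measure (law (mat 1)) A \<le> (1 / a) * measure (law \<rho>) A" if A: "A \<in> sets \<Omega>" for A
  proof -
    have "measure (law (a *\<^sub>R mat 1 + (\<rho> - a *\<^sub>R mat 1))) A = measure (law (a *\<^sub>R mat 1)) A + measure (law (\<rho> - a *\<^sub>R mat 1)) A"
      using a by (intro law_add psd_scaleR psd_mat_1 A) auto
    then have "measure (law \<rho>) A = a * measure (law (mat 1)) A + measure (law (\<rho> - a *\<^sub>R mat 1)) A"
      using a law_scaleR[OF psd_mat_1 _ A, of a] by simp
    moreover have "0 \<le> measure (law (\<rho> - a *\<^sub>R mat 1)) A" by simp
    ultimately have "a * measure (law (mat 1)) A \<le> measure (law \<rho>) A" by linarith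
    then show ?thesis using a by (simp add: field_simps)
  qed
  have AE: "AE \<omega> in law (mat 1). Q \<omega>" if "AE \<omega> in law \<rho>. Q \<omega>" for Q
    by (rule AE_law_mono[OF psd_mat_1 \<rho>(1) le that])
  have prob: "prob_space (law \<rho>)"
    by (rule prob_spaceI) (simp add: space_law[OF \<rho>(1)] emeasure_law_eq_measure[OF \<rho>(1)] measure_law_UNIV[OF \<rho>(1)] \<rho>(2))
  interpret L: prob_space "law \<rho>" by (rule prob)
  have "ergodic_map (law \<rho>) shift"
  proof (intro ergodic_map.intro ergodic_map_axioms.intro prob)
    show "shift \<in> law \<rho> \<rightarrow>\<^sub>M law \<rho>"
      using measurable_shift by (simp add: measurable_cong_sets[OF sets_law[OF \<rho>(1)] sets_law[OF \<rho>(1)]])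
    show "distr (law \<rho>) (law \<rho>) shift = law \<rho>" by (rule law_stationary[OF \<rho>(1,3)])
    fix A assume A: "A \<in> sets (law \<rho>)" and inv: "AE \<omega> in law \<rho>. shift \<omega> \<in> A \<longleftrightarrow> \<omega> \<in> A"
    then have A': "A \<in> sets \<Omega>" "UNIV - A \<in> sets \<Omega>"
      using sets.compl_sets[of A \<Omega>] by (simp_all add: sets_law[OF \<rho>(1)] space_PiM)
    have z: "measure (law \<rho>) B = 0" if "B \<in> sets \<Omega>" "measure (law (mat 1)) B = 0" for B
      using law_le_mat_1[OF \<rho>(1) that(1)] that(2) by (simp add: measure_le_0_iff)
    from invariant_event_0_1[OF A'(1) AE[OF inv]] show "L.prob A = 0 \<or> L.prob A = 1"
    proof
      assume "measure (law (mat 1)) (UNIV - A) = 0"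
      then have "L.prob (UNIV - A) = 0" by (rule z[OF A'(2)])
      then show ?thesis using L.prob_compl[OF A] by (simp add: space_law[OF \<rho>(1)])
    qed (use z[OF A'(1)] in simp)
  qed
  then show ?thesis using \<rho>(1) AE by blast
qed

theorem submultiplicative_limit:
  fixes a :: "nat \<Rightarrow> (nat \<Rightarrow> complex^'k^'k) \<Rightarrow> real"
  assumes "\<And>n. a n \<in> borel_measurable \<Omega>"
    and "\<And>n m \<omega>. a (n + m) \<omega> \<le> a m ((shift ^^ n) \<omega>) * a n \<omega>"
    and "\<And>n \<omega>. a n \<omega> \<le> B ^ n" "\<And>n \<omega>. 0 \<le> a n \<omega>" "B \<ge> 1"
  shows "\<exists>s<\<infinity>. AE \<omega> in law (mat 1). (\<lambda>n. elog (a n \<omega>) / ereal (real n)) \<longlonglongrightarrow> s"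
proof -
  obtain \<rho> where \<rho>: "psd \<rho>" "ergodic_map (law \<rho>) shift"
    and AE: "\<And>Q. (AE \<omega> in law \<rho>. Q \<omega>) \<Longrightarrow> AE \<omega> in law (mat 1). Q \<omega>"
    using exists_ergodic_law by blast
  have "\<exists>s<\<infinity>. AE \<omega> in law \<rho>. (\<lambda>n. elog (a n \<omega>) / ereal (real n)) \<longlonglongrightarrow> s"
    using assms by (intro ergodic_map.kingman[OF \<rho>(2), where B=B])
      (auto simp: measurable_cong_sets[OF sets_law[OF \<rho>(1)] refl])
  then show ?thesis using AE by blast
qed

end

section \<open>Contraction of the second exterior power\<close>

text \<open>The norm of the bivector spanned by \<open>x\<close> and \<open>y\<close>, as
  \<open>ext_norm_wedge_2\<close> shows.\<close>

definition area :: "complex^'k \<Rightarrow> complex^'k \<Rightarrow> real" where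
  "area x y = sqrt ((norm x)\<^sup>2 * (norm y)\<^sup>2 - (cmod (cinner x y))\<^sup>2)"

lemma cmod_cinner_square_le: "(cmod (cinner x y))\<^sup>2 \<le> (norm x)\<^sup>2 * (norm y)\<^sup>2"
  using power_mono[OF cmod_cinner_le[of x y], of 2] by (simp add: power_mult_distrib)

lemma area_nonneg [simp]: "0 \<le> area x y"
  by (simp add: area_def cmod_cinner_square_le)

lemma area_square: "(area x y)\<^sup>2 = (norm x)\<^sup>2 * (norm y)\<^sup>2 - (cmod (cinner x y))\<^sup>2"
  by (simp add: area_def cmod_cinner_square_le)

lemma area_self [simp]: "area x x = 0"
  by (simp add: area_def cinner_self norm_power power2_eq_square norm_mult)

lemma area_le_mult: "area x y \<le> norm x * norm y"
proof (rule power2_le_imp_le)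
  show "(area x y)\<^sup>2 \<le> (norm x * norm y)\<^sup>2" by (simp add: area_square power_mult_distrib)
qed simp

lemma area_le_mean: "area x y \<le> ((norm x)\<^sup>2 + (norm y)\<^sup>2) / 2"
proof -
  have "norm x * norm y \<le> ((norm x)\<^sup>2 + (norm y)\<^sup>2) / 2"
    using sum_squares_bound[of "norm x" "norm y"] by simp
  then show ?thesis using area_le_mult[of x y] by linarith
qed

text \<open>The square of the mean minus the square of the area is a quarter of a sum of two
  nonnegative terms, \<open>4 * (cmod (cinner x y))\<^sup>2\<close> and the squared difference of
  the squared norms. For images of an orthonormal pair under \<open>W\<close>, equality means that
  \<open>W\<close> is conformal on the plane.\<close>

lemma area_eq_mean:
  assumes "area x y = ((norm x)\<^sup>2 + (norm y)\<^sup>2) / 2"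
  shows "norm x = norm y" "cinner x y = 0"
proof -
  have "(norm x)\<^sup>2 * (norm y)\<^sup>2 - (cmod (cinner x y))\<^sup>2 = (((norm x)\<^sup>2 + (norm y)\<^sup>2) / 2)\<^sup>2"
    unfolding assms[symmetric] by (rule area_square[symmetric])
  then have eq: "4 * (cmod (cinner x y))\<^sup>2 + ((norm x)\<^sup>2 - (norm y)\<^sup>2)\<^sup>2 = 0"
    by (simp add: power2_eq_square field_simps)
  moreover have "0 \<le> (cmod (cinner x y))\<^sup>2" "0 \<le> ((norm x)\<^sup>2 - (norm y)\<^sup>2)\<^sup>2" by simp_all
  ultimately have "(cmod (cinner x y))\<^sup>2 = 0" "((norm x)\<^sup>2 - (norm y)\<^sup>2)\<^sup>2 = 0" by linarith+
  then show "norm x = norm y" "cinner x y = 0" by (simp_all add: power2_eq_iff_nonneg)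
qed

lemma area_combination: "area (a *s x) (b *s x + c *s y) = cmod a * cmod c * area x y"
proof -
  have gram: "of_real ((area x y)\<^sup>2) = cinner x x * cinner y y - cinner x y * cinner y x" for x y :: "complex^'a"
    unfolding area_square cinner_self cinner_commute[of y x]
    by (simp only: of_real_diff of_real_mult complex_norm_square)
  have "of_real ((area (a *s x) (b *s x + c *s y))\<^sup>2)
     = a * cnj a * (c * cnj c) * (cinner x x * cinner y y - cinner x y * cinner y x)"
    unfolding gram by (simp add: cinner_add_left cinner_add_right cinner_cmult_left cinner_cmult_right algebra_simps)
  also have "\<dots> = of_real ((cmod a * cmod c * area x y)\<^sup>2)"
    by (simp only: gram[symmetric] complex_norm_square[symmetric] power_mult_distrib of_real_mult)
  finally have "(area (a *s x) (b *s x + c *s y))\<^sup>2 = (cmod a * cmod c * area x y)\<^sup>2"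
    by (simp only: of_real_eq_iff)
  then show ?thesis by (simp add: power2_eq_iff_nonneg)
qed

lemma continuous_on_area [continuous_intros]:
  "continuous_on S f \<Longrightarrow> continuous_on S g \<Longrightarrow> continuous_on S (\<lambda>x. area (f x) (g x))"
  unfolding area_def by (intro continuous_intros)

definition orth_pairs :: "((complex^'k) \<times> (complex^'k)) set" where
  "orth_pairs = {(x, y). norm x = 1 \<and> norm y = 1 \<and> cinner x y = 0}"

lemma area_orth_pair: "(x, y) \<in> orth_pairs \<Longrightarrow> area x y = 1"
  by (simp add: orth_pairs_def area_def)

lemma compact_orth_pairs: "compact (orth_pairs :: ((complex^'k) \<times> (complex^'k)) set)"
proof -
  have "closed (orth_pairs :: ((complex^'k) \<times> (complex^'k)) set)"
    unfolding orth_pairs_def case_prod_beta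
    by (intro closed_Collect_conj closed_Collect_eq continuous_intros)
  moreover have "bounded (orth_pairs :: ((complex^'k) \<times> (complex^'k)) set)"
  proof (rule bounded_subset)
    show "bounded (sphere 0 1 \<times> sphere 0 1 :: ((complex^'k) \<times> (complex^'k)) set)"
      by (intro bounded_Times bounded_sphere)
  qed (auto simp: orth_pairs_def)
  ultimately show ?thesis by (simp add: compact_eq_bounded_closed)
qed

text \<open>Gram-Schmidt; the triangular shape is what \<open>area_combination\<close> asks for. If
  \<open>y\<close> is a multiple of \<open>x'\<close>, the coefficient \<open>c\<close> is 0 and any
  unit vector orthogonal to \<open>x'\<close> completes the pair, which takes dimension at least
  2.\<close>

lemma exists_orth_pair_basis:
  fixes x y :: "complex^'k"
  assumes k: "2 \<le> CARD('k)"
  obtains x' y' a b c where "(x', y') \<in> orth_pairs" "x = a *s x'" "y = b *s x' + c *s y'"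
proof -
  obtain x' a where x': "norm x' = 1" "x = a *s x'"
  proof (cases "x = 0")
    case True
    have "x = 0 *s axis undefined 1" by (simp add: True)
    then show ?thesis by (intro that[of "axis undefined 1" 0]) auto
  next
    case False
    have "x = of_real (norm x) *s (of_real (1 / norm x) *s x)" using False by (simp add: vec_eq_iff)
    moreover have "norm (of_real (1 / norm x) *s x) = 1" using False by (simp add: norm_cmult_vec norm_divide)
    ultimately show ?thesis by (intro that)
  qed
  have o: "orthonormal 1 (\<lambda>_. x')" using x'(1) by (simp add: orthonormal_def cinner_self)
  define r where "r = y - cinner y x' *s x'"
  have y: "y = cinner y x' *s x' + r" by (simp add: r_def)
  have r: "cinner r x' = 0"
    using x'(1) by (simp add: r_def cinner_diff_left cinner_cmult_left cinner_self)
  show thesis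
  proof (cases "r = 0")
    case True
    obtain y' where y': "norm y' = 1" "cinner y' x' = 0"
      using orthonormal_incomplete[OF o] k by auto
    have "(x', y') \<in> orth_pairs" using x'(1) y' cinner_commute[of x' y'] by (simp add: orth_pairs_def)
    then show thesis using x'(2) y True by (intro that[of x' y' a "cinner y x'" 0]) auto
  next
    case False
    let ?y = "of_real (1 / norm r) *s r"
    have "cinner x' r = 0" using r cinner_commute[of x' r] by simp
    then have "(x', ?y) \<in> orth_pairs"
      using x'(1) False by (simp add: orth_pairs_def norm_cmult_vec norm_divide cinner_cmult_right)
    moreover have "y = cinner y x' *s x' + of_real (norm r) *s ?y"
      using False by (subst y) (simp add: vec_eq_iff)
    ultimately show thesis using x'(2) by (intro that)
  qed
qed

text \<open>The distortion of area by \<open>W\<close> depends only on the plane: passing from the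
  orthonormal pair to \<open>x\<close> and \<open>y\<close> multiplies the areas before and after
  \<open>W\<close> by the same factor \<open>cmod a * cmod c\<close>.\<close>

lemma area_map_eq:
  fixes W :: "complex^'k^'k"
  assumes "(x', y') \<in> orth_pairs" "x = a *s x'" "y = b *s x' + c *s y'"
  shows "area (W *v x) (W *v y) = area x y * area (W *v x') (W *v y')"
proof -
  have "area (W *v x) (W *v y) = cmod a * cmod c * area (W *v x') (W *v y')"
    unfolding assms(2,3) matrix_vector_right_distrib vector_scalar_commute[symmetric]
    by (simp only: vector_scalar_commute area_combination)
  moreover have "area x y = cmod a * cmod c"
    unfolding assms(2,3) area_combination by (simp add: area_orth_pair[OF assms(1)])
  ultimately show ?thesis by simp
qed

lemma ext_bound_2: "ext_bound 2 W = (\<Sum>j\<in>tuples 2. area (W *v axis (j 0) 1) (W *v axis (j 1) 1))"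
  by (simp add: ext_bound_def ext_norm_wedge_2 area_def)

text \<open>On a plane where \<open>W\<close> is conformal, \<open>cadj W ** W\<close> compresses to
  a multiple of the projector. This projector has rank two, so purification forbids that all
  products are almost surely conformal on one plane.\<close>

lemma projector_of_orth_pair:
  assumes xy: "(x, y) \<in> orth_pairs" and q: "q = outer x + outer (y :: complex^'k)"
  shows "orth_projector q" "q \<noteq> 0" "vec.dim (range (\<lambda>z. q *v z)) \<noteq> 1"
    and "norm (W *v x) = norm (W *v y) \<Longrightarrow> cinner (W *v x) (W *v y) = 0 \<Longrightarrow>
      q ** cadj W ** W ** q = mat (of_real ((norm (W *v x))\<^sup>2)) ** q"
proof -
  have n: "norm x = 1" "norm y = 1" "cinner x y = 0" using xy by (auto simp: orth_pairs_def)
  have n': "cinner y x = 0" using n(3) cinner_commute[of y x] by simp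
  have qv: "q *v z = cinner z x *s x + cinner z y *s y" for z
    by (simp add: q matrix_vector_mult_add_rdistrib outer_mult_vec)
  have qx: "q *v x = x" "q *v y = y" using n n' by (simp_all add: qv cinner_self)
  show proj: "orth_projector q"
  proof -
    have "q ** q = q"
      by (subst matrix_eq) (simp add: qx qv[of "_ + _"] qv n n' cinner_self cinner_add_left cinner_cmult_left flip: matrix_vector_mul_assoc)
    moreover have "cadj q = q" by (simp add: q cadj_add cadj_outer)
    ultimately show ?thesis by (simp add: orth_projector_def)
  qed
  show "q \<noteq> 0" using qx n by auto
  show "vec.dim (range (\<lambda>z. q *v z)) \<noteq> 1"
  proof
    assume d: "vec.dim (range (\<lambda>z. q *v z)) = 1"
    let ?f = "\<lambda>i::nat. if i = 0 then x else y"
    have o: "orthonormal 2 ?f"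
      using n n' by (auto simp: orthonormal_def less_2_cases_iff cinner_self)
    have "?f ` {..<2} \<subseteq> range (\<lambda>z. q *v z)"
      using qx by (auto intro: range_eqI[of _ _ x] range_eqI[of _ _ y])
    then have "card (?f ` {..<2}) \<le> vec.dim (range (\<lambda>z. q *v z))"
      using orthonormal_independent(2)[OF o] by (rule vec.independent_card_le_dim)
    then show False using d card_image[OF orthonormal_independent(1)[OF o]] by simp
  qed
  assume W: "norm (W *v x) = norm (W *v y)" "cinner (W *v x) (W *v y) = 0"
  then have W': "cinner (W *v y) (W *v x) = 0" using cinner_commute[of "W *v y" "W *v x"] by simp
  show "q ** cadj W ** W ** q = mat (of_real ((norm (W *v x))\<^sup>2)) ** q"
  proof (subst matrix_eq, rule allI)
    fix z
    let ?u = "cinner z x *s x + cinner z y *s y" and ?c = "of_real ((norm (W *v x))\<^sup>2) :: complex"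
    have u: "W *v ?u = cinner z x *s (W *v x) + cinner z y *s (W *v y)"
      by (simp add: matrix_vector_right_distrib vector_scalar_commute)
    have "(q ** cadj W ** W ** q) *v z = q *v (cadj W *v (W *v ?u))"
      by (simp add: qv[of z, symmetric] matrix_vector_mul_assoc matrix_mul_assoc)
    also have "\<dots> = cinner (W *v ?u) (W *v x) *s x + cinner (W *v ?u) (W *v y) *s y"
      unfolding qv[of "cadj W *v _"] by (simp add: cinner_cadj[of "cadj W"])
    also have "\<dots> = (?c * cinner z x) *s x + (?c * cinner z y) *s y"
      unfolding u using W W' by (simp add: cinner_add_left cinner_cmult_left cinner_self mult.commute)
    also have "\<dots> = ?c *s (q *v z)"
      unfolding qv by (simp add: vec_eq_iff algebra_simps)
    also have "\<dots> = (mat ?c ** q) *v z"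
    proof -
      have "mat a *v w = a *s w" for a :: complex and w :: "complex^'k"
        by (simp add: vec_eq_iff matrix_vector_mult_def mat_def if_distrib if_distribR cong: if_cong)
      then show ?thesis by (simp add: matrix_vector_mul_assoc[symmetric])
    qed
    finally show "(q ** cadj W ** W ** q) *v z = (mat ?c ** q) *v z" .
  qed
qed

section \<open>Mean distortion of areas by the products\<close>

context instrument
begin

text \<open>The expectation is taken under the reference product measure. Dividing the area by the
  squared Frobenius norm and integrating against \<open>law (mat 1)\<close> gives the same number,
  since that square is the density; in the present form independence of the factors can be used
  directly.\<close>

definition mean_area :: "nat \<Rightarrow> complex^'k \<Rightarrow> complex^'k \<Rightarrow> real" where
  "mean_area n x y = (LINT \<omega>|seq.S. area (Wprod V n \<omega> *v x) (Wprod V n \<omega> *v y))"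

lemma norm_W: "norm (Wprod V n \<omega>) \<le> norm (mat 1 :: complex^'k^'k) * C ^ n"
proof (induction n)
  case (Suc n)
  have "norm (V (\<omega> n) ** Wprod V n \<omega>) \<le> norm (V (\<omega> n)) * norm (Wprod V n \<omega>)" by (rule norm_matrix_mult_le)
  also have "\<dots> \<le> C * (norm (mat 1 :: complex^'k^'k) * C ^ n)"
    using norm_V[of "\<omega> n"] by (intro mult_mono Suc) (auto intro: order_trans[OF norm_ge_zero])
  finally show ?case by (simp add: mult_ac)
qed simp

lemma measurable_area_W [measurable]: "(\<lambda>\<omega>. area (Wprod V n \<omega> *v x) (Wprod V n \<omega> *v y)) \<in> borel_measurable \<Omega>"
  unfolding area_def by measurable

lemma area_W_le: "area (Wprod V n \<omega> *v x) (Wprod V n \<omega> *v y) \<le> (norm (mat 1 :: complex^'k^'k) * C ^ n)\<^sup>2 * (norm x * norm y)"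
proof -
  let ?K = "norm (mat 1 :: complex^'k^'k) * C ^ n"
  have K: "0 \<le> ?K" by (rule order_trans[OF norm_ge_zero norm_W])
  have "norm (Wprod V n \<omega> *v z) \<le> ?K * norm z" for z
    by (rule order_trans[OF norm_matrix_vector_mult_le]) (intro mult_right_mono norm_W norm_ge_zero)
  then have "norm (Wprod V n \<omega> *v x) * norm (Wprod V n \<omega> *v y) \<le> (?K * norm x) * (?K * norm y)"
    using K by (intro mult_mono) auto
  then show ?thesis using area_le_mult[of "Wprod V n \<omega> *v x" "Wprod V n \<omega> *v y"]
    by (simp add: power2_eq_square mult_ac)
qed

lemma integrable_area: "integrable seq.S (\<lambda>\<omega>. area (Wprod V n \<omega> *v x) (Wprod V n \<omega> *v y))"
  by (rule seq.P.integrable_const_bound[where B="(norm (mat 1 :: complex^'k^'k) * C ^ n)\<^sup>2 * (norm x * norm y)"])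
     (use area_W_le in auto)

lemma nn_integral_area: "(\<integral>\<^sup>+\<omega>. ennreal (area (Wprod V n \<omega> *v x) (Wprod V n \<omega> *v y)) \<partial>seq.S) = ennreal (mean_area n x y)"
  unfolding mean_area_def by (rule nn_integral_eq_integral[OF integrable_area]) simp

lemma mean_area_nonneg: "0 \<le> mean_area n x y"
  unfolding mean_area_def by (rule Bochner_Integration.integral_nonneg) simp

text \<open>Dominated convergence; the bound on \<open>V\<close> provides the majorant.\<close>

lemma continuous_on_mean_area: "continuous_on (orth_pairs :: ((complex^'k) \<times> (complex^'k)) set) (\<lambda>(x, y). mean_area n x y)"
proof (unfold continuous_on_sequentially, intro allI ballI impI, clarsimp simp: o_def case_prod_beta)
  fix z :: "nat \<Rightarrow> (complex^'k) \<times> (complex^'k)" and x y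
  assume z: "\<forall>i. z i \<in> orth_pairs" and lim: "z \<longlonglongrightarrow> (x, y)"
  show "(\<lambda>i. mean_area n (fst (z i)) (snd (z i))) \<longlonglongrightarrow> mean_area n x y"
    unfolding mean_area_def
  proof (rule integral_dominated_convergence[where w="\<lambda>_. (norm (mat 1 :: complex^'k^'k) * C ^ n)\<^sup>2"])
    show "AE \<omega> in seq.S. (\<lambda>i. area (Wprod V n \<omega> *v fst (z i)) (Wprod V n \<omega> *v snd (z i)))
        \<longlonglongrightarrow> area (Wprod V n \<omega> *v x) (Wprod V n \<omega> *v y)"
    proof (rule AE_I2)
      fix \<omega>
      have "continuous_on UNIV (\<lambda>p :: (complex^'k) \<times> (complex^'k). area (Wprod V n \<omega> *v fst p) (Wprod V n \<omega> *v snd p))"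
        by (intro continuous_intros)
      then show "(\<lambda>i. area (Wprod V n \<omega> *v fst (z i)) (Wprod V n \<omega> *v snd (z i)))
        \<longlonglongrightarrow> area (Wprod V n \<omega> *v x) (Wprod V n \<omega> *v y)"
        using continuous_on_tendsto_compose[OF _ lim] by fastforce
    qed
    have nz: "norm (fst (z i)) = 1" "norm (snd (z i)) = 1" for i
      using z by (auto simp: orth_pairs_def split: prod.splits) (metis prod.collapse)+
    show "AE \<omega> in seq.S. norm (area (Wprod V n \<omega> *v fst (z i)) (Wprod V n \<omega> *v snd (z i)))
       \<le> (norm (mat 1 :: complex^'k^'k) * C ^ n)\<^sup>2" for i
      using area_W_le[of n _ "fst (z i)" "snd (z i)"] by (intro AE_I2) (simp add: nz)
  qed auto
qed

lemma nn_integral_norm_W: "(\<integral>\<^sup>+\<omega>. ennreal ((norm (Wprod V n \<omega> *v x))\<^sup>2) \<partial>seq.S) = ennreal ((norm x)\<^sup>2)"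
proof -
  have "emeasure (law (outer x)) UNIV = (\<integral>\<^sup>+\<omega>. ennreal ((norm (Wprod V n \<omega> *v x))\<^sup>2) \<partial>seq.S)"
    using emeasure_law[OF psd_outer cylinder_UNIV, of x n] by (simp add: weight_outer)
  moreover have "emeasure (law (outer x)) UNIV = ennreal ((norm x)\<^sup>2)"
    unfolding emeasure_law_eq_measure[OF psd_outer] measure_law_UNIV[OF psd_outer] weight_id[symmetric] weight_outer by simp
  ultimately show ?thesis by simp
qed

lemma integral_norm_W:
  "integrable seq.S (\<lambda>\<omega>. (norm (Wprod V n \<omega> *v x))\<^sup>2)" "(LINT \<omega>|seq.S. (norm (Wprod V n \<omega> *v x))\<^sup>2) = (norm x)\<^sup>2"
proof -
  have m: "(\<lambda>\<omega>. (norm (Wprod V n \<omega> *v x))\<^sup>2) \<in> borel_measurable seq.S" by measurable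
  show "integrable seq.S (\<lambda>\<omega>. (norm (Wprod V n \<omega> *v x))\<^sup>2)"
    by (rule integrableI_nonneg[OF m]) (auto simp: nn_integral_norm_W)
  show "(LINT \<omega>|seq.S. (norm (Wprod V n \<omega> *v x))\<^sup>2) = (norm x)\<^sup>2"
    by (subst integral_eq_nn_integral[OF m]) (auto simp: nn_integral_norm_W)
qed

text \<open>By \<open>area_le_mean\<close> the area is at most half the sum of two squared norms,
  each of mean 1. If the means agree, equality holds almost surely and \<open>area_eq_mean\<close>
  applies.\<close>

lemma mean_area_le_1: "(x, y) \<in> orth_pairs \<Longrightarrow> mean_area n x y \<le> 1"
  and mean_area_eq_1: "(x, y) \<in> orth_pairs \<Longrightarrow> mean_area n x y = 1 \<Longrightarrow>
    AE \<omega> in seq.S. norm (Wprod V n \<omega> *v x) = norm (Wprod V n \<omega> *v y) \<and> cinner (Wprod V n \<omega> *v x) (Wprod V n \<omega> *v y) = 0"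
proof -
  assume xy: "(x, y) \<in> orth_pairs"
  let ?g = "\<lambda>\<omega>. ((norm (Wprod V n \<omega> *v x))\<^sup>2 + (norm (Wprod V n \<omega> *v y))\<^sup>2) / 2"
  have int: "integrable seq.S ?g" using integral_norm_W(1) by auto
  have one: "(LINT \<omega>|seq.S. ?g \<omega>) = 1"
    using xy by (simp add: integral_norm_W orth_pairs_def)
  have diff: "(LINT \<omega>|seq.S. ?g \<omega> - area (Wprod V n \<omega> *v x) (Wprod V n \<omega> *v y)) = 1 - mean_area n x y"
    using Bochner_Integration.integral_diff[OF int integrable_area] one by (simp add: mean_area_def)
  have nonneg: "AE \<omega> in seq.S. 0 \<le> ?g \<omega> - area (Wprod V n \<omega> *v x) (Wprod V n \<omega> *v y)"
    using area_le_mean by (intro AE_I2) simp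
  show "mean_area n x y \<le> 1" using integral_nonneg_AE[OF nonneg] unfolding diff by simp
  assume "mean_area n x y = 1"
  then have "(LINT \<omega>|seq.S. ?g \<omega> - area (Wprod V n \<omega> *v x) (Wprod V n \<omega> *v y)) = 0" unfolding diff by simp
  then have "AE \<omega> in seq.S. ?g \<omega> - area (Wprod V n \<omega> *v x) (Wprod V n \<omega> *v y) = 0"
    using integral_nonneg_eq_0_iff_AE[OF Bochner_Integration.integrable_diff[OF int integrable_area] nonneg] by simp
  then show "AE \<omega> in seq.S. norm (Wprod V n \<omega> *v x) = norm (Wprod V n \<omega> *v y) \<and> cinner (Wprod V n \<omega> *v x) (Wprod V n \<omega> *v y) = 0"
    by eventually_elim (use area_eq_mean in force)
qed

text \<open>Given the first \<open>n\<close> factors, the plane spanned by the images of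
  \<open>x\<close> and \<open>y\<close> is fixed, and the next \<open>p\<close> independent factors
  multiply areas in it by at most \<open>r\<close> on average.\<close>

lemma mean_area_add_le:
  assumes k: "2 \<le> CARD('k)" and r: "\<And>x y. (x, y) \<in> orth_pairs \<Longrightarrow> mean_area p x y \<le> r" and r0: "0 \<le> r"
  shows "mean_area (n + p) x y \<le> r * mean_area n x y"
proof -
  have gen: "(\<integral>\<^sup>+\<omega>'. ennreal (area (Wprod V p \<omega>' *v u) (Wprod V p \<omega>' *v v)) \<partial>seq.S) \<le> ennreal r * ennreal (area u v)" for u v
  proof -
    obtain x' y' a b c where xy: "(x', y') \<in> orth_pairs" "u = a *s x'" "v = b *s x' + c *s y'"
      by (rule exists_orth_pair_basis[OF k])
    have "mean_area p u v = area u v * mean_area p x' y'"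
      unfolding mean_area_def area_map_eq[OF xy] by simp
    also have "\<dots> \<le> area u v * r" using r[OF xy(1)] by (intro mult_left_mono) auto
    finally show ?thesis unfolding nn_integral_area using r0 by (simp add: ennreal_mult[symmetric] mult.commute ennreal_leI)
  qed
  have "ennreal (mean_area (n + p) x y)
     = (\<integral>\<^sup>+\<omega>. \<integral>\<^sup>+\<omega>'. ennreal (area (Wprod V p \<omega>' *v (Wprod V n \<omega> *v x)) (Wprod V p \<omega>' *v (Wprod V n \<omega> *v y))) \<partial>seq.S \<partial>seq.S)"
    unfolding nn_integral_area[symmetric]
    by (subst seq.nn_integral_comb_seq[of _ n]) (auto simp: Wprod_comb_seq matrix_vector_mul_assoc)
  also have "\<dots> \<le> (\<integral>\<^sup>+\<omega>. ennreal r * ennreal (area (Wprod V n \<omega> *v x) (Wprod V n \<omega> *v y)) \<partial>seq.S)"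
    by (intro nn_integral_mono gen)
  also have "\<dots> = ennreal (r * mean_area n x y)"
    using r0 mean_area_nonneg by (simp add: nn_integral_cmult nn_integral_area ennreal_mult)
  finally show ?thesis using r0 mean_area_nonneg by (simp add: ennreal_le_iff mult_nonneg_nonneg)
qed

text \<open>If \<open>mean_area n\<close> had maximum 1 on orthonormal pairs for every \<open>n\<close>, a limit pair would span a
  plane on which all \<open>Wprod V n\<close> act conformally, contradicting purification.\<close>

lemma mean_area_contraction:
  assumes k: "2 \<le> CARD('k)"
    and pur: "\<And>q :: complex^'k^'k. orth_projector q \<Longrightarrow> q \<noteq> 0 \<Longrightarrow>
      (\<And>n. AE \<omega> in seq.S. \<exists>c. q ** cadj (Wprod V n \<omega>) ** Wprod V n \<omega> ** q = mat c ** q) \<Longrightarrow>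
      vec.dim (range (\<lambda>x. q *v x)) = 1"
  shows "\<exists>N>0. \<exists>r. 0 < r \<and> r < 1 \<and> (\<forall>x y. (x, y) \<in> orth_pairs \<longrightarrow> mean_area N x y \<le> r)"
proof -
  have dec: "mean_area (n + p) x y \<le> mean_area n x y" for n p x y
    using mean_area_add_le[OF k mean_area_le_1, of n p x y] by simp
  have "\<exists>N. \<forall>x y. (x, y) \<in> orth_pairs \<longrightarrow> mean_area N x y < 1"
  proof (rule ccontr)
    assume "\<not> ?thesis"
    then have "\<forall>N. \<exists>z. z \<in> orth_pairs \<and> 1 \<le> mean_area N (fst z) (snd z)" by (auto simp: not_less)
    then obtain z where z: "\<And>N. z N \<in> orth_pairs" "\<And>N. 1 \<le> mean_area N (fst (z N)) (snd (z N))" by metis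
    obtain l s where l: "l \<in> orth_pairs" and s: "strict_mono s" and lim: "(z \<circ> s) \<longlonglongrightarrow> l"
      using compact_orth_pairs z(1) unfolding compact_def by blast
    obtain x y where xy: "l = (x, y)" by (cases l)
    have one: "mean_area n x y = 1" for n
    proof (rule antisym)
      show "mean_area n x y \<le> 1" using l xy by (intro mean_area_le_1) simp
      have "((\<lambda>(x, y). mean_area n x y) \<circ> (z \<circ> s)) \<longlonglongrightarrow> (\<lambda>(x, y). mean_area n x y) l"
        using continuous_on_mean_area[of n] l lim z(1) unfolding continuous_on_sequentially by (auto simp: o_def)
      then have "(\<lambda>i. mean_area n (fst (z (s i))) (snd (z (s i)))) \<longlonglongrightarrow> mean_area n x y"
        by (simp add: o_def case_prod_beta xy)
      \<comment> \<open>For a fixed pair \<open>mean_area\<close> decreases in time, so the pairs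
        chosen for later times are already extremal at time \<open>n\<close>; continuity carries
        this to the limit pair.\<close>
      moreover have "1 \<le> mean_area n (fst (z (s i))) (snd (z (s i)))" if "n \<le> i" for i
      proof -
        have "n \<le> s i" using that seq_suble[OF s, of i] by simp
        then show ?thesis using z(2)[of "s i"] dec[of n "s i - n" "fst (z (s i))" "snd (z (s i))"] by simp
      qed
      ultimately show "1 \<le> mean_area n x y"
        by (intro LIMSEQ_le_const) auto
    qed
    define q where "q = outer x + outer y"
    have o: "(x, y) \<in> orth_pairs" using l xy by simp
    note Q = projector_of_orth_pair[OF o q_def]
    have "AE \<omega> in seq.S. \<exists>c. q ** cadj (Wprod V n \<omega>) ** Wprod V n \<omega> ** q = mat c ** q" for n
      using mean_area_eq_1[OF o one[of n]] by eventually_elim (use Q(4) in blast)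
    from pur[OF Q(1,2) this] Q(3) show False by simp
  qed
  then obtain N where N: "\<And>x y. (x, y) \<in> orth_pairs \<Longrightarrow> mean_area N x y < 1" by blast
  have o: "orthonormal 0 (\<lambda>_. 0 :: complex^'k)" by (simp add: orthonormal_def)
  obtain x' y' :: "complex^'k" and a b c where ne: "(x', y') \<in> orth_pairs"
    using exists_orth_pair_basis[OF k, of 0 0] by metis
  obtain l where l: "l \<in> orth_pairs" and max: "\<And>z. z \<in> orth_pairs \<Longrightarrow> (\<lambda>(x, y). mean_area N x y) z \<le> (\<lambda>(x, y). mean_area N x y) l"
    using continuous_attains_sup[OF compact_orth_pairs _ continuous_on_mean_area[of N]] ne by blast
  \<comment> \<open>The value 1/2 keeps \<open>r\<close> positive, since the decay estimate takes a
    root of \<open>r\<close> and divides by it.\<close>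
  define r where "r = max (1/2) (mean_area N (fst l) (snd l))"
  have r: "0 < r" "r < 1" using N[of "fst l" "snd l"] l by (auto simp: r_def)
  have le: "mean_area N x y \<le> r" if "(x, y) \<in> orth_pairs" for x y
    using max[OF that] by (auto simp: r_def case_prod_beta)
  have "N > 0"
  proof (rule ccontr)
    assume "\<not> N > 0"
    then have "mean_area N x' y' = 1" using area_orth_pair[OF ne] by (simp add: mean_area_def seq.P.prob_space)
    then show False using N[OF ne] by simp
  qed
  then show ?thesis using r le by blast
qed

text \<open>Borel-Cantelli, with the probabilities under \<open>law \<rho>\<close> written as
  integrals of the weight over the reference measure.\<close>

lemma AE_eventually_not:
  assumes \<rho>: "psd \<rho>" and B: "\<And>n. B n \<in> sets borel"
    and le: "\<And>n. (\<integral>\<^sup>+\<omega>. ennreal (weight \<rho> (Wprod V n \<omega>)) * indicator (B n) (Wprod V n \<omega>) \<partial>seq.S) \<le> ennreal (b n)"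
    and b: "summable b" "\<And>n. 0 \<le> b n"
  shows "AE \<omega> in law \<rho>. \<forall>\<^sub>F n in sequentially. Wprod V n \<omega> \<notin> B n"
proof -
  let ?E = "\<lambda>n. {\<omega>. Wprod V n \<omega> \<in> B n}"
  have c: "cylinder n (?E n)" for n by (rule cylinder_Wprod[OF measurable_V B])
  have le': "measure (law \<rho>) (?E n) \<le> b n" for n
  proof -
    have "emeasure (law \<rho>) (?E n) \<le> ennreal (b n)"
      using le[of n] unfolding emeasure_law[OF \<rho> c] by (simp add: indicator_def)
    then show ?thesis unfolding emeasure_law_eq_measure[OF \<rho>] using b(2)[of n] by (simp add: ennreal_le_iff)
  qed
  have "AE \<omega> in law \<rho>. \<forall>\<^sub>F n in sequentially. \<omega> \<in> space (law \<rho>) - ?E n"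
  proof (rule borel_cantelli_AE1)
    show "?E n \<in> sets (law \<rho>)" for n using cylinder_sets[OF c] by (simp add: sets_law[OF \<rho>])
    show "emeasure (law \<rho>) (?E n) < \<infinity>" for n by (simp add: emeasure_law_eq_measure[OF \<rho>])
    show "summable (\<lambda>n. measure (law \<rho>) (?E n))"
      by (rule summable_comparison_test'[OF b(1), of 0]) (use le' in auto)
  qed
  then show ?thesis by eventually_elim (auto elim: eventually_mono)
qed

text \<open>The mean of \<open>ext_bound 2\<close> under the reference measure decays like
  \<open>t ^ n\<close>. On the event \<open>B n\<close> the density of \<open>law (mat 1)\<close>,
  the squared Frobenius norm, is below \<open>ext_bound 2\<close> divided by
  \<open>\<beta> ^ n\<close>, so this event has probability at most a constant times
  \<open>(t / \<beta>) ^ n\<close>.\<close>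

lemma ext_bound_2_decay:
  assumes k: "2 \<le> CARD('k)" and N: "N > 0" and r: "0 < r" "r < 1"
    and le: "\<And>x y. (x, y) \<in> orth_pairs \<Longrightarrow> mean_area N x y \<le> r"
  shows "\<exists>\<beta>. 0 < \<beta> \<and> \<beta> < 1 \<and> (AE \<omega> in law (mat 1). \<forall>\<^sub>F n in sequentially.
    ext_bound 2 (Wprod V n \<omega>) \<le> \<beta> ^ n * (norm (Wprod V n \<omega>))\<^sup>2)"
proof -
  have pow: "mean_area (j * N) x y \<le> r ^ j" if "(x, y) \<in> orth_pairs" for j x y
  proof (induction j)
    case (Suc j)
    have "mean_area (j * N + N) x y \<le> r * mean_area (j * N) x y"
      using r by (intro mean_area_add_le[OF k le]) auto
    also have "\<dots> \<le> r * r ^ j" using Suc r by (intro mult_left_mono) auto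
    finally show ?case by (simp add: add.commute)
  qed (simp add: mean_area_le_1[OF that])
  have pow': "mean_area n x y \<le> r ^ (n div N)" if xy: "(x, y) \<in> orth_pairs" for n x y
  proof -
    have "mean_area (n div N * N + n mod N) x y \<le> 1 * mean_area (n div N * N) x y"
      by (intro mean_area_add_le[OF k mean_area_le_1]) auto
    then show ?thesis using pow[OF xy, of "n div N"] by simp
  qed
  define t where "t = r powr (1 / N)"
  have t: "0 < t" "t < 1" using r N powr_less_mono2[of "1 / N" r 1] by (auto simp: t_def)
  \<comment> \<open>\<open>t\<close> is the \<open>N\<close>-th root of \<open>r\<close>; rounding
    \<open>n / N\<close> down loses at most one factor \<open>r\<close>, whence the
    division.\<close>
  have rt: "r ^ (n div N) \<le> t ^ n / r" for n
  proof -
    have tN: "t ^ N = r" using r N by (simp add: t_def powr_power)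
    have "t ^ n = t ^ (n div N * N + n mod N)" by simp
    also have "\<dots> = r ^ (n div N) * t ^ (n mod N)" by (simp only: power_add power_mult mult.commute[of _ N] tN)
    also have "\<dots> \<ge> r ^ (n div N) * t ^ N"
      using t r N by (intro mult_left_mono power_decreasing) (auto simp: less_imp_le)
    finally show ?thesis using r unfolding tN by (simp add: field_simps)
  qed
  let ?K = "real (card (tuples 2 :: (nat \<Rightarrow> 'k) set))"
  have bound: "(\<integral>\<^sup>+\<omega>. ennreal (ext_bound 2 (Wprod V n \<omega>)) \<partial>seq.S) \<le> ennreal (?K * (t ^ n / r))" for n
  proof -
    have "(\<integral>\<^sup>+\<omega>. ennreal (ext_bound 2 (Wprod V n \<omega>)) \<partial>seq.S)
      = (\<Sum>j\<in>(tuples 2 :: (nat \<Rightarrow> 'k) set). \<integral>\<^sup>+\<omega>. ennreal (area (Wprod V n \<omega> *v axis (j 0) 1) (Wprod V n \<omega> *v axis (j 1) 1)) \<partial>seq.S)"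
      unfolding ext_bound_2 by (subst nn_integral_sum[symmetric]) (auto simp: sum_ennreal)
    also have "\<dots> \<le> (\<Sum>j\<in>(tuples 2 :: (nat \<Rightarrow> 'k) set). ennreal (t ^ n / r))"
    proof (rule sum_mono)
      fix j :: "nat \<Rightarrow> 'k"
      show "(\<integral>\<^sup>+\<omega>. ennreal (area (Wprod V n \<omega> *v axis (j 0) 1) (Wprod V n \<omega> *v axis (j 1) 1)) \<partial>seq.S) \<le> ennreal (t ^ n / r)"
      proof (cases "j 0 = j 1")
        case True
        then show ?thesis by simp
      next
        case False
        then have "(axis (j 0) 1, axis (j 1) 1 :: complex^'k) \<in> orth_pairs"
          by (simp add: orth_pairs_def cinner_axis_right) (simp add: axis_def)
        from pow'[OF this, of n] rt[of n] show ?thesis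
          unfolding nn_integral_area by (intro ennreal_leI) linarith
      qed
    qed
    also have "\<dots> = ennreal (?K * (t ^ n / r))"
    proof -
      have "(\<Sum>j\<in>(tuples 2 :: (nat \<Rightarrow> 'k) set). ennreal (t ^ n / r)) = ennreal ?K * ennreal (t ^ n / r)"
        by (simp only: sum_constant ennreal_of_nat_eq_real_of_nat)
      also have "\<dots> = ennreal (?K * (t ^ n / r))" using t r by (intro ennreal_mult[symmetric]) auto
      finally show ?thesis .
    qed
    finally show ?thesis .
  qed
  \<comment> \<open>The square root splits the decay \<open>t ^ n\<close> evenly between the
    threshold in \<open>B n\<close> and the probability of \<open>B n\<close>.\<close>
  define \<beta> where "\<beta> = sqrt t"
  have \<beta>: "0 < \<beta>" "\<beta> < 1" using t by (auto simp: \<beta>_def)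
  have t_eq: "t ^ n / \<beta> ^ n = \<beta> ^ n" for n
  proof -
    have "t = \<beta> * \<beta>" using t by (simp add: \<beta>_def)
    then show ?thesis using \<beta> by (simp add: power_mult_distrib)
  qed
  define B where "B n = {W :: complex^'k^'k. \<beta> ^ n * (norm W)\<^sup>2 < ext_bound 2 W}" for n
  have [measurable]: "ext_bound 2 \<in> borel_measurable (borel :: (complex^'k^'k) measure)"
    unfolding ext_bound_2 by (intro borel_measurable_continuous_onI continuous_intros)
  have "AE \<omega> in law (mat 1). \<forall>\<^sub>F n in sequentially. Wprod V n \<omega> \<notin> B n"
  proof (rule AE_eventually_not[OF psd_mat_1, where b="\<lambda>n. ?K / r * \<beta> ^ n"])
    show "B n \<in> sets borel" for n unfolding B_def by measurable
    show "summable (\<lambda>n. ?K / r * \<beta> ^ n)" using \<beta> by (intro summable_mult summable_geometric) auto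
    show "0 \<le> ?K / r * \<beta> ^ n" for n using \<beta> r by auto
    fix n
    have "(\<integral>\<^sup>+\<omega>. ennreal (weight (mat 1) (Wprod V n \<omega>)) * indicator (B n) (Wprod V n \<omega>) \<partial>seq.S)
       \<le> (\<integral>\<^sup>+\<omega>. ennreal (1 / \<beta> ^ n) * ennreal (ext_bound 2 (Wprod V n \<omega>)) \<partial>seq.S)"
    proof (rule nn_integral_mono)
      fix \<omega>
      show "ennreal (weight (mat 1) (Wprod V n \<omega>)) * indicator (B n) (Wprod V n \<omega>)
        \<le> ennreal (1 / \<beta> ^ n) * ennreal (ext_bound 2 (Wprod V n \<omega>))"
      proof (cases "Wprod V n \<omega> \<in> B n")
        case True
        then have "(norm (Wprod V n \<omega>))\<^sup>2 \<le> 1 / \<beta> ^ n * ext_bound 2 (Wprod V n \<omega>)"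
          using \<beta> by (simp add: B_def field_simps)
        then show ?thesis using True \<beta> by (simp add: weight_mat_1 ennreal_leI flip: ennreal_mult')
      qed simp
    qed
    also have "\<dots> = ennreal (1 / \<beta> ^ n) * (\<integral>\<^sup>+\<omega>. ennreal (ext_bound 2 (Wprod V n \<omega>)) \<partial>seq.S)"
      by (rule nn_integral_cmult) measurable
    also have "\<dots> \<le> ennreal (1 / \<beta> ^ n) * ennreal (?K * (t ^ n / r))"
      by (intro mult_left_mono bound) auto
    also have "\<dots> = ennreal (?K / r * (t ^ n / \<beta> ^ n))"
      using \<beta> r t by (simp add: mult_ac flip: ennreal_mult')
    finally show "(\<integral>\<^sup>+\<omega>. ennreal (weight (mat 1) (Wprod V n \<omega>)) * indicator (B n) (Wprod V n \<omega>) \<partial>seq.S)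
       \<le> ennreal (?K / r * \<beta> ^ n)" unfolding t_eq .
  qed
  then have "AE \<omega> in law (mat 1). \<forall>\<^sub>F n in sequentially. ext_bound 2 (Wprod V n \<omega>) \<le> \<beta> ^ n * (norm (Wprod V n \<omega>))\<^sup>2"
    by eventually_elim (auto elim!: eventually_mono simp: B_def not_less)
  then show ?thesis using \<beta> by blast
qed

text \<open>The squared Frobenius norm is the density of \<open>law (mat 1)\<close>, so the event
  that it lies below \<open>(1 / 2) ^ n\<close> has probability at most \<open>(1 / 2) ^ n\<close>.
  The rate is arbitrary; what matters is that the products neither vanish nor decay
  superexponentially.\<close>

lemma AE_norm_W_ge: "AE \<omega> in law (mat 1). \<forall>\<^sub>F n in sequentially. (1 / 2) ^ n \<le> (norm (Wprod V n \<omega>))\<^sup>2"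
proof -
  define B where "B n = {W :: complex^'k^'k. (norm W)\<^sup>2 < (1 / 2) ^ n}" for n
  have "AE \<omega> in law (mat 1). \<forall>\<^sub>F n in sequentially. Wprod V n \<omega> \<notin> B n"
  proof (rule AE_eventually_not[OF psd_mat_1, where b="\<lambda>n. (1 / 2) ^ n"])
    show "B n \<in> sets borel" for n unfolding B_def by measurable
    fix n
    have "(\<integral>\<^sup>+\<omega>. ennreal (weight (mat 1) (Wprod V n \<omega>)) * indicator (B n) (Wprod V n \<omega>) \<partial>seq.S)
       \<le> (\<integral>\<^sup>+\<omega>. ennreal ((1 / 2) ^ n) \<partial>seq.S)"
      by (intro nn_integral_mono) (auto simp: weight_mat_1 B_def indicator_def intro!: ennreal_leI)
    also have "\<dots> = ennreal ((1 / 2) ^ n)" by (simp add: seq.P.emeasure_space_1)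
    finally show "(\<integral>\<^sup>+\<omega>. ennreal (weight (mat 1) (Wprod V n \<omega>)) * indicator (B n) (Wprod V n \<omega>) \<partial>seq.S)
       \<le> ennreal ((1 / 2) ^ n)" .
  qed (auto intro!: summable_geometric)
  then show ?thesis by eventually_elim (auto elim!: eventually_mono simp: B_def not_less)
qed

lemma AE_norm_W_vec_ge:
  "AE \<omega> in law (outer x). \<forall>\<^sub>F n in sequentially. (norm (Wprod V n \<omega>))\<^sup>2 / (real n)\<^sup>2 \<le> (norm (Wprod V n \<omega> *v x))\<^sup>2"
proof -
  define B where "B n = {W :: complex^'k^'k. (norm (W *v x))\<^sup>2 < (norm W)\<^sup>2 / (real n)\<^sup>2}" for n
  have [measurable]: "(\<lambda>W :: complex^'k^'k. W *v x) \<in> borel_measurable borel" by measurable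
  have "AE \<omega> in law (outer x). \<forall>\<^sub>F n in sequentially. Wprod V n \<omega> \<notin> B n"
  proof (rule AE_eventually_not[OF psd_outer, where b="\<lambda>n. CARD('k) * (1 / (real n)\<^sup>2)"])
    show "B n \<in> sets borel" for n unfolding B_def by measurable
    show "summable (\<lambda>n. CARD('k) * (1 / (real n)\<^sup>2))"
      using inverse_power_summable[of 2, where 'a=real] by (intro summable_mult) (simp add: field_simps)
    fix n
    have total: "(\<integral>\<^sup>+\<omega>. ennreal ((norm (Wprod V n \<omega>))\<^sup>2) \<partial>seq.S) = ennreal (CARD('k))"
    proof -
      have "emeasure (law (mat 1)) UNIV = (\<integral>\<^sup>+\<omega>. ennreal ((norm (Wprod V n \<omega>))\<^sup>2) \<partial>seq.S)"
        using emeasure_law[OF psd_mat_1 cylinder_UNIV, of n] by (simp add: weight_mat_1)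
      moreover have "emeasure (law (mat 1)) UNIV = ennreal (CARD('k))"
        unfolding emeasure_law_eq_measure[OF psd_mat_1] measure_law_UNIV[OF psd_mat_1] by (simp add: trace_I)
      ultimately show ?thesis by simp
    qed
    have "(\<integral>\<^sup>+\<omega>. ennreal (weight (outer x) (Wprod V n \<omega>)) * indicator (B n) (Wprod V n \<omega>) \<partial>seq.S)
       \<le> (\<integral>\<^sup>+\<omega>. ennreal (1 / (real n)\<^sup>2) * ennreal ((norm (Wprod V n \<omega>))\<^sup>2) \<partial>seq.S)"
      by (intro nn_integral_mono) (auto simp: weight_outer B_def indicator_def intro!: ennreal_leI simp flip: ennreal_mult')
    also have "\<dots> = ennreal (1 / (real n)\<^sup>2) * (\<integral>\<^sup>+\<omega>. ennreal ((norm (Wprod V n \<omega>))\<^sup>2) \<partial>seq.S)"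
      by (rule nn_integral_cmult) measurable
    also have "\<dots> = ennreal (CARD('k) * (1 / (real n)\<^sup>2))"
      unfolding total by (simp add: mult.commute flip: ennreal_mult')
    finally show "(\<integral>\<^sup>+\<omega>. ennreal (weight (outer x) (Wprod V n \<omega>)) * indicator (B n) (Wprod V n \<omega>) \<partial>seq.S)
       \<le> ennreal (CARD('k) * (1 / (real n)\<^sup>2))" .
  qed auto
  then show ?thesis by eventually_elim (auto elim!: eventually_mono simp: B_def not_less)
qed

end

section \<open>Finite products of densities\<close>

text \<open>No sigma-finiteness of \<open>M\<close> is needed: only the part of \<open>M\<close> on which \<open>f\<close> does not vanish matters.\<close>

lemma PiM_density:
  fixes f :: "'a \<Rightarrow> ennreal"
  assumes I: "finite I" and f [measurable]: "f \<in> borel_measurable M" and fin: "(\<integral>\<^sup>+x. f x \<partial>M) < \<infinity>"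
  shows "PiM I (\<lambda>_. density M f) = density (PiM I (\<lambda>_. M)) (\<lambda>\<omega>. \<Prod>i\<in>I. f (\<omega> i))"
proof -
  define A where "A = {x \<in> space M. f x \<noteq> 0}"
  have A [measurable]: "A \<in> sets M" unfolding A_def by measurable
  define N where "N = density M (indicator A)"
  have sets_N [measurable_cong]: "sets N = sets M" by (simp add: N_def)
  have emeasure_N: "emeasure N X = emeasure M (X \<inter> A)" if [measurable]: "X \<in> sets M" for X
  proof -
    have "emeasure N X = (\<integral>\<^sup>+x. indicator A x * indicator X x \<partial>M)"
      unfolding N_def by (rule emeasure_density) measurable
    also have "\<dots> = (\<integral>\<^sup>+x. indicator (X \<inter> A) x \<partial>M)"
      by (intro nn_integral_cong) (simp split: split_indicator)
    also have "\<dots> = emeasure M (X \<inter> A)" by (intro nn_integral_indicator) measurable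
    finally show ?thesis .
  qed
  have "sigma_finite_measure N"
  proof
    \<comment> \<open>\<open>N\<close> has no mass where \<open>f\<close> vanishes, and
      \<open>f\<close> is at least \<open>1 / (j + 1)\<close> only on a set of finite measure, by
      Markov's inequality.\<close>
    define F where "F j = {x \<in> space M. f x = 0 \<or> 1 \<le> ennreal (Suc j) * f x}" for j :: nat
    have F [measurable]: "F j \<in> sets M" for j unfolding F_def by measurable
    have "(\<Union>j. F j) = space M"
    proof (intro equalityI subsetI)
      fix x assume x: "x \<in> space M"
      show "x \<in> (\<Union>j. F j)"
      proof (cases "f x = 0")
        case False
        have "\<exists>j::nat. 1 \<le> ennreal (Suc j) * f x"
        proof (cases "f x")
          case (real r)
          then have r: "0 < r" using False by (auto simp: less_le)
          obtain j :: nat where "1 / r \<le> real j" using real_arch_simple by blast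
          then have "1 \<le> real (Suc j) * r" using r by (simp add: field_simps)
          then have "1 \<le> ennreal (real (Suc j) * r)" by (simp del: of_nat_Suc)
          then show ?thesis using real r by (intro exI[of _ j]) (simp only: ennreal_mult)
        next
          case top
          have "ennreal (Suc 0) * f x = \<top>" by (simp add: top)
          then show ?thesis by (intro exI[of _ 0]) (simp only: top_greatest)
        qed
        then show ?thesis using x by (auto simp: F_def)
      qed (use x in \<open>auto simp: F_def\<close>)
    qed (auto simp: F_def)
    moreover have "emeasure N (F j) \<noteq> \<infinity>" for j
    proof -
      have "emeasure N (F j) = emeasure M (F j \<inter> A)" by (rule emeasure_N) measurable
      also have "F j \<inter> A \<subseteq> {x \<in> space M. 1 \<le> ennreal (Suc j) * f x} \<inter> space M"
      proof
        fix x assume "x \<in> F j \<inter> A"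
        then show "x \<in> {x \<in> space M. 1 \<le> ennreal (Suc j) * f x} \<inter> space M"
          by (auto simp: F_def A_def)
      qed
      then have "emeasure M (F j \<inter> A) \<le> emeasure M ({x \<in> space M. 1 \<le> ennreal (Suc j) * f x} \<inter> space M)"
        by (rule emeasure_mono) measurable
      also have "\<dots> \<le> ennreal (Suc j) * (\<integral>\<^sup>+x. f x * indicator (space M) x \<partial>M)"
      proof -
        have "{x \<in> space M. 1 \<le> ennreal (Suc j) * f x} \<inter> space M = {x \<in> space M. 1 \<le> ennreal (Suc j) * f x}" by auto
        then show ?thesis by (simp only:) (intro nn_integral_Markov_inequality; measurable)
      qed
      also have "(\<integral>\<^sup>+x. f x * indicator (space M) x \<partial>M) = (\<integral>\<^sup>+x. f x \<partial>M)" by (intro nn_integral_cong) simp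
      also have "ennreal (Suc j) * (\<integral>\<^sup>+x. f x \<partial>M) < \<infinity>" using fin by (simp add: ennreal_mult_less_top)
      finally show ?thesis by simp
    qed
    ultimately show "\<exists>A. countable A \<and> A \<subseteq> sets N \<and> \<Union>A = space N \<and> (\<forall>a\<in>A. emeasure N a \<noteq> \<infinity>)"
      by (intro exI[of _ "range F"]) (auto simp: sets_N N_def)
  qed
  then interpret N: product_sigma_finite "\<lambda>_. N" by (intro product_sigma_finite.intro)
  have "finite_measure (density M f)"
    using fin by (intro finite_measureI) (simp add: emeasure_density cong: nn_integral_cong)
  then interpret D: product_sigma_finite "\<lambda>_. density M f"
    by (intro product_sigma_finite.intro finite_measure.axioms(1))
  let ?\<chi> = "\<lambda>\<omega>. \<Prod>i\<in>I. indicator A (\<omega> i) :: ennreal"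
  have sets_eq: "sets (PiM I (\<lambda>_. N)) = sets (PiM I (\<lambda>_. M))" by (intro sets_PiM_cong) (auto simp: sets_N)
  \<comment> \<open>The power of the sigma-finite \<open>N\<close> is characterised by its values on
    boxes; for the power of \<open>M\<close> these come from \<open>emeasure_PiM_box\<close>, which
    covers arbitrary measures.\<close>
  have N_eq: "density (PiM I (\<lambda>_. M)) ?\<chi> = PiM I (\<lambda>_. N)"
  proof (rule N.PiM_eqI[OF I])
    fix X assume "\<And>i. i \<in> I \<Longrightarrow> X i \<in> sets N"
    then have X: "\<And>i. i \<in> I \<Longrightarrow> X i \<in> sets M" by (simp add: sets_N)
    then have [measurable]: "PiE I X \<in> sets (PiM I (\<lambda>_. M))" using I by (intro sets_PiM_I_finite) auto
    have XA: "\<And>i. i \<in> I \<Longrightarrow> X i \<inter> A \<in> sets M" using X by auto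
    have [measurable]: "PiE I (\<lambda>i. X i \<inter> A) \<in> sets (PiM I (\<lambda>_. M))" using I XA by (intro sets_PiM_I_finite) auto
    have "emeasure (density (PiM I (\<lambda>_. M)) ?\<chi>) (PiE I X) = (\<integral>\<^sup>+\<omega>. ?\<chi> \<omega> * indicator (PiE I X) \<omega> \<partial>PiM I (\<lambda>_. M))"
      by (rule emeasure_density) measurable
    also have "\<dots> = (\<integral>\<^sup>+\<omega>. indicator (PiE I (\<lambda>i. X i \<inter> A)) \<omega> \<partial>PiM I (\<lambda>_. M))"
    proof (rule nn_integral_cong)
      fix \<omega>
      show "?\<chi> \<omega> * indicator (PiE I X) \<omega> = indicator (PiE I (\<lambda>i. X i \<inter> A)) \<omega>"
      proof (cases "\<forall>i\<in>I. \<omega> i \<in> A")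
        case False
        then have "?\<chi> \<omega> = 0" using I by (intro prod_zero) (auto simp: indicator_def)
        then show ?thesis using False by (auto simp: PiE_iff indicator_def)
      qed (auto simp: PiE_iff indicator_def)
    qed
    also have "\<dots> = emeasure (PiM I (\<lambda>_. M)) (PiE I (\<lambda>i. X i \<inter> A))"
      by (intro nn_integral_indicator) measurable
    also have "\<dots> = (\<Prod>i\<in>I. emeasure N (X i))"
      using X XA by (simp add: emeasure_PiM_box[OF I] emeasure_N)
    finally show "emeasure (density (PiM I (\<lambda>_. M)) ?\<chi>) (PiE I X) = (\<Prod>i\<in>I. emeasure N (X i))" .
  qed (simp add: sets_eq)
  have "density (PiM I (\<lambda>_. N)) (\<lambda>\<omega>. \<Prod>i\<in>I. f (\<omega> i)) = PiM I (\<lambda>_. density M f)"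
  proof (rule D.PiM_eqI[OF I])
    show "sets (density (PiM I (\<lambda>_. N)) (\<lambda>\<omega>. \<Prod>i\<in>I. f (\<omega> i))) = sets (PiM I (\<lambda>_. density M f))"
      unfolding sets_density sets_eq by (intro sets_PiM_cong) auto
    fix X assume "\<And>i. i \<in> I \<Longrightarrow> X i \<in> sets (density M f)"
    then have X: "\<And>i. i \<in> I \<Longrightarrow> X i \<in> sets M" by simp
    then have [measurable]: "PiE I X \<in> sets (PiM I (\<lambda>_. N))" unfolding sets_eq using I by (intro sets_PiM_I_finite) auto
    have "emeasure (density (PiM I (\<lambda>_. N)) (\<lambda>\<omega>. \<Prod>i\<in>I. f (\<omega> i))) (PiE I X)
      = (\<integral>\<^sup>+\<omega>. (\<Prod>i\<in>I. f (\<omega> i)) * indicator (PiE I X) \<omega> \<partial>PiM I (\<lambda>_. N))"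
      by (rule emeasure_density) measurable
    also have "\<dots> = (\<integral>\<^sup>+\<omega>. (\<Prod>i\<in>I. f (\<omega> i) * indicator (X i) (\<omega> i)) \<partial>PiM I (\<lambda>_. N))"
    proof (rule nn_integral_cong)
      fix \<omega> assume "\<omega> \<in> space (PiM I (\<lambda>_. N))"
      then have "\<omega> \<in> extensional I" by (simp add: space_PiM PiE_iff)
      then have "indicator (PiE I X) \<omega> = (\<Prod>i\<in>I. indicator (X i) (\<omega> i) :: ennreal)"
        using I by (cases "\<omega> \<in> PiE I X") (auto simp: PiE_iff indicator_def intro!: prod.neutral[symmetric] prod_zero[symmetric])
      then show "(\<Prod>i\<in>I. f (\<omega> i)) * indicator (PiE I X) \<omega> = (\<Prod>i\<in>I. f (\<omega> i) * indicator (X i) (\<omega> i))"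
        by (simp add: prod.distrib)
    qed
    also have "\<dots> = (\<Prod>i\<in>I. \<integral>\<^sup>+x. f x * indicator (X i) x \<partial>N)"
    proof (rule N.product_nn_integral_prod[OF I])
      fix i assume "i \<in> I"
      then have [measurable]: "X i \<in> sets M" by (rule X)
      show "(\<lambda>x. f x * indicator (X i) x) \<in> borel_measurable N" by measurable
    qed
    also have "\<dots> = (\<Prod>i\<in>I. emeasure (density M f) (X i))"
    proof (rule prod.cong[OF refl])
      fix i assume "i \<in> I"
      then have [measurable]: "X i \<in> sets M" by (rule X)
      have "(\<integral>\<^sup>+x. f x * indicator (X i) x \<partial>N) = (\<integral>\<^sup>+x. indicator A x * (f x * indicator (X i) x) \<partial>M)"
        unfolding N_def by (rule nn_integral_density) measurable
      also have "\<dots> = (\<integral>\<^sup>+x. f x * indicator (X i) x \<partial>M)"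
        by (intro nn_integral_cong) (auto simp: A_def indicator_def)
      also have "\<dots> = emeasure (density M f) (X i)" by (rule emeasure_density[symmetric]) measurable
      finally show "(\<integral>\<^sup>+x. f x * indicator (X i) x \<partial>N) = emeasure (density M f) (X i)" .
    qed
    finally show "emeasure (density (PiM I (\<lambda>_. N)) (\<lambda>\<omega>. \<Prod>i\<in>I. f (\<omega> i))) (PiE I X)
      = (\<Prod>i\<in>I. emeasure (density M f) (X i))" .
  qed
  moreover have "density (PiM I (\<lambda>_. N)) (\<lambda>\<omega>. \<Prod>i\<in>I. f (\<omega> i))
     = density (PiM I (\<lambda>_. M)) (\<lambda>\<omega>. ?\<chi> \<omega> * (\<Prod>i\<in>I. f (\<omega> i)))"
    unfolding N_eq[symmetric] by (rule density_density_eq) measurable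
  \<comment> \<open>\<open>?\<chi>\<close> may be dropped because the product of the
    \<open>f (\<omega> i)\<close> vanishes wherever \<open>?\<chi>\<close> does.\<close>
  moreover have "\<dots> = density (PiM I (\<lambda>_. M)) (\<lambda>\<omega>. \<Prod>i\<in>I. f (\<omega> i))"
  proof (rule density_cong)
    show "AE \<omega> in PiM I (\<lambda>_. M). ?\<chi> \<omega> * (\<Prod>i\<in>I. f (\<omega> i)) = (\<Prod>i\<in>I. f (\<omega> i))"
    proof (rule AE_I2)
      fix \<omega> assume \<omega>: "\<omega> \<in> space (PiM I (\<lambda>_. M))"
      have "indicator A (\<omega> i) * f (\<omega> i) = f (\<omega> i)" if "i \<in> I" for i
        using \<omega> that by (auto simp: A_def space_PiM PiE_iff indicator_def)
      then show "?\<chi> \<omega> * (\<Prod>i\<in>I. f (\<omega> i)) = (\<Prod>i\<in>I. f (\<omega> i))" by (simp flip: prod.distrib)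
    qed
  qed measurable
  ultimately show ?thesis by simp
qed

section \<open>Projective space\<close>

lemma line_proj_class: "x \<noteq> 0 \<Longrightarrow> line (proj_class x) = vec.span {x :: complex^'k}"
proof -
  assume "x \<noteq> 0"
  then have "vec.dim (vec.span {x}) = 1" by (simp add: vec.dim_span vec.dim_eq_card_independent)
  then show ?thesis unfolding proj_class_def by (subst Abs_cproj_inverse) (auto simp: vec.subspace_span)
qed

lemma line_eq_span:
  obtains x :: "complex^'k" where "x \<noteq> 0" "line xh = vec.span {x}"
proof -
  have E: "vec.subspace (line xh)" "vec.dim (line xh) = 1" using line[of xh] by auto
  obtain B where B: "B \<subseteq> line xh" "vec.independent B" "line xh \<subseteq> vec.span B" "card B = 1"
    using vec.basis_exists[of "line xh"] E(2) by auto
  then obtain x where x: "B = {x}" using card_1_singletonE by blast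
  have "x \<noteq> 0" using B(2) x vec.dependent_zero by blast
  moreover have "line xh = vec.span {x}"
    using B x vec.span_minimal[OF B(1) E(1)] by auto
  ultimately show thesis by (rule that)
qed

lemma unit_rep: "unit_rep xh \<in> line xh" "norm (unit_rep xh) = 1"
proof -
  obtain x where x: "x \<noteq> 0" "line xh = vec.span {x}" by (rule line_eq_span)
  have "of_real (1 / norm x) *s x \<in> line xh" unfolding x(2) by (intro vec.span_scale vec.span_base) simp
  moreover have "norm (of_real (1 / norm x) *s x) = 1" using x by (simp add: norm_cmult_vec norm_divide)
  ultimately have "\<exists>x. x \<in> line xh \<and> norm x = 1" by blast
  from someI_ex[OF this] show "unit_rep xh \<in> line xh" "norm (unit_rep xh) = 1" by (auto simp: unit_rep_def)
qed

lemma line_multiple_unit_rep: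
  assumes "x \<in> line xh" shows "\<exists>a. x = a *s unit_rep xh"
proof -
  obtain z where z: "z \<noteq> 0" "line xh = vec.span {z}" by (rule line_eq_span)
  obtain b where b: "unit_rep xh = b *s z" using unit_rep(1)[of xh] unfolding z(2) vec.span_singleton by auto
  obtain a where a: "x = a *s z" using assms unfolding z(2) vec.span_singleton by auto
  have "b \<noteq> 0" using unit_rep(2)[of xh] b by auto
  then have "x = (a / b) *s unit_rep xh" unfolding a b by simp
  then show ?thesis ..
qed

text \<open>\<open>unit_rep\<close> is an arbitrary choice and need not depend measurably on the
  line, but \<open>f\<close> does not see phases: its value at
  \<open>unit_rep (proj_class x)\<close> is \<open>f x\<close> divided by the squared norm of
  \<open>x\<close>, which is continuous off 0.\<close>

lemma continuous_on_cproj: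
  fixes f :: "complex^'k \<Rightarrow> 'b::real_normed_vector"
  assumes f: "continuous_on UNIV f" and hom: "\<And>a x. f (a *s x) = (cmod a)\<^sup>2 *\<^sub>R f x"
  shows "continuous_on UNIV (\<lambda>xh. f (unit_rep xh))"
proof (unfold continuous_on_open_vimage[OF open_UNIV], intro allI impI)
  fix U :: "'b set" assume U: "open U"
  have eq: "f (unit_rep (proj_class x)) = (1 / (norm x)\<^sup>2) *\<^sub>R f x" if x: "x \<noteq> 0" for x
  proof -
    obtain a where a: "unit_rep (proj_class x) = a *s x"
      using unit_rep(1)[of "proj_class x"] unfolding line_proj_class[OF x] vec.span_singleton by auto
    have "cmod a * norm x = 1" using unit_rep(2)[of "proj_class x"] unfolding a norm_cmult_vec .
    then have "cmod a = 1 / norm x" using x by (simp add: field_simps)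
    then show ?thesis unfolding a hom by (simp add: power_divide)
  qed
  have "{x :: complex^'k. x \<noteq> 0 \<and> proj_class x \<in> (\<lambda>xh. f (unit_rep xh)) -` U \<inter> UNIV}
     = - {0} \<inter> (\<lambda>x. (1 / (norm x)\<^sup>2) *\<^sub>R f x) -` U"
    using eq by auto
  moreover have "open (- {0} \<inter> (\<lambda>x. (1 / (norm x)\<^sup>2) *\<^sub>R f x) -` U)"
  proof (rule continuous_open_preimage[OF _ _ U])
    show "continuous_on (- {0}) (\<lambda>x. (1 / (norm x)\<^sup>2) *\<^sub>R f x)"
      by (intro continuous_intros continuous_on_subset[OF f]) auto
  qed auto
  ultimately show "open ((\<lambda>xh. f (unit_rep xh)) -` U \<inter> UNIV)"
    by (simp add: open_cproj_def)
qed

lemma outer_cmult: "outer (a *s x) = (cmod a)\<^sup>2 *\<^sub>R outer x"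
proof -
  have "a * z * (cnj a * w) = of_real ((cmod a)\<^sup>2) * (z * w)" for z w
    unfolding complex_norm_square by (simp add: mult_ac)
  then show ?thesis by (simp add: outer_def vec_eq_iff scaleR_conv_of_real[where 'a=complex])
qed

lemma measurable_outer_unit_rep [measurable]: "(\<lambda>xh. outer (unit_rep xh)) \<in> borel_measurable borel"
  by (intro borel_measurable_continuous_onI continuous_on_cproj continuous_outer outer_cmult)

section \<open>Uniqueness of the trajectory measure\<close>

lemma sets_pair_cylinder:
  "sets ((borel :: 'b::topological_space measure) \<Otimes>\<^sub>M PiM UNIV (\<lambda>_. borel))
    = sigma_sets UNIV {S \<times> E | S E n. S \<in> sets borel \<and> cylinder n (E :: (nat \<Rightarrow> 'a::topological_space) set)}"
  (is "sets ?P = sigma_sets UNIV ?G")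
proof
  have "?G \<subseteq> sets ?P" using cylinder_sets by blast
  then show "sigma_sets UNIV ?G \<subseteq> sets ?P"
    using sets.sigma_sets_subset[of ?G ?P] by (simp add: space_pair_measure space_PiM)
  have "S \<times> E \<in> sigma_sets UNIV ?G" if S: "S \<in> sets borel" and E: "E \<in> sets (PiM UNIV (\<lambda>_. borel))" for S E
    using E
  proof (induction E rule: cylinder_induct)
    case (cylinder n E)
    then show ?case using S by (intro sigma_sets.Basic) blast
  next
    case (compl E)
    interpret sigma_algebra UNIV "sigma_sets UNIV ?G" by (rule sigma_algebra_sigma_sets) simp
    have "S \<times> UNIV \<in> sigma_sets UNIV ?G"
      using S cylinder_UNIV by (intro sigma_sets.Basic) blast
    moreover have "S \<times> (UNIV - E) = S \<times> UNIV - S \<times> E" by auto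
    ultimately show ?case using compl Diff by simp
  next
    case (union E)
    then have "(\<Union>i. S \<times> E i) \<in> sigma_sets UNIV ?G" by (intro sigma_sets.Union) auto
    moreover have "S \<times> (\<Union>i. E i) = (\<Union>i. S \<times> E i)" by auto
    ultimately show ?case by simp
  qed
  then have "{a \<times> b | a b. a \<in> sets borel \<and> b \<in> sets (PiM UNIV (\<lambda>_. borel))} \<subseteq> sigma_sets UNIV ?G" by blast
  from sigma_sets_mono[OF this] show "sets ?P \<subseteq> sigma_sets UNIV ?G"
    by (simp add: sets_pair_measure space_PiM)
qed

text \<open>Rectangles over cylinders form a generator closed under intersections. The uniqueness
  obtained here is what makes the definite description in \<open>traj_measure\<close> denote a
  measure.\<close>

lemma measure_eqI_pair_cylinder:
  fixes P Q :: "('b::topological_space \<times> (nat \<Rightarrow> 'a::topological_space)) measure"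
  assumes P: "prob_space P" "sets P = sets (borel \<Otimes>\<^sub>M PiM UNIV (\<lambda>_. borel))"
    and Q: "sets Q = sets (borel \<Otimes>\<^sub>M PiM UNIV (\<lambda>_. borel))"
    and eq: "\<And>S n E. S \<in> sets borel \<Longrightarrow> cylinder n E \<Longrightarrow> emeasure P (S \<times> E) = emeasure Q (S \<times> E)"
  shows "P = Q"
proof (rule measure_eqI_generator_eq)
  let ?G = "{S \<times> E | S E n. S \<in> sets (borel :: 'b measure) \<and> cylinder n (E :: (nat \<Rightarrow> 'a) set)}"
  show "Int_stable ?G"
  proof (rule Int_stableI, clarify)
    fix S T :: "'b set" and E F :: "(nat \<Rightarrow> 'a) set" and n p
    assume *: "S \<in> sets borel" "T \<in> sets borel" "cylinder n E" "cylinder p F"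
    have "cylinder (max n p) (E \<inter> F)"
      using * by (intro cylinder_Int) (auto intro: cylinder_mono)
    moreover have "S \<times> E \<inter> T \<times> F = (S \<inter> T) \<times> (E \<inter> F)" by auto
    ultimately show "\<exists>S' E' n'. S \<times> E \<inter> T \<times> F = S' \<times> E' \<and> S' \<in> sets borel \<and> cylinder n' E'"
      using * by (intro exI[of _ "S \<inter> T"] exI[of _ "E \<inter> F"] exI[of _ "max n p"]) auto
  qed
  show "sets P = sigma_sets UNIV ?G" "sets Q = sigma_sets UNIV ?G" by (simp_all add: P Q sets_pair_cylinder)
  show "range (\<lambda>_::nat. UNIV) \<subseteq> ?G"
    using cylinder_UNIV[of 0] by (auto intro!: exI[of _ UNIV] exI[of _ 0])
  show "emeasure P X = emeasure Q X" if "X \<in> ?G" for X using that eq by blast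
  show "emeasure P UNIV \<noteq> \<infinity>"
    using prob_space.emeasure_le_1[OF P(1), of UNIV] by (auto simp: top_unique)
qed auto

section \<open>Growth of exterior powers\<close>

lemma opnorm_scaleR: "opnorm (c *\<^sub>R A) = \<bar>c\<bar> * opnorm (A :: complex^'k^'k)"
proof -
  have "(\<lambda>x. (c *\<^sub>R A) *v x) = (\<lambda>x. c *\<^sub>R (A *v x))"
    by (simp add: bounded_bilinear.scaleR_left[OF bounded_bilinear_matrix_vector_mult])
  then show ?thesis unfolding opnorm_def by (simp only: onorm_scaleR[OF matrix_vector_mul_bounded_linear])
qed

lemma ext_map_scaleR: "ext_map p (c *\<^sub>R W) t = (\<lambda>i. of_real (c ^ p) * ext_map p W t i)"
  by (rule ext) (simp add: ext_map_def scaleR_conv_of_real[where 'a=complex] prod.distrib sum_distrib_left mult_ac)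

text \<open>The reverse inequality is the direct one for the factor \<open>1 / c\<close>. The case
  \<open>c = 0\<close>, \<open>p = 0\<close> is apart: \<open>0 ^ 0 = 1\<close>, and the zeroth
  exterior power does not depend on the matrix.\<close>

lemma ext_opnorm_scaleR:
  assumes "c \<ge> 0"
  shows "ext_opnorm p (c *\<^sub>R A) = c ^ p * ext_opnorm p (A :: complex^'k^'k)"
proof (rule antisym)
  have le: "ext_opnorm p (c *\<^sub>R A) \<le> c ^ p * ext_opnorm p A" if c: "c \<ge> 0" for c and A :: "complex^'k^'k"
    unfolding ext_opnorm_def[of p "c *\<^sub>R A"]
  proof (rule cSUP_least[OF ext_unit_ball_ne])
    fix t :: "(nat \<Rightarrow> 'k) \<Rightarrow> complex" assume "t \<in> {t \<in> ext_space p. ext_norm p t \<le> 1}"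
    then show "ext_norm p (ext_map p (c *\<^sub>R A) t) \<le> c ^ p * ext_opnorm p A"
      unfolding ext_map_scaleR ext_norm_cmult
      using c by (auto simp: norm_power intro!: mult_left_mono ext_norm_map_le)
  qed
  show "ext_opnorm p (c *\<^sub>R A) \<le> c ^ p * ext_opnorm p A" by (rule le[OF assms])
  show "c ^ p * ext_opnorm p A \<le> ext_opnorm p (c *\<^sub>R A)"
  proof (cases "c = 0 \<and> p > 0")
    case False
    show ?thesis
    proof (cases "c = 0")
      case True
      with False have p: "p = 0" by simp
      have "ext_map 0 (0 *\<^sub>R A) t = ext_map 0 A t" for t by (rule ext) (simp add: ext_map_def)
      then show ?thesis unfolding True p ext_opnorm_def by simp
    next
      case False
      with assms have c: "c > 0" by simp
      have "ext_opnorm p ((1 / c) *\<^sub>R (c *\<^sub>R A)) \<le> (1 / c) ^ p * ext_opnorm p (c *\<^sub>R A)"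
        using c by (intro le) auto
      then show ?thesis using c by (simp add: field_simps power_divide)
    qed
  qed (simp add: zero_power)
qed

text \<open>Only an inequality, as the exterior power is zero for \<open>p > CARD('k)\<close>; it
  starts the induction that bounds the products by \<open>B ^ n\<close>.\<close>

lemma ext_opnorm_mat_1_le: "ext_opnorm p (mat 1 :: complex^'k^'k) \<le> 1"
  unfolding ext_opnorm_def
proof (rule cSUP_least[OF ext_unit_ball_ne])
  fix t :: "(nat \<Rightarrow> 'k) \<Rightarrow> complex" assume t: "t \<in> {t \<in> ext_space p. ext_norm p t \<le> 1}"
  have "ext_map p (mat 1) t i = t i" if i: "i \<in> tuples p" for i
  proof -
    have "(\<Prod>a<p. (mat 1 :: complex^'k^'k) $ i a $ j a) * t j = (if j = i then t i else 0)" if j: "j \<in> tuples p" for j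
    proof (cases "j = i")
      case False
      have "\<exists>a<p. j a \<noteq> i a"
      proof (rule ccontr)
        assume "\<not> ?thesis"
        then have "j = i" using i j unfolding tuples_def by (intro PiE_ext[of j "{..<p}" _ i]) auto
        then show False using False by simp
      qed
      then obtain a where "a < p" "j a \<noteq> i a" by blast
      then have "(\<Prod>a<p. (mat 1 :: complex^'k^'k) $ i a $ j a) = 0"
        by (intro prod_zero bexI[of _ a]) (auto simp: mat_def)
      then show ?thesis using False by simp
    qed (simp add: mat_def)
    then show ?thesis using i by (simp add: ext_map_def)
  qed
  then have "ext_norm p (ext_map p (mat 1) t) = ext_norm p t"
    unfolding ext_norm_eq_L2 by (intro arg_cong2[where f="(/)"] L2_set_cong) auto
  then show "ext_norm p (ext_map p (mat 1) t) \<le> 1" using t by simp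
qed

lemma ext_const_nonneg: "0 \<le> ext_const TYPE('k::finite) p"
  by (simp add: ext_const_def)

text \<open>The first exterior power is the space itself; a comparison up to a constant is all that
  exponents require.\<close>

lemma opnorm_le_ext_opnorm_1: "opnorm A \<le> ext_opnorm 1 (A :: complex^'k^'k)"
  and ext_opnorm_1_le: "ext_opnorm 1 A \<le> ext_const TYPE('k) 1 * opnorm A"
proof -
  obtain s where s: "s 0 = opnorm A" "\<And>p. p \<le> CARD('k) \<Longrightarrow> (\<Prod>i<p. s i) \<le> ext_opnorm p A"
    "\<And>p. p \<le> CARD('k) \<Longrightarrow> ext_bound p A \<le> ext_const TYPE('k) p * (\<Prod>i<p. s i)"
    by (rule ext_opnorm_singular_values[of A]) blast
  have "1 \<le> CARD('k)" by (simp add: Suc_leI)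
  from s(2,3)[OF this] show "opnorm A \<le> ext_opnorm 1 A" "ext_opnorm 1 A \<le> ext_const TYPE('k) 1 * opnorm A"
    using ext_opnorm_le_bound[of 1 A] by (auto simp: s(1))
qed

lemma ext_opnorm_le_opnorm_power:
  assumes "p \<le> CARD('k)"
  shows "ext_opnorm p (A :: complex^'k^'k) \<le> ext_const TYPE('k) p * opnorm A ^ p"
proof -
  obtain s where s: "\<And>i. 0 \<le> s i" "\<And>i j. i \<le> j \<Longrightarrow> j < CARD('k) \<Longrightarrow> s j \<le> s i" "s 0 = opnorm A"
    "\<And>p. p \<le> CARD('k) \<Longrightarrow> ext_bound p A \<le> ext_const TYPE('k) p * (\<Prod>i<p. s i)"
    by (rule ext_opnorm_singular_values[of A]) blast
  have "(\<Prod>i<p. s i) \<le> (\<Prod>i<p. s 0)" using s(1,2) assms by (intro prod_mono) auto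
  then have "ext_const TYPE('k) p * (\<Prod>i<p. s i) \<le> ext_const TYPE('k) p * opnorm A ^ p"
    by (intro mult_left_mono ext_const_nonneg) (simp add: s(3))
  then show ?thesis using s(4)[OF assms] ext_opnorm_le_bound[of p A] by linarith
qed

text \<open>The additional singular value is at most the largest one. For the limits this means that
  once they reach \<open>-\<infinity>\<close> they stay there as \<open>p\<close> grows.\<close>

lemma ext_opnorm_Suc_le:
  assumes "Suc p \<le> CARD('k)"
  shows "ext_opnorm (Suc p) (A :: complex^'k^'k) \<le> ext_const TYPE('k) (Suc p) * (ext_opnorm p A * opnorm A)"
proof -
  obtain s where s: "\<And>i. 0 \<le> s i" "\<And>i j. i \<le> j \<Longrightarrow> j < CARD('k) \<Longrightarrow> s j \<le> s i" "s 0 = opnorm A"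
    "\<And>p. p \<le> CARD('k) \<Longrightarrow> (\<Prod>i<p. s i) \<le> ext_opnorm p A"
    "\<And>p. p \<le> CARD('k) \<Longrightarrow> ext_bound p A \<le> ext_const TYPE('k) p * (\<Prod>i<p. s i)"
    by (rule ext_opnorm_singular_values[of A]) blast
  have "(\<Prod>i<Suc p. s i) \<le> ext_opnorm p A * opnorm A"
    using s(4)[of p] s(2)[of 0 p] assms unfolding s(3)[symmetric]
    by (simp, intro mult_mono) (auto simp: s(1))
  then have "ext_const TYPE('k) (Suc p) * (\<Prod>i<Suc p. s i) \<le> ext_const TYPE('k) (Suc p) * (ext_opnorm p A * opnorm A)"
    by (intro mult_left_mono ext_const_nonneg)
  then show ?thesis using s(5)[OF assms] ext_opnorm_le_bound[of "Suc p" A] by linarith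
qed

text \<open>Partial products of a decreasing sequence are log-concave; in the limit this orders the
  exponents.\<close>

lemma ext_opnorm_log_concave:
  assumes p: "Suc (Suc p) \<le> CARD('k)"
  shows "ext_opnorm (Suc (Suc p)) A * ext_opnorm p A
    \<le> ext_const TYPE('k) (Suc (Suc p)) * ext_const TYPE('k) p * (ext_opnorm (Suc p) (A :: complex^'k^'k))\<^sup>2"
proof -
  obtain s where s: "\<And>i. 0 \<le> s i" "\<And>i j. i \<le> j \<Longrightarrow> j < CARD('k) \<Longrightarrow> s j \<le> s i"
    "\<And>p. p \<le> CARD('k) \<Longrightarrow> (\<Prod>i<p. s i) \<le> ext_opnorm p A"
    "\<And>p. p \<le> CARD('k) \<Longrightarrow> ext_bound p A \<le> ext_const TYPE('k) p * (\<Prod>i<p. s i)"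
    by (rule ext_opnorm_singular_values[of A]) blast
  have up: "ext_opnorm q A \<le> ext_const TYPE('k) q * (\<Prod>i<q. s i)" if "q \<le> CARD('k)" for q
    using s(4)[OF that] ext_opnorm_le_bound[of q A] by linarith
  have "ext_opnorm (Suc (Suc p)) A * ext_opnorm p A
     \<le> (ext_const TYPE('k) (Suc (Suc p)) * (\<Prod>i<Suc (Suc p). s i)) * (ext_const TYPE('k) p * (\<Prod>i<p. s i))"
    using p by (intro mult_mono up) (auto intro!: mult_nonneg_nonneg ext_const_nonneg prod_nonneg s(1))
  also have "\<dots> = ext_const TYPE('k) (Suc (Suc p)) * ext_const TYPE('k) p * ((\<Prod>i<Suc (Suc p). s i) * (\<Prod>i<p. s i))"
    by (simp only: mult_ac)
  also have "\<dots> \<le> ext_const TYPE('k) (Suc (Suc p)) * ext_const TYPE('k) p * (ext_opnorm (Suc p) A)\<^sup>2"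
  proof (rule mult_left_mono)
    let ?q = "\<Prod>i<p. s i"
    have "(\<Prod>i<Suc (Suc p). s i) * ?q = (?q * s p) * (?q * s (Suc p))" by (simp add: mult_ac)
    also have "\<dots> \<le> (?q * s p) * (?q * s p)"
      using s(2)[of p "Suc p"] p by (intro mult_left_mono) (auto intro!: mult_nonneg_nonneg prod_nonneg s(1))
    also have "\<dots> = (\<Prod>i<Suc p. s i)\<^sup>2" by (simp add: power2_eq_square)
    also have "\<dots> \<le> (ext_opnorm (Suc p) A)\<^sup>2"
      using p by (intro power_mono s(3) prod_nonneg) (auto simp: s(1))
    finally show "(\<Prod>i<Suc (Suc p). s i) * ?q \<le> (ext_opnorm (Suc p) A)\<^sup>2" .
  qed (auto intro!: mult_nonneg_nonneg ext_const_nonneg)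
  finally show ?thesis .
qed

section \<open>Limits of logarithms\<close>

lemma elog_tendsto_real:
  assumes "(\<lambda>n. elog (x n) / ereal (real n)) \<longlonglongrightarrow> ereal r" and "\<And>n. 0 \<le> x n"
  shows "\<forall>\<^sub>F n in sequentially. 0 < x n" "(\<lambda>n. ln (x n) / real n) \<longlonglongrightarrow> r"
proof -
  have "\<forall>\<^sub>F n in sequentially. ereal (r - 1) < elog (x n) / ereal (real n)"
    using assms(1) by (rule order_tendstoD) simp
  with eventually_gt_at_top[of 0] show pos: "\<forall>\<^sub>F n in sequentially. 0 < x n"
  proof eventually_elim
    case (elim n)
    have "x n \<noteq> 0"
    proof
      assume "x n = 0"
      then have "elog (x n) / ereal (real n) = -\<infinity>" using elim(1) by (simp add: elog_def)
      then show False using elim(2) by simp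
    qed
    then show ?case using assms(2)[of n] by simp
  qed
  have "\<forall>\<^sub>F n in sequentially. elog (x n) / ereal (real n) = ereal (ln (x n) / real n)"
    using pos eventually_gt_at_top[of 0] by eventually_elim (simp add: elog_def)
  then have "(\<lambda>n. ereal (ln (x n) / real n)) \<longlonglongrightarrow> ereal r"
    by (rule Lim_transform_eventually[OF assms(1)])
  then show "(\<lambda>n. ln (x n) / real n) \<longlonglongrightarrow> r" by simp
qed

lemma elog_tendsto_MInf:
  assumes "(\<lambda>n. elog (x n) / ereal (real n)) \<longlonglongrightarrow> -\<infinity>" and pos: "\<forall>\<^sub>F n in sequentially. 0 < x n"
  shows "\<forall>\<^sub>F n in sequentially. ln (x n) / real n < b"
proof -
  have "\<forall>\<^sub>F n in sequentially. elog (x n) / ereal (real n) < ereal b"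
    using assms(1) by (rule order_tendstoD) simp
  with pos eventually_gt_at_top[of 0] show ?thesis
    by eventually_elim (simp add: elog_def)
qed

text \<open>The exponents are the increments of the limits \<open>s p\<close> for the exterior powers, with \<open>-\<infinity>\<close> from the
  first \<open>p\<close> with \<open>s p = -\<infinity>\<close> on.\<close>

lemma exponents_of_limits:
  fixes W :: "nat \<Rightarrow> complex^'k^'k" and s :: "nat \<Rightarrow> ereal"
  assumes lim: "\<And>p. p \<in> {1..CARD('k)} \<Longrightarrow> (\<lambda>n. elog (ext_opnorm p (W n)) / ereal (real n)) \<longlonglongrightarrow> s p"
    and s: "\<And>p. s p < \<infinity>" and B: "\<And>n. opnorm (W n) \<le> B ^ n" "B \<ge> 1"
  obtains \<gamma> where "\<And>p. p \<in> {1..CARD('k)} \<Longrightarrow> (\<Sum>j=1..p. \<gamma> j) = s p"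
    "\<And>i j. 1 \<le> i \<Longrightarrow> i \<le> j \<Longrightarrow> j \<le> CARD('k) \<Longrightarrow> \<gamma> j \<le> \<gamma> i" "\<gamma> 1 = s 1"
    "2 \<le> CARD('k) \<Longrightarrow> s 1 \<noteq> -\<infinity> \<Longrightarrow> \<gamma> 2 = s 2 - s 1"
proof -
  \<comment> \<open>The first exponent is set apart, since \<open>s 0\<close> is not the limit of
    anything.\<close>
  define \<gamma> where "\<gamma> j = (if s j = -\<infinity> then -\<infinity> else if j \<le> 1 then s j else s j - s (j - 1))" for j
  define x where "x p n = ext_opnorm p (W n)" for p n
  have x0: "0 \<le> x p n" for p n by (simp add: x_def)
  have lim': "(\<lambda>n. elog (x p n) / ereal (real n)) \<longlonglongrightarrow> s p" if "p \<in> {1..CARD('k)}" for p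
    using lim[OF that] by (simp add: x_def)
  have real_s: "\<exists>r. s p = ereal r" if "s p \<noteq> -\<infinity>" for p
    using s[of p] that by (cases "s p") auto
  \<comment> \<open>Finiteness passes from \<open>p + 1\<close> down to \<open>p\<close>: the norm
    of the higher power is at most that of the lower one times a constant and
    \<open>B ^ n\<close>.\<close>
  have pred: "s p \<noteq> -\<infinity>" if p: "1 \<le> p" "Suc p \<le> CARD('k)" and sp: "s (Suc p) \<noteq> -\<infinity>" for p
  proof
    assume inf: "s p = -\<infinity>"
    obtain r where r: "s (Suc p) = ereal r" using real_s[OF sp] by blast
    let ?K = "ext_const TYPE('k) (Suc p) + 1"
    have K: "?K \<ge> 1" using ext_const_nonneg[where 'k='k, of "Suc p"] by simp
    have "(\<lambda>n. elog (x (Suc p) n) / ereal (real n)) \<longlonglongrightarrow> ereal r" using lim'[of "Suc p"] p r by auto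
    note L = elog_tendsto_real[OF this x0]
    have le: "x (Suc p) n \<le> ?K * (x p n * B ^ n)" for n
    proof -
      have "x (Suc p) n \<le> ext_const TYPE('k) (Suc p) * (x p n * opnorm (W n))"
        unfolding x_def by (rule ext_opnorm_Suc_le[OF p(2)])
      also have "\<dots> \<le> ?K * (x p n * B ^ n)"
        using x0[of p n] B(1)[of n] ext_const_nonneg[where 'k='k, of "Suc p"]
        by (intro mult_mono) (auto intro!: mult_nonneg_nonneg opnorm_nonneg)
      finally show ?thesis .
    qed
    have pos: "\<forall>\<^sub>F n in sequentially. 0 < x p n"
      using L(1)
    proof eventually_elim
      case (elim n)
      have "x p n \<noteq> 0" using le[of n] elim by auto
      then show ?case using x0[of p n] by simp
    qed
    have "(\<lambda>n. elog (x p n) / ereal (real n)) \<longlonglongrightarrow> -\<infinity>" using lim'[of p] p inf by auto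
    from elog_tendsto_MInf[OF this pos]
    have small: "\<forall>\<^sub>F n in sequentially. ln (x p n) / real n < r - 1 - ln ?K - ln B" .
    have big: "\<forall>\<^sub>F n in sequentially. r - 1 < ln (x (Suc p) n) / real n"
      using L(2) by (rule order_tendstoD) simp
    have "\<forall>\<^sub>F n :: nat in sequentially. False"
      using L(1) pos small big eventually_gt_at_top[of 0]
    proof eventually_elim
      fix n assume n: "0 < x (Suc p) n" "0 < x p n" "ln (x p n) / real n < r - 1 - ln ?K - ln B"
        "r - 1 < ln (x (Suc p) n) / real n" "0 < n"
      have "ln (x (Suc p) n) \<le> ln (?K * (x p n * B ^ n))"
        using le[of n] n(1) by simp
      also have "\<dots> = ln ?K + ln (x p n) + n * ln B"
        using K n(2) B(2) by (simp add: ln_mult ln_realpow)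
      finally have "ln (x (Suc p) n) / real n \<le> (ln ?K + ln (x p n) + n * ln B) / real n"
        by (intro divide_right_mono) auto
      moreover have "(ln ?K + ln (x p n) + n * ln B) / real n = ln ?K / real n + ln (x p n) / real n + ln B"
        using n(5) by (simp add: add_divide_distrib)
      moreover have "ln ?K / real n \<le> ln ?K" using K n(5) by (simp add: divide_le_eq mult_le_cancel_left1)
      ultimately show False using n(3,4) by linarith
    qed
    then show False by simp
  qed
  \<comment> \<open>Discrete concavity of the sequence of limits, with 0 in the place of
    \<open>s 0\<close>.\<close>
  have conc: "r2 + r0 \<le> 2 * r1"
    if p: "Suc (Suc p) \<le> CARD('k)" and r: "s (Suc (Suc p)) = ereal r2" "s (Suc p) = ereal r1"
      and r0: "if p = 0 then r0 = 0 else s p = ereal r0" for p r0 r1 r2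
  proof -
    define y where "y n = (if p = 0 then 1 else x p n)" for n
    \<comment> \<open>One constant for both cases \<open>p = 0\<close> and \<open>p > 0\<close>; the
      summand 1 keeps its logarithm nonnegative.\<close>
    define K where "K = ext_const TYPE('k) (Suc (Suc p)) * ext_const TYPE('k) p + ext_const TYPE('k) 2 + 1"
    have c: "0 \<le> ext_const TYPE('k) q" for q by (rule ext_const_nonneg)
    have K: "K \<ge> 1" unfolding K_def using c by (simp add: add_nonneg_nonneg)
    have lim2: "(\<lambda>n. elog (x (Suc (Suc p)) n) / ereal (real n)) \<longlonglongrightarrow> ereal r2" using lim'[of "Suc (Suc p)"] p r by auto
    have lim1: "(\<lambda>n. elog (x (Suc p) n) / ereal (real n)) \<longlonglongrightarrow> ereal r1" using lim'[of "Suc p"] p r by auto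
    note L2 = elog_tendsto_real[OF lim2 x0] and L1 = elog_tendsto_real[OF lim1 x0]
    have Y: "\<forall>\<^sub>F n in sequentially. 0 < y n" "(\<lambda>n. ln (y n) / real n) \<longlonglongrightarrow> r0"
    proof -
      show "\<forall>\<^sub>F n in sequentially. 0 < y n"
      proof (cases "p = 0")
        case False
        then have "(\<lambda>n. elog (x p n) / ereal (real n)) \<longlonglongrightarrow> ereal r0" using lim'[of p] p r0 by auto
        from elog_tendsto_real(1)[OF this x0] show ?thesis using False by (simp add: y_def)
      qed (simp add: y_def)
      show "(\<lambda>n. ln (y n) / real n) \<longlonglongrightarrow> r0"
      proof (cases "p = 0")
        case False
        then have "(\<lambda>n. elog (x p n) / ereal (real n)) \<longlonglongrightarrow> ereal r0" using lim'[of p] p r0 by auto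
        from elog_tendsto_real(2)[OF this x0] show ?thesis using False by (simp add: y_def)
      qed (use r0 in \<open>simp add: y_def\<close>)
    qed
    have le: "x (Suc (Suc p)) n * y n \<le> K * (x (Suc p) n)\<^sup>2" for n
    proof (cases "p = 0")
      case True
      have two: "2 \<le> CARD('k)" using p True by simp
      have "x 2 n \<le> ext_const TYPE('k) 2 * opnorm (W n) ^ 2"
        unfolding x_def by (rule ext_opnorm_le_opnorm_power[OF two])
      also have "\<dots> \<le> K * (x 1 n)\<^sup>2"
        unfolding x_def K_def using c[of "Suc (Suc p)"] c[of p] c[of 2]
        by (intro mult_mono power_mono opnorm_le_ext_opnorm_1 opnorm_nonneg) (auto intro!: add_nonneg_nonneg mult_nonneg_nonneg)
      finally show ?thesis using True by (simp add: y_def numeral_2_eq_2)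
    next
      case False
      have "x (Suc (Suc p)) n * x p n \<le> ext_const TYPE('k) (Suc (Suc p)) * ext_const TYPE('k) p * (x (Suc p) n)\<^sup>2"
        unfolding x_def by (rule ext_opnorm_log_concave[OF p])
      also have "\<dots> \<le> K * (x (Suc p) n)\<^sup>2"
        unfolding K_def using c[of 2] by (intro mult_right_mono) auto
      finally show ?thesis using False by (simp add: y_def)
    qed
    have "(\<lambda>n. ln (x (Suc (Suc p)) n) / real n + ln (y n) / real n) \<longlonglongrightarrow> r2 + r0"
      by (intro tendsto_add L2(2) Y(2))
    moreover have "(\<lambda>n. ln K / real n + 2 * (ln (x (Suc p) n) / real n)) \<longlonglongrightarrow> 0 + 2 * r1"
      by (intro tendsto_intros lim_const_over_n L1(2))
    moreover have "\<forall>\<^sub>F n in sequentially. ln (x (Suc (Suc p)) n) / real n + ln (y n) / real n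
        \<le> ln K / real n + 2 * (ln (x (Suc p) n) / real n)"
      using L2(1) L1(1) Y(1) eventually_gt_at_top[of 0]
    proof eventually_elim
      case (elim n)
      have "ln (x (Suc (Suc p)) n * y n) \<le> ln (K * (x (Suc p) n)\<^sup>2)"
        using elim mult_pos_pos[of "x (Suc (Suc p)) n" "y n"] by (intro ln_mono[OF le]) auto
      then have "ln (x (Suc (Suc p)) n) + ln (y n) \<le> ln K + 2 * ln (x (Suc p) n)"
        using elim K by (simp add: ln_mult ln_realpow)
      then have "(ln (x (Suc (Suc p)) n) + ln (y n)) / real n \<le> (ln K + 2 * ln (x (Suc p) n)) / real n"
        by (intro divide_right_mono) auto
      then show ?case by (simp add: add_divide_distrib)
    qed
    ultimately show ?thesis by (intro tendsto_le[OF _ _ _, of sequentially]) auto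
  qed
  have dec: "\<gamma> (Suc (Suc p)) \<le> \<gamma> (Suc p)" if p: "Suc (Suc p) \<le> CARD('k)" for p
  proof (cases "s (Suc (Suc p)) = -\<infinity>")
    case False
    then obtain r2 where r2: "s (Suc (Suc p)) = ereal r2" using real_s by blast
    have "s (Suc p) \<noteq> -\<infinity>" using pred[of "Suc p"] p False by simp
    then obtain r1 where r1: "s (Suc p) = ereal r1" using real_s by blast
    show ?thesis
    proof (cases "p = 0")
      case True
      then show ?thesis using conc[OF p r2 r1, of 0] r1 r2 by (simp add: \<gamma>_def)
    next
      case False
      then have "s p \<noteq> -\<infinity>" using pred[of p] p r1 by simp
      then obtain r0 where r0: "s p = ereal r0" using real_s by blast
      show ?thesis using conc[OF p r2 r1, of r0] r0 r1 r2 False by (simp add: \<gamma>_def)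
    qed
  qed (simp add: \<gamma>_def)
  show thesis
  proof (rule that[of \<gamma>])
    show "\<gamma> 1 = s 1" by (simp add: \<gamma>_def)
    show "\<gamma> 2 = s 2 - s 1" if s1: "2 \<le> CARD('k)" "s 1 \<noteq> -\<infinity>"
    proof (cases "s 2 = -\<infinity>")
      case True
      obtain r where "s 1 = ereal r" using real_s[OF s1(2)] by blast
      then show ?thesis using True by (simp add: \<gamma>_def)
    qed (simp add: \<gamma>_def)
    show "\<gamma> j \<le> \<gamma> i" if ij: "1 \<le> i" "i \<le> j" "j \<le> CARD('k)" for i j
      using ij(2,3)
    proof (induction j rule: dec_induct)
      case (step n)
      have "\<gamma> (Suc (Suc (n - 1))) \<le> \<gamma> (Suc (n - 1))" using step ij(1) by (intro dec) auto
      then have "\<gamma> (Suc n) \<le> \<gamma> n" using step ij(1) by simp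
      with step show ?case by auto
    qed simp
    show "(\<Sum>j=1..p. \<gamma> j) = s p" if "p \<in> {1..CARD('k)}" for p
    proof -
      have "1 \<le> p \<Longrightarrow> p \<le> CARD('k) \<Longrightarrow> (\<Sum>j=1..p. \<gamma> j) = s p"
      proof (induction p rule: dec_induct)
        case base
        show ?case by (simp add: \<gamma>_def)
      next
        case (step n)
        then have IH: "(\<Sum>j=1..n. \<gamma> j) = s n" by simp
        have sum: "(\<Sum>j=1..Suc n. \<gamma> j) = s n + \<gamma> (Suc n)" using IH by simp
        show ?case
        proof (cases "s (Suc n) = -\<infinity>")
          case True
          then show ?thesis unfolding sum using s[of n] by (simp add: \<gamma>_def)
        next
          case False
          then obtain r where r: "s (Suc n) = ereal r" using real_s by blast
          have "s n \<noteq> -\<infinity>" using pred[of n] step False by simp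
          then obtain r' where r': "s n = ereal r'" using real_s by blast
          show ?thesis unfolding sum using r r' step by (simp add: \<gamma>_def)
        qed
      qed
      then show ?thesis using that by simp
    qed
  qed
qed

lemma opnorm_limit:
  fixes W :: "nat \<Rightarrow> complex^'k^'k"
  assumes lim: "(\<lambda>n. elog (ext_opnorm 1 (W n)) / ereal (real n)) \<longlonglongrightarrow> ereal r"
  shows "\<forall>\<^sub>F n in sequentially. 0 < opnorm (W n)" "(\<lambda>n. ln (opnorm (W n)) / real n) \<longlonglongrightarrow> r"
proof -
  let ?c = "ext_const TYPE('k) 1 + 1"
  have c: "1 \<le> ?c" using ext_const_nonneg[where 'k='k, of 1] by simp
  note e = elog_tendsto_real[OF lim ext_opnorm_nonneg]
  have le: "ext_opnorm 1 (W n) \<le> ?c * opnorm (W n)" for n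
    using ext_opnorm_1_le[of "W n"] opnorm_nonneg[of "W n"] by (simp add: distrib_right)
  show pos: "\<forall>\<^sub>F n in sequentially. 0 < opnorm (W n)"
    using e(1)
  proof eventually_elim
    case (elim n)
    then show ?case using le[of n] opnorm_nonneg[of "W n"] by (cases "opnorm (W n) = 0") auto
  qed
  show "(\<lambda>n. ln (opnorm (W n)) / real n) \<longlonglongrightarrow> r"
  proof (rule tendsto_sandwich)
    have "(\<lambda>n. ln (ext_opnorm 1 (W n)) / real n - ln ?c / real n) \<longlonglongrightarrow> r - 0"
      by (intro tendsto_diff e(2) lim_const_over_n)
    then show "(\<lambda>n. ln (ext_opnorm 1 (W n)) / real n - ln ?c / real n) \<longlonglongrightarrow> r" by simp
    show "(\<lambda>n. ln (ext_opnorm 1 (W n)) / real n) \<longlonglongrightarrow> r" by (rule e(2))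
    show "\<forall>\<^sub>F n in sequentially. ln (opnorm (W n)) / real n \<le> ln (ext_opnorm 1 (W n)) / real n"
      using pos by eventually_elim (intro divide_right_mono ln_mono opnorm_le_ext_opnorm_1; simp)
    show "\<forall>\<^sub>F n in sequentially. ln (ext_opnorm 1 (W n)) / real n - ln ?c / real n \<le> ln (opnorm (W n)) / real n"
      using pos e(1)
    proof eventually_elim
      case (elim n)
      have "ln (ext_opnorm 1 (W n)) \<le> ln (?c * opnorm (W n))" by (rule ln_mono[OF le elim(2)])
      also have "\<dots> = ln ?c + ln (opnorm (W n))" using c elim(1) by (intro ln_mult_pos) auto
      finally show ?case unfolding diff_divide_distrib[symmetric] by (intro divide_right_mono) auto
    qed
  qed
qed

text \<open>\<open>x n\<close> may vanish and \<open>s\<close> may be \<open>-\<infinity>\<close>;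
  the finiteness of \<open>r\<close> is what makes the difference of limits meaningful.\<close>

lemma elog_ratio_limit:
  assumes x: "(\<lambda>n. elog (x n) / ereal (real n)) \<longlonglongrightarrow> s" "\<And>n. 0 \<le> x n"
    and y: "\<forall>\<^sub>F n in sequentially. 0 < y n" "(\<lambda>n. ln (y n) / real n) \<longlonglongrightarrow> r"
  shows "(\<lambda>n. elog (x n / (y n)\<^sup>2) / ereal (real n)) \<longlonglongrightarrow> s - ereal (2 * r)"
proof -
  have "(\<lambda>n. elog (x n) / ereal (real n) - ereal (2 * (ln (y n) / real n))) \<longlonglongrightarrow> s - ereal (2 * r)"
    using x(1) y(2) by (intro tendsto_diff_ereal_general tendsto_intros) auto
  moreover have "\<forall>\<^sub>F n in sequentially. elog (x n) / ereal (real n) - ereal (2 * (ln (y n) / real n))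
      = elog (x n / (y n)\<^sup>2) / ereal (real n)"
    using y(1) eventually_gt_at_top[of 0]
  proof eventually_elim
    case (elim n)
    show ?case
    proof (cases "x n = 0")
      case False
      then have "0 < x n" using x(2)[of n] by simp
      then have "ln (x n / (y n)\<^sup>2) = ln (x n) - 2 * ln (y n)"
        using elim(1) by (simp add: ln_div ln_realpow)
      then show ?thesis using \<open>0 < x n\<close> elim by (simp add: elog_def diff_divide_distrib)
    qed (use elim in \<open>simp add: elog_def\<close>)
  qed
  ultimately show ?thesis by (rule Lim_transform_eventually)
qed

lemma elog_limit_neg:
  assumes x: "(\<lambda>n. elog (x n) / ereal (real n)) \<longlonglongrightarrow> d" "\<And>n. 0 \<le> x n"
    and le: "\<forall>\<^sub>F n in sequentially. x n \<le> c * \<beta> ^ n" and c: "0 < c" and \<beta>: "0 < \<beta>" "\<beta> < 1"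
  shows "d < 0"
proof -
  have "(\<lambda>n. ereal (ln c / real n + ln \<beta>)) \<longlonglongrightarrow> ereal (0 + ln \<beta>)"
    by (intro tendsto_intros lim_const_over_n)
  moreover have "\<forall>\<^sub>F n in sequentially. elog (x n) / ereal (real n) \<le> ereal (ln c / real n + ln \<beta>)"
    using le eventually_gt_at_top[of 0]
  proof eventually_elim
    case (elim n)
    show ?case
    proof (cases "x n = 0")
      case False
      then have "ln (x n) \<le> ln (c * \<beta> ^ n)" using elim(1) x(2)[of n] by (intro ln_mono) auto
      also have "\<dots> = ln c + n * ln \<beta>" using c \<beta> by (simp add: ln_mult ln_realpow)
      finally have "ln (x n) / n \<le> (ln c + n * ln \<beta>) / n" by (intro divide_right_mono) auto
      then show ?thesis using False elim(2) by (simp add: elog_def add_divide_distrib)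
    qed (use elim in \<open>simp add: elog_def\<close>)
  qed
  ultimately have "d \<le> ereal (0 + ln \<beta>)"
    using x(1) by (intro tendsto_le[OF trivial_limit_sequentially])
  also have "\<dots> < 0" using \<beta> by simp
  finally show ?thesis .
qed

section \<open>The trajectory measure as a mixture\<close>

context instrument
begin

definition kernel :: "'k cproj \<Rightarrow> (nat \<Rightarrow> complex^'k^'k) measure" where
  "kernel xh = law (outer (unit_rep xh))"

lemma measurable_kernel: "kernel \<in> borel \<rightarrow>\<^sub>M subprob_algebra \<Omega>"
proof (rule measurable_subprob_algebra)
  fix xh :: "'k cproj"
  show "subprob_space (kernel xh)"
  proof (rule subprob_spaceI)
    have "measure (law (outer (unit_rep xh))) UNIV = 1"
      unfolding measure_law_UNIV[OF psd_outer] weight_id[symmetric] weight_outer by (simp add: unit_rep)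
    then show "emeasure (kernel xh) (space (kernel xh)) \<le> 1"
      by (simp add: kernel_def space_law[OF psd_outer] emeasure_law_eq_measure[OF psd_outer])
    show "space (kernel xh) \<noteq> {}" by (simp add: kernel_def space_law[OF psd_outer])
  qed
  show "sets (kernel xh) = sets \<Omega>" by (simp add: kernel_def sets_law[OF psd_outer])
next
  fix A assume A: "A \<in> sets \<Omega>"
  have "continuous_on UNIV (\<lambda>xh :: 'k cproj. measure (law (outer (unit_rep xh))) A)"
    by (rule continuous_on_cproj[OF continuous_law_outer[OF A]]) (simp add: law_outer_cmult[OF A])
  then have "(\<lambda>xh :: 'k cproj. measure (law (outer (unit_rep xh))) A) \<in> borel_measurable borel"
    by (rule borel_measurable_continuous_onI)
  then show "(\<lambda>xh. emeasure (kernel xh) A) \<in> borel_measurable borel"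
    unfolding kernel_def emeasure_law_eq_measure[OF psd_outer] by measurable
qed

definition mixture :: "'k cproj measure \<Rightarrow> ('k cproj \<times> (nat \<Rightarrow> complex^'k^'k)) measure" where
  "mixture \<nu> = \<nu> \<bind> (\<lambda>xh. distr (kernel xh) (borel \<Otimes>\<^sub>M \<Omega>) (\<lambda>\<omega>. (xh, \<omega>)))"

context
  fixes \<nu> :: "'k cproj measure"
  assumes \<nu>: "prob_space \<nu>" "sets \<nu> = sets borel"
begin

lemma measurable_pair_kernel:
  "(\<lambda>xh. distr (kernel xh) (borel \<Otimes>\<^sub>M \<Omega>) (\<lambda>\<omega>. (xh, \<omega>))) \<in> \<nu> \<rightarrow>\<^sub>M subprob_algebra (borel \<Otimes>\<^sub>M \<Omega>)"
proof (rule measurable_distr2[where M=\<Omega>])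
  show "kernel \<in> \<nu> \<rightarrow>\<^sub>M subprob_algebra \<Omega>"
    using measurable_kernel by (simp add: measurable_cong_sets[OF \<nu>(2) refl])
  have "(\<lambda>(xh, \<omega>). (xh, \<omega>)) \<in> borel \<Otimes>\<^sub>M \<Omega> \<rightarrow>\<^sub>M borel \<Otimes>\<^sub>M \<Omega>" by measurable
  then show "(\<lambda>(xh, \<omega>). (xh, \<omega>)) \<in> \<nu> \<Otimes>\<^sub>M \<Omega> \<rightarrow>\<^sub>M borel \<Otimes>\<^sub>M \<Omega>"
    by (simp add: measurable_cong_sets[OF sets_pair_measure_cong[OF \<nu>(2) refl] refl])
qed

lemma space_\<nu>: "space \<nu> = UNIV" using sets_eq_imp_space_eq[OF \<nu>(2)] by simp

lemma sets_mixture: "sets (mixture \<nu>) = sets (borel \<Otimes>\<^sub>M \<Omega>)"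
  unfolding mixture_def using \<nu> by (intro sets_bind) (auto simp: space_\<nu>)

lemma measurable_Pair_kernel: "(\<lambda>\<omega>. (xh, \<omega>)) \<in> kernel xh \<rightarrow>\<^sub>M borel \<Otimes>\<^sub>M \<Omega>"
  by (simp add: kernel_def measurable_cong_sets[OF sets_law[OF psd_outer] refl])

lemma emeasure_mixture:
  assumes S: "S \<in> sets borel" and E: "E \<in> sets \<Omega>"
  shows "emeasure (mixture \<nu>) (S \<times> E) = (\<integral>\<^sup>+xh\<in>S. emeasure (kernel xh) E \<partial>\<nu>)"
proof -
  have SE: "S \<times> E \<in> sets (borel \<Otimes>\<^sub>M \<Omega>)" using S E by simp
  have "emeasure (mixture \<nu>) (S \<times> E) = (\<integral>\<^sup>+xh. emeasure (distr (kernel xh) (borel \<Otimes>\<^sub>M \<Omega>) (\<lambda>\<omega>. (xh, \<omega>))) (S \<times> E) \<partial>\<nu>)"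
    unfolding mixture_def by (rule emeasure_bind[OF _ measurable_pair_kernel SE]) (simp add: space_\<nu>)
  also have "\<dots> = (\<integral>\<^sup>+xh\<in>S. emeasure (kernel xh) E \<partial>\<nu>)"
  proof (rule nn_integral_cong)
    fix xh
    have "(\<lambda>\<omega>. (xh, \<omega>)) -` (S \<times> E) \<inter> space (kernel xh) = (if xh \<in> S then E else {})"
      by (auto simp: kernel_def space_law[OF psd_outer])
    then show "emeasure (distr (kernel xh) (borel \<Otimes>\<^sub>M \<Omega>) (\<lambda>\<omega>. (xh, \<omega>))) (S \<times> E) = emeasure (kernel xh) E * indicator S xh"
      by (simp add: emeasure_distr[OF measurable_Pair_kernel SE])
  qed
  finally show ?thesis .
qed

lemma prob_space_mixture: "prob_space (mixture \<nu>)"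
proof (rule prob_spaceI)
  have sp: "space (mixture \<nu>) = UNIV \<times> UNIV"
    using sets_eq_imp_space_eq[OF sets_mixture] by (simp add: space_pair_measure space_PiM)
  have "emeasure (kernel xh) UNIV = 1" for xh
  proof -
    have "measure (law (outer (unit_rep xh))) UNIV = 1"
      unfolding measure_law_UNIV[OF psd_outer] weight_id[symmetric] weight_outer by (simp add: unit_rep)
    then show ?thesis by (simp add: kernel_def emeasure_law_eq_measure[OF psd_outer])
  qed
  then show "emeasure (mixture \<nu>) (space (mixture \<nu>)) = 1"
    unfolding sp using prob_space.emeasure_space_1[OF \<nu>(1)] cylinder_sets[OF cylinder_UNIV[of 0]]
    by (subst emeasure_mixture) (auto simp: space_\<nu>)
qed

text \<open>\<open>law (mat 1)\<close> dominates the laws of all lines, so a single null set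
  \<open>N\<close> serves every fibre.\<close>

lemma AE_mixture:
  assumes "AE \<omega> in law (mat 1). Q \<omega>"
  shows "AE (xh, \<omega>) in mixture \<nu>. Q \<omega>"
proof -
  from assms obtain N where N: "{\<omega> \<in> space (law (mat 1)). \<not> Q \<omega>} \<subseteq> N" "emeasure (law (mat 1)) N = 0" "N \<in> sets (law (mat 1))"
    by (rule AE_E)
  then have NS: "N \<in> sets \<Omega>" by (simp add: sets_law[OF psd_mat_1])
  have "emeasure (kernel xh) N = 0" for xh
  proof -
    have "measure (law (outer (unit_rep xh))) N \<le> norm (outer (unit_rep xh)) * measure (law (mat 1)) N"
      by (rule law_le_mat_1[OF psd_outer NS])
    also have "\<dots> = 0" using N(2) by (simp add: measure_def)
    finally show ?thesis by (simp add: kernel_def emeasure_law_eq_measure[OF psd_outer] ennreal_neg)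
  qed
  then have "emeasure (mixture \<nu>) (UNIV \<times> N) = 0" by (subst emeasure_mixture[OF _ NS]) auto
  then have "UNIV \<times> N \<in> null_sets (mixture \<nu>)" using NS by (auto simp: null_sets_def sets_mixture)
  then have "AE z in mixture \<nu>. z \<notin> UNIV \<times> N" by (rule AE_not_in)
  then show ?thesis by eventually_elim (use N(1) in \<open>auto simp: space_law[OF psd_mat_1]\<close>)
qed

text \<open>The event depends on the line, so it is tested fibre by fibre, which takes joint
  measurability. \<open>unit_rep\<close> need not be measurable, but
  \<open>outer (unit_rep xh)\<close> is; hence the detour through \<open>weight\<close>.\<close>

lemma AE_mixture_norm_ge:
  "AE (xh, \<omega>) in mixture \<nu>. \<forall>\<^sub>F n in sequentially.
    (norm (Wprod V n \<omega>))\<^sup>2 / (real n)\<^sup>2 \<le> (norm (Wprod V n \<omega> *v unit_rep xh))\<^sup>2"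
proof -
  let ?P = "\<lambda>z. \<forall>\<^sub>F n in sequentially. (norm (Wprod V n (snd z)))\<^sup>2 / (real n)\<^sup>2 \<le> weight (outer (unit_rep (fst z))) (Wprod V n (snd z))"
  have [measurable]: "Measurable.pred (borel \<Otimes>\<^sub>M \<Omega>) ?P"
    unfolding eventually_sequentially by measurable
  then have P_sets: "{z. ?P z} \<in> sets (borel \<Otimes>\<^sub>M \<Omega>)"
    by (simp add: pred_def space_pair_measure space_PiM)
  have "AE z in mixture \<nu>. ?P z"
    unfolding mixture_def
  proof (subst AE_bind[OF measurable_pair_kernel])
    show "AE xh in \<nu>. AE z in distr (kernel xh) (borel \<Otimes>\<^sub>M \<Omega>) (Pair xh). ?P z"
    proof (rule AE_I2)
      fix xh
      have "AE \<omega> in kernel xh. ?P (xh, \<omega>)"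
        unfolding kernel_def using AE_norm_W_vec_ge[of "unit_rep xh"] by (simp add: weight_outer)
      then show "AE z in distr (kernel xh) (borel \<Otimes>\<^sub>M \<Omega>) (Pair xh). ?P z"
        using P_sets by (subst AE_distr_iff[OF measurable_Pair_kernel]) (simp_all add: space_pair_measure space_PiM)
    qed
  qed measurable
  then show ?thesis by eventually_elim (auto simp: weight_outer)
qed

end

end

section \<open>Stochastic maps\<close>

locale stochastic_map =
  fixes \<mu> :: "(complex^'k^'k) measure" and L :: "complex^'k^'k \<Rightarrow> complex^'k^'k"
  assumes sets_\<mu> [measurable_cong]: "sets \<mu> = sets borel"
    and L: "L \<in> bcontfun" "stochastic \<mu> L" "irreducible_for \<mu> L" "purification \<mu> L"
begin

text \<open>\<open>m\<close> is a probability measure even when \<open>\<mu>\<close> is not sigma-finite, and \<open>(V, m)\<close> defines the same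
  trajectories as \<open>(L, \<mu>)\<close>, up to a scalar factor of the products.\<close>

definition m :: "(complex^'k^'k) measure" where
  "m = density \<mu> (\<lambda>v. ennreal ((norm (L v))\<^sup>2 / CARD('k)))"

definition V :: "complex^'k^'k \<Rightarrow> complex^'k^'k" where
  "V v = (sqrt CARD('k) / norm (L v)) *\<^sub>R L v"

definition scal :: "nat \<Rightarrow> (nat \<Rightarrow> complex^'k^'k) \<Rightarrow> real" where
  "scal n \<omega> = (\<Prod>i<n. norm (L (\<omega> i)) / sqrt CARD('k))"

lemma k_pos: "0 < real CARD('k)" by simp

lemma measurable_L [measurable]: "L \<in> borel_measurable borel"
  using L(1) by (intro borel_measurable_continuous_onI) (simp add: bcontfun_def)

lemma L_bounded: obtains K where "K \<ge> 1" "\<And>v. norm (L v) \<le> K"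
proof -
  obtain K where "\<And>v. norm (L v) \<le> K"
    using L(1) by (auto simp: bcontfun_def bounded_iff)
  then show thesis by (intro that[of "max 1 K"]) (auto simp: le_max_iff_disj)
qed

text \<open>A function that is not integrable has integral 0 by convention, and 0 is not the
  identity.\<close>

lemma LL: "integrable \<mu> (\<lambda>v. cadj (L v) ** L v)" "(LINT v|\<mu>. cadj (L v) ** L v) = mat 1"
proof -
  show eq: "(LINT v|\<mu>. cadj (L v) ** L v) = mat 1" using L(2) by (simp add: stochastic_def)
  show "integrable \<mu> (\<lambda>v. cadj (L v) ** L v)"
  proof (rule ccontr)
    assume "\<not> ?thesis"
    then have "mat 1 = (0 :: complex^'k^'k)" using eq not_integrable_integral_eq by metis
    then have "(mat 1 :: complex^'k^'k) $ undefined $ undefined = 0" by simp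
    then show False by (simp add: mat_def)
  qed
qed

text \<open>The trace of the stochasticity identity; this is why the density of \<open>m\<close>
  divides by \<open>CARD('k)\<close>.\<close>

lemma norm_L_square: "integrable \<mu> (\<lambda>v. (norm (L v))\<^sup>2)" "(LINT v|\<mu>. (norm (L v))\<^sup>2) = CARD('k)"
proof -
  have bl: "bounded_linear (\<lambda>X :: complex^'k^'k. Re (trace X))"
    by (intro bounded_linear_compose[OF bounded_linear_Re] bounded_linear_trace)
  have eq: "(norm (L v))\<^sup>2 = Re (trace (cadj (L v) ** L v))" for v
    using trace_form[of "mat 1" "L v"] by (simp add: weight_mat_1)
  show "integrable \<mu> (\<lambda>v. (norm (L v))\<^sup>2)" unfolding eq by (rule integrable_bounded_linear[OF bl LL(1)])
  show "(LINT v|\<mu>. (norm (L v))\<^sup>2) = CARD('k)"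
    unfolding eq integral_bounded_linear[OF bl LL(1)] LL(2) by (simp add: trace_I)
qed

lemma nn_integral_density_L: "(\<integral>\<^sup>+v. ennreal ((norm (L v))\<^sup>2 / CARD('k)) \<partial>\<mu>) = 1"
proof -
  have "(\<integral>\<^sup>+v. ennreal ((norm (L v))\<^sup>2 / CARD('k)) \<partial>\<mu>) = ennreal (LINT v|\<mu>. (norm (L v))\<^sup>2 / CARD('k))"
    using norm_L_square(1) by (intro nn_integral_eq_integral) auto
  then show ?thesis by (simp add: norm_L_square)
qed

lemma V_0: "L v = 0 \<Longrightarrow> V v = 0" by (simp add: V_def)

lemma L_eq_V: "L v = (norm (L v) / sqrt CARD('k)) *\<^sub>R V v"
  by (cases "L v = 0") (simp_all add: V_def)

lemma Wprod_L: "Wprod L n \<omega> = scal n \<omega> *\<^sub>R Wprod V n \<omega>"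
proof (induction n)
  case (Suc n)
  have "L (\<omega> n) ** Wprod L n \<omega> = ((norm (L (\<omega> n)) / sqrt CARD('k)) *\<^sub>R V (\<omega> n)) ** (scal n \<omega> *\<^sub>R Wprod V n \<omega>)"
    by (simp only: L_eq_V[symmetric] Suc)
  then show ?case by (simp add: matrix_mult_scaleR scal_def mult.commute)
qed (simp add: scal_def)

lemma scal_pos: "Wprod V n \<omega> \<noteq> 0 \<Longrightarrow> 0 < scal n \<omega>"
proof (induction n)
  case (Suc n)
  then have "V (\<omega> n) \<noteq> 0" "Wprod V n \<omega> \<noteq> 0" by auto
  then show ?case using Suc.IH V_0[of "\<omega> n"] unfolding scal_def prod.lessThan_Suc
    by (intro mult_pos_pos divide_pos_pos) auto
qed (simp add: scal_def)

lemma prob_space_m: "prob_space m"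
proof (rule prob_spaceI)
  show "emeasure m (space m) = 1"
    unfolding m_def by (simp add: emeasure_density nn_integral_density_L cong: nn_integral_cong)
qed

lemma AE_m: "(AE v in m. P v) \<longleftrightarrow> (AE v in \<mu>. L v \<noteq> 0 \<longrightarrow> P v)"
  unfolding m_def by (subst AE_density) auto

end

text \<open>Where \<open>L v = 0\<close> the density of \<open>m\<close> vanishes, so the default
  value \<open>V v = 0\<close> has no influence; elsewhere \<open>V v\<close> has Frobenius norm
  exactly \<open>sqrt CARD('k)\<close>.\<close>

sublocale stochastic_map \<subseteq> instrument m V "sqrt CARD('k)"
proof (intro instrument.intro instrument_axioms.intro prob_space_m)
  show "sets m = sets borel" by (simp add: m_def sets_\<mu>)
  show V [measurable]: "V \<in> borel_measurable borel" unfolding V_def by measurable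
  show "norm (V v) \<le> sqrt CARD('k)" for v by (cases "L v = 0") (auto simp: V_def)
  have "(LINT v|m. cadj (V v) ** V v) = (LINT v|\<mu>. ((norm (L v))\<^sup>2 / CARD('k)) *\<^sub>R (cadj (V v) ** V v))"
    unfolding m_def by (rule integral_density) auto
  also have "(\<lambda>v. ((norm (L v))\<^sup>2 / CARD('k)) *\<^sub>R (cadj (V v) ** V v)) = (\<lambda>v. cadj (L v) ** L v)"
  proof
    fix v
    have "cadj (L v) ** L v = cadj ((norm (L v) / sqrt CARD('k)) *\<^sub>R V v) ** ((norm (L v) / sqrt CARD('k)) *\<^sub>R V v)"
      by (simp only: L_eq_V[symmetric])
    also have "\<dots> = ((norm (L v) / sqrt CARD('k)) * (norm (L v) / sqrt CARD('k))) *\<^sub>R (cadj (V v) ** V v)"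
      by (simp add: cadj_scaleR matrix_mult_scaleR)
    also have "(norm (L v) / sqrt CARD('k)) * (norm (L v) / sqrt CARD('k)) = (norm (L v))\<^sup>2 / CARD('k)"
      by (simp add: power2_eq_square)
    finally show "((norm (L v))\<^sup>2 / CARD('k)) *\<^sub>R (cadj (V v) ** V v) = cadj (L v) ** L v" ..
  qed
  finally show "(LINT v|m. cadj (V v) ** V v) = mat 1" using LL(2) by simp
qed

text \<open>A nontrivial \<open>p\<close> would contradict the irreducibility of \<open>L\<close>
  with the constant \<open>CARD('k)\<close>. The form of \<open>channel \<mu> L p\<close> at
  \<open>x\<close> is the integral of the squared norm of \<open>p *v (cadj (L v) *v x)\<close>;
  invariance of the range of \<open>p\<close> lets \<open>p *v x\<close> take the place of
  \<open>x\<close> there, and the squared norm of \<open>L v\<close> integrates to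
  \<open>CARD('k)\<close>.\<close>

sublocale stochastic_map \<subseteq> irreducible_instrument m V "sqrt CARD('k)"
proof
  fix p :: "complex^'k^'k"
  assume p: "orth_projector p" and AE: "AE v in m. (mat 1 - p) ** V v ** p = 0"
  have pp: "p ** p = p" "cadj p = p" using p by (auto simp: orth_projector_def)
  show "p = 0 \<or> p = mat 1"
  proof (rule ccontr)
    assume ne: "\<not> ?thesis"
    have LpAE: "AE v in \<mu>. L v ** p = p ** L v ** p"
      using AE unfolding AE_m
    proof eventually_elim
      case (elim v)
      have "(mat 1 - p) ** L v ** p = 0"
      proof (cases "L v = 0")
        case False
        then have "(mat 1 - p) ** ((norm (L v) / sqrt CARD('k)) *\<^sub>R V v) ** p = 0"
          using elim by (simp add: matrix_mult_scaleR)
        then show ?thesis by (simp only: L_eq_V[symmetric])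
      qed (simp add: bounded_bilinear.zero_right[OF bounded_bilinear_matrix_mult] bounded_bilinear.zero_left[OF bounded_bilinear_matrix_mult])
      then show ?case by (simp add: bounded_bilinear.diff_left[OF bounded_bilinear_matrix_mult])
    qed
    have range0: "range (\<lambda>x. p *v x) \<noteq> {0}"
    proof
      assume *: "range (\<lambda>x. p *v x) = {0}"
      have "p = 0"
      proof (rule matrix_eq_axis)
        fix i show "p *v axis i 1 = 0 *v axis i 1" using * by auto
      qed
      then show False using ne by simp
    qed
    have range1: "range (\<lambda>x. p *v x) \<noteq> UNIV"
    proof
      assume *: "range (\<lambda>x. p *v x) = UNIV"
      have "p *v y = y" for y
      proof -
        obtain z where "y = p *v z" using * by (metis rangeE UNIV_I)
        then show ?thesis by (simp add: matrix_vector_mul_assoc pp)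
      qed
      then have "p = mat 1" by (intro matrix_eq_axis) simp
      then show False using ne by simp
    qed
    have int: "integrable \<mu> (\<lambda>v. L v ** p ** cadj (L v))"
    proof (rule Bochner_Integration.integrable_bound[where f="\<lambda>v. norm p * (norm (L v))\<^sup>2"])
      show "integrable \<mu> (\<lambda>v. norm p * (norm (L v))\<^sup>2)" using norm_L_square(1) by auto
      have "norm (L v ** p ** cadj (L v)) \<le> norm p * (norm (L v))\<^sup>2" for v
      proof -
        have "norm (L v ** p ** cadj (L v)) \<le> norm (L v ** p) * norm (L v)"
          using norm_matrix_mult_le[of "L v ** p" "cadj (L v)"] by simp
        also have "\<dots> \<le> (norm (L v) * norm p) * norm (L v)" by (intro mult_right_mono norm_matrix_mult_le) auto
        finally show ?thesis by (simp add: power2_eq_square mult_ac)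
      qed
      then show "AE v in \<mu>. norm (L v ** p ** cadj (L v)) \<le> norm (norm p * (norm (L v))\<^sup>2)" by simp
    qed measurable
    have "loewner_le (channel \<mu> L p) (CARD('k) *\<^sub>R p)"
      unfolding loewner_le_def
    proof (intro allI)
      fix x
      let ?g = "\<lambda>v. (norm (p *v (cadj (L v) *v x)))\<^sup>2"
      have bl: "bounded_linear (\<lambda>X :: complex^'k^'k. cinner (X *v x) x)"
        by (intro bounded_linear_compose[OF bounded_bilinear.bounded_linear_left[OF bounded_bilinear_cinner]]
            bounded_bilinear.bounded_linear_left[OF bounded_bilinear_matrix_vector_mult])
      have cp: "cinner (p *v y) y = of_real ((norm (p *v y))\<^sup>2)" for y
      proof -
        have "cinner (p *v y) y = cinner (p *v (p *v y)) y" by (simp add: matrix_vector_mul_assoc pp)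
        also have "\<dots> = cinner (p *v y) (p *v y)" using cinner_cadj[of p "p *v y" y] by (simp add: pp)
        finally show ?thesis by (simp only: cinner_self)
      qed
      have eq: "cinner ((L v ** p ** cadj (L v)) *v x) x = of_real (?g v)" for v
      proof -
        have "cinner ((L v ** p ** cadj (L v)) *v x) x = cinner (p *v (cadj (L v) *v x)) (cadj (L v) *v x)"
          by (simp add: cinner_cadj[of "L v"] flip: matrix_vector_mul_assoc)
        then show ?thesis by (simp only: cp)
      qed
      have "cinner (channel \<mu> L p *v x) x = (LINT v|\<mu>. complex_of_real (?g v))"
        unfolding channel_def integral_bounded_linear[OF bl int, symmetric] eq ..
      then have ch: "cinner (channel \<mu> L p *v x) x = of_real (LINT v|\<mu>. ?g v)"
        by (simp only: integral_complex_of_real)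
      have int_g: "integrable \<mu> ?g"
        using integrable_bounded_linear[OF bounded_linear_compose[OF bounded_linear_Re bl] int] unfolding eq by simp
      have "(LINT v|\<mu>. ?g v) \<le> (LINT v|\<mu>. (norm (L v))\<^sup>2 * (norm (p *v x))\<^sup>2)"
      proof (rule integral_mono_AE[OF int_g])
        show "integrable \<mu> (\<lambda>v. (norm (L v))\<^sup>2 * (norm (p *v x))\<^sup>2)" using norm_L_square(1) by auto
        show "AE v in \<mu>. ?g v \<le> (norm (L v))\<^sup>2 * (norm (p *v x))\<^sup>2"
          using LpAE
        proof eventually_elim
          case (elim v)
          have "cadj (L v ** p) = cadj (p ** L v ** p)" using elim by simp
          then have "p ** cadj (L v) = p ** cadj (L v) ** p" by (simp add: cadj_mult pp matrix_mul_assoc)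
          then have "p *v (cadj (L v) *v x) = p *v (cadj (L v) *v (p *v x))"
            by (metis matrix_vector_mul_assoc)
          moreover have "norm (p *v y) \<le> norm y" for y
          proof -
            have "(norm (p *v y))\<^sup>2 = Re (cinner (p *v y) y)" unfolding cp by simp
            also have "\<dots> \<le> norm (p *v y) * norm y" using cmod_cinner_le complex_Re_le_cmod order_trans by blast
            finally show ?thesis by (cases "p *v y = 0") (auto simp: power2_eq_square)
          qed
          ultimately have "norm (p *v (cadj (L v) *v x)) \<le> norm (cadj (L v) *v (p *v x))" by metis
          also have "\<dots> \<le> norm (L v) * norm (p *v x)"
            using norm_matrix_vector_mult_le[of "cadj (L v)" "p *v x"] by simp
          finally have "?g v \<le> (norm (L v) * norm (p *v x))\<^sup>2" by (intro power_mono) auto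
          then show ?case by (simp add: power_mult_distrib)
        qed
      qed
      also have "\<dots> = CARD('k) * (norm (p *v x))\<^sup>2" by (simp add: norm_L_square)
      finally have le: "(LINT v|\<mu>. ?g v) \<le> CARD('k) * (norm (p *v x))\<^sup>2" .
      have "cinner ((CARD('k) *\<^sub>R p - channel \<mu> L p) *v x) x = of_real (CARD('k) * (norm (p *v x))\<^sup>2 - (LINT v|\<mu>. ?g v))"
        by (simp add: matrix_vector_mult_diff_rdistrib bounded_bilinear.scaleR_left[OF bounded_bilinear_matrix_vector_mult]
            cinner_diff_left cinner_scaleR_left ch cp)
      then show "Im (cinner ((CARD('k) *\<^sub>R p - channel \<mu> L p) *v x) x) = 0 \<and> 0 \<le> Re (cinner ((CARD('k) *\<^sub>R p - channel \<mu> L p) *v x) x)"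
        using le by simp
    qed
    then show False
      using L(3) p range0 range1 k_pos unfolding irreducible_for_def by blast
  qed
qed

section \<open>The trajectory measure in terms of \<open>m\<close> and \<open>V\<close>\<close>

context stochastic_map
begin

lemma PiM_m: "PiM {..<n} (\<lambda>_. m) = density (PiM {..<n} (\<lambda>_. \<mu>)) (\<lambda>\<omega>. ennreal ((scal n \<omega>)\<^sup>2))"
proof -
  have "PiM {..<n} (\<lambda>_. m) = density (PiM {..<n} (\<lambda>_. \<mu>)) (\<lambda>\<omega>. \<Prod>i<n. ennreal ((norm (L (\<omega> i)))\<^sup>2 / CARD('k)))"
    unfolding m_def by (rule PiM_density) (auto simp: nn_integral_density_L)
  also have "(\<lambda>\<omega>. \<Prod>i<n. ennreal ((norm (L (\<omega> i)))\<^sup>2 / CARD('k))) = (\<lambda>\<omega>. ennreal ((scal n \<omega>)\<^sup>2))"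
    by (rule ext) (simp add: prod_ennreal scal_def prod_power_distrib power_divide)
  finally show ?thesis .
qed

lemma sets_PiM_\<mu>: "sets (PiM {..<n} (\<lambda>_. \<mu>)) = sets (PiM {..<n} (\<lambda>_. borel))"
  by (intro sets_PiM_cong) (auto simp: sets_\<mu>)

lemma sets_PiM_m: "sets (PiM {..<n} (\<lambda>_. m)) = sets (PiM {..<n} (\<lambda>_. borel))"
  by (intro sets_PiM_cong) (auto simp: sets_m)

lemma distr_restrict: "distr seq.S (PiM {..<n} (\<lambda>_. m)) (\<lambda>\<omega>. restrict \<omega> {..<n}) = PiM {..<n} (\<lambda>_. m)"
  by (rule seq.distr_PiM_restrict_finite) auto

lemma measurable_scal: "scal n \<in> borel_measurable (PiM {..<n} (\<lambda>_. \<mu>))"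
  unfolding scal_def by measurable

text \<open>The products of \<open>L\<close> are those of \<open>V\<close> times
  \<open>scal n\<close>, and the square of this factor is the density of the \<open>n\<close>-th
  power of \<open>m\<close> with respect to that of \<open>\<mu>\<close>; the change of measure
  absorbs it.\<close>

lemma emeasure_law_eq_PiM:
  assumes E: "E \<in> sets (PiM {..<n} (\<lambda>_. borel))"
  shows "emeasure (law (outer x)) {\<omega>. restrict \<omega> {..<n} \<in> E}
    = (\<integral>\<^sup>+\<omega>\<in>E. ennreal ((norm (Wprod L n \<omega> *v x))\<^sup>2) \<partial>PiM {..<n} (\<lambda>_. \<mu>))"
proof -
  have W [measurable]: "Wprod V n \<in> borel_measurable (PiM {..<n} (\<lambda>_. borel))"
    by (rule measurable_Wprod) auto
  have W' [measurable]: "Wprod V n \<in> borel_measurable (PiM {..<n} (\<lambda>_. m))" "Wprod V n \<in> borel_measurable (PiM {..<n} (\<lambda>_. \<mu>))"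
    using W by (simp_all add: measurable_cong_sets[OF sets_PiM_m refl] measurable_cong_sets[OF sets_PiM_\<mu> refl])
  have [measurable]: "E \<in> sets (PiM {..<n} (\<lambda>_. m))" "E \<in> sets (PiM {..<n} (\<lambda>_. \<mu>))"
    using E by (simp_all add: sets_PiM_m sets_PiM_\<mu>)
  have "(\<integral>\<^sup>+\<omega>\<in>E. ennreal ((norm (Wprod L n \<omega> *v x))\<^sup>2) \<partial>PiM {..<n} (\<lambda>_. \<mu>))
     = (\<integral>\<^sup>+\<omega>. ennreal ((scal n \<omega>)\<^sup>2) * (ennreal ((norm (Wprod V n \<omega> *v x))\<^sup>2) * indicator E \<omega>) \<partial>PiM {..<n} (\<lambda>_. \<mu>))"
  proof (rule nn_integral_cong)
    fix \<omega>
    have "(norm (Wprod L n \<omega> *v x))\<^sup>2 = (scal n \<omega>)\<^sup>2 * (norm (Wprod V n \<omega> *v x))\<^sup>2"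
      by (simp add: Wprod_L bounded_bilinear.scaleR_left[OF bounded_bilinear_matrix_vector_mult] power_mult_distrib)
    then show "ennreal ((norm (Wprod L n \<omega> *v x))\<^sup>2) * indicator E \<omega>
      = ennreal ((scal n \<omega>)\<^sup>2) * (ennreal ((norm (Wprod V n \<omega> *v x))\<^sup>2) * indicator E \<omega>)"
      by (simp add: ennreal_mult mult.assoc)
  qed
  also have "\<dots> = (\<integral>\<^sup>+\<omega>. ennreal ((norm (Wprod V n \<omega> *v x))\<^sup>2) * indicator E \<omega> \<partial>PiM {..<n} (\<lambda>_. m))"
    unfolding PiM_m using measurable_scal[of n] by (intro nn_integral_density[symmetric] borel_measurable_times_ennreal) auto
  also have "\<dots> = (\<integral>\<^sup>+\<omega>. ennreal ((norm (Wprod V n \<omega> *v x))\<^sup>2) * indicator E \<omega> \<partial>distr seq.S (PiM {..<n} (\<lambda>_. m)) (\<lambda>\<omega>. restrict \<omega> {..<n}))"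
    by (simp only: distr_restrict)
  also have "\<dots> = (\<integral>\<^sup>+\<omega>. ennreal ((norm (Wprod V n (restrict \<omega> {..<n}) *v x))\<^sup>2) * indicator E (restrict \<omega> {..<n}) \<partial>seq.S)"
    by (rule nn_integral_distr) (auto intro: measurable_restrict_subset)
  also have "\<dots> = (\<integral>\<^sup>+\<omega>. ennreal (weight (outer x) (Wprod V n \<omega>)) * indicator {\<omega>. restrict \<omega> {..<n} \<in> E} \<omega> \<partial>seq.S)"
  proof (rule nn_integral_cong)
    fix \<omega>
    have "Wprod V n (restrict \<omega> {..<n}) = Wprod V n \<omega>" by (rule Wprod_cong) simp
    then show "ennreal ((norm (Wprod V n (restrict \<omega> {..<n}) *v x))\<^sup>2) * indicator E (restrict \<omega> {..<n})
      = ennreal (weight (outer x) (Wprod V n \<omega>)) * indicator {\<omega>. restrict \<omega> {..<n} \<in> E} \<omega>"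
      by (simp add: weight_outer indicator_def)
  qed
  also have "\<dots> = emeasure (law (outer x)) {\<omega>. restrict \<omega> {..<n} \<in> E}"
    by (rule emeasure_law[OF psd_outer cylinder_restrict[OF E], symmetric])
  finally show ?thesis ..
qed

lemma traj_measure_eq:
  assumes \<nu>: "prob_space \<nu>" "sets \<nu> = sets (borel :: 'k cproj measure)"
  shows "traj_measure \<mu> L \<nu> = mixture \<nu>"
  unfolding traj_measure_def
proof (rule the_equality)
  let ?\<phi> = "\<lambda>P. prob_space P \<and> sets P = sets (borel \<Otimes>\<^sub>M PiM UNIV (\<lambda>_. borel)) \<and>
     (\<forall>n. \<forall>S\<in>sets borel. \<forall>A\<in>sets (PiM {..<n} (\<lambda>_. borel)).
        emeasure P (S \<times> {\<omega>. restrict \<omega> {..<n} \<in> A}) =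
          (\<integral>\<^sup>+ xh\<in>S. (\<integral>\<^sup>+ \<omega>\<in>A. ennreal ((norm (Wprod L n \<omega> *v unit_rep xh))\<^sup>2)
             \<partial>PiM {..<n} (\<lambda>_. \<mu>)) \<partial>\<nu>))"
  show mix: "?\<phi> (mixture \<nu>)"
  proof (intro conjI allI ballI)
    show "prob_space (mixture \<nu>)" by (rule prob_space_mixture[OF \<nu>])
    show "sets (mixture \<nu>) = sets (borel \<Otimes>\<^sub>M \<Omega>)" by (rule sets_mixture[OF \<nu>])
    fix n and S :: "'k cproj set" and A :: "(nat \<Rightarrow> complex^'k^'k) set"
    assume S: "S \<in> sets borel" and A: "A \<in> sets (PiM {..<n} (\<lambda>_. borel))"
    show "emeasure (mixture \<nu>) (S \<times> {\<omega>. restrict \<omega> {..<n} \<in> A}) =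
          (\<integral>\<^sup>+ xh\<in>S. (\<integral>\<^sup>+ \<omega>\<in>A. ennreal ((norm (Wprod L n \<omega> *v unit_rep xh))\<^sup>2)
             \<partial>PiM {..<n} (\<lambda>_. \<mu>)) \<partial>\<nu>)"
      unfolding emeasure_mixture[OF \<nu> S cylinder_sets[OF cylinder_restrict[OF A]]] kernel_def emeasure_law_eq_PiM[OF A] ..
  qed
  fix P assume P: "?\<phi> P"
  show "P = mixture \<nu>"
  proof (rule measure_eqI_pair_cylinder)
    show "prob_space P" "sets P = sets (borel \<Otimes>\<^sub>M PiM UNIV (\<lambda>_. borel))" using P by auto
    show "sets (mixture \<nu>) = sets (borel \<Otimes>\<^sub>M PiM UNIV (\<lambda>_. borel))" by (rule sets_mixture[OF \<nu>])
    fix S :: "'k cproj set" and n and E :: "(nat \<Rightarrow> complex^'k^'k) set"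
    assume S: "S \<in> sets borel" and E: "cylinder n E"
    then obtain X where X: "X \<in> sets (PiM {..<n} (\<lambda>_. borel))" "E = {\<omega>. restrict \<omega> {..<n} \<in> X}"
      by (metis cylinder_eq_restrict)
    show "emeasure P (S \<times> E) = emeasure (mixture \<nu>) (S \<times> E)"
      unfolding X(2) using P mix S X(1) by simp
  qed
qed

text \<open>The matrices \<open>W\<close> whose compression is a multiple of \<open>q\<close> are
  closed under real scaling, so the property passes from the products of \<open>V\<close> to those
  of \<open>L\<close>. Where \<open>scal n\<close> vanishes, which \<open>m\<close> does not see,
  the product of \<open>L\<close> is 0 and \<open>c = 0\<close> serves.\<close>

lemma purification_V:
  fixes q :: "complex^'k^'k"
  assumes q: "orth_projector q" "q \<noteq> 0"
    and AE: "\<And>n. AE \<omega> in seq.S. \<exists>c. q ** cadj (Wprod V n \<omega>) ** Wprod V n \<omega> ** q = mat c ** q"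
  shows "vec.dim (range (\<lambda>x. q *v x)) = 1"
proof -
  \<comment> \<open>Membership in this finite-dimensional, hence closed, subspace replaces the
    existential quantifier over \<open>c\<close>; the resulting measurability is needed to pass to
    the first \<open>n\<close> coordinates.\<close>
  define T where "T = range (\<lambda>c. mat c ** q)"
  have matc: "mat (c + d) = mat c + (mat d :: complex^'k^'k)" "mat (r *\<^sub>R c) = r *\<^sub>R (mat c :: complex^'k^'k)" for c d :: complex and r
    by (simp_all add: mat_def vec_eq_iff)
  have "linear (\<lambda>c. mat c ** q)"
    by (rule linearI) (simp_all add: matc matrix_add_rdistrib matrix_mult_scaleR)
  then have "subspace T" unfolding T_def by (rule linear_subspace_image) (rule subspace_UNIV)
  then have "closed T" by (rule closed_subspace)
  then have [measurable]: "T \<in> sets borel" by (rule borel_closed)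
  define G where "G W \<longleftrightarrow> q ** cadj W ** W ** q \<in> T" for W :: "complex^'k^'k"
  have G_iff: "G W \<longleftrightarrow> (\<exists>c. q ** cadj W ** W ** q = mat c ** q)" for W by (auto simp: G_def T_def)
  have G_scale: "G (a *\<^sub>R W)" if "G W" for a W
  proof -
    have "q ** cadj (a *\<^sub>R W) ** (a *\<^sub>R W) ** q = (a * a) *\<^sub>R (q ** cadj W ** W ** q)"
      by (simp add: cadj_scaleR matrix_mult_scaleR)
    also have "\<dots> \<in> T" using that \<open>subspace T\<close> by (auto simp: G_def intro: subspace_scale)
    finally show ?thesis by (simp add: G_def)
  qed
  have "AE \<omega> in PiM {..<n} (\<lambda>_. \<mu>). \<exists>c. q ** cadj (Wprod L n \<omega>) ** Wprod L n \<omega> ** q = mat c ** q" for n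
  proof -
    have W [measurable]: "Wprod V n \<in> borel_measurable (PiM {..<n} (\<lambda>_. borel))"
      by (rule measurable_Wprod) auto
    have [measurable]: "Wprod V n \<in> borel_measurable (PiM {..<n} (\<lambda>_. m))"
      using W by (simp add: measurable_cong_sets[OF sets_PiM_m refl])
    have G_meas: "{\<omega> \<in> space (PiM {..<n} (\<lambda>_. m)). G (Wprod V n \<omega>)} \<in> sets (PiM {..<n} (\<lambda>_. m))"
      unfolding G_def by measurable
    have "AE \<omega> in seq.S. G (Wprod V n (restrict \<omega> {..<n}))"
      using AE[of n] unfolding G_iff
    proof eventually_elim
      case (elim \<omega>)
      have "Wprod V n (restrict \<omega> {..<n}) = Wprod V n \<omega>" by (rule Wprod_cong) simp
      with elim show ?case by simp
    qed
    then have "AE \<omega> in distr seq.S (PiM {..<n} (\<lambda>_. m)) (\<lambda>\<omega>. restrict \<omega> {..<n}). G (Wprod V n \<omega>)"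
      using G_meas by (subst AE_distr_iff) (auto intro: measurable_restrict_subset)
    then have "AE \<omega> in PiM {..<n} (\<lambda>_. m). G (Wprod V n \<omega>)" by (simp only: distr_restrict)
    then have "AE \<omega> in PiM {..<n} (\<lambda>_. \<mu>). 0 < ennreal ((scal n \<omega>)\<^sup>2) \<longrightarrow> G (Wprod V n \<omega>)"
      unfolding PiM_m using measurable_scal[of n] by (subst (asm) AE_density) auto
    then have "AE \<omega> in PiM {..<n} (\<lambda>_. \<mu>). G (Wprod L n \<omega>)"
    proof eventually_elim
      case (elim \<omega>)
      show ?case
      proof (cases "scal n \<omega> = 0")
        case True
        then have "Wprod L n \<omega> = 0" by (simp add: Wprod_L)
        moreover have "0 \<in> T" using \<open>subspace T\<close> by (rule subspace_0)
        ultimately show ?thesis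
          by (simp add: G_def bounded_bilinear.zero_right[OF bounded_bilinear_matrix_mult] bounded_bilinear.zero_left[OF bounded_bilinear_matrix_mult])
      next
        case False
        then have "G (Wprod V n \<omega>)" using elim by simp
        then show ?thesis unfolding Wprod_L by (rule G_scale)
      qed
    qed
    then show ?thesis unfolding G_iff .
  qed
  then show ?thesis using L(4) q unfolding purification_def by blast
qed

text \<open>Stated for a general \<open>F\<close> under the law of the trajectories, because it is
  applied both to \<open>L\<close> and to \<open>V\<close>.\<close>

lemma exists_limit:
  fixes F :: "complex^'k^'k \<Rightarrow> complex^'k^'k"
  assumes F [measurable]: "F \<in> borel_measurable borel" and K: "\<And>v. norm (F v) \<le> K" and p: "p \<le> CARD('k)"
  shows "\<exists>s<\<infinity>. AE \<omega> in law (mat 1). (\<lambda>n. elog (ext_opnorm p (Wprod F n \<omega>)) / ereal (real n)) \<longlonglongrightarrow> s"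
proof -
  define B where "B = max 1 (ext_const TYPE('k) p * K ^ p)"
  have step: "ext_opnorm p (F v) \<le> B" for v
  proof -
    have "ext_opnorm p (F v) \<le> ext_const TYPE('k) p * opnorm (F v) ^ p"
      by (rule ext_opnorm_le_opnorm_power[OF p])
    also have "\<dots> \<le> ext_const TYPE('k) p * K ^ p"
      using order_trans[OF opnorm_le_norm K] by (intro mult_left_mono power_mono opnorm_nonneg ext_const_nonneg)
    finally show ?thesis by (simp add: B_def)
  qed
  show ?thesis
  proof (rule submultiplicative_limit)
    fix n
    have "Wprod F n \<in> borel_measurable \<Omega>" by (rule measurable_Wprod) auto
    then show "(\<lambda>\<omega>. ext_opnorm p (Wprod F n \<omega>)) \<in> borel_measurable \<Omega>" by measurable
  next
    fix n l \<omega>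
    show "ext_opnorm p (Wprod F (n + l) \<omega>) \<le> ext_opnorm p (Wprod F l ((shift ^^ n) \<omega>)) * ext_opnorm p (Wprod F n \<omega>)"
      unfolding Wprod_add by (rule ext_opnorm_mult)
  next
    fix n \<omega>
    show "ext_opnorm p (Wprod F n \<omega>) \<le> B ^ n"
    proof (induction n)
      case 0
      show ?case using ext_opnorm_mat_1_le by simp
    next
      case (Suc n)
      have "ext_opnorm p (F (\<omega> n) ** Wprod F n \<omega>) \<le> ext_opnorm p (F (\<omega> n)) * ext_opnorm p (Wprod F n \<omega>)"
        by (rule ext_opnorm_mult)
      also have "\<dots> \<le> B * B ^ n" by (intro mult_mono step Suc) (auto simp: B_def)
      finally show ?case by simp
    qed
  qed (auto simp: B_def)
qed

lemma opnorm_Wprod_le: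
  assumes K: "\<And>v. norm (L v) \<le> K" "K \<ge> 1"
  shows "opnorm (Wprod L n \<omega>) \<le> K ^ n"
proof (induction n)
  case 0
  show ?case by (simp add: opnorm_def) (rule onorm_bound; simp)
next
  case (Suc n)
  have "norm ((L (\<omega> n) ** Wprod L n \<omega>) *v x) \<le> K * K ^ n * norm x" for x
  proof -
    have "norm (L (\<omega> n) *v (Wprod L n \<omega> *v x)) \<le> norm (L (\<omega> n)) * norm (Wprod L n \<omega> *v x)"
      by (rule norm_matrix_vector_mult_le)
    also have "\<dots> \<le> K * (K ^ n * norm x)"
      using K by (intro mult_mono order_trans[OF norm_matrix_vector_mult_le_opnorm] mult_right_mono Suc) auto
    finally show ?thesis by (simp add: matrix_vector_mul_assoc)
  qed
  then show ?case unfolding opnorm_def using K(2) by (intro onorm_bound) auto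
qed

text \<open>The law has mass \<open>CARD('k)\<close>, so an almost sure property holds somewhere;
  relations between constants are extracted from almost sure statements in this way.\<close>

lemma AE_law_pick:
  assumes "AE \<omega> in law (mat 1). Q \<omega>" shows "\<exists>\<omega>. Q \<omega>"
proof (rule ccontr)
  assume "\<not> ?thesis"
  then have "AE \<omega> in law (mat 1). False" using assms by simp
  then have "emeasure (law (mat 1)) (space (law (mat 1))) = 0" by (simp add: AE_iff_measurable[OF _ refl])
  then have "measure (law (mat 1)) UNIV = 0" by (simp add: space_law[OF psd_mat_1] measure_def)
  then show False unfolding measure_law_UNIV[OF psd_mat_1] by (simp add: trace_I)
qed

lemma AE_W_nonzero: "AE \<omega> in law (mat 1). \<forall>\<^sub>F n in sequentially. Wprod V n \<omega> \<noteq> 0 \<and> 0 < scal n \<omega>"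
  using AE_norm_W_ge
proof eventually_elim
  case (elim \<omega>)
  then show ?case
  proof eventually_elim
    case (elim n)
    have "0 < (1 / 2 :: real) ^ n" by simp
    with elim have "0 < (norm (Wprod V n \<omega>))\<^sup>2" by linarith
    then show ?case using scal_pos[of n \<omega>] by auto
  qed
qed

lemma AE_traj_measure:
  assumes \<nu>: "prob_space \<nu>" "sets \<nu> = sets (borel :: 'k cproj measure)" and AE: "AE \<omega> in law (mat 1). Q \<omega>"
  shows "AE (xh, \<omega>) in traj_measure \<mu> L \<nu>. Q \<omega>"
  unfolding traj_measure_eq[OF \<nu>] by (rule AE_mixture[OF \<nu> AE])

lemma AE_ext_opnorm_2_decay:
  assumes k: "2 \<le> CARD('k)"
  obtains \<beta> where "0 < \<beta>" "\<beta> < 1" "AE \<omega> in law (mat 1). \<forall>\<^sub>F n in sequentially.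
    ext_opnorm 2 (Wprod V n \<omega>) / (opnorm (Wprod V n \<omega>))\<^sup>2 \<le> real CARD('k) * \<beta> ^ n"
proof -
  obtain N r where Nr: "N > 0" "0 < r" "r < 1" "\<And>x y. (x, y) \<in> orth_pairs \<Longrightarrow> mean_area N x y \<le> r"
    using mean_area_contraction[OF k purification_V] by blast
  obtain \<beta> where \<beta>: "0 < \<beta>" "\<beta> < 1" "AE \<omega> in law (mat 1). \<forall>\<^sub>F n in sequentially.
    ext_bound 2 (Wprod V n \<omega>) \<le> \<beta> ^ n * (norm (Wprod V n \<omega>))\<^sup>2"
    using ext_bound_2_decay[OF k Nr] by blast
  show thesis
  proof (rule that[OF \<beta>(1,2)])
    show "AE \<omega> in law (mat 1). \<forall>\<^sub>F n in sequentially.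
      ext_opnorm 2 (Wprod V n \<omega>) / (opnorm (Wprod V n \<omega>))\<^sup>2 \<le> real CARD('k) * \<beta> ^ n"
      using \<beta>(3)
    proof eventually_elim
      case (elim \<omega>)
      then show ?case
      proof eventually_elim
        case (elim n)
        have "ext_opnorm 2 (Wprod V n \<omega>) \<le> \<beta> ^ n * (norm (Wprod V n \<omega>))\<^sup>2"
          using ext_opnorm_le_bound elim by (rule order_trans)
        also have "\<dots> \<le> \<beta> ^ n * (CARD('k) * (opnorm (Wprod V n \<omega>))\<^sup>2)"
          using \<beta>(1) by (intro mult_left_mono norm_le_opnorm) auto
        finally have "ext_opnorm 2 (Wprod V n \<omega>) \<le> (CARD('k) * \<beta> ^ n) * (opnorm (Wprod V n \<omega>))\<^sup>2"
          by (simp add: mult_ac)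
        then show ?case using \<beta>(1)
          by (cases "opnorm (Wprod V n \<omega>) = 0") (simp_all add: pos_divide_le_eq)
      qed
    qed
  qed
qed

text \<open>The exponential lower bound for the Frobenius norm excludes the limit
  \<open>-\<infinity>\<close>, all these norms being comparable.\<close>

lemma limit_V_finite:
  assumes "(\<lambda>n. elog (ext_opnorm 1 (Wprod V n \<omega>)) / ereal (real n)) \<longlonglongrightarrow> s" and "s < \<infinity>"
    and ge: "\<forall>\<^sub>F n in sequentially. (1 / 2) ^ n \<le> (norm (Wprod V n \<omega>))\<^sup>2"
  shows "\<exists>r. s = ereal r"
proof (cases s)
  case MInf
  let ?e = "\<lambda>n. ext_opnorm 1 (Wprod V n \<omega>)"
  have le: "\<forall>\<^sub>F n in sequentially. (1 / 2) ^ n \<le> CARD('k) * (?e n)\<^sup>2"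
    using ge
  proof eventually_elim
    case (elim n)
    also have "(norm (Wprod V n \<omega>))\<^sup>2 \<le> CARD('k) * (opnorm (Wprod V n \<omega>))\<^sup>2" by (rule norm_le_opnorm)
    also have "\<dots> \<le> CARD('k) * (?e n)\<^sup>2"
      by (intro mult_left_mono power_mono opnorm_le_ext_opnorm_1 opnorm_nonneg) auto
    finally show ?case .
  qed
  have pos: "\<forall>\<^sub>F n in sequentially. 0 < ?e n"
    using le
  proof eventually_elim
    case (elim n)
    have "0 < (1 / 2 :: real) ^ n" by simp
    then have "0 < CARD('k) * (?e n)\<^sup>2" using elim by linarith
    then have "?e n \<noteq> 0" by auto
    then show ?case using ext_opnorm_nonneg[of 1 "Wprod V n \<omega>"] by (simp add: order_less_le)
  qed
  \<comment> \<open>The threshold is low enough that twice it outweighs both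
    \<open>ln CARD('k)\<close> and the rate \<open>ln 2\<close> of the lower bound.\<close>
  have "\<forall>\<^sub>F n in sequentially. ln (?e n) / real n < - (ln CARD('k) + ln 2)"
    using assms(1) pos unfolding MInf by (rule elog_tendsto_MInf)
  then have "\<forall>\<^sub>F n :: nat in sequentially. False"
    using le pos eventually_gt_at_top[of 0]
  proof eventually_elim
    case (elim n)
    have k: "0 \<le> ln (real CARD('k))" by simp
    have "ln ((1 / 2 :: real) ^ n) \<le> ln (CARD('k) * (?e n)\<^sup>2)" using elim(2) by (intro ln_mono) auto
    then have "- (n * ln 2) \<le> ln CARD('k) + 2 * ln (?e n)"
      using elim(3) by (simp add: ln_mult ln_realpow ln_div)
    moreover have "ln (?e n) < - (ln CARD('k) + ln 2) * n" using elim(1,4) by (simp add: divide_less_eq)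
    moreover have "ln CARD('k) \<le> n * ln CARD('k)" using elim(4) k mult_right_mono[of 1 "real n" "ln CARD('k)"] by simp
    moreover have "0 \<le> n * ln (2 :: real)" "0 \<le> n * ln CARD('k)" using k by simp_all
    ultimately show ?case by (simp add: algebra_simps)
  qed
  then show ?thesis by simp
qed (use assms(2) in auto)

text \<open>Multiplying the product by \<open>scal n > 0\<close> does not change the ratio, so it is
  computed with \<open>V\<close>. There the exponent of the norm is a finite \<open>r\<close>, and
  the limit is \<open>s2 - 2 * r\<close> even if the products of \<open>L\<close> decay
  superexponentially.\<close>

lemma ratio_limit:
  assumes k: "2 \<le> CARD('k)"
  obtains d where "d < 0" "AE \<omega> in law (mat 1).
    (\<lambda>n. elog (ext_opnorm 2 (Wprod L n \<omega>) / (opnorm (Wprod L n \<omega>))\<^sup>2) / ereal (real n)) \<longlonglongrightarrow> d"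
proof -
  have V: "V \<in> borel_measurable borel" "\<And>v. norm (V v) \<le> sqrt CARD('k)" by (rule measurable_V, rule norm_V)
  obtain s1 where s1: "s1 < \<infinity>" "AE \<omega> in law (mat 1). (\<lambda>n. elog (ext_opnorm 1 (Wprod V n \<omega>)) / ereal (real n)) \<longlonglongrightarrow> s1"
    using exists_limit[OF V, of 1] k by auto
  obtain s2 where s2: "AE \<omega> in law (mat 1). (\<lambda>n. elog (ext_opnorm 2 (Wprod V n \<omega>)) / ereal (real n)) \<longlonglongrightarrow> s2"
    using exists_limit[OF V, of 2] k by auto
  obtain \<beta> where \<beta>: "0 < \<beta>" "\<beta> < 1" "AE \<omega> in law (mat 1). \<forall>\<^sub>F n in sequentially.
    ext_opnorm 2 (Wprod V n \<omega>) / (opnorm (Wprod V n \<omega>))\<^sup>2 \<le> real CARD('k) * \<beta> ^ n"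
    by (rule AE_ext_opnorm_2_decay[OF k])
  have "AE \<omega> in law (mat 1). \<exists>r. s1 = ereal r"
    using s1(2) AE_norm_W_ge by eventually_elim (use limit_V_finite s1(1) in blast)
  from AE_law_pick[OF this] obtain r where r: "s1 = ereal r" by blast
  have lim: "AE \<omega> in law (mat 1).
    (\<lambda>n. elog (ext_opnorm 2 (Wprod V n \<omega>) / (opnorm (Wprod V n \<omega>))\<^sup>2) / ereal (real n)) \<longlonglongrightarrow> s2 - ereal (2 * r)"
    using s1(2) s2
  proof eventually_elim
    case (elim \<omega>)
    show ?case using opnorm_limit[OF elim(1)[unfolded r]] elim(2) by (intro elog_ratio_limit) auto
  qed
  show thesis
  proof (rule that)
    have "AE \<omega> in law (mat 1). s2 - ereal (2 * r) < 0"
      using lim \<beta>(3) by eventually_elim (rule elog_limit_neg[OF _ _ _ k_pos \<beta>(1,2)]; simp)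
    from AE_law_pick[OF this] show "s2 - ereal (2 * r) < 0" by blast
    show "AE \<omega> in law (mat 1).
      (\<lambda>n. elog (ext_opnorm 2 (Wprod L n \<omega>) / (opnorm (Wprod L n \<omega>))\<^sup>2) / ereal (real n)) \<longlonglongrightarrow> s2 - ereal (2 * r)"
      using lim AE_W_nonzero
    proof eventually_elim
      case (elim \<omega>)
      from elim(2) have "\<forall>\<^sub>F n in sequentially.
          elog (ext_opnorm 2 (Wprod V n \<omega>) / (opnorm (Wprod V n \<omega>))\<^sup>2) / ereal (real n)
          = elog (ext_opnorm 2 (Wprod L n \<omega>) / (opnorm (Wprod L n \<omega>))\<^sup>2) / ereal (real n)"
        by eventually_elim (simp add: Wprod_L ext_opnorm_scaleR opnorm_scaleR power_mult_distrib)
      with elim(1) show ?case by (rule Lim_transform_eventually)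
    qed
  qed
qed

lemma exists_lyapunov_exponents:
  obtains \<gamma> where "lyapunov_exponents \<mu> L \<gamma>" "2 \<le> CARD('k) \<Longrightarrow> \<gamma> 1 \<noteq> -\<infinity> \<Longrightarrow> \<gamma> 2 - \<gamma> 1 < 0"
proof -
  obtain K where K: "K \<ge> 1" "\<And>v. norm (L v) \<le> K" by (rule L_bounded) blast
  have "\<forall>p. \<exists>s<\<infinity>. p \<in> {1..CARD('k)} \<longrightarrow>
      (AE \<omega> in law (mat 1). (\<lambda>n. elog (ext_opnorm p (Wprod L n \<omega>)) / ereal (real n)) \<longlonglongrightarrow> s)"
  proof
    fix p
    show "\<exists>s<\<infinity>. p \<in> {1..CARD('k)} \<longrightarrow>
      (AE \<omega> in law (mat 1). (\<lambda>n. elog (ext_opnorm p (Wprod L n \<omega>)) / ereal (real n)) \<longlonglongrightarrow> s)"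
    proof (cases "p \<le> CARD('k)")
      case True
      then show ?thesis using exists_limit[OF measurable_L K(2)] by blast
    next
      case False
      then show ?thesis by (intro exI[of _ 0]) auto
    qed
  qed
  from choice[OF this] obtain s where s: "\<And>p. s p < \<infinity>" "\<And>p. p \<in> {1..CARD('k)} \<Longrightarrow>
      AE \<omega> in law (mat 1). (\<lambda>n. elog (ext_opnorm p (Wprod L n \<omega>)) / ereal (real n)) \<longlonglongrightarrow> s p"
    by blast
  have "AE \<omega> in law (mat 1). \<forall>p\<in>{1..CARD('k)}.
      (\<lambda>n. elog (ext_opnorm p (Wprod L n \<omega>)) / ereal (real n)) \<longlonglongrightarrow> s p"
    using s(2) by (intro AE_finite_allI) auto
  note all = this
  \<comment> \<open>The limits are constants, so the relations among them may be read off along one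
    trajectory on which all of them exist.\<close>
  from AE_law_pick[OF all] obtain \<omega>0 where \<omega>0: "\<And>p. p \<in> {1..CARD('k)} \<Longrightarrow>
      (\<lambda>n. elog (ext_opnorm p (Wprod L n \<omega>0)) / ereal (real n)) \<longlonglongrightarrow> s p" by blast
  obtain \<gamma> where \<gamma>: "\<And>p. p \<in> {1..CARD('k)} \<Longrightarrow> (\<Sum>j=1..p. \<gamma> j) = s p"
    "\<And>i j. 1 \<le> i \<Longrightarrow> i \<le> j \<Longrightarrow> j \<le> CARD('k) \<Longrightarrow> \<gamma> j \<le> \<gamma> i" "\<gamma> 1 = s 1"
    "2 \<le> CARD('k) \<Longrightarrow> s 1 \<noteq> -\<infinity> \<Longrightarrow> \<gamma> 2 = s 2 - s 1"
  proof (rule exponents_of_limits[OF \<omega>0 s(1) opnorm_Wprod_le[OF K(2,1)] K(1)])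
    fix \<gamma> :: "nat \<Rightarrow> ereal"
    assume "\<And>p. p \<in> {1..CARD('k)} \<Longrightarrow> (\<Sum>j=1..p. \<gamma> j) = s p"
      "\<And>i j. 1 \<le> i \<Longrightarrow> i \<le> j \<Longrightarrow> j \<le> CARD('k) \<Longrightarrow> \<gamma> j \<le> \<gamma> i" "\<gamma> 1 = s 1"
      "2 \<le> CARD('k) \<Longrightarrow> s 1 \<noteq> -\<infinity> \<Longrightarrow> \<gamma> 2 = s 2 - s 1"
    then show thesis by (rule that)
  qed
  show thesis
  proof (rule that)
    show "lyapunov_exponents \<mu> L \<gamma>"
      unfolding lyapunov_exponents_def
    proof (intro conjI allI impI ballI)
      show "\<gamma> 1 < \<infinity>" using s(1)[of 1] \<gamma>(3) by simp
      show "\<gamma> j \<le> \<gamma> i" if "1 \<le> i \<and> i \<le> j \<and> j \<le> CARD('k)" for i j using \<gamma>(2) that by blast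
      fix \<nu> :: "'k cproj measure" and p
      assume \<nu>: "prob_space \<nu> \<and> sets \<nu> = sets borel" and p: "p \<in> {1..CARD('k)}"
      show "AE (xh, \<omega>) in traj_measure \<mu> L \<nu>.
          (\<lambda>n. elog (ext_opnorm p (Wprod L n \<omega>)) / ereal (real n)) \<longlonglongrightarrow> (\<Sum>j=1..p. \<gamma> j)"
        unfolding \<gamma>(1)[OF p] using \<nu> s(2)[OF p] by (intro AE_traj_measure) auto
    qed
    assume k: "2 \<le> CARD('k)" and "\<gamma> 1 \<noteq> -\<infinity>"
    then obtain r where r: "s 1 = ereal r" using s(1)[of 1] \<gamma>(3) by (cases "s 1") auto
    obtain d where d: "d < 0" "AE \<omega> in law (mat 1).
      (\<lambda>n. elog (ext_opnorm 2 (Wprod L n \<omega>) / (opnorm (Wprod L n \<omega>))\<^sup>2) / ereal (real n)) \<longlonglongrightarrow> d"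
      by (rule ratio_limit[OF k])
    have "AE \<omega> in law (mat 1). s 2 - ereal (2 * r) = d"
      using all d(2)
    proof eventually_elim
      case (elim \<omega>)
      have lims: "(\<lambda>n. elog (ext_opnorm 1 (Wprod L n \<omega>)) / ereal (real n)) \<longlonglongrightarrow> ereal r"
        "(\<lambda>n. elog (ext_opnorm 2 (Wprod L n \<omega>)) / ereal (real n)) \<longlonglongrightarrow> s 2"
        using elim(1) k by (auto simp flip: r)
      have "(\<lambda>n. elog (ext_opnorm 2 (Wprod L n \<omega>) / (opnorm (Wprod L n \<omega>))\<^sup>2) / ereal (real n)) \<longlonglongrightarrow> s 2 - ereal (2 * r)"
        using opnorm_limit[OF lims(1)] lims(2) by (intro elog_ratio_limit) auto
      from LIMSEQ_unique[OF this elim(2)] show ?case .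
    qed
    from AE_law_pick[OF this] have "s 2 - ereal (2 * r) = d" by blast
    \<comment> \<open>\<open>\<gamma> 2 - \<gamma> 1\<close> equals \<open>s 2 - 2 * s 1\<close>,
      the limit \<open>d\<close> of the normalised logarithm of the ratio.\<close>
    then show "\<gamma> 2 - \<gamma> 1 < 0" using d(1) \<gamma>(3,4) k r by (cases "s 2") auto
  qed
qed

text \<open>Scalar factors cancel, and the operator norm is at most the Frobenius norm, so
  eventually the quotient of the two norms lies between \<open>1 / n\<close> and 1 and its logarithm
  is negligible against \<open>n\<close>. Unit vectors of one line differ by a phase, which does not
  change norms.\<close>

lemma AE_norm_W_vec_over_opnorm:
  assumes \<nu>: "prob_space \<nu>" "sets \<nu> = sets (borel :: 'k cproj measure)"
  shows "AE (xh, \<omega>) in traj_measure \<mu> L \<nu>. \<forall>x\<in>line xh. norm x = 1 \<longrightarrow>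
    (\<lambda>n. (elog (norm (Wprod L n \<omega> *v x)) - elog (opnorm (Wprod L n \<omega>))) / ereal (real n)) \<longlonglongrightarrow> 0"
  using AE_mixture_norm_ge[OF \<nu>, folded traj_measure_eq[OF \<nu>]] AE_traj_measure[OF \<nu> AE_W_nonzero]
proof eventually_elim
  case (elim z)
  obtain xh \<omega> where z: "z = (xh, \<omega>)" by (cases z)
  have *: "\<forall>\<^sub>F n in sequentially. (norm (Wprod V n \<omega>))\<^sup>2 / (real n)\<^sup>2 \<le> (norm (Wprod V n \<omega> *v unit_rep xh))\<^sup>2"
    "\<forall>\<^sub>F n in sequentially. Wprod V n \<omega> \<noteq> 0 \<and> 0 < scal n \<omega>" using elim by (simp_all add: z)
  have "(\<lambda>n. (elog (norm (Wprod L n \<omega> *v x)) - elog (opnorm (Wprod L n \<omega>))) / ereal (real n)) \<longlonglongrightarrow> 0"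
    if x: "x \<in> line xh" "norm x = 1" for x
  proof -
    obtain a where a: "x = a *s unit_rep xh" using line_multiple_unit_rep[OF x(1)] by blast
    then have "cmod a = 1" using x(2) by (simp add: norm_cmult_vec unit_rep(2))
    then have Wx: "norm (W *v x) = norm (W *v unit_rep xh)" for W :: "complex^'k^'k"
      by (simp add: a vector_scalar_commute norm_cmult_vec)
    \<comment> \<open>The identity with the extended logarithms relies on both norms being positive,
      which comes out of the same estimates as the two bounds; hence the three are proved
      together.\<close>
    have eq: "\<forall>\<^sub>F n in sequentially. ereal ((ln (norm (Wprod L n \<omega> *v x)) - ln (opnorm (Wprod L n \<omega>))) / real n)
       = (elog (norm (Wprod L n \<omega> *v x)) - elog (opnorm (Wprod L n \<omega>))) / ereal (real n) \<and>
       - (ln (real n) / real n) \<le> (ln (norm (Wprod L n \<omega> *v x)) - ln (opnorm (Wprod L n \<omega>))) / real n \<and>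
       (ln (norm (Wprod L n \<omega> *v x)) - ln (opnorm (Wprod L n \<omega>))) / real n \<le> 0"
      using * eventually_gt_at_top[of 0]
    proof eventually_elim
      case (elim n)
      let ?x = "norm (Wprod L n \<omega> *v x)" and ?o = "opnorm (Wprod L n \<omega>)"
      have "(norm (Wprod V n \<omega>) / n)\<^sup>2 \<le> (norm (Wprod V n \<omega> *v x))\<^sup>2" using elim(1) by (simp add: Wx power_divide)
      then have le: "norm (Wprod V n \<omega>) / n \<le> norm (Wprod V n \<omega> *v x)" by (rule power2_le_imp_le) simp
      have x_eq: "?x = scal n \<omega> * norm (Wprod V n \<omega> *v x)"
        using elim(2) by (simp add: Wprod_L bounded_bilinear.scaleR_left[OF bounded_bilinear_matrix_vector_mult])
      have "?o / n \<le> norm (Wprod L n \<omega>) / n" by (intro divide_right_mono opnorm_le_norm) auto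
      also have "\<dots> = scal n \<omega> * (norm (Wprod V n \<omega>) / n)" using elim(2) by (simp add: Wprod_L)
      also have "\<dots> \<le> ?x" unfolding x_eq using elim(2) by (intro mult_left_mono le) auto
      finally have ge: "?o / n \<le> ?x" .
      have "0 < norm (Wprod V n \<omega>) / n" using elim by simp
      then have x_pos: "0 < ?x" unfolding x_eq using le elim(2) by (intro mult_pos_pos) linarith+
      have x_le: "?x \<le> ?o" using norm_matrix_vector_mult_le_opnorm[of "Wprod L n \<omega>" x] x(2) by simp
      then have o_pos: "0 < ?o" using x_pos by linarith
      have "ln (?o / n) \<le> ln ?x" using ge o_pos elim(3) by (intro ln_mono) auto
      then have "- ln n \<le> ln ?x - ln ?o" using o_pos elim(3) by (simp add: ln_div)
      then have "- ln n / n \<le> (ln ?x - ln ?o) / n" by (intro divide_right_mono) auto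
      moreover have "ln ?x - ln ?o \<le> 0" using ln_mono[OF x_le x_pos] by simp
      then have "(ln ?x - ln ?o) / n \<le> 0" by (simp add: divide_nonpos_nonneg)
      ultimately show ?case using x_pos o_pos elim(3) by (simp add: elog_def)
    qed
    have "(\<lambda>n. (ln (norm (Wprod L n \<omega> *v x)) - ln (opnorm (Wprod L n \<omega>))) / real n) \<longlonglongrightarrow> 0"
    proof (rule tendsto_sandwich)
      show "(\<lambda>n. - (ln (real n) / real n)) \<longlonglongrightarrow> 0" using tendsto_minus[OF lim_ln_over_n] by simp
      show "\<forall>\<^sub>F n in sequentially. - (ln (real n) / real n) \<le> (ln (norm (Wprod L n \<omega> *v x)) - ln (opnorm (Wprod L n \<omega>))) / real n"
        using eq by eventually_elim blast
      show "\<forall>\<^sub>F n in sequentially. (ln (norm (Wprod L n \<omega> *v x)) - ln (opnorm (Wprod L n \<omega>))) / real n \<le> 0"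
        using eq by eventually_elim blast
    qed simp
    then have "(\<lambda>n. ereal ((ln (norm (Wprod L n \<omega> *v x)) - ln (opnorm (Wprod L n \<omega>))) / real n)) \<longlonglongrightarrow> 0"
      unfolding zero_ereal_def by (rule tendsto_ereal)
    moreover have "\<forall>\<^sub>F n in sequentially. ereal ((ln (norm (Wprod L n \<omega> *v x)) - ln (opnorm (Wprod L n \<omega>))) / real n)
       = (elog (norm (Wprod L n \<omega> *v x)) - elog (opnorm (Wprod L n \<omega>))) / ereal (real n)"
      using eq by eventually_elim blast
    ultimately show ?thesis by (rule Lim_transform_eventually)
  qed
  then show ?case unfolding z prod.case by blast
qed

end

theorem theorem7p3:
  fixes \<mu> :: "(complex^'k^'k) measure"
    and L :: "complex^'k^'k \<Rightarrow> complex^'k^'k"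
  assumes "sets \<mu> = sets borel"
    and "\<exists>a\<in>msupp \<mu>. \<exists>b\<in>msupp \<mu>. a \<noteq> b"
    and "L \<in> bcontfun"
    and "stochastic \<mu> L"
    and "L \<in> generic_maps \<mu>"
    and "(\<integral>\<^sup>+ v. ennreal ((opnorm (L v))\<^sup>2 * ln (opnorm (L v))) \<partial>\<mu>) < \<infinity>"
  shows "(\<exists>\<gamma>. lyapunov_exponents \<mu> L \<gamma> \<and>
      (2 \<le> CARD('k) \<longrightarrow>
        (\<gamma> 1 \<noteq> -\<infinity> \<longrightarrow> \<gamma> 2 - \<gamma> 1 < 0) \<and>
        (\<gamma> 1 = -\<infinity> \<longrightarrow>
          (\<exists>d<0. \<forall>\<nu>. prob_space \<nu> \<and> sets \<nu> = sets (borel :: 'k cproj measure) \<longrightarrow>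
            (AE (xh, \<omega>) in traj_measure \<mu> L \<nu>.
              (\<lambda>n. elog (ext_opnorm 2 (Wprod L n \<omega>) / (opnorm (Wprod L n \<omega>))\<^sup>2) / ereal (real n))
                \<longlonglongrightarrow> d)))))
    \<and> (\<forall>\<nu>. prob_space \<nu> \<and> sets \<nu> = sets (borel :: 'k cproj measure) \<longrightarrow>
        (AE (xh, \<omega>) in traj_measure \<mu> L \<nu>.
          \<forall>x\<in>line xh. norm x = 1 \<longrightarrow>
            (\<lambda>n. (elog (norm (Wprod L n \<omega> *v x)) - elog (opnorm (Wprod L n \<omega>))) / ereal (real n))
              \<longlonglongrightarrow> 0))"
proof -
  interpret stochastic_map \<mu> L
    using assms(1,3,4,5) by (intro stochastic_map.intro) (simp_all add: generic_maps_def)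
  obtain \<gamma> where \<gamma>: "lyapunov_exponents \<mu> L \<gamma>" "2 \<le> CARD('k) \<Longrightarrow> \<gamma> 1 \<noteq> -\<infinity> \<Longrightarrow> \<gamma> 2 - \<gamma> 1 < 0"
    by (rule exists_lyapunov_exponents) blast
  have ratio: "\<exists>d<0. \<forall>\<nu>. prob_space \<nu> \<and> sets \<nu> = sets (borel :: 'k cproj measure) \<longrightarrow>
      (AE (xh, \<omega>) in traj_measure \<mu> L \<nu>.
        (\<lambda>n. elog (ext_opnorm 2 (Wprod L n \<omega>) / (opnorm (Wprod L n \<omega>))\<^sup>2) / ereal (real n)) \<longlonglongrightarrow> d)" (is ?ratio)
    if k: "2 \<le> CARD('k)"
  proof -
    obtain d where d: "d < 0" "AE \<omega> in law (mat 1).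
      (\<lambda>n. elog (ext_opnorm 2 (Wprod L n \<omega>) / (opnorm (Wprod L n \<omega>))\<^sup>2) / ereal (real n)) \<longlonglongrightarrow> d"
      by (rule ratio_limit[OF k])
    show ?thesis
    proof (intro exI[of _ d] conjI allI impI d(1))
      fix \<nu> :: "'k cproj measure" assume "prob_space \<nu> \<and> sets \<nu> = sets borel"
      then show "AE (xh, \<omega>) in traj_measure \<mu> L \<nu>.
        (\<lambda>n. elog (ext_opnorm 2 (Wprod L n \<omega>) / (opnorm (Wprod L n \<omega>))\<^sup>2) / ereal (real n)) \<longlonglongrightarrow> d"
        by (intro AE_traj_measure d(2)) blast+
    qed
  qed
  show ?thesis
  proof (rule conjI)
    show "\<exists>\<gamma>. lyapunov_exponents \<mu> L \<gamma> \<and> (2 \<le> CARD('k) \<longrightarrow>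
        (\<gamma> 1 \<noteq> -\<infinity> \<longrightarrow> \<gamma> 2 - \<gamma> 1 < 0) \<and> (\<gamma> 1 = -\<infinity> \<longrightarrow> ?ratio))"
      by (rule exI[of _ \<gamma>], intro conjI impI \<gamma> ratio)
    show "\<forall>\<nu>. prob_space \<nu> \<and> sets \<nu> = sets (borel :: 'k cproj measure) \<longrightarrow>
        (AE (xh, \<omega>) in traj_measure \<mu> L \<nu>. \<forall>x\<in>line xh. norm x = 1 \<longrightarrow>
            (\<lambda>n. (elog (norm (Wprod L n \<omega> *v x)) - elog (opnorm (Wprod L n \<omega>))) / ereal (real n)) \<longlonglongrightarrow> 0)"
      by (intro allI impI AE_norm_W_vec_over_opnorm) blast+
  qed
qed

end
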